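(* Let $A$ be a recursive subhomogeneous algebra with total space $X$, and with topological dimension function $d \colon X \to \mathbf{N} \cup \{0\}$. Let $p, q \in M_\infty(A)$ be projections with $p \leq q$. (1) If $\mathrm{rank}(\mathrm{ev}_x(p)) \geq \frac{1}{2} d(x)$ for all $x \in X$, and $u \in U(q M_\infty(A) q)$, then there exists $v \in U(p M_\infty(A) p)$ such that $v + (q - p)$ is homotopic to $u$ in $U(q M_\infty(A) q)$. (2) If $\mathrm{rank}(\mathrm{ev}_x(p)) \geq \frac{1}{2}[d(x) + 1]$ for all $x \in X$, and $v^{(0)}, v^{(1)} \in U(p M_\infty(A) p)$ are unitaries such that $v^{(0)} + (q - p)$ is homotopic to $v^{(1)} + (q - p)$ in $U(q M_\infty(A) q)$, then $v^{(0)}$ is homotopic to $v^{(1)}$ in $U(p M_\infty(A) p)$.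
   Context: Homomorphisms of C*-algebras are *-homomorphisms, and $M_n = M_n(\mathbf{C})$. Recursive subhomogeneous algebras. The class is defined recursively: (i) if $X$ is a compact Hausdorff space and $n \geq 1$, then $C(X, M_n)$ is a recursive subhomogeneous algebra; (ii) if $A$ is a recursive subhomogeneous algebra, $X$ is compact Hausdorff, $X^{(0)} \subset X$ is closed (possibly empty), $\varphi \colon A \to C(X^{(0)}, M_n)$ is any unital homomorphism and $\rho \colon C(X, M_n) \to C(X^{(0)}, M_n)$ is restriction, then the pullback $A \oplus_{C(X^{(0)}, M_n)} C(X, M_n) = \{(a,f) \in A \oplus C(X, M_n) : \varphi(a) = \rho(f)\}$ is a recursive subhomogeneous algebra. The zero algebra is also allowed. Every such algebra $R$ comes with a given decomposition as an iterated pullback: compact Hausdorff spaces $X_0, \dots, X_l$, positive integers $n(0), \dots, n(l)$, closed subsets $X_k^{(0)} \subset X_k$ ($1 \leq k \leq l$), $C_k = C(X_k, M_{n(k)})$, $C_k^{(0)} = C(X_k^{(0)}, M_{n(k)})$, with $R^{(0)} = C_0$, $R^{(k)} = R^{(k-1)} \oplus_{C_k^{(0)}} C_k$ formed using a unital homomorphism $R^{(k-1)} \to C_k^{(0)}$ and the restriction map $C_k \to C_k^{(0)}$, and $R = R^{(l)}$. Its total space is $X = \coprod_{k=0}^l X_k$. Its topological dimension function is $d(x) = \dim(X_k)$ (covering dimension, here finite) for $x \in X_k$. Forgetting the pullback conditions embeds $R$ in $\bigoplus_{k=0}^l C(X_k, M_{n(k)})$, and for $x \in X_k$ the evaluation map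 $\mathrm{ev}_x \colon R \to M_{n(k)}$ is the restriction to $R$ of evaluation at $x$ on the summand $C(X_k, M_{n(k)})$. $M_\infty(A)$ is the algebraic direct limit of the $M_n(A)$ under $a \mapsto a \oplus 0$, and $\mathrm{ev}_x$ is extended entrywise to $M_\infty(A)$. If $p \in M_m(A) \subset M_\infty(A)$ is a projection, then $p M_\infty(A) p = p M_m(A) p$ is a unital C*-algebra with identity $p$. $U(B)$ denotes the unitary group of a unital C*-algebra $B$; homotopic means connected by a norm continuous path in the indicated group. *)

theory Defs
  imports
    "HOL-Analysis.T1_Spaces"
    "Jordan_Normal_Form.DL_Rank"
    "Jordan_Normal_Form.Schur_Decomposition"
begin

text \<open>The record is only a signature. The field \<open>one\<close> has a meaning only for the unital
  algebras below.\<close>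

record 'b star_algebra = "(complex, 'b) module" +
  star :: "'b \<Rightarrow> 'b"

definition unital_star_hom ::
    "('b, 'm) star_algebra_scheme \<Rightarrow> ('c, 'n) star_algebra_scheme \<Rightarrow> ('b \<Rightarrow> 'c) set" where
  "unital_star_hom A B =
     {h \<in> Ring.ring_hom A B.
        (\<forall>c. \<forall>a\<in>carrier A. h (c \<odot>\<^bsub>A\<^esub> a) = c \<odot>\<^bsub>B\<^esub> h a) \<and>
        (\<forall>a\<in>carrier A. h (star A a) = star B (h a))}"

definition projections :: "('b, 'm) star_algebra_scheme \<Rightarrow> 'b set" where
  "projections B = {p \<in> carrier B. p \<otimes>\<^bsub>B\<^esub> p = p \<and> star B p = p}"

text \<open>The order of a C*-algebra; the positive elements are those of the form \<open>c* c\<close>.\<close>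

definition star_le :: "('b, 'm) star_algebra_scheme \<Rightarrow> 'b \<Rightarrow> 'b \<Rightarrow> bool" where
  "star_le B a b \<longleftrightarrow> (\<exists>c\<in>carrier B. b \<ominus>\<^bsub>B\<^esub> a = (star B c) \<otimes>\<^bsub>B\<^esub> c)"

definition corner :: "'b star_algebra \<Rightarrow> 'b \<Rightarrow> 'b star_algebra" where
  "corner B p = B\<lparr>carrier := {p \<otimes>\<^bsub>B\<^esub> a \<otimes>\<^bsub>B\<^esub> p | a. a \<in> carrier B}, one := p\<rparr>"

definition unitaries :: "('b, 'm) star_algebra_scheme \<Rightarrow> 'b set" where
  "unitaries B =
     {u \<in> carrier B. (star B u) \<otimes>\<^bsub>B\<^esub> u = \<one>\<^bsub>B\<^esub> \<and> u \<otimes>\<^bsub>B\<^esub> (star B u) = \<one>\<^bsub>B\<^esub>}"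

text \<open>\<open>M\<^sub>\<infinity>(A)\<close>: the direct limit of the \<open>M\<^sub>m(A)\<close> under \<open>a \<mapsto> a \<oplus> 0\<close> is realised as the union of
  the sets \<open>M\<^sub>m(A)\<close> of infinite matrices over \<open>A\<close> vanishing outside the upper left \<open>m \<times> m\<close> block.
  The sum in the product runs over the finitely many nonzero terms. There is no unit; the field
  \<open>one\<close> is unspecified (and is set by \<^const>\<open>corner\<close>).\<close>

definition mat_in ::
    "('b, 'm) star_algebra_scheme \<Rightarrow> nat \<Rightarrow> (nat \<Rightarrow> nat \<Rightarrow> 'b) set" where
  "mat_in A m = {a. (\<forall>i j. a i j \<in> carrier A) \<and> (\<forall>i j. m \<le> i \<or> m \<le> j \<longrightarrow> a i j = \<zero>\<^bsub>A\<^esub>)}"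

definition Minf :: "'b star_algebra \<Rightarrow> (nat \<Rightarrow> nat \<Rightarrow> 'b) star_algebra" where
  "Minf A =
     \<lparr>carrier = (\<Union>m. mat_in A m),
      monoid.mult = (\<lambda>a b i j. \<Oplus>\<^bsub>A\<^esub>k\<in>{k. a i k \<otimes>\<^bsub>A\<^esub> b k j \<noteq> \<zero>\<^bsub>A\<^esub>}. a i k \<otimes>\<^bsub>A\<^esub> b k j),
      monoid.one = undefined,
      ring.zero = (\<lambda>i j. \<zero>\<^bsub>A\<^esub>),
      ring.add = (\<lambda>a b i j. a i j \<oplus>\<^bsub>A\<^esub> b i j),
      module.smult = (\<lambda>c a i j. c \<odot>\<^bsub>A\<^esub> a i j),
      star = (\<lambda>a i j. star A (a j i))\<rparr>"

text \<open>\<open>C(X, M\<^sub>n)\<close>, where \<open>M\<^sub>n\<close> has its usual topology (that of the space of its entries).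
  Functions are extensional on the underlying set of \<open>X\<close>.\<close>

definition C_alg :: "'a topology \<Rightarrow> nat \<Rightarrow> ('a \<Rightarrow> complex mat) star_algebra" where
  "C_alg X n =
     \<lparr>carrier = {f \<in> topspace X \<rightarrow>\<^sub>E carrier_mat n n.
                   \<forall>i<n. \<forall>j<n. continuous_map X euclidean (\<lambda>x. f x $$ (i, j))},
      monoid.mult = (\<lambda>f g. \<lambda>x\<in>topspace X. f x * g x),
      monoid.one = (\<lambda>x\<in>topspace X. 1\<^sub>m n),
      ring.zero = (\<lambda>x\<in>topspace X. 0\<^sub>m n n),
      ring.add = (\<lambda>f g. \<lambda>x\<in>topspace X. f x + g x),
      module.smult = (\<lambda>c f. \<lambda>x\<in>topspace X. c \<cdot>\<^sub>m f x),
      star = (\<lambda>f. \<lambda>x\<in>topspace X. mat_adjoint (f x))\<rparr>"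

definition sum_alg :: "nat set \<Rightarrow> (nat \<Rightarrow> 'b star_algebra) \<Rightarrow> (nat \<Rightarrow> 'b) star_algebra" where
  "sum_alg I B =
     \<lparr>carrier = (\<Pi>\<^sub>E i\<in>I. carrier (B i)),
      monoid.mult = (\<lambda>a b. \<lambda>i\<in>I. a i \<otimes>\<^bsub>B i\<^esub> b i),
      monoid.one = (\<lambda>i\<in>I. \<one>\<^bsub>B i\<^esub>),
      ring.zero = (\<lambda>i\<in>I. \<zero>\<^bsub>B i\<^esub>),
      ring.add = (\<lambda>a b. \<lambda>i\<in>I. a i \<oplus>\<^bsub>B i\<^esub> b i),
      module.smult = (\<lambda>c a. \<lambda>i\<in>I. c \<odot>\<^bsub>B i\<^esub> a i),
      star = (\<lambda>a. \<lambda>i\<in>I. star (B i) (a i))\<rparr>"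

definition covering_dim_le :: "'a topology \<Rightarrow> nat \<Rightarrow> bool" where
  "covering_dim_le X n \<longleftrightarrow>
     (\<forall>\<U>. finite \<U> \<and> (\<forall>U\<in>\<U>. openin X U) \<and> \<Union>\<U> = topspace X \<longrightarrow>
        (\<exists>\<V>. finite \<V> \<and> (\<forall>V\<in>\<V>. openin X V) \<and> \<Union>\<V> = topspace X \<and>
             (\<forall>V\<in>\<V>. \<exists>U\<in>\<U>. V \<subseteq> U) \<and>
             (\<forall>x\<in>topspace X. card {V \<in> \<V>. x \<in> V} \<le> n + 1)))"

definition finite_covering_dim :: "'a topology \<Rightarrow> bool" where
  "finite_covering_dim X \<longleftrightarrow> (\<exists>n. covering_dim_le X n)"

text \<open>Used only under \<^const>\<open>finite_covering_dim\<close>. The empty space gets 0 rather than \<open>-1\<close>;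
  it contributes no point to a total space.\<close>

definition covering_dim :: "'a topology \<Rightarrow> nat" where
  "covering_dim X = (LEAST n. covering_dim_le X n)"

text \<open>The data of a decomposition: \<open>len\<close> is \<open>l\<close>, \<open>space k\<close> is \<open>X\<^sub>k\<close>, \<open>msize k\<close> is \<open>n(k)\<close>, and, for
  \<open>1 \<le> k \<le> l\<close>, \<open>bdry k\<close> is the closed subset of \<open>X\<^sub>k\<close> and \<open>attach k\<close> is the homomorphism from the
  stage \<open>k - 1\<close>. The points of all \<open>X\<^sub>k\<close> are taken from one type; this is no restriction, since
  \<open>X\<^sub>0, \<dots>, X\<^sub>l\<close> embed in their disjoint union. The \<open>X\<^sub>k\<close> need not be disjoint subsets of the type.\<close>

record 'a rsh_data =
  len :: nat
  space :: "nat \<Rightarrow> 'a topology"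
  msize :: "nat \<Rightarrow> nat"
  bdry :: "nat \<Rightarrow> 'a set"
  attach :: "nat \<Rightarrow> (nat \<Rightarrow> 'a \<Rightarrow> complex mat) \<Rightarrow> ('a \<Rightarrow> complex mat)"

abbreviation (input) C_stage :: "'a rsh_data \<Rightarrow> nat \<Rightarrow> ('a \<Rightarrow> complex mat) star_algebra" where
  "C_stage D k \<equiv> C_alg (space D k) (msize D k)"

abbreviation (input) C_bdry :: "'a rsh_data \<Rightarrow> nat \<Rightarrow> ('a \<Rightarrow> complex mat) star_algebra" where
  "C_bdry D k \<equiv> C_alg (subtopology (space D k) (bdry D k)) (msize D k)"

text \<open>An element of the \<open>k\<close>-th stage is written as the tuple of its components in
  \<open>C\<^sub>0 \<oplus> \<dots> \<oplus> C\<^sub>k\<close> rather than as a nested pair.\<close>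

primrec rsh_carrier :: "'a rsh_data \<Rightarrow> nat \<Rightarrow> (nat \<Rightarrow> 'a \<Rightarrow> complex mat) set" where
  "rsh_carrier D 0 = carrier (sum_alg {..0} (C_stage D))"
| "rsh_carrier D (Suc k) =
     {f \<in> carrier (sum_alg {..Suc k} (C_stage D)).
        restrict f {..k} \<in> rsh_carrier D k \<and>
        attach D (Suc k) (restrict f {..k}) = restrict (f (Suc k)) (bdry D (Suc k))}"

definition rsh_stage :: "'a rsh_data \<Rightarrow> nat \<Rightarrow> (nat \<Rightarrow> 'a \<Rightarrow> complex mat) star_algebra" where
  "rsh_stage D k = (sum_alg {..k} (C_stage D))\<lparr>carrier := rsh_carrier D k\<rparr>"

text \<open>The spaces may be empty, which includes the zero algebra.\<close>

definition rsh_decomposition :: "'a rsh_data \<Rightarrow> bool" where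
  "rsh_decomposition D \<longleftrightarrow>
     (\<forall>k\<le>len D. compact_space (space D k) \<and> Hausdorff_space (space D k) \<and> 1 \<le> msize D k) \<and>
     (\<forall>k\<in>{1..len D}. closedin (space D k) (bdry D k) \<and>
        attach D k \<in> unital_star_hom (rsh_stage D (k - 1)) (C_bdry D k))"

definition rsh_algebra :: "'a rsh_data \<Rightarrow> (nat \<Rightarrow> 'a \<Rightarrow> complex mat) star_algebra" where
  "rsh_algebra D = rsh_stage D (len D)"

abbreviation rsh_Minf :: "'a rsh_data \<Rightarrow> (nat \<Rightarrow> nat \<Rightarrow> nat \<Rightarrow> 'a \<Rightarrow> complex mat) star_algebra" where
  "rsh_Minf D \<equiv> Minf (rsh_algebra D)"

definition total_space :: "'a rsh_data \<Rightarrow> (nat \<times> 'a) set" where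
  "total_space D = (SIGMA k:{..len D}. topspace (space D k))"

definition top_dim :: "'a rsh_data \<Rightarrow> nat \<times> 'a \<Rightarrow> nat" where
  "top_dim D = (\<lambda>(k, x). covering_dim (space D k))"

definition finite_top_dim :: "'a rsh_data \<Rightarrow> bool" where
  "finite_top_dim D \<longleftrightarrow> (\<forall>k\<le>len D. finite_covering_dim (space D k))"

definition ev :: "nat \<times> 'a \<Rightarrow> (nat \<Rightarrow> 'a \<Rightarrow> complex mat) \<Rightarrow> complex mat" where
  "ev = (\<lambda>(k, x) f. f k x)"

text \<open>The entrywise extension of \<^const>\<open>ev\<close> to \<open>M\<^sub>\<infinity>\<close>: for \<open>a \<in> M\<^sub>m(A)\<close> with \<open>m\<close> least, the matrix
  \<open>(ev\<^sub>x(a\<^sub>i\<^sub>j))\<close> in \<open>M\<^sub>m(M\<^sub>n) = M\<^sub>m\<^sub>n\<close>. A larger \<open>m\<close> only adds zero rows and columns.\<close>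

definition ev_Minf ::
    "'a rsh_data \<Rightarrow> nat \<times> 'a \<Rightarrow> (nat \<Rightarrow> nat \<Rightarrow> nat \<Rightarrow> 'a \<Rightarrow> complex mat) \<Rightarrow> complex mat" where
  "ev_Minf D z a =
     (let m = (LEAST m. a \<in> mat_in (rsh_algebra D) m); n = msize D (fst z)
      in mat (m * n) (m * n)
           (\<lambda>(r, s). ev z (a (r div n) (s div n)) $$ (r mod n, s mod n)))"

definition mat_rank :: "complex mat \<Rightarrow> nat" where
  "mat_rank M = vec_space.rank (dim_row M) M"

definition l2norm :: "complex vec \<Rightarrow> real" where
  "l2norm v = sqrt (\<Sum>i<dim_vec v. (cmod (v $ i))\<^sup>2)"

definition op_norm :: "complex mat \<Rightarrow> real" where
  "op_norm M = Sup {l2norm (M *\<^sub>v v) | v. v \<in> carrier_vec (dim_col M) \<and> l2norm v \<le> 1}"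

text \<open>The C*-norm of \<open>M\<^sub>\<infinity>(A)\<close>, i.e. the norm it inherits from the algebras
  \<open>M\<^sub>m(\<Oplus>\<^sub>k C(X\<^sub>k, M\<^sub>n\<^sub>(\<^sub>k\<^sub>)))\<close>. Inserting 0 only matters if the total space is empty.\<close>

definition Minf_norm ::
    "'a rsh_data \<Rightarrow> (nat \<Rightarrow> nat \<Rightarrow> nat \<Rightarrow> 'a \<Rightarrow> complex mat) \<Rightarrow> real" where
  "Minf_norm D a = Sup (insert 0 ((\<lambda>z. op_norm (ev_Minf D z a)) ` total_space D))"

definition homotopic_unitaries ::
    "'a rsh_data \<Rightarrow> (nat \<Rightarrow> nat \<Rightarrow> nat \<Rightarrow> 'a \<Rightarrow> complex mat) \<Rightarrow>
     (nat \<Rightarrow> nat \<Rightarrow> nat \<Rightarrow> 'a \<Rightarrow> complex mat) \<Rightarrow>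
     (nat \<Rightarrow> nat \<Rightarrow> nat \<Rightarrow> 'a \<Rightarrow> complex mat) \<Rightarrow> bool" where
  "homotopic_unitaries D e u v \<longleftrightarrow>
     (\<exists>\<gamma>. (\<forall>t\<in>{0..1::real}. \<gamma> t \<in> unitaries (corner (rsh_Minf D) e)) \<and>
          \<gamma> 0 = u \<and> \<gamma> 1 = v \<and>
          (\<forall>t\<in>{0..1}. ((\<lambda>s. Minf_norm D (\<gamma> s \<ominus>\<^bsub>rsh_Minf D\<^esub> \<gamma> t)) \<longlongrightarrow> 0)
                         (at t within {0..1})))"

end

theory Submission
  imports "HOL-Analysis.Urysohn" Defs
begin

text \<open>
  Put \<open>e = q - p\<close>. The unitaries \<open>v + e\<close> with \<open>v \<in> U(p M\<^sub>\<infinity>(A) p)\<close> are exactly the unitaries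
  \<open>w \<in> U(q M\<^sub>\<infinity>(A) q)\<close> with \<open>w e = e\<close>. So the first part asks for a deformation of \<open>u\<close> to such a
  \<open>w\<close>, and the second one for a deformation, with fixed end points, of a path whose end points
  satisfy \<open>w e = e\<close> into a path all of whose members do. Both are cases of one statement about a
  family \<open>(U\<^sub>t)\<close> of unitaries indexed by a compact \<open>T\<close>, whose members with \<open>t\<close> in a closed subset
  \<open>T\<^sub>0\<close> already fix \<open>e\<close> and must not move: \<open>T = {0}\<close>, \<open>T\<^sub>0 = {}\<close> in the first part and
  \<open>T = [0, 1]\<close>, \<open>T\<^sub>0 = {0, 1}\<close> in the second (\<open>deform_paths\<close>).

  Over a single space \<open>X\<close>, \<open>u \<mapsto> u e\<close> sends unitaries of \<open>q\<close> to isometries from the range of \<open>e\<close>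
  into the range of \<open>q\<close>. At each point these isometries form a Stiefel manifold, which is
  \<open>2r\<close>-connected for \<open>r = rank q - rank e = rank p\<close>. Hence \<open>u e\<close> can be deformed to \<open>e\<close>, with
  the deformation prescribed on a closed subset, as soon as \<open>dim (X \<times> T \<times> [0, 1]) \<le> 2r + 1\<close>. The
  dimension on the left is at most \<open>d + 1\<close> in the first and \<open>d + 2\<close> in the second part, and this is
  where the two rank conditions come from. The deformation of \<open>u e\<close> is then lifted to one of \<open>u\<close>
  (\<open>deform_unitaries_over_space\<close>).

  The extension theorem for isometries (\<open>extend_partial_isometry\<close>) is proved without homotopy
  groups. Extension problems whose solutions are defined pointwise may be solved locally
  (\<open>glue_local_extensions\<close>); locally \<open>e\<close> has a unit section, and splitting it off reduces the problem
  to one for unit sections of a projection of rank \<open>m\<close> in dimension less than \<open>2m\<close>. A section has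
  \<open>2m\<close> real coordinates there, and these can be perturbed so as to have no common zero
  (\<open>perturb_to_nonvanishing\<close>). The lifting to unitaries is a homotopy lifting property
  (\<open>unitary_lift\<close>), made explicit by the Cayley transform: near the identity, the equation \<open>w s = t\<close>
  for a unitary \<open>w\<close> becomes a linear equation for a skew-Hermitian matrix.

  For a recursive subhomogeneous algebra the deformation is built stage by stage
  (\<open>deform_unitaries\<close>). The homomorphism from the stage \<open>k\<close> carries the deformation found so far to
  the closed subset \<open>X\<^sub>k\<^sub>+\<^sub>1\<^sup>(\<^sup>0\<^sup>)\<close> of \<open>X\<^sub>k\<^sub>+\<^sub>1\<close>, and the result is extended over \<open>X\<^sub>k\<^sub>+\<^sub>1\<close>. The
  transported family is again jointly continuous because homomorphisms are bounded
  (\<open>\<alpha>_bounded\<close>): a stage contains the pointwise inverses of its elements, so a homomorphism cannot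
  enlarge spectra.

  A matrix over the algebra is handled as the family of its values, and a path of such matrices is
  norm continuous iff the corresponding families are jointly continuous in the point and the
  parameter (\<open>homotopicD\<close>, \<open>homotopicI\<close>), by compactness of the spaces.
\<close>

section \<open>Finitely supported complex matrices\<close>

text \<open>The matrices of all sizes form one type, the ring \<open>M\<^sub>\<infinity>(\<complex>)\<close>. It serves for the values of matrices over
  an algebra whose fibres have varying size, and as the ring has no unit, each argument picks a
  bound \<open>N\<close> for the sizes and works with \<open>Id N\<close>. The norm is the Frobenius norm, which comes from an
  inner product.\<close>

typedef fmat = "{a :: nat \<Rightarrow> nat \<Rightarrow> complex. \<exists>N. \<forall>i j. N \<le> i \<or> N \<le> j \<longrightarrow> a i j = 0}"
  morphisms ent Fmat
  by (rule exI[of _ "\<lambda>_ _. 0"]) simp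

definition bnd :: "nat \<Rightarrow> fmat \<Rightarrow> bool" where
  "bnd N a \<longleftrightarrow> (\<forall>i j. N \<le> i \<or> N \<le> j \<longrightarrow> ent a i j = 0)"

definition fm :: "nat \<Rightarrow> (nat \<Rightarrow> nat \<Rightarrow> complex) \<Rightarrow> fmat" where
  "fm N f = Fmat (\<lambda>i j. if i < N \<and> j < N then f i j else 0)"

definition deg :: "fmat \<Rightarrow> nat" where "deg a = (LEAST N. bnd N a)"

lemma ent_Fmat: "(\<And>i j. N \<le> i \<or> N \<le> j \<Longrightarrow> a i j = 0) \<Longrightarrow> ent (Fmat a) = a"
  by (rule Fmat_inverse) blast

lemma ent_fm [simp]: "ent (fm N f) i j = (if i < N \<and> j < N then f i j else 0)"
  unfolding fm_def by (subst ent_Fmat[of N]) auto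

lemma fmat_eqI: "(\<And>i j. ent a i j = ent b i j) \<Longrightarrow> a = b"
  by (metis ent_inject ext)

lemma ex_bnd: "\<exists>N. bnd N a"
  using ent[of a] by (auto simp: bnd_def)

lemma bnd_deg: "bnd (deg a) a"
  unfolding deg_def using ex_bnd by (metis LeastI)

lemma bnd_mono: "bnd N a \<Longrightarrow> N \<le> M \<Longrightarrow> bnd M a"
  by (auto simp: bnd_def)

lemma bnd_fm [simp]: "bnd N (fm N f)"
  by (auto simp: bnd_def)

lemma bnd_ent: "bnd N a \<Longrightarrow> N \<le> i \<or> N \<le> j \<Longrightarrow> ent a i j = 0"
  by (auto simp: bnd_def)

lemma ex_bnd2: obtains N where "bnd N a" "bnd N b"
  using bnd_mono[OF bnd_deg, of a "max (deg a) (deg b)"] bnd_mono[OF bnd_deg, of b "max (deg a) (deg b)"] by auto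

lemma ex_bnd3: obtains N where "bnd N a" "bnd N b" "bnd N c"
proof -
  obtain M where "bnd M a" "bnd M b" using ex_bnd2 by blast
  then show ?thesis
    using bnd_mono[of M _ "max M (deg c)"] bnd_mono[OF bnd_deg, of c "max M (deg c)"] that by auto
qed

instantiation fmat :: ring
begin
definition "0 = Fmat (\<lambda>_ _. 0)"
definition "a + b = Fmat (\<lambda>i j. ent a i j + ent b i j)"
definition "a - b = Fmat (\<lambda>i j. ent a i j - ent b i j)"
definition "- a = Fmat (\<lambda>i j. - ent a i j)"
definition "a * b = Fmat (\<lambda>i j. \<Sum>l<deg a. ent a i l * ent b l j)"

lemma ent_0 [simp]: "ent 0 i j = 0"
  unfolding zero_fmat_def by (subst ent_Fmat) auto
lemma ent_add [simp]: "ent (a + b) i j = ent a i j + ent b i j"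
proof -
  obtain N where "bnd N a" "bnd N b" by (rule ex_bnd2)
  then show ?thesis unfolding plus_fmat_def by (subst ent_Fmat[of N]) (auto simp: bnd_def)
qed
lemma ent_diff [simp]: "ent (a - b) i j = ent a i j - ent b i j"
proof -
  obtain N where "bnd N a" "bnd N b" by (rule ex_bnd2)
  then show ?thesis unfolding minus_fmat_def by (subst ent_Fmat[of N]) (auto simp: bnd_def)
qed
lemma ent_uminus [simp]: "ent (- a) i j = - ent a i j"
  unfolding uminus_fmat_def using bnd_deg[of a] by (subst ent_Fmat[of "deg a"]) (auto simp: bnd_def)

lemma ent_mult: assumes "bnd N a" shows "ent (a * b) i j = (\<Sum>l<N. ent a i l * ent b l j)"
proof -
  obtain M where M: "bnd M a" "bnd M b" by (rule ex_bnd2)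
  have "ent (a * b) i j = (\<Sum>l<deg a. ent a i l * ent b l j)"
    unfolding times_fmat_def using M by (subst ent_Fmat[of M]) (auto simp: bnd_def)
  also have "\<dots> = (\<Sum>l<max N (deg a). ent a i l * ent b l j)"
    by (rule sum.mono_neutral_left) (auto simp: bnd_ent[OF bnd_deg])
  also have "\<dots> = (\<Sum>l<N. ent a i l * ent b l j)"
    by (rule sum.mono_neutral_right) (auto simp: bnd_ent[OF assms])
  finally show ?thesis .
qed

instance
proof
  fix a b c :: fmat
  obtain N where N: "bnd N a" "bnd N b" "bnd N c" by (rule ex_bnd3)
  have ab: "bnd N (a * b)" using N by (auto simp: bnd_def ent_mult[OF N(1)])
  have bc: "bnd N (a + b)" using N by (auto simp: bnd_def)
  show "a * b * c = a * (b * c)"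
  proof (rule fmat_eqI)
    fix i j
    have "ent (a * b * c) i j = (\<Sum>l<N. \<Sum>k<N. ent a i k * ent b k l * ent c l j)"
      by (simp add: ent_mult[OF ab] ent_mult[OF N(1)] sum_distrib_right)
    also have "\<dots> = (\<Sum>k<N. \<Sum>l<N. ent a i k * ent b k l * ent c l j)" by (rule sum.swap)
    also have "\<dots> = ent (a * (b * c)) i j"
      by (simp add: ent_mult[OF N(2)] ent_mult[OF N(1)] sum_distrib_left mult.assoc)
    finally show "ent (a * b * c) i j = ent (a * (b * c)) i j" .
  qed
  show "(a + b) * c = a * c + b * c"
    by (rule fmat_eqI) (simp add: ent_mult[OF bc] ent_mult[OF N(1)] ent_mult[OF N(2)] algebra_simps sum.distrib)
  show "a * (b + c) = a * b + a * c"
    by (rule fmat_eqI) (simp add: ent_mult[OF N(1)] algebra_simps sum.distrib)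
qed (rule fmat_eqI, simp)+
end

lemma bnd_0 [simp]: "bnd N 0" by (simp add: bnd_def)
lemma bnd_add [simp]: "bnd N a \<Longrightarrow> bnd N b \<Longrightarrow> bnd N (a + b)" by (simp add: bnd_def)
lemma bnd_diff [simp]: "bnd N a \<Longrightarrow> bnd N b \<Longrightarrow> bnd N (a - b)" by (simp add: bnd_def)
lemma bnd_mult [simp]: "bnd N a \<Longrightarrow> bnd N b \<Longrightarrow> bnd N (a * b)"
  by (auto simp: bnd_def ent_mult[of N])
lemma bnd_sum [simp]: "(\<And>i. i \<in> I \<Longrightarrow> bnd N (f i)) \<Longrightarrow> bnd N (sum f I)"
  by (induction I rule: infinite_finite_induct) auto

lemma ent_sum [simp]: "ent (sum f I) i j = (\<Sum>k\<in>I. ent (f k) i j)"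
  by (induction I rule: infinite_finite_induct) auto

lemma ent_mult': assumes "bnd N b" shows "ent (a * b) i j = (\<Sum>l<N. ent a i l * ent b l j)"
proof -
  obtain M where M: "bnd M a" "bnd M b" by (rule ex_bnd2)
  have "ent (a * b) i j = (\<Sum>l<max N M. ent a i l * ent b l j)"
    using M(1) by (intro ent_mult) (auto elim: bnd_mono)
  also have "\<dots> = (\<Sum>l<N. ent a i l * ent b l j)"
    by (rule sum.mono_neutral_right) (auto simp: bnd_ent[OF assms])
  finally show ?thesis .
qed

instantiation fmat :: real_inner
begin
definition "r *\<^sub>R a = Fmat (\<lambda>i j. r *\<^sub>R ent a i j)"
definition "inner a b = (\<Sum>i<deg a. \<Sum>j<deg a. inner (ent a i j) (ent b i j))"
definition "norm (a::fmat) = sqrt (inner a a)"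
definition "sgn (a::fmat) = inverse (norm a) *\<^sub>R a"
definition "dist a (b::fmat) = norm (a - b)"
definition uniformity_fmat :: "(fmat \<times> fmat) filter" where
  "uniformity_fmat = (INF e\<in>{0<..}. principal {(x, y). dist x y < e})"
definition open_fmat :: "fmat set \<Rightarrow> bool" where
  "open_fmat U \<longleftrightarrow> (\<forall>x\<in>U. eventually (\<lambda>(x', y). x' = x \<longrightarrow> y \<in> U) uniformity)"

lemma ent_scaleR [simp]: "ent (r *\<^sub>R a) i j = r *\<^sub>R ent a i j"
  unfolding scaleR_fmat_def using bnd_deg[of a] by (subst ent_Fmat[of "deg a"]) (auto simp: bnd_def)

lemma inner_fmat: assumes "bnd N a"
  shows "inner a b = (\<Sum>i<N. \<Sum>j<N. inner (ent a i j) (ent b i j))"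
proof -
  let ?f = "\<lambda>(i, j). inner (ent a i j) (ent b i j)"
  let ?M = "max N (deg a)"
  have *: "?f (i, j) = 0" if "\<not> (i < N \<and> j < N) \<or> \<not> (i < deg a \<and> j < deg a)" for i j
    using that bnd_ent[OF assms, of i j] bnd_ent[OF bnd_deg, of a i j] by (auto simp: not_less)
  have "inner a b = sum ?f ({..<deg a} \<times> {..<deg a})"
    unfolding inner_fmat_def by (simp only: sum.cartesian_product)
  also have "\<dots> = sum ?f ({..<?M} \<times> {..<?M})"
    by (rule sum.mono_neutral_left) (use * in auto)
  also have "\<dots> = sum ?f ({..<N} \<times> {..<N})"
    by (rule sum.mono_neutral_right) (use * in auto)
  finally show ?thesis by (simp only: sum.cartesian_product)
qed

instance
proof
  fix a b c :: fmat and r s :: real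
  obtain N where N: "bnd N a" "bnd N b" "bnd N c" by (rule ex_bnd3)
  show "r *\<^sub>R (a + b) = r *\<^sub>R a + r *\<^sub>R b" by (rule fmat_eqI) (simp add: algebra_simps)
  show "(r + s) *\<^sub>R a = r *\<^sub>R a + s *\<^sub>R a" by (rule fmat_eqI) (simp add: algebra_simps)
  show "r *\<^sub>R s *\<^sub>R a = (r * s) *\<^sub>R a" by (rule fmat_eqI) simp
  show "1 *\<^sub>R a = a" by (rule fmat_eqI) simp
  show "dist a b = norm (a - b)" by (rule dist_fmat_def)
  show "sgn a = inverse (norm a) *\<^sub>R a" by (rule sgn_fmat_def)
  show "inner a b = inner b a"
    by (simp add: inner_fmat[OF N(1)] inner_fmat[OF N(2)] inner_commute)
  have "bnd N (a + b)" using N by (simp add: bnd_def)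
  then show "inner (a + b) c = inner a c + inner b c"
    by (simp add: inner_fmat[of N] N inner_add_left sum.distrib)
  have "bnd N (r *\<^sub>R a)" using N by (simp add: bnd_def)
  then show "inner (r *\<^sub>R a) b = r * inner a b"
    by (simp add: inner_fmat[of N] N sum_distrib_left)
  show "0 \<le> inner a a"
    by (simp add: inner_fmat[OF N(1)] sum_nonneg)
  show "inner a a = 0 \<longleftrightarrow> a = 0"
  proof
    assume "inner a a = 0"
    then have "(\<Sum>(i, j)\<in>{..<N} \<times> {..<N}. (cmod (ent a i j))\<^sup>2) = 0"
      by (simp add: inner_fmat[OF N(1)] power2_norm_eq_inner sum.cartesian_product)
    then have "\<forall>x\<in>{..<N} \<times> {..<N}. (case x of (i, j) \<Rightarrow> (cmod (ent a i j))\<^sup>2) = 0"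
      by (subst (asm) sum_nonneg_eq_0_iff) auto
    then show "a = 0" using N(1) by (intro fmat_eqI) (force simp: bnd_def not_le)
  next
    assume "a = 0"
    with N(1) show "inner a a = 0" by (simp add: inner_fmat[of N])
  qed
  show "norm a = sqrt (inner a a)" by (rule norm_fmat_def)
qed (rule uniformity_fmat_def open_fmat_def)+
end

lemma bnd_scaleR [simp]: "bnd N a \<Longrightarrow> bnd N (r *\<^sub>R a)" by (simp add: bnd_def)

lemma norm_fmat_sq: assumes "bnd N a" shows "(norm a)\<^sup>2 = (\<Sum>i<N. \<Sum>j<N. (cmod (ent a i j))\<^sup>2)"
  by (simp add: power2_norm_eq_inner inner_fmat[OF assms])

instance fmat :: real_normed_algebra
proof
  fix a b :: fmat and r :: real
  show "r *\<^sub>R a * b = r *\<^sub>R (a * b)"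
    using bnd_deg[of a] by (intro fmat_eqI) (simp add: ent_mult[of "deg a"] scaleR_sum_right)
  show "a * r *\<^sub>R b = r *\<^sub>R (a * b)"
    using bnd_deg[of a] by (intro fmat_eqI) (simp add: ent_mult[of "deg a"] scaleR_sum_right)
  obtain N where N: "bnd N a" "bnd N b" by (rule ex_bnd2)
  have "(norm (a * b))\<^sup>2 = (\<Sum>i<N. \<Sum>j<N. (cmod (\<Sum>l<N. ent a i l * ent b l j))\<^sup>2)"
    using N by (simp add: norm_fmat_sq[of N] ent_mult[OF N(1)])
  also have "\<dots> \<le> (\<Sum>i<N. \<Sum>j<N. (\<Sum>l<N. (cmod (ent a i l))\<^sup>2) * (\<Sum>l<N. (cmod (ent b l j))\<^sup>2))"
  proof (intro sum_mono)
    fix i j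
    have "cmod (\<Sum>l<N. ent a i l * ent b l j) \<le> (\<Sum>l<N. cmod (ent a i l) * cmod (ent b l j))"
      by (rule order_trans[OF norm_sum]) (simp add: norm_mult)
    then have "(cmod (\<Sum>l<N. ent a i l * ent b l j))\<^sup>2 \<le> (\<Sum>l<N. cmod (ent a i l) * cmod (ent b l j))\<^sup>2"
      by (simp add: power_mono)
    also have "\<dots> \<le> (\<Sum>l<N. (cmod (ent a i l))\<^sup>2) * (\<Sum>l<N. (cmod (ent b l j))\<^sup>2)"
      by (rule Cauchy_Schwarz_ineq_sum)
    finally show "(cmod (\<Sum>l<N. ent a i l * ent b l j))\<^sup>2 \<le>
      (\<Sum>l<N. (cmod (ent a i l))\<^sup>2) * (\<Sum>l<N. (cmod (ent b l j))\<^sup>2)" .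
  qed
  also have "\<dots> = (\<Sum>i<N. \<Sum>l<N. (cmod (ent a i l))\<^sup>2) * (\<Sum>j<N. \<Sum>l<N. (cmod (ent b l j))\<^sup>2)"
    by (simp add: sum_product)
  also have "\<dots> = (norm a)\<^sup>2 * (norm b)\<^sup>2"
    using N by (simp add: norm_fmat_sq[of N], subst (2) sum.swap) simp
  finally have "(norm (a * b))\<^sup>2 \<le> (norm a * norm b)\<^sup>2" by (simp add: power_mult_distrib)
  then show "norm (a * b) \<le> norm a * norm b"
    by (rule power2_le_imp_le) simp
qed

definition adj :: "fmat \<Rightarrow> fmat" where
  "adj a = fm (deg a) (\<lambda>i j. cnj (ent a j i))"

lemma ent_adj [simp]: "ent (adj a) i j = cnj (ent a j i)"
  using bnd_deg[of a] by (auto simp: adj_def bnd_def not_less)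

lemma bnd_adj [simp]: "bnd N (adj a) \<longleftrightarrow> bnd N a"
  by (auto simp: bnd_def)

lemma adj_add [simp]: "adj (a + b) = adj a + adj b" by (rule fmat_eqI) simp
lemma adj_diff [simp]: "adj (a - b) = adj a - adj b" by (rule fmat_eqI) simp
lemma adj_uminus [simp]: "adj (- a) = - adj a" by (rule fmat_eqI) simp
lemma adj_0 [simp]: "adj 0 = 0" by (rule fmat_eqI) simp
lemma adj_scaleR [simp]: "adj (r *\<^sub>R a) = r *\<^sub>R adj a" by (rule fmat_eqI) simp
lemma adj_adj [simp]: "adj (adj a) = a" by (rule fmat_eqI) simp
lemma adj_mult [simp]: "adj (a * b) = adj b * adj a"
proof (rule fmat_eqI)
  fix i j
  obtain N where N: "bnd N a" "bnd N b" by (rule ex_bnd2)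
  then show "ent (adj (a * b)) i j = ent (adj b * adj a) i j"
    by (simp add: ent_mult[of N] mult.commute)
qed

lemma inner_adj: "inner (adj a) (adj b) = inner a b"
proof -
  have "bnd (deg a) a" "bnd (deg a) (adj a)" using bnd_deg by simp_all
  then show ?thesis
    by (simp only: inner_fmat[of "deg a"] ent_adj, subst sum.swap) (simp add: inner_complex_def)
qed

lemma norm_adj [simp]: "norm (adj a) = norm a"
  by (simp add: norm_eq_sqrt_inner inner_adj)

lemma inner_mult_left: "inner (a * b) c = inner b (adj a * c)"
proof -
  obtain N where N: "bnd N a" "bnd N b" "bnd N c" by (rule ex_bnd3)
  let ?f = "\<lambda>i j l. Re (cnj (ent a i l) * cnj (ent b l j) * ent c i j)"
  have i: "inner z w = Re (cnj z * w)" for z w by (simp add: inner_complex_def)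
  have "inner (a * b) c = (\<Sum>i<N. \<Sum>j<N. \<Sum>l<N. ?f i j l)"
    using N by (simp only: inner_fmat[OF bnd_mult] i ent_mult[OF N(1)] cnj_sum complex_cnj_mult
        sum_distrib_right Re_sum)
  also have "\<dots> = (\<Sum>i<N. \<Sum>l<N. \<Sum>j<N. ?f i j l)"
    by (rule sum.cong[OF refl], rule sum.swap)
  also have "\<dots> = (\<Sum>l<N. \<Sum>i<N. \<Sum>j<N. ?f i j l)"
    by (rule sum.swap)
  also have "\<dots> = (\<Sum>l<N. \<Sum>j<N. \<Sum>i<N. ?f i j l)"
    by (rule sum.cong[OF refl], rule sum.swap)
  also have "\<dots> = inner b (adj a * c)"
    using N by (simp add: inner_fmat[OF N(2)] i ent_mult[of N "adj a"] sum_distrib_left Re_sum ac_simps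
      del: times_complex.simps)
  finally show ?thesis .
qed

lemma inner_mult_right: "inner (a * b) c = inner a (c * adj b)"
  by (metis adj_adj adj_mult inner_adj inner_mult_left)

definition Id :: "nat \<Rightarrow> fmat" where "Id N = fm N (\<lambda>i j. if i = j then 1 else 0)"

lemma ent_Id: "ent (Id N) i j = (if i = j \<and> i < N then 1 else 0)" by (auto simp: Id_def)
lemma bnd_Id [simp]: "bnd N (Id N)" by (simp add: Id_def)
lemma adj_Id [simp]: "adj (Id N) = Id N" by (rule fmat_eqI) (simp add: ent_Id)
lemma Id_mult: "bnd N a \<Longrightarrow> Id N * a = a"
proof (rule fmat_eqI)
  fix i j assume N: "bnd N a"
  have "ent (Id N * a) i j = (\<Sum>l<N. if l = i then ent a i j else 0)"
    by (subst ent_mult[of N], simp, rule sum.cong) (auto simp: ent_Id)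
  then show "ent (Id N * a) i j = ent a i j" using bnd_ent[OF N, of i j] by (auto simp: not_less)
qed
lemma mult_Id: "bnd N a \<Longrightarrow> a * Id N = a"
  using Id_mult[of N "adj a"] by (metis adj_Id adj_adj adj_mult bnd_adj)

lemma adj_mult_self_eq_0 [simp]: "adj a * a = 0 \<longleftrightarrow> a = 0"
proof
  assume 0: "adj a * a = 0"
  have "inner a a = inner (a * Id (deg a)) a" by (simp add: mult_Id bnd_deg)
  also have "\<dots> = 0" by (simp add: inner_mult_left 0)
  finally show "a = 0" by simp
qed simp

text \<open>The matrix with the single nonzero entry \<open>z\<close>.\<close>

definition unit_mat :: "nat \<Rightarrow> nat \<Rightarrow> complex \<Rightarrow> fmat" where
  "unit_mat i j z = fm (Suc (max i j)) (\<lambda>k l. if k = i \<and> l = j then z else 0)"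

lemma ent_unit_mat [simp]: "ent (unit_mat i j z) k l = (if k = i \<and> l = j then z else 0)"
  by (auto simp: unit_mat_def)

lemma bnd_unit_mat: "i < N \<Longrightarrow> j < N \<Longrightarrow> bnd N (unit_mat i j z)"
  by (auto simp: bnd_def)

lemma adj_unit_mat [simp]: "adj (unit_mat i j z) = unit_mat j i (cnj z)"
  by (rule fmat_eqI) auto

lemma mult_unit_mat_ent: "ent (a * unit_mat i j z) k l = (if l = j then ent a k i * z else 0)"
  by (auto simp: ent_mult'[OF bnd_unit_mat[of i "Suc (max i j)"]] if_distrib[of "\<lambda>x. _ * x"] cong: if_cong)

lemma unit_mat_mult [simp]: "unit_mat i j z * unit_mat k l w = (if j = k then unit_mat i l (z * w) else 0)"
  by (rule fmat_eqI) (auto simp: mult_unit_mat_ent)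

lemma norm_unit_mat [simp]: "norm (unit_mat i j z) = cmod z"
proof -
  obtain N where N: "i < N" "j < N" by (meson less_Suc_eq_le max.cobounded1 max.cobounded2)
  have "(\<Sum>l<N. (cmod (ent (unit_mat i j z) k l))\<^sup>2) = (if k = i then (cmod z)\<^sup>2 else 0)" for k
  proof -
    have "(\<Sum>l<N. (cmod (ent (unit_mat i j z) k l))\<^sup>2) = (\<Sum>l<N. if l = j then if k = i then (cmod z)\<^sup>2 else 0 else 0)"
      by (rule sum.cong) auto
    then show ?thesis using N by simp
  qed
  then have "(norm (unit_mat i j z))\<^sup>2 = (cmod z)\<^sup>2"
    using N by (simp add: norm_fmat_sq[OF bnd_unit_mat[OF N]])
  then show ?thesis by simp
qed

lemma unit_mat_add: "unit_mat i j (z + w) = unit_mat i j z + unit_mat i j w"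
  by (rule fmat_eqI) auto

lemma unit_mat_0 [simp]: "unit_mat i j 0 = 0"
  by (rule fmat_eqI) auto

lemma fmat_eq_sum_unit_mat: "bnd N a \<Longrightarrow> a = (\<Sum>i<N. \<Sum>j<N. unit_mat i j (ent a i j))"
proof (rule fmat_eqI)
  fix k l assume N: "bnd N a"
  have "(\<Sum>j<N. ent (unit_mat i j (ent a i j)) k l) = (if i = k then ent a k l else 0)" for i
  proof -
    have "(\<Sum>j<N. ent (unit_mat i j (ent a i j)) k l) = (\<Sum>j<N. if j = l then if i = k then ent a k l else 0 else 0)"
      by (rule sum.cong) auto
    then show ?thesis using bnd_ent[OF N, of k l] by (auto simp: not_less)
  qed
  then have "ent (\<Sum>i<N. \<Sum>j<N. unit_mat i j (ent a i j)) k l = (\<Sum>i<N. if i = k then ent a k l else 0)"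
    by (simp only: ent_sum)
  also have "\<dots> = ent a k l" using bnd_ent[OF N, of k l] by (auto simp: not_less)
  finally show "ent a k l = ent (\<Sum>i<N. \<Sum>j<N. unit_mat i j (ent a i j)) k l" by simp
qed

lemma norm_ent_le: "cmod (ent a i j) \<le> norm a"
proof -
  define N where "N = Suc (max (deg a) (max i j))"
  have N: "bnd N a" "i < N" "j < N" by (auto simp: N_def intro: bnd_mono[OF bnd_deg])
  have "(cmod (ent a i j))\<^sup>2 \<le> (\<Sum>j<N. (cmod (ent a i j))\<^sup>2)"
    using N by (intro member_le_sum[of j "{..<N}" "\<lambda>j. (cmod (ent a i j))\<^sup>2"]) auto
  also have "\<dots> \<le> (\<Sum>i<N. \<Sum>j<N. (cmod (ent a i j))\<^sup>2)"
    using N by (intro member_le_sum[of i "{..<N}" "\<lambda>i. \<Sum>j<N. (cmod (ent a i j))\<^sup>2"]) (auto intro: sum_nonneg)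
  also have "\<dots> = (norm a)\<^sup>2" using N by (simp add: norm_fmat_sq)
  finally show ?thesis by (rule power2_le_imp_le) simp
qed

lemma norm_le_sum_ent: assumes "bnd N a" shows "norm a \<le> (\<Sum>i<N. \<Sum>j<N. cmod (ent a i j))"
proof -
  have "norm (\<Sum>i<N. \<Sum>j<N. unit_mat i j (ent a i j)) \<le> (\<Sum>i<N. \<Sum>j<N. norm (unit_mat i j (ent a i j)))"
    by (rule order_trans[OF norm_sum sum_mono[OF norm_sum]])
  then show ?thesis by (simp only: fmat_eq_sum_unit_mat[OF assms, symmetric] norm_unit_mat)
qed

subsection \<open>Continuous matrix-valued functions\<close>

lemma continuous_map_fmat_compose:
  assumes "continuous_map X euclidean f" "continuous_on UNIV g"
  shows "continuous_map X euclidean (\<lambda>x. g (f x))"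
  using continuous_map_compose[OF assms(1), of euclidean g] assms(2) by (simp add: o_def)

lemma continuous_on_ent: "continuous_on UNIV (\<lambda>a. ent a i j)"
proof -
  have "bounded_linear (\<lambda>a. ent a i j)"
    by (rule bounded_linear_intro[of _ 1]) (simp_all add: norm_ent_le)
  then show ?thesis by (simp add: linear_continuous_on)
qed

lemma continuous_on_adj: "continuous_on UNIV adj"
proof -
  have "bounded_linear adj"
    by (rule bounded_linear_intro[of _ 1]) (simp_all)
  then show ?thesis by (simp add: linear_continuous_on)
qed

lemma continuous_on_unit_mat: "continuous_on UNIV (unit_mat i j)"
proof -
  have "bounded_linear (unit_mat i j)"
    by (rule bounded_linear_intro[of _ 1]) (auto simp: unit_mat_add intro: fmat_eqI)
  then show ?thesis by (simp add: linear_continuous_on)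
qed

lemma continuous_map_ent [continuous_intros]:
  "continuous_map X euclidean f \<Longrightarrow> continuous_map X euclidean (\<lambda>x. ent (f x) i j)"
  by (rule continuous_map_fmat_compose[OF _ continuous_on_ent])

lemma continuous_map_adj [continuous_intros]:
  "continuous_map X euclidean f \<Longrightarrow> continuous_map X euclidean (\<lambda>x. adj (f x))"
  by (rule continuous_map_fmat_compose[OF _ continuous_on_adj])

lemma continuous_map_unit_mat [continuous_intros]:
  "continuous_map X euclidean f \<Longrightarrow> continuous_map X euclidean (\<lambda>x. unit_mat i j (f x))"
  by (rule continuous_map_fmat_compose[OF _ continuous_on_unit_mat])

lemma continuous_map_bilinear:
  fixes h :: "'b::real_normed_vector \<Rightarrow> 'c::real_normed_vector \<Rightarrow> 'd::real_normed_vector"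
  assumes "bounded_bilinear h" "continuous_map X euclidean f" "continuous_map X euclidean g"
  shows "continuous_map X euclidean (\<lambda>x. h (f x) (g x))"
proof -
  interpret bounded_bilinear h by fact
  have "continuous_map X (prod_topology euclidean euclidean) (\<lambda>x. (f x, g x))"
    using assms by (intro continuous_map_pairedI)
  then have "continuous_map X euclidean (\<lambda>x. (f x, g x))"
    by (simp only: prod_topology_euclidean)
  moreover have "continuous_on UNIV (\<lambda>p::'b \<times> 'c. h (fst p) (snd p))"
    by (rule continuous_on) (rule continuous_on_fst continuous_on_snd continuous_on_id)+
  ultimately show ?thesis
    using continuous_map_fmat_compose[of X "\<lambda>x. (f x, g x)" "\<lambda>p. h (fst p) (snd p)"]
    by (simp only: fst_conv snd_conv)
qed

lemma continuous_map_fmat_mult [continuous_intros]: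
  fixes f g :: "'x \<Rightarrow> fmat"
  shows "continuous_map X euclidean f \<Longrightarrow> continuous_map X euclidean g \<Longrightarrow> continuous_map X euclidean (\<lambda>x. f x * g x)"
  by (rule continuous_map_bilinear[OF bounded_bilinear_mult])

lemma continuous_map_fmat_scaleR [continuous_intros]:
  fixes g :: "'x \<Rightarrow> fmat"
  shows "continuous_map X euclidean f \<Longrightarrow> continuous_map X euclidean g \<Longrightarrow> continuous_map X euclidean (\<lambda>x. f x *\<^sub>R g x)"
  by (rule continuous_map_bilinear[OF bounded_bilinear_scaleR])

lemma continuous_map_fmat_iff:
  assumes "\<And>x. x \<in> topspace X \<Longrightarrow> bnd N (f x)"
  shows "continuous_map X euclidean f \<longleftrightarrow> (\<forall>i<N. \<forall>j<N. continuous_map X euclidean (\<lambda>x. ent (f x) i j))"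
proof
  assume R: "\<forall>i<N. \<forall>j<N. continuous_map X euclidean (\<lambda>x. ent (f x) i j)"
  have "continuous_map X euclidean (\<lambda>x. \<Sum>i<N. \<Sum>j<N. unit_mat i j (ent (f x) i j))"
    using R by (intro continuous_map_sum continuous_map_unit_mat) auto
  then show "continuous_map X euclidean f"
    by (rule continuous_map_eq) (use assms fmat_eq_sum_unit_mat[symmetric] in blast)
qed (use continuous_map_ent in blast)

section \<open>Inverses and the Cayley transform\<close>

lemma inverse_of_injective_fmat:
  assumes x: "bnd N x" and inj: "\<And>v. bnd N v \<Longrightarrow> x * v = 0 \<Longrightarrow> v = 0"
  shows "\<exists>y. bnd N y \<and> x * y = Id N \<and> y * x = Id N"
proof -
  define A where "A = mat N N (\<lambda>(i, j). ent x i j)"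
  have A: "A \<in> carrier_mat N N" by (simp add: A_def)
  have "det A \<noteq> 0"
  proof
    assume "det A = 0"
    then obtain v where v: "v \<in> carrier_vec N" "v \<noteq> 0\<^sub>v N" "A *\<^sub>v v = 0\<^sub>v N"
      using det_0_iff_vec_prod_zero_field[OF A] by blast
    then have N: "0 < N" by (cases N) auto
    define V where "V = fm N (\<lambda>i j. if j = 0 then vec_index v i else 0)"
    have "x * V = 0"
    proof (rule fmat_eqI)
      fix i j
      show "ent (x * V) i j = ent 0 i j"
      proof (cases "i < N \<and> j = 0")
        case True
        have "ent (x * V) i 0 = (\<Sum>l<N. ent x i l * vec_index v l)"
          unfolding ent_mult[OF x] by (rule sum.cong) (use N in \<open>auto simp: V_def\<close>)
        also have "\<dots> = vec_index (A *\<^sub>v v) i"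
          using True v(1) by (auto simp: A_def scalar_prod_def lessThan_atLeast0 intro!: sum.cong)
        also have "\<dots> = 0" using v(3) True by simp
        finally show ?thesis using True by simp
      next
        case False
        then show ?thesis
          unfolding ent_mult[OF x] using bnd_ent[OF x] by (auto simp: V_def not_less intro!: sum.neutral)
      qed
    qed
    then have "V = 0" by (rule inj[rotated]) (simp add: V_def)
    have vi: "vec_index v i = 0" if "i < N" for i
    proof -
      have "ent V i 0 = 0" by (simp only: \<open>V = 0\<close> ent_0)
      then show ?thesis using that N by (simp add: V_def)
    qed
    have "v = 0\<^sub>v N" by (rule eq_vecI) (use v(1) vi in auto)
    with v(2) show False by blast
  qed
  from det_non_zero_imp_unit[OF A this, of "()"]
  obtain B where B: "B \<in> carrier_mat N N" "A * B = 1\<^sub>m N" "B * A = 1\<^sub>m N"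
    by (auto simp: Units_def ring_mat_def)
  define y where "y = fm N (\<lambda>i j. B $$ (i, j))"
  have y: "bnd N y" by (simp add: y_def)
  have "x * y = Id N"
  proof (rule fmat_eqI)
    fix i j
    show "ent (x * y) i j = ent (Id N) i j"
    proof (cases "i < N \<and> j < N")
      case True
      have "ent (x * y) i j = (A * B) $$ (i, j)"
        unfolding ent_mult[OF x] using True B(1)
        by (auto simp: A_def y_def scalar_prod_def lessThan_atLeast0 intro!: sum.cong)
      then show ?thesis using True by (simp add: B(2) ent_Id)
    next
      case False
      then show ?thesis using bnd_ent[OF bnd_mult[OF x y], of i j] by (auto simp: ent_Id not_less)
    qed
  qed
  moreover have "y * x = Id N"
  proof (rule fmat_eqI)
    fix i j
    show "ent (y * x) i j = ent (Id N) i j"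
    proof (cases "i < N \<and> j < N")
      case True
      have "ent (y * x) i j = (B * A) $$ (i, j)"
        unfolding ent_mult[OF y] using True B(1)
        by (auto simp: A_def y_def scalar_prod_def lessThan_atLeast0 intro!: sum.cong)
      then show ?thesis using True by (simp add: B(3) ent_Id)
    next
      case False
      then show ?thesis using bnd_ent[OF bnd_mult[OF y x], of i j] by (auto simp: ent_Id not_less)
    qed
  qed
  ultimately show ?thesis using y by blast
qed

text \<open>For \<open>c > 0\<close>, positivity of the real part, \<open>Re \<langle>v, x v\<rangle> \<ge> c |v|\<^sup>2\<close>, makes \<open>x\<close> invertible with \<open>|x\<^sup>-\<^sup>1 v| \<le> c\<^sup>-\<^sup>1 |v|\<close>. All
  inverses below are taken of such matrices, and the uniform bound makes them depend continuously on
  the matrix.\<close>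

definition accretive :: "nat \<Rightarrow> real \<Rightarrow> fmat \<Rightarrow> bool" where
  "accretive N c x \<longleftrightarrow> bnd N x \<and> (\<forall>v. bnd N v \<longrightarrow> c * (norm v)\<^sup>2 \<le> inner v (x * v))"

definition inv_mat :: "nat \<Rightarrow> fmat \<Rightarrow> fmat" where
  "inv_mat N x = (SOME y. bnd N y \<and> x * y = Id N \<and> y * x = Id N)"

lemma accretive_norm_le:
  assumes "accretive N c x" "bnd N v" shows "c * norm v \<le> norm (x * v)"
proof (cases "v = 0")
  case False
  have "c * (norm v)\<^sup>2 \<le> inner v (x * v)" using assms by (simp add: accretive_def)
  also have "\<dots> \<le> norm v * norm (x * v)" by (rule norm_cauchy_schwarz)
  finally have "norm v * (c * norm v) \<le> norm v * norm (x * v)"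
    by (simp add: power2_eq_square algebra_simps)
  then show ?thesis using False by simp
qed simp

lemma inv_mat:
  assumes "accretive N c x" "0 < c"
  shows "bnd N (inv_mat N x)" "x * inv_mat N x = Id N" "inv_mat N x * x = Id N"
proof -
  have "\<exists>y. bnd N y \<and> x * y = Id N \<and> y * x = Id N"
  proof (rule inverse_of_injective_fmat)
    show "bnd N x" using assms by (simp add: accretive_def)
    fix v assume "bnd N v" "x * v = 0"
    then show "v = 0" using accretive_norm_le[OF assms(1), of v] assms(2)
      by (simp add: mult_le_0_iff)
  qed
  then have "bnd N (inv_mat N x) \<and> x * inv_mat N x = Id N \<and> inv_mat N x * x = Id N"
    unfolding inv_mat_def by (rule someI_ex)
  then show "bnd N (inv_mat N x)" "x * inv_mat N x = Id N" "inv_mat N x * x = Id N" by auto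
qed

lemmas inv_mat_1 = inv_mat[where c = 1, simplified]

lemma inv_mat_unique:
  assumes "accretive N c x" "0 < c" "bnd N y" "x * y = Id N"
  shows "inv_mat N x = y"
proof -
  have "inv_mat N x = inv_mat N x * (x * y)" using inv_mat[OF assms(1,2)] assms by (simp add: mult_Id)
  also have "\<dots> = (inv_mat N x * x) * y" by (simp only: mult.assoc)
  also have "\<dots> = y" using inv_mat[OF assms(1,2)] assms by (simp add: Id_mult)
  finally show ?thesis .
qed

lemma continuous_map_inv_mat:
  assumes f: "continuous_map X euclidean f"
    and acc: "\<And>x. x \<in> topspace X \<Longrightarrow> accretive N c (f x)" and c: "0 < c"
  shows "continuous_map X euclidean (\<lambda>x. inv_mat N (f x))"
proof -
  let ?S = "{x. accretive N c x}"
  define K where "K = norm (Id N) / c"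
  have bd: "norm (inv_mat N x) \<le> K" if "x \<in> ?S" for x
    using accretive_norm_le[of N c x "inv_mat N x"] inv_mat[of N c x] that c
    by (simp add: K_def field_simps)
  have lip: "dist (inv_mat N x) (inv_mat N y) \<le> K * K * dist x y" if "x \<in> ?S" "y \<in> ?S" for x y
  proof -
    have eq: "inv_mat N x - inv_mat N y = inv_mat N x * (y - x) * inv_mat N y"
    proof -
      note ix = inv_mat[of N c x] and iy = inv_mat[of N c y]
      have "inv_mat N x * (y - x) * inv_mat N y
        = inv_mat N x * (y * inv_mat N y) - (inv_mat N x * x) * inv_mat N y"
        by (simp add: algebra_simps)
      then show ?thesis using ix iy that c by (simp add: Id_mult mult_Id)
    qed
    have "norm (inv_mat N x - inv_mat N y) \<le> norm (inv_mat N x * (y - x)) * norm (inv_mat N y)"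
      unfolding eq by (rule norm_mult_ineq)
    also have "\<dots> \<le> (norm (inv_mat N x) * norm (y - x)) * norm (inv_mat N y)"
      by (intro mult_right_mono norm_mult_ineq) simp
    also have "\<dots> \<le> (K * norm (y - x)) * K"
      using bd that by (intro mult_mono mult_nonneg_nonneg) (auto intro: order_trans[OF norm_ge_zero])
    finally show ?thesis by (simp add: dist_norm norm_minus_commute mult.assoc mult.commute)
  qed
  have "continuous_on ?S (inv_mat N)"
  proof (rule continuous_onI)
    fix x e assume x: "x \<in> ?S" and e: "0 < (e::real)"
    have "K * K \<ge> 0" by simp
    show "\<exists>d>0. \<forall>x'\<in>?S. dist x' x < d \<longrightarrow> dist (inv_mat N x') (inv_mat N x) \<le> e"
    proof (intro exI[of _ "e / (K * K + 1)"] conjI ballI impI)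
      show "0 < e / (K * K + 1)" using e \<open>K * K \<ge> 0\<close> by (intro divide_pos_pos) linarith+
      fix x' assume x': "x' \<in> ?S" "dist x' x < e / (K * K + 1)"
      have "dist (inv_mat N x') (inv_mat N x) \<le> K * K * dist x' x" using lip x x' by blast
      also have "\<dots> \<le> (K * K + 1) * dist x' x" by (intro mult_right_mono) auto
      also have "\<dots> \<le> (K * K + 1) * (e / (K * K + 1))"
        using x' \<open>K * K \<ge> 0\<close> by (intro mult_left_mono) auto
      also have "\<dots> = e" using \<open>K * K \<ge> 0\<close> by (simp add: add_nonneg_eq_0_iff)
      finally show "dist (inv_mat N x') (inv_mat N x) \<le> e" .
    qed
  qed
  then have "continuous_map (top_of_set ?S) euclidean (inv_mat N)" by simp
  moreover have "continuous_map X (top_of_set ?S) f"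
    using f acc by (intro continuous_map_into_subtopology) auto
  ultimately have "continuous_map X euclidean (inv_mat N \<circ> f)" by (rule continuous_map_compose[rotated])
  then show ?thesis by (simp only: comp_def)
qed

definition unitary_mat :: "nat \<Rightarrow> fmat \<Rightarrow> bool" where
  "unitary_mat N w \<longleftrightarrow> bnd N w \<and> adj w * w = Id N \<and> w * adj w = Id N"

definition skew :: "nat \<Rightarrow> fmat \<Rightarrow> bool" where
  "skew N h \<longleftrightarrow> bnd N h \<and> adj h = - h"

text \<open>The Cayley transform maps the linear space of skew-Hermitian matrices onto the unitaries without
  the eigenvalue \<open>-1\<close>; \<open>cayley_log\<close> below is its inverse.\<close>

definition cayley :: "nat \<Rightarrow> fmat \<Rightarrow> fmat" where
  "cayley N h = inv_mat N (Id N - h) * (Id N + h)"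

lemma accretive_Id_minus_skew:
  assumes "skew N h" shows "accretive N 1 (Id N - h)"
proof -
  have "inner v (h * v) = 0" for v
  proof -
    have "inner v (h * v) = inner (adj h * v) v" by (metis inner_mult_left adj_adj)
    also have "\<dots> = - inner (h * v) v" using assms by (simp add: skew_def)
    finally show ?thesis by (simp add: inner_commute)
  qed
  then show ?thesis using assms
    by (simp add: accretive_def skew_def algebra_simps Id_mult inner_diff_right power2_norm_eq_inner)
qed

lemma unitary_cayley:
  assumes h: "skew N h" shows "unitary_mat N (cayley N h)"
proof -
  let ?I = "Id N"
  define R where "R = inv_mat N (?I - h)"
  note R = inv_mat_1[OF accretive_Id_minus_skew[OF h], folded R_def]
  have hb: "bnd N h" "adj h = - h" using h by (simp_all add: skew_def)
  have comm: "(?I + h) * (?I - h) = (?I - h) * (?I + h)"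
    using hb by (simp add: algebra_simps Id_mult mult_Id)
  have aR: "adj R * (?I + h) = ?I" "(?I + h) * adj R = ?I"
    using arg_cong[OF R(2), of adj] arg_cong[OF R(3), of adj] hb by simp_all
  have w: "cayley N h = R * (?I + h)" "adj (cayley N h) = (?I - h) * adj R"
    by (simp_all add: cayley_def R_def hb)
  have "R * (?I + h) = (R * (?I + h)) * ((?I - h) * R)" using R hb by (simp add: mult_Id)
  also have "\<dots> = R * ((?I + h) * (?I - h)) * R" by (simp only: mult.assoc)
  also have "\<dots> = (R * (?I - h)) * ((?I + h) * R)" by (simp only: comm mult.assoc)
  also have "\<dots> = (?I + h) * R" using R hb by (simp add: Id_mult)
  finally have c2: "R * (?I + h) = (?I + h) * R" .
  have "(R * (?I + h)) * ((?I - h) * adj R) = ((?I + h) * (R * (?I - h))) * adj R"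
    unfolding c2 by (simp only: mult.assoc)
  also have "\<dots> = ?I" using R hb aR by (simp add: mult_Id)
  finally have 1: "cayley N h * adj (cayley N h) = ?I" unfolding w(2) unfolding w(1) .
  have "adj (cayley N h) = adj ((?I + h) * R)" by (simp only: w(1) c2)
  also have "\<dots> = adj R * (?I - h)" using hb by simp
  finally have w2: "adj (cayley N h) = adj R * (?I - h)" .
  have "adj (cayley N h) * cayley N h = adj R * ((?I - h) * R) * (?I + h)"
    unfolding w2 unfolding w(1) by (simp only: mult.assoc)
  also have "\<dots> = ?I" using R aR by (simp add: mult_Id)
  finally have 2: "adj (cayley N h) * cayley N h = ?I" .
  show ?thesis using 1 2 R hb by (simp add: unitary_mat_def cayley_def R_def[symmetric])
qed

text \<open>The defining equation \<open>w = (1 - h)\<^sup>-\<^sup>1(1 + h)\<close> turns the condition \<open>w s = t\<close> into a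
  condition that is linear in \<open>h\<close>, which is what makes the extension problem below solvable.\<close>

lemma cayley_mult_eq:
  assumes h: "skew N h" and st: "bnd N s" "bnd N t" "h * (s + t) = t - s"
  shows "cayley N h * s = t"
proof -
  note R = inv_mat_1[OF accretive_Id_minus_skew[OF h]]
  have "(Id N + h) * s = (Id N - h) * t"
    using st by (simp add: algebra_simps Id_mult)
  then have "cayley N h * s = inv_mat N (Id N - h) * ((Id N - h) * t)"
    by (simp add: cayley_def mult.assoc)
  also have "\<dots> = (inv_mat N (Id N - h) * (Id N - h)) * t" by (simp only: mult.assoc)
  also have "\<dots> = t" using R st by (simp add: Id_mult)
  finally show ?thesis .
qed

definition cayley_log :: "nat \<Rightarrow> fmat \<Rightarrow> fmat" where
  "cayley_log N w = (w - Id N) * inv_mat N (w + Id N)"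

lemma accretive_near_Id:
  assumes "bnd N w" "norm (w - Id N) \<le> 1" shows "accretive N 1 (w + Id N)"
  unfolding accretive_def
proof (intro conjI allI impI)
  fix v assume v: "bnd N v"
  have "\<bar>inner v ((w - Id N) * v)\<bar> \<le> norm v * norm ((w - Id N) * v)" by (rule Cauchy_Schwarz_ineq2)
  also have "\<dots> \<le> norm v * (norm (w - Id N) * norm v)" by (intro mult_left_mono norm_mult_ineq) simp
  also have "\<dots> \<le> norm v * (1 * norm v)" using assms by (intro mult_left_mono mult_right_mono) auto
  finally have "inner v ((w - Id N) * v) \<ge> - (norm v)\<^sup>2" by (simp add: power2_eq_square)
  moreover have "(w + Id N) * v = (w - Id N) * v + 2 *\<^sub>R v" using v
    by (simp add: algebra_simps Id_mult scaleR_2)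
  ultimately show "1 * (norm v)\<^sup>2 \<le> inner v ((w + Id N) * v)"
    by (simp add: inner_add_right power2_norm_eq_inner)
qed (use assms in simp)

lemma cayley_log:
  assumes w: "unitary_mat N w" "norm (w - Id N) \<le> 1"
  shows "skew N (cayley_log N w)" "cayley N (cayley_log N w) = w"
    "\<And>s t. bnd N s \<Longrightarrow> bnd N t \<Longrightarrow> w * s = t \<Longrightarrow> cayley_log N w * (s + t) = t - s"
proof -
  let ?I = "Id N" and ?h = "cayley_log N w"
  define S where "S = inv_mat N (w + ?I)"
  have wb: "bnd N w" "adj w * w = ?I" "w * adj w = ?I" using w by (simp_all add: unitary_mat_def)
  note S = inv_mat_1[OF accretive_near_Id[OF wb(1) w(2)], folded S_def]
  have hS: "?h = (w - ?I) * S" by (simp add: cayley_log_def S_def)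
  have aS: "adj S * (adj w + ?I) = ?I"
    using arg_cong[OF S(2), of adj] by simp
  have key: "(adj w - ?I) * (w + ?I) = - ((adj w + ?I) * (w - ?I))"
    using wb by (simp add: algebra_simps Id_mult mult_Id)
  have "adj ?h = adj S * (adj w - ?I) * ((w + ?I) * S)"
    using S wb by (simp add: hS mult_Id)
  also have "\<dots> = adj S * ((adj w - ?I) * (w + ?I)) * S" by (simp only: mult.assoc)
  also have "\<dots> = - ((adj S * (adj w + ?I)) * ((w - ?I) * S))"
    unfolding key by (simp add: mult.assoc)
  also have "\<dots> = - ?h" unfolding aS using S wb by (simp add: hS Id_mult)
  finally show sk: "skew N ?h" using S wb by (simp add: skew_def hS)
  have "?I - ?h = (w + ?I) * S - (w - ?I) * S" by (simp only: hS S)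
  also have "\<dots> = 2 *\<^sub>R S" using S by (simp add: algebra_simps Id_mult scaleR_2)
  finally have m: "?I - ?h = 2 *\<^sub>R S" .
  have "?I + ?h = (w + ?I) * S + (w - ?I) * S" by (simp only: hS S)
  also have "\<dots> = 2 *\<^sub>R (w * S)" by (simp add: algebra_simps scaleR_2)
  finally have p: "?I + ?h = 2 *\<^sub>R (w * S)" .
  have inv: "inv_mat N (?I - ?h) = (1/2) *\<^sub>R (w + ?I)"
    by (rule inv_mat_unique[OF accretive_Id_minus_skew[OF sk]]) (use S wb in \<open>simp_all add: m\<close>)
  have "cayley N ?h = (w + ?I) * (w * S)" unfolding cayley_def inv p by simp
  also have "\<dots> = w * ((w + ?I) * S)" using wb S(1) by (simp add: algebra_simps Id_mult mult_Id)
  finally show "cayley N ?h = w" using S wb by (simp add: mult_Id)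
  fix s t assume st: "bnd N s" "bnd N t" "w * s = t"
  have "s + t = (w + ?I) * s" using st by (simp add: algebra_simps Id_mult)
  then have "S * (s + t) = (S * (w + ?I)) * s" by (simp only: mult.assoc)
  then have "S * (s + t) = s" using S st by (simp add: Id_mult)
  then show "?h * (s + t) = t - s" using st by (simp add: hS mult.assoc left_diff_distrib Id_mult)
qed

lemma norm_unitary: assumes "unitary_mat N w" shows "norm w = norm (Id N)"
proof -
  have "inner w w = inner (w * Id N) w" using assms by (simp add: unitary_mat_def mult_Id)
  also have "\<dots> = inner (Id N) (Id N)" using assms by (simp add: inner_mult_left unitary_mat_def)
  finally show ?thesis by (simp add: norm_eq_sqrt_inner)
qed

lemma unitary_mult: "unitary_mat N u \<Longrightarrow> unitary_mat N w \<Longrightarrow> unitary_mat N (u * w)"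
  unfolding unitary_mat_def
proof (elim conjE, intro conjI)
  assume u: "bnd N u" "adj u * u = Id N" "u * adj u = Id N" and w: "bnd N w" "adj w * w = Id N" "w * adj w = Id N"
  have "adj (u * w) * (u * w) = adj w * (adj u * u) * w" by (simp add: mult.assoc)
  then show "adj (u * w) * (u * w) = Id N" using u w by (simp add: mult_Id)
  have "(u * w) * adj (u * w) = u * (w * adj w) * adj u" by (simp add: mult.assoc)
  then show "(u * w) * adj (u * w) = Id N" using u w by (simp add: mult_Id)
qed simp

lemma unitary_adj: "unitary_mat N u \<Longrightarrow> unitary_mat N (adj u)"
  by (simp add: unitary_mat_def)

section \<open>Extending unitaries\<close>

lemma Tietze_fmat:
  assumes Y: "normal_space Y" "closedin Y Z"
    and f: "continuous_map (subtopology Y Z) euclidean f" and bnd: "\<And>z. z \<in> Z \<Longrightarrow> bnd N (f z)"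
  obtains g where "continuous_map Y euclidean g" "\<And>y. bnd N (g y)" "\<And>z. z \<in> Z \<Longrightarrow> g z = f z"
proof -
  have "\<exists>g. continuous_map Y euclidean g \<and> (\<forall>z\<in>Z. g z = \<phi> (ent (f z) i j))"
    if \<phi>: "continuous_on UNIV \<phi>" for i j and \<phi> :: "complex \<Rightarrow> real"
  proof -
    have "continuous_map (subtopology Y Z) euclidean (\<lambda>z. \<phi> (ent (f z) i j))"
      using continuous_map_ent[OF f] \<phi> by (rule continuous_map_fmat_compose)
    then show ?thesis
      using Tietze_extension_realinterval[OF Y is_interval_univ, of "\<lambda>z. \<phi> (ent (f z) i j)"]
      by (metis UNIV_not_empty subset_UNIV)
  qed
  from this[of Re] this[of Im]
  have "\<forall>i j. \<exists>g. continuous_map Y euclideanreal g \<and> (\<forall>z\<in>Z. g z = Re (ent (f z) i j))"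
    "\<forall>i j. \<exists>g. continuous_map Y euclideanreal g \<and> (\<forall>z\<in>Z. g z = Im (ent (f z) i j))"
    by (simp_all add: continuous_on_Re continuous_on_Im)
  then obtain r s where r: "\<And>i j. continuous_map Y euclideanreal (r i j)" "\<And>i j z. z \<in> Z \<Longrightarrow> r i j z = Re (ent (f z) i j)"
    and s: "\<And>i j. continuous_map Y euclideanreal (s i j)" "\<And>i j z. z \<in> Z \<Longrightarrow> s i j z = Im (ent (f z) i j)"
    by metis
  define g where "g y = (\<Sum>i<N. \<Sum>j<N. r i j y *\<^sub>R unit_mat i j 1 + s i j y *\<^sub>R unit_mat i j \<i>)" for y
  show ?thesis
  proof
    show "continuous_map Y euclidean g"
      unfolding g_def
      by (intro continuous_map_sum continuous_map_add continuous_map_fmat_scaleR r s) auto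
    show "bnd N (g y)" for y by (auto simp: g_def intro!: bnd_sum bnd_add bnd_scaleR bnd_unit_mat)
    fix z assume z: "z \<in> Z"
    have u: "unit_mat i j w = Re w *\<^sub>R unit_mat i j 1 + Im w *\<^sub>R unit_mat i j \<i>" for i j w
      by (rule fmat_eqI) (auto simp: complex_eq_iff)
    have "g z = (\<Sum>i<N. \<Sum>j<N. unit_mat i j (ent (f z) i j))"
      unfolding g_def by (simp only: r(2)[OF z] s(2)[OF z] u[symmetric])
    then show "g z = f z" by (simp only: fmat_eq_sum_unit_mat[OF bnd[OF z], symmetric])
  qed
qed

lemma partial_isometry_mult:
  assumes "adj u * u = e" "e * e = e" shows "u * e = u"
proof -
  have "adj e = e" unfolding assms(1)[symmetric] by simp
  then have "adj (u - u * e) * (u - u * e)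
    = adj u * u - (adj u * u) * e - e * (adj u * u) + e * (adj u * u) * e"
    by (simp add: algebra_simps)
  then have "adj (u - u * e) * (u - u * e) = 0" by (simp add: assms)
  then have "u - u * e = 0" using adj_mult_self_eq_0 by blast
  then show ?thesis by simp
qed

text \<open>The matrix \<open>h\<close> below is the general solution of \<open>h(s + t) = t - s\<close> among the skew-Hermitian
  matrices: the solution is forced on the range of \<open>s + t\<close> and is an arbitrary skew-Hermitian \<open>k\<close> on
  its complement.\<close>

lemma skew_solution:
  fixes s t :: fmat
  assumes b: "bnd N s" "bnd N t" and e: "adj s * s = e" "adj t * t = e" "e * e = e"
    and near: "norm (s - t) \<le> 1/2" and k: "skew N k"
  defines "a \<equiv> s + t"
  defines "x \<equiv> adj a * a + Id N - e"
  defines "c \<equiv> (t - s) * (inv_mat N x * adj a)" and "P \<equiv> a * inv_mat N x * adj a"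
  defines "h \<equiv> c - adj c * (Id N - P) + (Id N - P) * k * (Id N - P)"
  shows "accretive N (1/2) x" "skew N h" "h * a = t - s" "k * a = t - s \<Longrightarrow> h = k"
proof -
  let ?I = "Id N"
  define d where "d = s - t"
  have ab: "bnd N a" and eb: "bnd N e" and db: "bnd N d" and ae: "adj e = e"
    using b by (auto simp: a_def d_def e(1)[symmetric])
  have se: "s * e = s" "t * e = t"
    by (rule partial_isometry_mult[OF e(1,3)], rule partial_isometry_mult[OF e(2,3)])
  have aa: "adj a * a = 4 *\<^sub>R e - adj d * d"
  proof -
    have "adj a * a + adj d * d = 2 *\<^sub>R (adj s * s) + 2 *\<^sub>R (adj t * t)"
      by (simp add: a_def d_def algebra_simps scaleR_2)
    also have "\<dots> = 4 *\<^sub>R e" by (simp add: e scaleR_left_distrib[symmetric])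
    finally show ?thesis by (simp add: algebra_simps)
  qed
  have xb: "bnd N x" using ab eb by (simp add: x_def)
  show acc: "accretive N (1/2) x"
    unfolding accretive_def
  proof (intro conjI allI impI)
    fix v assume v: "bnd N v"
    have "norm (d * v) \<le> 1/2 * norm v"
      using norm_mult_ineq[of d v] near mult_right_mono[of "norm d" "1/2" "norm v"] by (simp add: d_def)
    then have "(norm (d * v))\<^sup>2 \<le> (1/2 * norm v)\<^sup>2" by (rule power_mono) simp
    then have 1: "inner (d * v) (d * v) \<le> 1/4 * inner v v"
      by (simp add: power2_norm_eq_inner[symmetric] power_mult_distrib power2_eq_square)
    have 2: "inner v (adj d * d * v) = inner (d * v) (d * v)"
      using inner_mult_left[of d v "d * v"] by (simp add: mult.assoc)
    have "inner v (e * v) = inner (e * v) (e * v)"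
      using inner_mult_left[of e v "e * v"] e(3) ae by (simp add: mult.assoc[symmetric])
    then have 3: "inner v (e * v) \<ge> 0" by simp
    have "x * v = v + 3 *\<^sub>R (e * v) - adj d * d * v"
    proof -
      have "x = ?I + 3 *\<^sub>R e - adj d * d"
        unfolding x_def aa using scaleR_left_distrib[of 3 1 e] by simp
      show ?thesis unfolding \<open>x = _\<close> using v by (simp add: algebra_simps Id_mult)
    qed
    then have "inner v (x * v) = inner v v + 3 * inner v (e * v) - inner (d * v) (d * v)"
      using 2 by (simp add: inner_diff_right inner_add_right)
    also have "\<dots> \<ge> 1/2 * inner v v" using 1 3 inner_ge_zero[of v] by linarith
    finally show "1/2 * (norm v)\<^sup>2 \<le> inner v (x * v)" by (simp add: power2_norm_eq_inner)
  qed (rule xb)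
  define y where "y = inv_mat N x"
  have "0 < (1/2::real)" by simp
  note y = inv_mat[OF acc this, folded y_def]
  have ax: "adj x = x" by (simp add: x_def ae)
  have ay: "adj y = y"
  proof -
    have "adj y = adj y * (x * y)" using y by (simp add: mult_Id)
    also have "\<dots> = adj (x * y) * y" using ax by (simp add: mult.assoc)
    also have "\<dots> = y" using y by (simp add: Id_mult)
    finally show ?thesis .
  qed
  have aea: "a * e = a" using se by (simp add: a_def algebra_simps)
  have xe: "x * e = adj a * a"
    using e(3) eb aea by (simp add: x_def algebra_simps Id_mult)
  have yaa: "y * (adj a * a) = e"
  proof -
    have "y * (adj a * a) = (y * x) * e" unfolding xe[symmetric] by (simp only: mult.assoc)
    then show ?thesis using y eb by (simp add: Id_mult)
  qed
  have Pd: "P = a * y * adj a" and cd: "c = (t - s) * (y * adj a)" by (simp_all add: P_def c_def y_def)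
  have Pb: "bnd N P" and cb: "bnd N c" using ab y b by (simp_all add: Pd cd)
  have aP: "adj P = P" by (simp add: Pd ay mult.assoc)
  have Pa: "P * a = a"
  proof -
    have "P * a = a * (y * (adj a * a))" by (simp only: Pd mult.assoc)
    then show ?thesis by (simp only: yaa aea)
  qed
  have be: "(t - s) * e = t - s" using se by (simp add: algebra_simps)
  have ca: "c * a = t - s"
  proof -
    have "c * a = (t - s) * (y * (adj a * a))" by (simp only: cd mult.assoc)
    then show ?thesis by (simp only: yaa be)
  qed
  have skb: "adj (t - s) * a + adj a * (t - s) = 0"
    by (simp add: a_def algebra_simps e)
  have van: "adj c * P + P * c = 0"
  proof -
    have "adj c * P + P * c = a * y * (adj (t - s) * a + adj a * (t - s)) * (y * adj a)"
      by (simp add: cd Pd ay algebra_simps)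
    then show ?thesis by (simp only: skb mult_zero_right mult_zero_left)
  qed
  have hd: "h = c - adj c + adj c * P + (?I - P) * k * (?I - P)"
    using cb Pb by (simp add: h_def algebra_simps mult_Id)
  have ak: "adj k = - k" and kb: "bnd N k" using k by (auto simp: skew_def)
  have "adj h + h = (adj c * P + P * c) + ((?I - P) * adj k * (?I - P) + (?I - P) * k * (?I - P))"
    unfolding hd by (simp add: aP mult.assoc)
  then have "adj h + h = 0" unfolding van ak by simp
  moreover have "bnd N h" using cb Pb kb by (simp add: hd)
  ultimately show "skew N h" by (simp only: skew_def eq_neg_iff_add_eq_0)
  have Ia: "(?I - P) * a = 0" using ab Pa by (simp add: algebra_simps Id_mult)
  have "h * a = c * a - adj c * ((?I - P) * a) + (?I - P) * k * ((?I - P) * a)"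
    by (simp add: h_def algebra_simps)
  then show "h * a = t - s" by (simp only: Ia ca mult_zero_right) simp
  assume ka: "k * a = t - s"
  have kP: "k * P = c"
  proof -
    have "k * P = (k * a) * (y * adj a)" by (simp only: Pd mult.assoc)
    then show ?thesis by (simp only: ka cd)
  qed
  have Pk: "P * k = - adj c" using arg_cong[OF kP, of adj] by (simp add: aP ak minus_equation_iff)
  have "(?I - P) * k * (?I - P) = k - k * P - P * k + P * (k * P)"
    using kb Pb by (simp add: algebra_simps Id_mult mult_Id)
  then have "h = (adj c * P + P * c) + k" unfolding hd kP Pk by (simp add: algebra_simps)
  then show "h = k" unfolding van by simp
qed

text \<open>The prescribed unitary \<open>w\<close> is replaced by its skew-Hermitian logarithm, this is extended by Tietze's
  theorem, and \<open>skew_solution\<close> corrects the extension, without changing it on \<open>Z\<close>, so that the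
  Cayley transform carries \<open>s\<close> to \<open>t\<close>.\<close>

lemma extend_unitary_near_identity:
  assumes Y: "compact_space Y" "Hausdorff_space Y" "closedin Y Z"
    and s: "continuous_map Y euclidean s" "continuous_map Y euclidean t"
    and st: "\<And>y. y \<in> topspace Y \<Longrightarrow> bnd N (s y) \<and> bnd N (t y) \<and> adj (s y) * s y = e y \<and>
        adj (t y) * t y = e y \<and> e y * e y = e y \<and> norm (s y - t y) \<le> 1/2"
    and w: "continuous_map (subtopology Y Z) euclidean w"
    and wZ: "\<And>z. z \<in> Z \<Longrightarrow> unitary_mat N (w z) \<and> norm (w z - Id N) \<le> 1 \<and> w z * s z = t z"
  obtains W where "continuous_map Y euclidean W" "\<And>y. y \<in> topspace Y \<Longrightarrow> unitary_mat N (W y)"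
    "\<And>y. y \<in> topspace Y \<Longrightarrow> W y * s y = t y" "\<And>z. z \<in> Z \<Longrightarrow> W z = w z"
proof -
  have nY: "normal_space Y" using Y compact_Hausdorff_or_regular_imp_normal_space by blast
  have ZY: "Z \<subseteq> topspace Y" using Y(3) closedin_subset by blast
  have wb: "bnd N (w z)" if "z \<in> Z" for z using wZ[OF that] by (simp add: unitary_mat_def)
  have k0: "continuous_map (subtopology Y Z) euclidean (\<lambda>z. cayley_log N (w z))"
    unfolding cayley_log_def
    by (intro continuous_map_fmat_mult continuous_map_diff continuous_map_inv_mat[where c = 1] continuous_map_add w)
      (use wZ wb accretive_near_Id in auto)
  have "bnd N (cayley_log N (w z))" if "z \<in> Z" for z
    using cayley_log(1)[of N "w z"] wZ[OF that] by (simp add: skew_def)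
  then obtain k1 where k1: "continuous_map Y euclidean k1" "\<And>y. bnd N (k1 y)" "\<And>z. z \<in> Z \<Longrightarrow> k1 z = cayley_log N (w z)"
    using Tietze_fmat[OF nY Y(3) k0] by blast
  \<comment> \<open>the skew-Hermitian part, so that \<open>k\<close> is skew-Hermitian off
      \<open>Z\<close> as well\<close>
  define k where "k y = (1/2) *\<^sub>R (k1 y - adj (k1 y))" for y
  have k: "skew N (k y)" for y
    using k1(2) by (simp add: k_def skew_def scaleR_minus_right[symmetric] del: scaleR_minus_right)
  have kZ: "k z = cayley_log N (w z)" if "z \<in> Z" for z
  proof -
    have "adj (k1 z) = - k1 z" using cayley_log(1)[of N "w z"] wZ[OF that] k1(3)[OF that] by (simp add: skew_def)
    then show ?thesis using k1(3)[OF that] by (simp add: k_def scaleR_2[symmetric])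
  qed
  have kc: "continuous_map Y euclidean k"
    unfolding k_def by (intro continuous_map_fmat_scaleR continuous_map_diff continuous_map_adj k1) simp
  define a where "a y = s y + t y" for y
  define x where "x y = adj (a y) * a y + Id N - adj (s y) * s y" for y
  define c where "c y = (t y - s y) * (inv_mat N (x y) * adj (a y))" for y
  define P where "P y = a y * inv_mat N (x y) * adj (a y)" for y
  define h where "h y = c y - adj (c y) * (Id N - P y) + (Id N - P y) * k y * (Id N - P y)" for y
  have sol: "accretive N (1/2) (x y)" "skew N (h y)" "h y * a y = t y - s y" "k y * a y = t y - s y \<Longrightarrow> h y = k y"
    if "y \<in> topspace Y" for y
    using skew_solution[of N "s y" "t y" "adj (s y) * s y" "k y"] st[OF that] k[of y]
    unfolding a_def x_def c_def P_def h_def by simp_all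
  have ac: "continuous_map Y euclidean a" unfolding a_def by (intro continuous_map_add s)
  have xc: "continuous_map Y euclidean x"
    unfolding x_def by (intro continuous_map_diff continuous_map_add continuous_map_fmat_mult continuous_map_adj ac s) simp
  have yc: "continuous_map Y euclidean (\<lambda>y. inv_mat N (x y))"
    by (rule continuous_map_inv_mat[OF xc sol(1)]) auto
  have cc: "continuous_map Y euclidean c"
    unfolding c_def by (intro continuous_map_diff continuous_map_fmat_mult continuous_map_adj ac s yc)
  have Pc: "continuous_map Y euclidean P"
    unfolding P_def by (intro continuous_map_fmat_mult continuous_map_adj ac yc)
  have hc: "continuous_map Y euclidean h"
    unfolding h_def by (intro continuous_map_diff continuous_map_add continuous_map_fmat_mult continuous_map_adj cc Pc kc) auto
  have Wc: "continuous_map Y euclidean (\<lambda>y. cayley N (h y))"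
    unfolding cayley_def
    by (intro continuous_map_fmat_mult continuous_map_add continuous_map_inv_mat[where c = 1] continuous_map_diff hc)
      (auto intro: accretive_Id_minus_skew sol)
  show ?thesis
  proof (rule that[OF Wc])
    fix y assume y: "y \<in> topspace Y"
    show "unitary_mat N (cayley N (h y))" by (rule unitary_cayley[OF sol(2)[OF y]])
    show "cayley N (h y) * s y = t y"
      using sol[OF y] st[OF y] by (intro cayley_mult_eq) (auto simp: a_def)
  next
    fix z assume z: "z \<in> Z"
    then have "z \<in> topspace Y" using ZY by blast
    moreover have "k z * a z = t z - s z"
      unfolding kZ[OF z] a_def using wZ[OF z] st[OF \<open>z \<in> topspace Y\<close>] by (intro cayley_log) auto
    ultimately show "cayley N (h z) = w z" using sol(4) kZ[OF z] cayley_log(2) wZ[OF z] by simp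
  qed
qed

text \<open>Compactness of \<open>X\<close> makes continuity in the parameter uniform over \<open>X\<close>.\<close>

lemma uniform_near_parameter:
  fixes f :: "'x \<times> 's \<Rightarrow> 'b::real_normed_vector"
  assumes X: "compact_space X" and f: "continuous_map (prod_topology X S) euclidean f"
    and s0: "s0 \<in> topspace S" and \<epsilon>: "0 < \<epsilon>"
  obtains U where "openin S U" "s0 \<in> U"
    "\<And>s x. s \<in> U \<Longrightarrow> x \<in> topspace X \<Longrightarrow> norm (f (x, s) - f (x, s0)) < \<epsilon>"
proof -
  let ?Y = "prod_topology X S"
  have "continuous_map ?Y ?Y (\<lambda>z. (fst z, s0))"
    using s0 by (intro continuous_map_pairedI continuous_map_fst) simp
  then have "continuous_map ?Y euclidean (\<lambda>z. f (fst z, s0))"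
    using continuous_map_compose[OF _ f] by (simp add: o_def)
  then have "continuous_map ?Y euclideanreal (\<lambda>z. norm (f z - f (fst z, s0)))"
    by (intro continuous_map_norm continuous_map_diff f)
  then have W: "openin ?Y {z \<in> topspace ?Y. norm (f z - f (fst z, s0)) \<in> {..<\<epsilon>}}"
    by (rule openin_continuous_map_preimage) auto
  have C: "topspace X \<times> {s0} \<subseteq> {z \<in> topspace ?Y. norm (f z - f (fst z, s0)) \<in> {..<\<epsilon>}}"
    using s0 \<epsilon> by auto
  have "compactin X (topspace X)" using X by (simp only: compact_space_def)
  from tube_lemma_left[OF W this s0 C] obtain U V where UV: "openin X U" "openin S V" "topspace X \<subseteq> U" "s0 \<in> V"
    "U \<times> V \<subseteq> {z \<in> topspace ?Y. norm (f z - f (fst z, s0)) \<in> {..<\<epsilon>}}"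
    by (elim exE conjE)
  show ?thesis
    by (rule that[OF UV(2,4)]) (use UV(3,5) in fastforce)
qed

lemma uniform_in_parameter:
  fixes f :: "'x \<times> 't::metric_space \<Rightarrow> 'b::real_normed_vector"
  assumes X: "compact_space X" and f: "continuous_map (prod_topology X (top_of_set T)) euclidean f"
    and T: "compact T" and \<epsilon>: "0 < \<epsilon>"
  obtains \<delta> where "0 < \<delta>"
    "\<And>s t x. s \<in> T \<Longrightarrow> t \<in> T \<Longrightarrow> dist s t < \<delta> \<Longrightarrow> x \<in> topspace X \<Longrightarrow> norm (f (x, s) - f (x, t)) < \<epsilon>"
proof -
  have "\<exists>G. open G \<and> t \<in> G \<and> (\<forall>s\<in>T \<inter> G. \<forall>x\<in>topspace X. norm (f (x, s) - f (x, t)) < \<epsilon>/2)" if t: "t \<in> T" for t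
  proof -
    have "t \<in> topspace (top_of_set T)" "0 < \<epsilon>/2" using t \<epsilon> by simp_all
    from uniform_near_parameter[OF X f this] obtain U where U: "openin (top_of_set T) U" "t \<in> U"
      "\<And>s x. s \<in> U \<Longrightarrow> x \<in> topspace X \<Longrightarrow> norm (f (x, s) - f (x, t)) < \<epsilon>/2" by metis
    then show ?thesis unfolding openin_open by blast
  qed
  then obtain G where G: "\<And>t. t \<in> T \<Longrightarrow> open (G t) \<and> t \<in> G t"
    "\<And>t s x. t \<in> T \<Longrightarrow> s \<in> T \<inter> G t \<Longrightarrow> x \<in> topspace X \<Longrightarrow> norm (f (x, s) - f (x, t)) < \<epsilon>/2"
    by metis
  obtain \<delta> where \<delta>: "0 < \<delta>" "\<And>t. t \<in> T \<Longrightarrow> \<exists>B\<in>G ` T. ball t \<delta> \<subseteq> B"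
    using Heine_Borel_lemma[OF T, of "G ` T"] G(1) by blast
  show ?thesis
  proof (rule that[OF \<delta>(1)])
    fix s t x assume st: "s \<in> T" "t \<in> T" "dist s t < \<delta>" "x \<in> topspace X"
    obtain t0 where t0: "t0 \<in> T" "ball t \<delta> \<subseteq> G t0" using \<delta>(2)[OF st(2)] by blast
    have "s \<in> G t0" "t \<in> G t0" using t0 st \<delta>(1) by (auto simp: dist_commute)
    then have "norm (f (x, s) - f (x, t0)) < \<epsilon>/2" "norm (f (x, t) - f (x, t0)) < \<epsilon>/2"
      using G(2)[OF t0(1)] st by blast+
    then show "norm (f (x, s) - f (x, t)) < \<epsilon>"
      using norm_triangle_ineq4[of "f (x, s) - f (x, t0)" "f (x, t) - f (x, t0)"] by simp
  qed
qed

text \<open>A relative homotopy lifting property for the map \<open>u \<mapsto> u e\<close> from unitaries to partial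
  isometries with initial projection \<open>e\<close>. The homotopy is cut into steps so short that the
  increment of the unitary is near the identity, and there the Cayley transform does the extending.\<close>

lemma unitary_lift:
  fixes X :: "'x topology" and s g :: "'x \<times> real \<Rightarrow> fmat"
  defines "Y \<equiv> prod_topology X (top_of_set {0..1::real})"
  assumes X: "compact_space X" "Hausdorff_space X" and B: "closedin X B"
    and s: "continuous_map Y euclidean s"
    and sy: "\<And>x t. x \<in> topspace X \<Longrightarrow> t \<in> {0..1} \<Longrightarrow> bnd N (s (x, t)) \<and> adj (s (x, t)) * s (x, t) = e x \<and> e x * e x = e x"
  defines "Z \<equiv> B \<times> {0..1} \<union> topspace X \<times> {0}"
  assumes g: "continuous_map (subtopology Y Z) euclidean g"
    and gz: "\<And>z. z \<in> Z \<Longrightarrow> unitary_mat N (g z) \<and> g z * e (fst z) = s z"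
  obtains G where "continuous_map Y euclidean G" "\<And>z. z \<in> topspace Y \<Longrightarrow> unitary_mat N (G z)"
    "\<And>z. z \<in> Z \<Longrightarrow> G z = g z" "\<And>z. z \<in> topspace Y \<Longrightarrow> G z * e (fst z) = s z"
proof -
  have Y: "compact_space Y" "Hausdorff_space Y"
    unfolding Y_def using X by (auto simp: compact_space_prod_topology Hausdorff_space_prod_topology
        compact_space_subtopology Hausdorff_space_subtopology)
  have tY: "topspace Y = topspace X \<times> {0..1}" by (simp add: Y_def)
  have BX: "B \<subseteq> topspace X" using B closedin_subset by blast
  have cZ: "closedin Y Z"
    unfolding Z_def Y_def
    by (intro closedin_Un) (auto simp: closedin_prod_Times_iff B closed_subset)
  have ZY: "Z \<subseteq> topspace Y" using cZ closedin_subset by blast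
  \<comment> \<open>every unitary has the norm of \<open>Id N\<close>, so unitaries at distance
      \<open>\<epsilon>\<close> have a quotient within 1 of \<open>Id N\<close>\<close>
  define \<epsilon> where "\<epsilon> = 1 / (1 + norm (Id N))"
  have \<epsilon>: "0 < \<epsilon>" "\<epsilon> * norm (Id N) \<le> 1"
    by (simp_all add: \<epsilon>_def add_pos_nonneg field_simps)
  obtain \<delta>1 where \<delta>1: "0 < \<delta>1" "\<And>a b x. a \<in> {0..1} \<Longrightarrow> b \<in> {0..1} \<Longrightarrow> dist a b < \<delta>1 \<Longrightarrow>
      x \<in> topspace X \<Longrightarrow> norm (s (x, a) - s (x, b)) < 1/2"
    using uniform_in_parameter[OF X(1) s[unfolded Y_def] compact_Icc, of "1/2"] by (auto simp del: atLeastAtMost_iff)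
  have gB: "continuous_map (prod_topology (subtopology X B) (top_of_set {0..1})) euclidean g"
  proof -
    have "prod_topology (subtopology X B) (top_of_set {0..1}) = subtopology Y (B \<times> {0..1})"
      unfolding Y_def prod_topology_subtopology(1) by (simp add: subtopology_subtopology)
    then show ?thesis using continuous_map_from_subtopology_mono[OF g, of "B \<times> {0..1}"] by (simp add: Z_def)
  qed
  have "compact_space (subtopology X B)" using X(1) B closedin_compact_space compact_space_subtopology by blast
  then obtain \<delta>2 where \<delta>2: "0 < \<delta>2" "\<And>a b x. a \<in> {0..1} \<Longrightarrow> b \<in> {0..1} \<Longrightarrow> dist a b < \<delta>2 \<Longrightarrow>
      x \<in> topspace (subtopology X B) \<Longrightarrow> norm (g (x, a) - g (x, b)) < \<epsilon>"
    using uniform_in_parameter[OF _ gB compact_Icc \<epsilon>(1)] by metis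
  obtain n :: nat where n: "0 < n" "1 / real n < min \<delta>1 \<delta>2"
    using ex_inverse_of_nat_less[of "min \<delta>1 \<delta>2"] \<delta>1(1) \<delta>2(1) by (auto simp: inverse_eq_divide)
  define c where "c i = real i / real n" for i
  have c01: "c i \<in> {0..1}" if "i \<le> n" for i using that n(1) by (simp add: c_def)
  \<comment> \<open>stopping the homotopy at time \<open>i / n\<close> keeps all maps defined on the
      whole of \<open>Y\<close>, so nothing has to be glued\<close>
  define \<rho> where "\<rho> i z = (fst z, min (snd z) (c i))" for i and z :: "'x \<times> real"
  have \<rho>c: "continuous_map Y Y (\<rho> i)" if "i \<le> n" for i
  proof -
    have "continuous_map Y euclideanreal snd"
      unfolding Y_def using continuous_map_snd continuous_map_into_fulltopology by blast
    then have "continuous_map Y (top_of_set {0..1}) (\<lambda>z. min (snd z) (c i))"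
      using c01[OF that] by (intro continuous_map_into_subtopology continuous_map_real_min) (auto simp: tY)
    then show ?thesis unfolding \<rho>_def
      by (simp add: Y_def continuous_map_pairedI continuous_map_fst)
  qed
  have \<rho>Z: "\<rho> i z \<in> Z" if "i \<le> n" "z \<in> Z" for i z
    using that c01[OF that(1)] by (auto simp: \<rho>_def Z_def min_def)
  have s\<rho>: "continuous_map Y euclidean (\<lambda>z. s (\<rho> i z))" if "i \<le> n" for i
    using continuous_map_compose[OF \<rho>c[OF that] s] by (simp add: o_def)
  have g\<rho>: "continuous_map (subtopology Y Z) euclidean (\<lambda>z. g (\<rho> i z))" if "i \<le> n" for i
  proof -
    have "continuous_map (subtopology Y Z) (subtopology Y Z) (\<rho> i)"
      using \<rho>c[OF that] \<rho>Z[OF that] by (intro continuous_map_into_subtopology continuous_map_from_subtopology) auto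
    from continuous_map_compose[OF this g] show ?thesis by (simp add: o_def)
  qed
  have "\<exists>G. continuous_map Y euclidean G \<and> (\<forall>z\<in>topspace Y. unitary_mat N (G z) \<and> G z * e (fst z) = s (\<rho> i z))
      \<and> (\<forall>z\<in>Z. G z = g (\<rho> i z))" if "i \<le> n" for i
    using that
  proof (induction i)
    case 0
    have r: "\<rho> 0 z \<in> topspace X \<times> {0} \<and> fst (\<rho> 0 z) = fst z" if "z \<in> topspace Y" for z
      using that by (auto simp: \<rho>_def c_def tY min_def)
    have "continuous_map Y (subtopology Y Z) (\<rho> 0)"
      using \<rho>c[of 0] r by (intro continuous_map_into_subtopology) (auto simp: Z_def)
    from continuous_map_compose[OF this g] have "continuous_map Y euclidean (\<lambda>z. g (\<rho> 0 z))"
      by (simp add: o_def)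
    moreover have "unitary_mat N (g (\<rho> 0 z)) \<and> g (\<rho> 0 z) * e (fst z) = s (\<rho> 0 z)" if "z \<in> topspace Y" for z
      using gz[of "\<rho> 0 z"] r[OF that] by (auto simp: Z_def)
    ultimately show ?case by blast
  next
    case (Suc i)
    then obtain G where G: "continuous_map Y euclidean G"
      "\<And>z. z \<in> topspace Y \<Longrightarrow> unitary_mat N (G z) \<and> G z * e (fst z) = s (\<rho> i z)"
      "\<And>z. z \<in> Z \<Longrightarrow> G z = g (\<rho> i z)" by auto
    have i: "i \<le> n" "Suc i \<le> n" using Suc.prems by auto
    have close: "dist (snd (\<rho> i z)) (snd (\<rho> (Suc i) z)) < min \<delta>1 \<delta>2" for z
    proof -
      obtain d where d: "d = 1 / real n" "0 < d" using n(1) by simp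
      have "c (Suc i) = c i + d" by (simp add: c_def d add_divide_distrib)
      then have "dist (snd (\<rho> i z)) (snd (\<rho> (Suc i) z)) \<le> d"
        using d(2) by (auto simp: \<rho>_def dist_real_def min_def)
      then show ?thesis using n(2) d by linarith
    qed
    have in01: "snd (\<rho> j z) \<in> {0..1}" if "z \<in> topspace Y" "j \<le> n" for z j
      using that c01[OF that(2)] by (auto simp: \<rho>_def tY)
    have f\<rho>: "fst (\<rho> j z) = fst z" for j z by (simp add: \<rho>_def)
    have eta: "(fst z, snd (\<rho> j z)) = \<rho> j z" for j z by (simp add: \<rho>_def)
    have st: "bnd N (s (\<rho> i y)) \<and> bnd N (s (\<rho> (Suc i) y)) \<and> adj (s (\<rho> i y)) * s (\<rho> i y) = e (fst y) \<and>
        adj (s (\<rho> (Suc i) y)) * s (\<rho> (Suc i) y) = e (fst y) \<and> e (fst y) * e (fst y) = e (fst y) \<and>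
        norm (s (\<rho> i y) - s (\<rho> (Suc i) y)) \<le> 1/2" if y: "y \<in> topspace Y" for y
    proof -
      have fy: "fst y \<in> topspace X" using y by (auto simp: tY)
      have "norm (s (fst y, snd (\<rho> i y)) - s (fst y, snd (\<rho> (Suc i) y))) < 1/2"
        using close[of y] by (intro \<delta>1(2) in01 i y fy) auto
      then show ?thesis
        using sy[OF fy in01[OF y i(1)]] sy[OF fy in01[OF y i(2)]] by (simp add: eta)
    qed
    define w where "w z = g (\<rho> (Suc i) z) * adj (g (\<rho> i z))" for z
    have wc: "continuous_map (subtopology Y Z) euclidean w"
      unfolding w_def by (intro continuous_map_fmat_mult continuous_map_adj g\<rho> i)
    have wZ: "unitary_mat N (w z) \<and> norm (w z - Id N) \<le> 1 \<and> w z * s (\<rho> i z) = s (\<rho> (Suc i) z)" if z: "z \<in> Z" for z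
    proof (intro conjI)
      have zY: "z \<in> topspace Y" using z ZY by blast
      note u = gz[OF \<rho>Z[OF i(1) z]] and u' = gz[OF \<rho>Z[OF i(2) z]]
      have ub: "bnd N (g (\<rho> i z))" "adj (g (\<rho> i z)) * g (\<rho> i z) = Id N" "g (\<rho> i z) * adj (g (\<rho> i z)) = Id N"
        and ub': "bnd N (g (\<rho> (Suc i) z))"
        using u u' by (auto simp: unitary_mat_def)
      show "unitary_mat N (w z)" unfolding w_def using u u' by (intro unitary_mult unitary_adj) auto
      have "w z - Id N = (g (\<rho> (Suc i) z) - g (\<rho> i z)) * adj (g (\<rho> i z))"
        by (simp add: w_def left_diff_distrib ub)
      then have "norm (w z - Id N) \<le> norm (g (\<rho> (Suc i) z) - g (\<rho> i z)) * norm (adj (g (\<rho> i z)))"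
        by (simp only: norm_mult_ineq)
      also have "\<dots> \<le> \<epsilon> * norm (Id N)"
      proof (rule mult_mono)
        show "norm (adj (g (\<rho> i z))) \<le> norm (Id N)" using norm_unitary[of N "g (\<rho> i z)"] u by simp
        show "norm (g (\<rho> (Suc i) z) - g (\<rho> i z)) \<le> \<epsilon>"
        proof (cases "fst z \<in> B")
          case True
          have "norm (g (fst z, snd (\<rho> (Suc i) z)) - g (fst z, snd (\<rho> i z))) < \<epsilon>"
            using close[of z] True BX by (intro \<delta>2(2) in01 i zY) (auto simp: dist_commute)
          then show ?thesis by (simp add: eta)
        next
          case False
          then have "\<rho> (Suc i) z = \<rho> i z" using z c01[OF i(1)] c01[OF i(2)] by (auto simp: Z_def \<rho>_def)
          then show ?thesis using \<epsilon> by simp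
        qed
      qed (use \<epsilon> in auto)
      finally show "norm (w z - Id N) \<le> 1" using \<epsilon> by linarith
      have e: "bnd N (e (fst z))"
        using sy[of "fst z" "snd z"] zY by (metis bnd_adj bnd_mult mem_Times_iff prod.collapse tY)
      have "w z * s (\<rho> i z) = g (\<rho> (Suc i) z) * (adj (g (\<rho> i z)) * g (\<rho> i z)) * e (fst z)"
        using u by (simp add: w_def mult.assoc f\<rho>)
      also have "\<dots> = s (\<rho> (Suc i) z)" using u' ub' by (simp add: ub mult_Id f\<rho>)
      finally show "w z * s (\<rho> i z) = s (\<rho> (Suc i) z)" .
    qed
    obtain W where W: "continuous_map Y euclidean W" "\<And>y. y \<in> topspace Y \<Longrightarrow> unitary_mat N (W y)"
      "\<And>y. y \<in> topspace Y \<Longrightarrow> W y * s (\<rho> i y) = s (\<rho> (Suc i) y)" "\<And>z. z \<in> Z \<Longrightarrow> W z = w z"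
      using extend_unitary_near_identity[OF Y cZ s\<rho>[OF i(1)] s\<rho>[OF i(2)] st wc wZ] by blast
    have "continuous_map Y euclidean (\<lambda>z. W z * G z)" by (intro continuous_map_fmat_mult W G)
    moreover have "unitary_mat N (W z * G z) \<and> W z * G z * e (fst z) = s (\<rho> (Suc i) z)" if "z \<in> topspace Y" for z
      using W(2,3)[OF that] G(2)[OF that] by (auto simp: unitary_mult mult.assoc)
    moreover have "W z * G z = g (\<rho> (Suc i) z)" if z: "z \<in> Z" for z
    proof -
      have "adj (g (\<rho> i z)) * g (\<rho> i z) = Id N" "bnd N (g (\<rho> (Suc i) z))"
        using gz[OF \<rho>Z[OF i(1) z]] gz[OF \<rho>Z[OF i(2) z]] by (auto simp: unitary_mat_def)
      then show ?thesis by (simp add: W(4)[OF z] G(3)[OF z] w_def mult.assoc mult_Id)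
    qed
    ultimately show ?case by (intro exI[of _ "\<lambda>z. W z * G z"]) blast
  qed
  from this[of n] obtain G where G: "continuous_map Y euclidean G"
    "\<And>z. z \<in> topspace Y \<Longrightarrow> unitary_mat N (G z) \<and> G z * e (fst z) = s (\<rho> n z)"
    "\<And>z. z \<in> Z \<Longrightarrow> G z = g (\<rho> n z)" by auto
  have "\<rho> n z = z" if "z \<in> topspace Y" for z
    using that n(1) by (auto simp: \<rho>_def tY c_def)
  then show ?thesis using G ZY by (intro that[of G]) (auto simp: subset_iff)
qed

section \<open>Covering dimension\<close>

lemma finite_point_subcover:
  assumes "compact_space X" "\<And>x. x \<in> topspace X \<Longrightarrow> openin X (W x) \<and> x \<in> W x"
  obtains F where "finite F" "F \<subseteq> topspace X" "topspace X \<subseteq> \<Union>(W ` F)"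
proof -
  have "\<forall>U\<in>W ` topspace X. openin X U" "topspace X \<subseteq> \<Union>(W ` topspace X)" using assms(2) by blast+
  then obtain \<F> where "finite \<F>" "\<F> \<subseteq> W ` topspace X" "topspace X \<subseteq> \<Union>\<F>"
    using assms(1)[unfolded compact_space_alt] by meson
  then show ?thesis using that by (metis finite_subset_image)
qed

lemma covering_dim_leD:
  assumes "covering_dim_le X n" "finite \<U>" "\<And>U. U \<in> \<U> \<Longrightarrow> openin X U" "\<Union>\<U> = topspace X"
  obtains \<V> where "finite \<V>" "\<And>V. V \<in> \<V> \<Longrightarrow> openin X V" "\<Union>\<V> = topspace X"
    "\<And>V. V \<in> \<V> \<Longrightarrow> V \<noteq> {} \<and> (\<exists>U\<in>\<U>. V \<subseteq> U)" "\<And>x. x \<in> topspace X \<Longrightarrow> card {V \<in> \<V>. x \<in> V} \<le> n + 1"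
proof -
  have "\<exists>\<V>. finite \<V> \<and> (\<forall>V\<in>\<V>. openin X V) \<and> \<Union>\<V> = topspace X \<and>
             (\<forall>V\<in>\<V>. \<exists>U\<in>\<U>. V \<subseteq> U) \<and> (\<forall>x\<in>topspace X. card {V \<in> \<V>. x \<in> V} \<le> n + 1)"
    by (rule mp[OF spec[OF assms(1)[unfolded covering_dim_le_def]]]) (intro conjI ballI assms)
  then obtain \<V> where V: "finite \<V>" "\<forall>V\<in>\<V>. openin X V" "\<Union>\<V> = topspace X"
    "\<forall>V\<in>\<V>. \<exists>U\<in>\<U>. V \<subseteq> U" "\<forall>x\<in>topspace X. card {V \<in> \<V>. x \<in> V} \<le> n + 1"
    by (elim exE conjE)
  have "{V \<in> \<V> - {{}}. x \<in> V} = {V \<in> \<V>. x \<in> V}" for x by auto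
  then show ?thesis using V by (intro that[of "\<V> - {{}}"]) auto
qed

lemma covering_dim_le_mono:
  assumes "covering_dim_le X n" "n \<le> m" shows "covering_dim_le X m"
  unfolding covering_dim_le_def
proof (intro allI impI)
  fix \<U> assume U: "finite \<U> \<and> (\<forall>U\<in>\<U>. openin X U) \<and> \<Union>\<U> = topspace X"
  then have U1: "finite \<U>" "\<And>U. U \<in> \<U> \<Longrightarrow> openin X U" "\<Union>\<U> = topspace X" by simp_all
  obtain \<V> where V: "finite \<V>" "\<And>V. V \<in> \<V> \<Longrightarrow> openin X V" "\<Union>\<V> = topspace X"
    "\<And>V. V \<in> \<V> \<Longrightarrow> V \<noteq> {} \<and> (\<exists>U\<in>\<U>. V \<subseteq> U)" "\<And>x. x \<in> topspace X \<Longrightarrow> card {V \<in> \<V>. x \<in> V} \<le> n + 1"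
    by (rule covering_dim_leD[OF assms(1) U1], assumption) (rule that)
  show "\<exists>\<V>. finite \<V> \<and> (\<forall>V\<in>\<V>. openin X V) \<and> \<Union>\<V> = topspace X \<and>
             (\<forall>V\<in>\<V>. \<exists>U\<in>\<U>. V \<subseteq> U) \<and> (\<forall>x\<in>topspace X. card {V \<in> \<V>. x \<in> V} \<le> m + 1)"
  proof (intro exI[of _ \<V>] conjI ballI)
    show "card {V \<in> \<V>. x \<in> V} \<le> m + 1" if "x \<in> topspace X" for x
      using V(5)[OF that] assms(2) by linarith
  qed (use V in simp_all)
qed

lemma Union_preimages: "\<Union>((\<lambda>U. {x \<in> A. f x \<in> U}) ` \<U>) = {x \<in> A. f x \<in> \<Union>\<U>}"
  by auto

lemma Union_traces: "\<Union>((\<lambda>V. V \<inter> F) ` \<V> - {{}}) = \<Union>\<V> \<inter> F"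
  by blast

lemma covering_dim_le_covering_dim: "finite_covering_dim X \<Longrightarrow> covering_dim_le X (covering_dim X)"
  unfolding finite_covering_dim_def covering_dim_def by (rule LeastI_ex)

lemma card_image_filter_le:
  assumes "finite \<V>" "\<And>W. W \<in> \<W> \<Longrightarrow> x \<in> W \<Longrightarrow> \<exists>V\<in>\<V>. y \<in> V \<and> W = f V"
  shows "card {W \<in> \<W>. x \<in> W} \<le> card {V \<in> \<V>. y \<in> V}"
proof -
  have "card {W \<in> \<W>. x \<in> W} \<le> card (f ` {V \<in> \<V>. y \<in> V})"
    using assms by (intro card_mono) auto
  also have "\<dots> \<le> card {V \<in> \<V>. y \<in> V}" using assms(1) by (intro card_image_le) simp
  finally show ?thesis .
qed

lemma covering_dim_le_retract:
  assumes dim: "covering_dim_le X n" and i: "continuous_map Y X i" and r: "continuous_map X Y r"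
    and ri: "\<And>y. y \<in> topspace Y \<Longrightarrow> r (i y) = y"
  shows "covering_dim_le Y n"
  unfolding covering_dim_le_def
proof (intro allI impI)
  fix \<U> assume U: "finite \<U> \<and> (\<forall>U\<in>\<U>. openin Y U) \<and> \<Union>\<U> = topspace Y"
  let ?p = "\<lambda>U. {x \<in> topspace X. r x \<in> U}" and ?q = "\<lambda>V. {y \<in> topspace Y. i y \<in> V}"
  have iY: "i y \<in> topspace X" if "y \<in> topspace Y" for y
    using that continuous_map_image_subset_topspace[OF i] by blast
  have rX: "r x \<in> topspace Y" if "x \<in> topspace X" for x
    using that continuous_map_image_subset_topspace[OF r] by blast
  have p1: "finite (?p ` \<U>)" using U by simp
  have p2: "openin X W" if "W \<in> ?p ` \<U>" for W
    using that U openin_continuous_map_preimage[OF r] by auto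
  have p3: "\<Union>(?p ` \<U>) = topspace X" unfolding Union_preimages using U rX by auto
  obtain \<V> where V: "finite \<V>" "\<And>V. V \<in> \<V> \<Longrightarrow> openin X V" "\<Union>\<V> = topspace X"
    "\<And>V. V \<in> \<V> \<Longrightarrow> V \<noteq> {} \<and> (\<exists>U\<in>?p ` \<U>. V \<subseteq> U)" "\<And>x. x \<in> topspace X \<Longrightarrow> card {V \<in> \<V>. x \<in> V} \<le> n + 1"
    by (rule covering_dim_leD[OF dim p1 p2 p3], assumption) (rule that)
  show "\<exists>\<V>. finite \<V> \<and> (\<forall>V\<in>\<V>. openin Y V) \<and> \<Union>\<V> = topspace Y \<and>
             (\<forall>V\<in>\<V>. \<exists>U\<in>\<U>. V \<subseteq> U) \<and> (\<forall>x\<in>topspace Y. card {V \<in> \<V>. x \<in> V} \<le> n + 1)"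
  proof (intro exI[of _ "?q ` \<V>"] conjI ballI)
    show "finite (?q ` \<V>)" using V by simp
    show "openin Y W" if "W \<in> ?q ` \<V>" for W using that V openin_continuous_map_preimage[OF i] by auto
    show "\<Union>(?q ` \<V>) = topspace Y" unfolding Union_preimages V(3) using iY by auto
    show "\<exists>U\<in>\<U>. W \<subseteq> U" if W: "W \<in> ?q ` \<V>" for W
    proof -
      obtain V where VV: "V \<in> \<V>" "W = ?q V" using W by blast
      obtain U where "U \<in> \<U>" "V \<subseteq> ?p U" using V(4)[OF VV(1)] by blast
      then show ?thesis using VV(2) ri by (intro bexI[of _ U]) auto
    qed
    show "card {V \<in> ?q ` \<V>. y \<in> V} \<le> n + 1" if y: "y \<in> topspace Y" for y
    proof -
      have "card {V \<in> ?q ` \<V>. y \<in> V} \<le> card {V \<in> \<V>. i y \<in> V}"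
        by (rule card_image_filter_le[where f = ?q]) (use V(1) in auto)
      then show ?thesis using V(5)[OF iY[OF y]] by linarith
    qed
  qed
qed

text \<open>A cover of \<open>F\<close> is completed to one of \<open>X\<close> by the complement of \<open>F\<close>; members of the refinement that lie in
  this complement leave no trace on \<open>F\<close>.\<close>

lemma covering_dim_le_closed:
  assumes dim: "covering_dim_le X n" and F: "closedin X F"
  shows "covering_dim_le (subtopology X F) n"
  unfolding covering_dim_le_def
proof (intro allI impI)
  fix \<U> assume U: "finite \<U> \<and> (\<forall>U\<in>\<U>. openin (subtopology X F) U) \<and> \<Union>\<U> = topspace (subtopology X F)"
  have FX: "F \<subseteq> topspace X" using F closedin_subset by blast
  have "\<forall>U\<in>\<U>. \<exists>W. openin X W \<and> U = W \<inter> F" using U by (simp add: openin_subtopology)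
  then obtain e where e: "\<And>U. U \<in> \<U> \<Longrightarrow> openin X (e U) \<and> U = e U \<inter> F" by metis
  let ?\<U> = "insert (topspace X - F) (e ` \<U>)"
  have op: "openin X W" if "W \<in> ?\<U>" for W using that e F by auto
  have "F \<subseteq> \<Union>(e ` \<U>)" using U e FX by (auto simp: Int_absorb1)
  then have FU: "F \<subseteq> \<Union>?\<U>" by blast
  have un: "\<Union>?\<U> = topspace X"
  proof
    show "\<Union>?\<U> \<subseteq> topspace X" by (rule Union_least) (rule openin_subset[OF op])
    show "topspace X \<subseteq> \<Union>?\<U>" using FU by auto
  qed
  have fin: "finite ?\<U>" using U by simp
  obtain \<V> where V: "finite \<V>" "\<And>V. V \<in> \<V> \<Longrightarrow> openin X V" "\<Union>\<V> = topspace X"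
    "\<And>V. V \<in> \<V> \<Longrightarrow> V \<noteq> {} \<and> (\<exists>U\<in>?\<U>. V \<subseteq> U)" "\<And>x. x \<in> topspace X \<Longrightarrow> card {V \<in> \<V>. x \<in> V} \<le> n + 1"
    by (rule covering_dim_leD[OF dim fin op un], assumption) (rule that)
  let ?q = "\<lambda>V. V \<inter> F"
  show "\<exists>\<V>. finite \<V> \<and> (\<forall>V\<in>\<V>. openin (subtopology X F) V) \<and> \<Union>\<V> = topspace (subtopology X F) \<and>
             (\<forall>V\<in>\<V>. \<exists>U\<in>\<U>. V \<subseteq> U) \<and> (\<forall>x\<in>topspace (subtopology X F). card {V \<in> \<V>. x \<in> V} \<le> n + 1)"
  proof (intro exI[of _ "?q ` \<V> - {{}}"] conjI ballI)
    show "finite (?q ` \<V> - {{}})" using V by simp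
    show "openin (subtopology X F) W" if "W \<in> ?q ` \<V> - {{}}" for W
      using that V(2) by (auto simp: openin_subtopology)
    show "\<Union>(?q ` \<V> - {{}}) = topspace (subtopology X F)" unfolding Union_traces V(3) by simp
    show "\<exists>U\<in>\<U>. W \<subseteq> U" if W: "W \<in> ?q ` \<V> - {{}}" for W
    proof -
      obtain V where VV: "V \<in> \<V>" "W = V \<inter> F" "W \<noteq> {}" using W by blast
      obtain U' where U': "U' \<in> ?\<U>" "V \<subseteq> U'" using V(4)[OF VV(1)] by blast
      then have "U' \<noteq> topspace X - F" using VV by blast
      then obtain U where "U \<in> \<U>" "U' = e U" using U' by blast
      then show ?thesis using VV(2) U'(2) e by (intro bexI[of _ U]) auto
    qed
    show "card {V \<in> ?q ` \<V> - {{}}. x \<in> V} \<le> n + 1" if x: "x \<in> topspace (subtopology X F)" for x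
    proof -
      have "card {V \<in> ?q ` \<V> - {{}}. x \<in> V} \<le> card {V \<in> \<V>. x \<in> V}"
        by (rule card_image_filter_le[where f = ?q]) (use V(1) in auto)
      then show ?thesis using V(5)[of x] x by simp
    qed
  qed
qed

text \<open>A Lebesgue number in the direction of the interval, uniform over \<open>X\<close>.\<close>

lemma uniform_cover_of_prod_interval:
  assumes X: "compact_space X" and U: "\<And>U. U \<in> \<U> \<Longrightarrow> openin (prod_topology X (top_of_set {0..1::real})) U"
    "\<Union>\<U> = topspace X \<times> {0..1}"
  obtains \<W> \<delta> where "finite \<W>" "\<And>W. W \<in> \<W> \<Longrightarrow> openin X W" "\<Union>\<W> = topspace X" "0 < (\<delta>::real)"
    "\<And>W t. W \<in> \<W> \<Longrightarrow> t \<in> {0..1} \<Longrightarrow> \<exists>U\<in>\<U>. W \<times> ({0..1} \<inter> ball t \<delta>) \<subseteq> U"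
proof -
  let ?Y = "prod_topology X (top_of_set {0..1::real})"
  have "\<exists>P d. openin X P \<and> fst z \<in> P \<and> 0 < d \<and> (\<exists>U\<in>\<U>. P \<times> ({0..1} \<inter> ball (snd z) (2 * d)) \<subseteq> U)"
    if z: "z \<in> topspace ?Y" for z
  proof -
    obtain U where UU: "U \<in> \<U>" "z \<in> U" using z U(2) by auto
    then obtain P Q where PQ: "openin X P" "openin (top_of_set {0..1}) Q" "fst z \<in> P" "snd z \<in> Q" "P \<times> Q \<subseteq> U"
      using U(1)[OF UU(1)] unfolding openin_prod_topology_alt by (metis prod.collapse)
    obtain Q' where Q': "open Q'" "Q = {0..1} \<inter> Q'" using PQ(2) unfolding openin_open by blast
    obtain d where d: "0 < d" "ball (snd z) d \<subseteq> Q'" using Q' PQ(4) open_contains_ball by blast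
    have "{0..1} \<inter> ball (snd z) (2 * (d/2)) \<subseteq> Q" using d(2) Q'(2) by auto
    then have "P \<times> ({0..1} \<inter> ball (snd z) (2 * (d/2))) \<subseteq> U" using PQ(5) by blast
    moreover have "0 < d/2" using d(1) by simp
    ultimately show ?thesis using UU(1) PQ(1,3) by blast
  qed
  then obtain P d where Pd: "\<And>z. z \<in> topspace ?Y \<Longrightarrow> openin X (P z) \<and> fst z \<in> P z \<and> 0 < d z \<and>
      (\<exists>U\<in>\<U>. P z \<times> ({0..1} \<inter> ball (snd z) (2 * d z)) \<subseteq> U)" by metis
  have cY: "compact_space ?Y" using X by (simp add: compact_space_prod_topology compact_space_subtopology)
  obtain K where K: "finite K" "K \<subseteq> topspace ?Y" "topspace ?Y \<subseteq> \<Union>((\<lambda>z. P z \<times> ({0..1} \<inter> ball (snd z) (d z))) ` K)"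
  proof (rule finite_point_subcover[OF cY, of "\<lambda>z. P z \<times> ({0..1} \<inter> ball (snd z) (d z))"])
    fix z assume z: "z \<in> topspace ?Y"
    show "openin ?Y (P z \<times> ({0..1} \<inter> ball (snd z) (d z))) \<and> z \<in> P z \<times> ({0..1} \<inter> ball (snd z) (d z))"
      using Pd[OF z] z by (auto simp: openin_prod_Times_iff openin_open_Int mem_Times_iff)
  qed blast
  define \<delta> where "\<delta> = (if K = {} then 1 else Min (d ` K))"
  have \<delta>: "0 < \<delta>" "\<And>z. z \<in> K \<Longrightarrow> \<delta> \<le> d z"
    using K(1,2) Pd by (auto simp: \<delta>_def subset_iff)
  \<comment> \<open>finitely many sets, because \<open>W x\<close> depends only on the set of those
      \<open>z \<in> K\<close> with \<open>x \<in> P z\<close>\<close>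
  define W where "W x = topspace X \<inter> \<Inter>(P ` {z \<in> K. x \<in> P z})" for x
  have fin: "finite (W ` topspace X)"
  proof -
    have "W ` topspace X \<subseteq> (\<lambda>L. topspace X \<inter> \<Inter>(P ` L)) ` Pow K"
      by (rule image_subsetI) (auto simp: W_def)
    then show ?thesis by (rule finite_subset) (simp add: K(1))
  qed
  have op: "openin X (W x)" for x
  proof (cases "{z \<in> K. x \<in> P z} = {}")
    case False
    then have "openin X (\<Inter>(P ` {z \<in> K. x \<in> P z}))" using K(1,2) Pd by (intro openin_Inter) auto
    then show ?thesis unfolding W_def by (rule openin_Int[OF openin_topspace])
  next
    case True
    then show ?thesis unfolding W_def True by simp
  qed
  show ?thesis
  proof (rule that[OF fin _ _ \<delta>(1)])
    show "openin X V" if "V \<in> W ` topspace X" for V using that op by blast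
    show "\<Union>(W ` topspace X) = topspace X" by (auto simp: W_def)
    fix V t assume V: "V \<in> W ` topspace X" and t: "t \<in> {0..1::real}"
    obtain x where x: "x \<in> topspace X" "V = W x" using V by blast
    obtain z where z: "z \<in> K" "x \<in> P z" "t \<in> ball (snd z) (d z)"
      using K(3) x(1) t by force
    obtain U where UU: "U \<in> \<U>" "P z \<times> ({0..1} \<inter> ball (snd z) (2 * d z)) \<subseteq> U" using Pd z(1) K(2) by blast
    have "ball t \<delta> \<subseteq> ball (snd z) (2 * d z)"
    proof
      fix s assume "s \<in> ball t \<delta>"
      then show "s \<in> ball (snd z) (2 * d z)"
        using z(3) \<delta>(2)[OF z(1)] dist_triangle[of "snd z" s t] by simp
    qed
    moreover have "W x \<subseteq> P z" using z unfolding W_def by blast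
    ultimately show "\<exists>U\<in>\<U>. V \<times> ({0..1} \<inter> ball t \<delta>) \<subseteq> U"
      unfolding x(2) using UU by (intro bexI[of _ U]) blast+
  qed
qed

text \<open>The members \<open>V\<close> of a good cover of \<open>X\<close> get different numbers \<open>\<nu> V < m\<close>, and \<open>V \<times> [0, 1]\<close> is cut
  at the points \<open>(\<nu> V + i m) / (m M)\<close>. Different members are cut at different points, so at each
  height at most one member contributes a second piece, and the order of the cover grows only by one.\<close>

lemma covering_dim_le_prod_interval:
  assumes X: "compact_space X" and dim: "covering_dim_le X n"
  shows "covering_dim_le (prod_topology X (top_of_set {0..1::real})) (n + 1)"
  unfolding covering_dim_le_def
proof (intro allI impI)
  let ?Y = "prod_topology X (top_of_set {0..1::real})"
  fix \<U> assume U: "finite \<U> \<and> (\<forall>U\<in>\<U>. openin ?Y U) \<and> \<Union>\<U> = topspace ?Y"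
  then have U1: "\<And>U. U \<in> \<U> \<Longrightarrow> openin ?Y U" and U2: "\<Union>\<U> = topspace X \<times> {0..1}" by auto
  obtain \<W> \<delta> where W: "finite \<W>" "\<And>W. W \<in> \<W> \<Longrightarrow> openin X W" "\<Union>\<W> = topspace X" "0 < (\<delta>::real)"
    "\<And>W t. W \<in> \<W> \<Longrightarrow> t \<in> {0..1} \<Longrightarrow> \<exists>U\<in>\<U>. W \<times> ({0..1} \<inter> ball t \<delta>) \<subseteq> U"
    by (rule uniform_cover_of_prod_interval[OF X U1 U2], assumption) (rule that)
  obtain \<V> where V: "finite \<V>" "\<And>V. V \<in> \<V> \<Longrightarrow> openin X V" "\<Union>\<V> = topspace X"
    "\<And>V. V \<in> \<V> \<Longrightarrow> V \<noteq> {} \<and> (\<exists>U\<in>\<W>. V \<subseteq> U)" "\<And>x. x \<in> topspace X \<Longrightarrow> card {V \<in> \<V>. x \<in> V} \<le> n + 1"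
    by (rule covering_dim_leD[OF dim W(1-3)], assumption) (rule that)
  define m where "m = card \<V> + 1"
  have m: "0 < m" "1 \<le> real m" by (simp_all add: m_def)
  obtain \<nu> where bij: "bij_betw \<nu> \<V> {0..<card \<V>}" using ex_bij_betw_finite_nat[OF V(1)] by blast
  have \<nu>: "inj_on \<nu> \<V>" "\<And>V. V \<in> \<V> \<Longrightarrow> \<nu> V < m"
    using bij_betw_imp_inj_on[OF bij] bij_betwE[OF bij] by (auto simp: m_def less_Suc_eq)
  obtain M :: nat where M: "0 < M" "2 / real M < \<delta>"
    using ex_inverse_of_nat_less[of "\<delta>/2"] W(4) by (auto simp: field_simps)
  \<comment> \<open>in the coordinate \<open>\<tau>\<close> the cuts of \<open>V\<close> are the
      integers congruent to \<open>\<nu> V\<close> modulo \<open>m\<close>; adjacent pieces overlap by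
      1/4 on either side of a cut\<close>
  define \<tau> where "\<tau> t = t * (real m * real M)" for t :: real
  define J where "J V i = {t \<in> {0..1}. real m * (real i - 1) + real (\<nu> V) - 1/4 < \<tau> t \<and> \<tau> t < real m * real i + real (\<nu> V) + 1/4}" for V i
  let ?E = "(\<lambda>(V, i). V \<times> J V i) ` (\<V> \<times> {..M}) - {{}}"
  have Jop: "openin (top_of_set {0..1}) (J V i)" for V i
  proof -
    have o: "open ({t. a < \<tau> t} \<inter> {t. \<tau> t < b})" for a b
      unfolding \<tau>_def by (rule open_Int; rule open_Collect_less) (auto intro!: continuous_intros)
    have J: "J V i = {0..1} \<inter> ({t. real m * (real i - 1) + real (\<nu> V) - 1/4 < \<tau> t} \<inter> {t. \<tau> t < real m * real i + real (\<nu> V) + 1/4})"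
      by (auto simp: J_def)
    show ?thesis unfolding J by (rule openin_open_Int[OF o])
  qed
  have op: "openin ?Y W" if "W \<in> ?E" for W
    using that V(2) Jop by (auto simp: openin_prod_Times_iff)
  have cov: "\<exists>i\<le>M. t \<in> J V i" if t: "t \<in> {0..1}" and VV: "V \<in> \<V>" for t V
  proof -
    define s where "s = (\<tau> t - real (\<nu> V)) / real m"
    have s1: "-1 < s"
    proof -
      have "0 \<le> \<tau> t" unfolding \<tau>_def using t by (intro mult_nonneg_nonneg) auto
      then have "- real m < \<tau> t - real (\<nu> V)" using \<nu>(2)[OF VV] by linarith
      then show ?thesis using m by (simp add: s_def field_simps)
    qed
    have s2: "s \<le> real M"
    proof -
      have "\<tau> t \<le> 1 * (real m * real M)" unfolding \<tau>_def using t by (intro mult_right_mono) auto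
      then have "\<tau> t - real (\<nu> V) \<le> real m * real M" by simp
      then show ?thesis using m by (simp add: s_def field_simps)
    qed
    define i where "i = nat \<lceil>s\<rceil>"
    have "0 \<le> \<lceil>s\<rceil>" using s1 by linarith
    then have i: "s \<le> real i" "real i < s + 1" unfolding i_def by (simp_all, linarith+)
    have "i \<le> M" using s2 i(2) \<open>0 \<le> \<lceil>s\<rceil>\<close> unfolding i_def by (simp add: nat_le_iff ceiling_le_iff)
    moreover have "\<tau> t = real m * s + real (\<nu> V)" using m by (simp add: s_def)
    moreover have "real m * s \<le> real m * real i" "real m * (real i - 1) \<le> real m * s"
      using i m by (intro mult_left_mono; simp)+
    ultimately show ?thesis using t by (intro exI[of _ i]) (auto simp: J_def)
  qed
  have ref: "\<exists>U\<in>\<U>. W \<subseteq> U" if E: "W \<in> ?E" for W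
  proof -
    obtain Vi where "Vi \<in> \<V> \<times> {..M}" "W = (\<lambda>(V, i). V \<times> J V i) Vi" "W \<noteq> {}" using E by blast
    then obtain V i where Vi: "V \<in> \<V>" "W = V \<times> J V i" "W \<noteq> {}" by (cases Vi) auto
    then obtain t where t: "t \<in> J V i" by blast
    obtain W' where W': "W' \<in> \<W>" "V \<subseteq> W'" using V(4)[OF Vi(1)] by blast
    obtain U where U: "U \<in> \<U>" "W' \<times> ({0..1} \<inter> ball t \<delta>) \<subseteq> U" using W(5)[OF W'(1), of t] t by (auto simp: J_def)
    have "J V i \<subseteq> {0..1} \<inter> ball t \<delta>"
    proof
      fix s assume s: "s \<in> J V i"
      have "\<bar>\<tau> s - \<tau> t\<bar> < real m + 1/2" using s t by (auto simp: J_def algebra_simps)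
      also have "\<dots> \<le> 2 * real m" using m by simp
      finally have "\<bar>s - t\<bar> * (real m * real M) < 2 * real m"
        by (simp add: \<tau>_def left_diff_distrib[symmetric] abs_mult)
      then have "\<bar>s - t\<bar> * real M < 2" using m by (simp add: field_simps)
      then have "\<bar>s - t\<bar> < 2 / real M" using M by (simp add: field_simps)
      then show "s \<in> {0..1} \<inter> ball t \<delta>" using s M by (auto simp: J_def dist_real_def)
    qed
    then show ?thesis using U W' Vi by (intro bexI[of _ U]) blast+
  qed
  have ord: "card {W \<in> ?E. z \<in> W} \<le> n + 1 + 1" if z: "z \<in> topspace ?Y" for z
  proof -
    obtain x t where xt: "z = (x, t)" "x \<in> topspace X" "t \<in> {0..1}" using z by auto
    define S where "S = {(V, i). V \<in> \<V> \<and> x \<in> V \<and> i \<le> M \<and> t \<in> J V i}"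
    define c where "c V = (SOME i. i \<le> M \<and> t \<in> J V i \<and> real m * (real i - 1) + real (\<nu> V) < \<tau> t \<and> \<tau> t \<le> real m * real i + real (\<nu> V))" for V
    define good where "good V i \<longleftrightarrow> real m * (real i - 1) + real (\<nu> V) < \<tau> t \<and> \<tau> t \<le> real m * real i + real (\<nu> V)" for V i
    have good_unique: "i = j" if "good V i" "good V j" for V i j
    proof -
      have "real m * (real i - 1) < real m * real j" "real m * (real j - 1) < real m * real i"
        using that by (auto simp: good_def)
      then have "real i - 1 < real j" "real j - 1 < real i" using m by simp_all
      then show ?thesis by linarith
    qed
    \<comment> \<open>the pairs reached only through the overlap; there is at most one, since
        \<open>\<tau> t\<close> is within 1/4 of at most one integer, whose residue determines
        \<open>V\<close>\<close>
    let ?B = "{(V, i) \<in> S. \<not> good V i}"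
    have bad: "(\<exists>k::int. real_of_int k - 1/4 < \<tau> t \<and> \<tau> t < real_of_int k + 1/4 \<and>
        ((k = int m * int i + int (\<nu> V) \<and> real_of_int k < \<tau> t) \<or> (k = int m * (int i - 1) + int (\<nu> V) \<and> \<tau> t \<le> real_of_int k)))"
      if "(V, i) \<in> ?B" for V i
    proof -
      have J: "t \<in> J V i" and g: "\<not> good V i" using that by (auto simp: S_def)
      consider "real m * real i + real (\<nu> V) < \<tau> t" | "\<tau> t \<le> real m * (real i - 1) + real (\<nu> V)"
        using g by (auto simp: good_def not_less not_le)
      then show ?thesis
      proof cases
        case 1 then show ?thesis using J by (intro exI[of _ "int m * int i + int (\<nu> V)"]) (auto simp: J_def algebra_simps)
      next
        case 2 then show ?thesis using J by (intro exI[of _ "int m * (int i - 1) + int (\<nu> V)"]) (auto simp: J_def algebra_simps)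
      qed
    qed
    have B1: "p = p'" if p: "p \<in> ?B" "p' \<in> ?B" for p p'
    proof -
      obtain V i V' i' where pp: "p = (V, i)" "p' = (V', i')" by (cases p, cases p') blast
      have VV: "V \<in> \<V>" "V' \<in> \<V>" using p pp by (auto simp: S_def)
      obtain k where k: "real_of_int k - 1/4 < \<tau> t" "\<tau> t < real_of_int k + 1/4"
        "(k = int m * int i + int (\<nu> V) \<and> real_of_int k < \<tau> t) \<or> (k = int m * (int i - 1) + int (\<nu> V) \<and> \<tau> t \<le> real_of_int k)"
        using bad p(1) unfolding pp by blast
      obtain k' where k': "real_of_int k' - 1/4 < \<tau> t" "\<tau> t < real_of_int k' + 1/4"
        "(k' = int m * int i' + int (\<nu> V') \<and> real_of_int k' < \<tau> t) \<or> (k' = int m * (int i' - 1) + int (\<nu> V') \<and> \<tau> t \<le> real_of_int k')"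
        using bad p(2) unfolding pp by blast
      have "k = k'" using k k' by linarith
      have "k mod int m = int (\<nu> V)" using k(3) \<nu>(2)[OF VV(1)] by auto
      moreover have "k' mod int m = int (\<nu> V')" using k'(3) \<nu>(2)[OF VV(2)] by auto
      ultimately have "\<nu> V = \<nu> V'" using \<open>k = k'\<close> by simp
      then have "V = V'" using \<nu>(1) VV by (auto dest: inj_onD)
      moreover have "int m * int i = int m * int i'"
        using k(3) k'(3) \<open>k = k'\<close> \<open>\<nu> V = \<nu> V'\<close> by (auto simp: algebra_simps)
      ultimately show ?thesis using m pp by simp
    qed
    have finS: "finite S"
      by (rule finite_subset[of _ "\<V> \<times> {..M}"]) (use V(1) in \<open>auto simp: S_def\<close>)
    have "?B \<subseteq> S" by auto
    then have "finite ?B" using finS finite_subset by blast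
    have cB: "card ?B \<le> 1" using card_le_Suc0_iff_eq[OF \<open>finite ?B\<close>] B1 by auto
    let ?G = "{(V, i) \<in> S. good V i}"
    have "inj_on fst ?G" by (rule inj_onI) (use good_unique in auto)
    then have "card ?G = card (fst ` ?G)" by (rule card_image[symmetric])
    also have "\<dots> \<le> card {V \<in> \<V>. x \<in> V}" using V(1) by (intro card_mono) (auto simp: S_def)
    also have "\<dots> \<le> n + 1" by (rule V(5)[OF xt(2)])
    finally have cG: "card ?G \<le> n + 1" .
    have "{W \<in> ?E. z \<in> W} \<subseteq> (\<lambda>(V, i). V \<times> J V i) ` S" by (auto simp: S_def xt(1))
    then have "card {W \<in> ?E. z \<in> W} \<le> card ((\<lambda>(V, i). V \<times> J V i) ` S)" using finS by (intro card_mono) auto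
    also have "\<dots> \<le> card S" using finS by (rule card_image_le)
    also have "\<dots> \<le> card (?G \<union> ?B)" by (rule card_mono) (use finS in \<open>auto intro: finite_subset[of _ S]\<close>)
    also have "\<dots> \<le> card ?G + card ?B" by (rule card_Un_le)
    finally show ?thesis using cG cB by linarith
  qed
  show "\<exists>\<V>. finite \<V> \<and> (\<forall>V\<in>\<V>. openin ?Y V) \<and> \<Union>\<V> = topspace ?Y \<and>
             (\<forall>V\<in>\<V>. \<exists>U\<in>\<U>. V \<subseteq> U) \<and> (\<forall>x\<in>topspace ?Y. card {V \<in> \<V>. x \<in> V} \<le> n + 1 + 1)"
  proof (intro exI[of _ ?E] conjI ballI)
    show "finite ?E" using V(1) by simp
    show "\<Union>?E = topspace ?Y"
    proof
      show "\<Union>?E \<subseteq> topspace ?Y" using op openin_subset by blast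
      show "topspace ?Y \<subseteq> \<Union>?E"
      proof
        fix z assume "z \<in> topspace ?Y"
        then obtain x t where xt: "z = (x, t)" "x \<in> topspace X" "t \<in> {0..1}" by auto
        obtain V where VV: "V \<in> \<V>" "x \<in> V" using V(3) xt(2) by blast
        obtain i where "i \<le> M" "t \<in> J V i" using cov[OF xt(3) VV(1)] by blast
        then show "z \<in> \<Union>?E" using VV xt(1) by (intro UnionI[of "V \<times> J V i"]) auto
      qed
    qed
  qed (use op ref ord in blast)+
qed

section \<open>General position\<close>

text \<open>More unknowns than equations.\<close>

lemma homogeneous_system_nontrivial:
  fixes A :: "nat \<Rightarrow> nat \<Rightarrow> real"
  assumes "r < n"
  obtains x where "\<exists>i<n. x i \<noteq> 0" "\<And>k. k < r \<Longrightarrow> (\<Sum>i<n. A k i * x i) = 0"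
proof -
  define c where "c k = (if k < r then vec n (A k) else 0\<^sub>v n)" for k
  define B where "B = mat\<^sub>r n n (\<lambda>k. if k = n - 1 then 0\<^sub>v n else c k)"
  have B: "B \<in> carrier_mat n n" by (simp add: B_def)
  have "det B = 0" unfolding B_def by (rule det_row_0) (use assms in \<open>auto simp: c_def\<close>)
  then obtain v where v: "v \<in> carrier_vec n" "v \<noteq> 0\<^sub>v n" "B *\<^sub>v v = 0\<^sub>v n"
    using det_0_iff_vec_prod_zero_field[OF B] by blast
  show ?thesis
  proof (rule that[of "vec_index v"])
    show "\<exists>i<n. vec_index v i \<noteq> 0"
    proof (rule ccontr)
      assume "\<not> (\<exists>i<n. vec_index v i \<noteq> 0)"
      then have "v = 0\<^sub>v n" by (intro eq_vecI) (use v(1) in auto)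
      then show False using v(2) by blast
    qed
    fix k assume k: "k < r"
    have "row B k = vec n (A k)"
      unfolding B_def using k assms by (subst row_mat_of_row_fun) (auto simp: c_def)
    then have "vec_index (B *\<^sub>v v) k = vec n (A k) \<bullet> v"
      using k assms B by simp
    also have "\<dots> = (\<Sum>i<n. A k i * vec_index v i)"
      using v(1) by (auto simp: scalar_prod_def lessThan_atLeast0 intro!: sum.cong)
    finally have "vec_index (B *\<^sub>v v) k = (\<Sum>i<n. A k i * vec_index v i)" .
    then show "(\<Sum>i<n. A k i * vec_index v i) = 0" using v(3) k assms by simp
  qed
qed

lemma partition_functions:
  assumes K: "compact_space K" "Hausdorff_space K" and V: "finite \<V>" "\<And>V. V \<in> \<V> \<Longrightarrow> openin K V" "\<Union>\<V> = topspace K"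
  obtains \<phi> where "\<And>V. V \<in> \<V> \<Longrightarrow> continuous_map K euclideanreal (\<phi> V)"
    "\<And>V y. V \<in> \<V> \<Longrightarrow> y \<in> topspace K \<Longrightarrow> 0 \<le> \<phi> V y" "\<And>V y. V \<in> \<V> \<Longrightarrow> y \<in> topspace K \<Longrightarrow> y \<notin> V \<Longrightarrow> \<phi> V y = 0"
    "\<And>y. y \<in> topspace K \<Longrightarrow> (\<Sum>V\<in>\<V>. \<phi> V y) = 1"
proof -
  have nK: "normal_space K" using K compact_Hausdorff_or_regular_imp_normal_space by blast
  have "\<exists>V g. V \<in> \<V> \<and> x \<in> V \<and> continuous_map K (top_of_set {0..1::real}) g \<and> g x = 1 \<and> (\<forall>y\<in>topspace K - V. g y = 0)"
    if x: "x \<in> topspace K" for x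
  proof -
    obtain V where VV: "V \<in> \<V>" "x \<in> V" using V(3) x by blast
    have "closedin K {x}" using K(2) x by (simp add: closedin_Hausdorff_singleton)
    moreover have "closedin K (topspace K - V)" using V(2)[OF VV(1)] by blast
    ultimately obtain g where "continuous_map K (top_of_set {0..1::real}) g" "g ` (topspace K - V) \<subseteq> {0}" "g ` {x} \<subseteq> {1}"
      using Urysohn_lemma[OF nK, of "topspace K - V" "{x}" 0 1] VV(2) by (auto simp: disjnt_def)
    then show ?thesis using VV by blast
  qed
  then obtain W g where Wg: "\<And>x. x \<in> topspace K \<Longrightarrow> W x \<in> \<V> \<and> x \<in> W x \<and> continuous_map K (top_of_set {0..1::real}) (g x) \<and> g x x = 1 \<and> (\<forall>y\<in>topspace K - W x. g x y = 0)"
    by metis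
  have gc: "continuous_map K euclideanreal (g x)" if "x \<in> topspace K" for x
    using Wg[OF that] continuous_map_into_fulltopology by blast
  have g0: "0 \<le> g x y" if "x \<in> topspace K" "y \<in> topspace K" for x y
    using Wg[OF that(1)] that(2) by (force simp: continuous_map_in_subtopology)
  obtain F where F: "finite F" "F \<subseteq> topspace K" "topspace K \<subseteq> \<Union>((\<lambda>x. {y \<in> topspace K. g x y \<in> {1/2<..}}) ` F)"
  proof (rule finite_point_subcover[OF K(1), of "\<lambda>x. {y \<in> topspace K. g x y \<in> {1/2<..}}"])
    fix x assume x: "x \<in> topspace K"
    show "openin K {y \<in> topspace K. g x y \<in> {1/2<..}} \<and> x \<in> {y \<in> topspace K. g x y \<in> {1/2<..}}"
      using openin_continuous_map_preimage[OF gc[OF x], of "{1/2<..}"] Wg[OF x] x by auto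
  qed blast
  define f where "f V y = (\<Sum>x\<in>{x \<in> F. W x = V}. g x y)" for V y
  define s where "s y = (\<Sum>V\<in>\<V>. f V y)" for y
  have fc: "continuous_map K euclideanreal (f V)" for V
    unfolding f_def using F by (intro continuous_map_sum gc) auto
  have sc: "continuous_map K euclideanreal s" unfolding s_def using V(1) by (intro continuous_map_sum fc)
  have f0: "0 \<le> f V y" if "y \<in> topspace K" for V y
    unfolding f_def using F(2) g0 that by (intro sum_nonneg) auto
  have seq: "s y = (\<Sum>x\<in>F. g x y)" for y
    unfolding s_def f_def using F(1,2) V(1) Wg by (intro sum.group) auto
  have s0: "0 < s y" if y: "y \<in> topspace K" for y
  proof -
    obtain x where x: "x \<in> F" "1/2 < g x y" using F(3) y by auto
    have "g x y \<le> s y" unfolding seq using F g0 y x(1) by (intro member_le_sum) auto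
    then show ?thesis using x by simp
  qed
  show ?thesis
  proof (rule that[of "\<lambda>V y. f V y / s y"])
    show "continuous_map K euclideanreal (\<lambda>y. f V y / s y)" for V
      by (rule continuous_map_real_divide) (use fc sc s0 in force)+
    show "0 \<le> f V y / s y" if "y \<in> topspace K" for V y using f0 s0 that by (simp add: less_imp_le)
    show "f V y / s y = 0" if "V \<in> \<V>" "y \<in> topspace K" "y \<notin> V" for V y
    proof -
      have "f V y = 0" unfolding f_def using that F(2) Wg by (intro sum.neutral) auto
      then show ?thesis by simp
    qed
    show "(\<Sum>V\<in>\<V>. f V y / s y) = 1" if "y \<in> topspace K" for y
      using s0[OF that] by (simp add: sum_divide_distrib[symmetric] s_def[symmetric])
  qed
qed

text \<open>A map from a space of dimension at most \<open>m\<close> to \<open>\<real>\<^sup>m\<^sup>+\<^sup>1\<close> is approximated by one whose image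
  lies in finitely many simplices with at most \<open>m + 1\<close> vertices each, hence in finitely many
  hyperplanes; a small translation, chosen on the moment curve, moves all of them off the origin.\<close>

lemma perturb_to_nonvanishing:
  fixes \<alpha> :: "nat \<Rightarrow> 'k \<Rightarrow> real"
  assumes K: "compact_space K" "Hausdorff_space K" and dim: "covering_dim_le K m"
    and \<alpha>: "\<And>i. i \<le> m \<Longrightarrow> continuous_map K euclideanreal (\<alpha> i)" and \<epsilon>: "0 < \<epsilon>"
  obtains \<beta> where "\<And>i. i \<le> m \<Longrightarrow> continuous_map K euclideanreal (\<beta> i)"
    "\<And>i y. i \<le> m \<Longrightarrow> y \<in> topspace K \<Longrightarrow> \<bar>\<beta> i y - \<alpha> i y\<bar> < \<epsilon>"
    "\<And>y. y \<in> topspace K \<Longrightarrow> \<exists>i\<le>m. \<beta> i y \<noteq> 0"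
proof -
  define O' where "O' x = topspace K \<inter> (\<Inter>i\<in>{..m}. {y \<in> topspace K. \<alpha> i y \<in> ball (\<alpha> i x) (\<epsilon>/4)})" for x
  have O': "openin K (O' x) \<and> x \<in> O' x" if "x \<in> topspace K" for x
  proof
    have "openin K (\<Inter>i\<in>{..m}. {y \<in> topspace K. \<alpha> i y \<in> ball (\<alpha> i x) (\<epsilon>/4)})"
    proof (rule openin_INT2)
      fix i assume "i \<in> {..m}"
      then show "openin K {y \<in> topspace K. \<alpha> i y \<in> ball (\<alpha> i x) (\<epsilon>/4)}"
        by (intro openin_continuous_map_preimage[OF \<alpha>]) auto
    qed auto
    then show "openin K (O' x)" by (simp add: O'_def openin_Int)
  qed (use that \<epsilon> in \<open>simp add: O'_def\<close>)
  obtain F where F: "finite F" "F \<subseteq> topspace K" "topspace K \<subseteq> \<Union>(O' ` F)"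
    by (rule finite_point_subcover[OF K(1) O'])
  have FO: "finite (O' ` F)" "\<And>U. U \<in> O' ` F \<Longrightarrow> openin K U" "\<Union>(O' ` F) = topspace K"
    using F O' by (auto simp: O'_def)
  obtain \<V> where V: "finite \<V>" "\<And>V. V \<in> \<V> \<Longrightarrow> openin K V" "\<Union>\<V> = topspace K"
    "\<And>V. V \<in> \<V> \<Longrightarrow> V \<noteq> {} \<and> (\<exists>U\<in>O' ` F. V \<subseteq> U)" "\<And>x. x \<in> topspace K \<Longrightarrow> card {V \<in> \<V>. x \<in> V} \<le> m + 1"
    by (rule covering_dim_leD[OF dim FO], assumption) (rule that)
  have "\<forall>V\<in>\<V>. \<exists>y. y \<in> V" using V(4) by blast
  then obtain y0 where y0: "\<And>V. V \<in> \<V> \<Longrightarrow> y0 V \<in> V" by metis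
  define A where "A V i = \<alpha> i (y0 V)" for V i
  have osc: "\<bar>A V i - \<alpha> i y\<bar> < \<epsilon>/2" if Vyi: "V \<in> \<V>" "y \<in> V" "i \<le> m" for V y i
  proof -
    obtain x where x: "V \<subseteq> O' x" using V(4)[OF Vyi(1)] by blast
    have "\<alpha> i y \<in> ball (\<alpha> i x) (\<epsilon>/4)" "\<alpha> i (y0 V) \<in> ball (\<alpha> i x) (\<epsilon>/4)"
      using x y0[OF Vyi(1)] Vyi(2,3) unfolding O'_def by auto
    then have "\<bar>\<alpha> i x - \<alpha> i y\<bar> < \<epsilon>/4" "\<bar>\<alpha> i x - A V i\<bar> < \<epsilon>/4"
      by (simp_all only: A_def mem_ball dist_real_def)
    then show ?thesis by linarith
  qed
  obtain \<phi> where \<phi>: "\<And>V. V \<in> \<V> \<Longrightarrow> continuous_map K euclideanreal (\<phi> V)"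
    "\<And>V y. V \<in> \<V> \<Longrightarrow> y \<in> topspace K \<Longrightarrow> 0 \<le> \<phi> V y" "\<And>V y. V \<in> \<V> \<Longrightarrow> y \<in> topspace K \<Longrightarrow> y \<notin> V \<Longrightarrow> \<phi> V y = 0"
    "\<And>y. y \<in> topspace K \<Longrightarrow> (\<Sum>V\<in>\<V>. \<phi> V y) = 1"
    by (rule partition_functions[OF K V(1-3)], assumption) (rule that)
  \<comment> \<open>a hyperplane \<open>\<Sum>\<lambda>\<^sub>i x\<^sub>i = c\<close> through the points
      \<open>A V\<close> with \<open>V \<in> S\<close>\<close>
  have hyper: "\<exists>l c. (\<exists>i\<le>m. l i \<noteq> 0) \<and> (\<forall>V\<in>S. (\<Sum>i\<le>m. l i * A V i) = c)"
    if S: "S \<subseteq> \<V>" "S \<noteq> {}" "card S \<le> m + 1" for S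
  proof -
    have "finite S" using S(1) V(1) finite_subset by blast
    then obtain h where h: "bij_betw h {0..<card S} S" using ex_bij_betw_nat_finite by blast
    define B where "B k i = (if i \<le> m then A (h k) i else -1)" for k i
    have "card S < m + 2" using S(3) by simp
    from homogeneous_system_nontrivial[OF this, of B]
    obtain x where x: "\<exists>i<m+2. x i \<noteq> 0" "\<And>k. k < card S \<Longrightarrow> (\<Sum>i<m+2. B k i * x i) = 0" by metis
    have eq: "(\<Sum>i\<le>m. x i * A V i) = x (m + 1)" if VS: "V \<in> S" for V
    proof -
      have "V \<in> h ` {0..<card S}" using h VS by (simp add: bij_betw_def)
      then obtain k where k: "k < card S" "h k = V" by auto
      have "{..<m+2} = insert (m + 1) {..m}" by auto
      then have "(\<Sum>i<m+2. B k i * x i) = - x (m + 1) + (\<Sum>i\<le>m. B k i * x i)" by (simp add: B_def)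
      also have "(\<Sum>i\<le>m. B k i * x i) = (\<Sum>i\<le>m. x i * A V i)" by (rule sum.cong) (auto simp: B_def k)
      finally show ?thesis using x(2)[OF k(1)] by simp
    qed
    moreover have "\<exists>i\<le>m. x i \<noteq> 0"
    proof (rule ccontr)
      assume n: "\<not> (\<exists>i\<le>m. x i \<noteq> 0)"
      then have "(\<Sum>i\<le>m. x i * A V i) = 0" for V by (intro sum.neutral) auto
      then have "x (m + 1) = 0" using eq S(2) by force
      then show False using x(1) n by (metis add_2_eq_Suc' less_Suc_eq_le Suc_eq_plus1 le_SucE)
    qed
    ultimately show ?thesis by blast
  qed
  let ?\<S> = "{S. S \<subseteq> \<V> \<and> S \<noteq> {} \<and> card S \<le> m + 1}"
  have "\<forall>S\<in>?\<S>. \<exists>l c. (\<exists>i\<le>m. l i \<noteq> 0) \<and> (\<forall>V\<in>S. (\<Sum>i\<le>m. l i * A V i) = c)" using hyper by blast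
  from bchoice[OF this] obtain l where "\<forall>S\<in>?\<S>. \<exists>c. (\<exists>i\<le>m. l S i \<noteq> 0) \<and> (\<forall>V\<in>S. (\<Sum>i\<le>m. l S i * A V i) = c)"
    by (elim exE)
  from bchoice[OF this] obtain c where lc0: "\<forall>S\<in>?\<S>. (\<exists>i\<le>m. l S i \<noteq> 0) \<and> (\<forall>V\<in>S. (\<Sum>i\<le>m. l S i * A V i) = c S)"
    by (elim exE)
  note lc = bspec[OF lc0]
  define r where "r = \<epsilon>/4"
  have r: "0 < r" using \<epsilon> by (simp add: r_def)
  have fr: "finite {s::real. c S + r * (\<Sum>i\<le>m. l S i * s ^ Suc i) = 0}" if S: "S \<in> ?\<S>" for S
  proof -
    define q where "q i = (case i of 0 \<Rightarrow> c S | Suc i \<Rightarrow> r * l S i)" for i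
    have e: "c S + r * (\<Sum>i\<le>m. l S i * s ^ Suc i) = (\<Sum>i\<le>Suc m. q i * s ^ i)" for s
      unfolding sum.atMost_Suc_shift by (simp add: q_def sum_distrib_left mult.assoc)
    have "\<exists>i\<le>Suc m. q i \<noteq> 0"
    proof -
      obtain i where "i \<le> m" "l S i \<noteq> 0" using lc[OF S] by blast
      then show ?thesis using r by (intro exI[of _ "Suc i"]) (simp add: q_def)
    qed
    then show ?thesis unfolding e by (rule polyfun_finite_roots[THEN iffD2])
  qed
  have "finite ?\<S>" using V(1) by (auto intro: finite_subset[of _ "Pow \<V>"])
  then have "finite (\<Union>S\<in>?\<S>. {s::real. c S + r * (\<Sum>i\<le>m. l S i * s ^ Suc i) = 0})" using fr by blast
  then have "infinite ({0<..<1} - (\<Union>S\<in>?\<S>. {s::real. c S + r * (\<Sum>i\<le>m. l S i * s ^ Suc i) = 0}))"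
    by (intro Diff_infinite_finite) auto
  from infinite_imp_nonempty[OF this]
  obtain s where ss: "s \<in> {0<..<1} - (\<Union>S\<in>?\<S>. {s::real. c S + r * (\<Sum>i\<le>m. l S i * s ^ Suc i) = 0})" by blast
  have s: "s \<in> {0<..<1}" "\<And>S. S \<in> ?\<S> \<Longrightarrow> c S + r * (\<Sum>i\<le>m. l S i * s ^ Suc i) \<noteq> 0"
    using ss by blast+
  define \<beta> where "\<beta> i y = (\<Sum>V\<in>\<V>. \<phi> V y * A V i) + r * s ^ Suc i" for i y
  show ?thesis
  proof (rule that[of \<beta>])
    show "continuous_map K euclideanreal (\<beta> i)" for i
      unfolding \<beta>_def using V(1) by (intro continuous_map_add continuous_map_sum continuous_map_real_mult \<phi>(1)) auto
    fix y assume y: "y \<in> topspace K"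
    show "\<bar>\<beta> i y - \<alpha> i y\<bar> < \<epsilon>" if i: "i \<le> m" for i
    proof -
      have "(\<Sum>V\<in>\<V>. \<phi> V y * A V i) - \<alpha> i y = (\<Sum>V\<in>\<V>. \<phi> V y * (A V i - \<alpha> i y))"
        using \<phi>(4)[OF y] by (simp add: right_diff_distrib sum_subtractf sum_distrib_right[symmetric])
      also have "\<bar>\<dots>\<bar> \<le> (\<Sum>V\<in>\<V>. \<bar>\<phi> V y * (A V i - \<alpha> i y)\<bar>)" by (rule sum_abs)
      also have "\<dots> \<le> (\<Sum>V\<in>\<V>. \<phi> V y * (\<epsilon>/2))"
      proof (rule sum_mono)
        fix V assume VV: "V \<in> \<V>"
        show "\<bar>\<phi> V y * (A V i - \<alpha> i y)\<bar> \<le> \<phi> V y * (\<epsilon>/2)"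
        proof (cases "y \<in> V")
          case True
          have "\<bar>\<phi> V y * (A V i - \<alpha> i y)\<bar> = \<phi> V y * \<bar>A V i - \<alpha> i y\<bar>"
            using \<phi>(2)[OF VV y] by (simp add: abs_mult)
          also have "\<dots> \<le> \<phi> V y * (\<epsilon>/2)"
            by (rule mult_left_mono[OF less_imp_le[OF osc[OF VV True i]] \<phi>(2)[OF VV y]])
          finally show ?thesis .
        next
          case False
          then show ?thesis using \<phi>(3)[OF VV y] by simp
        qed
      qed
      also have "\<dots> = \<epsilon>/2" unfolding sum_distrib_right[symmetric] \<phi>(4)[OF y] by simp
      finally have 1: "\<bar>(\<Sum>V\<in>\<V>. \<phi> V y * A V i) - \<alpha> i y\<bar> \<le> \<epsilon>/2" .
      have "s ^ Suc i \<le> 1" using s(1) by (intro power_le_one) auto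
      moreover have "0 \<le> s ^ Suc i" using s(1) by (intro zero_le_power) auto
      ultimately have "0 \<le> r * s ^ Suc i \<and> r * s ^ Suc i \<le> r * 1"
        using r by (metis less_imp_le mult_left_mono mult_nonneg_nonneg)
      moreover have "r = \<epsilon>/4" by (rule r_def)
      ultimately show ?thesis using 1 \<epsilon> unfolding \<beta>_def by linarith
    qed
    show "\<exists>i\<le>m. \<beta> i y \<noteq> 0"
    proof (rule ccontr)
      assume n: "\<not> (\<exists>i\<le>m. \<beta> i y \<noteq> 0)"
      define S where "S = {V \<in> \<V>. y \<in> V}"
      have S: "S \<in> ?\<S>" using V(3) V(5)[OF y] y by (auto simp: S_def)
      have "0 = (\<Sum>i\<le>m. l S i * \<beta> i y)" using n by simp
      also have "\<dots> = (\<Sum>i\<le>m. \<Sum>V\<in>\<V>. \<phi> V y * (l S i * A V i)) + r * (\<Sum>i\<le>m. l S i * s ^ Suc i)"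
        by (simp add: \<beta>_def distrib_left sum.distrib sum_distrib_left mult.left_commute del: power_Suc)
      also have "(\<Sum>i\<le>m. \<Sum>V\<in>\<V>. \<phi> V y * (l S i * A V i)) = (\<Sum>V\<in>\<V>. \<phi> V y * (\<Sum>i\<le>m. l S i * A V i))"
        by (subst sum.swap) (simp add: sum_distrib_left)
      also have "\<dots> = (\<Sum>V\<in>\<V>. \<phi> V y * c S)"
      proof (rule sum.cong[OF refl])
        fix V assume VV: "V \<in> \<V>"
        show "\<phi> V y * (\<Sum>i\<le>m. l S i * A V i) = \<phi> V y * c S"
        proof (cases "y \<in> V")
          case True
          then show ?thesis using lc[OF S] VV by (simp add: S_def)
        next
          case False
          then show ?thesis using \<phi>(3)[OF VV y] by simp
        qed
      qed
      also have "\<dots> = c S" using \<phi>(4)[OF y] by (simp add: sum_distrib_right[symmetric])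
      finally show False using s(2)[OF S] by simp
    qed
  qed
qed

section \<open>Extending sections and partial isometries\<close>

lemma closed_neighbourhood:
  assumes "compact_space Y" "Hausdorff_space Y" "openin Y W" "y \<in> W"
  obtains U F where "openin Y U" "y \<in> U" "U \<subseteq> F" "closedin Y F" "F \<subseteq> W"
proof -
  have nY: "normal_space Y" using assms compact_Hausdorff_or_regular_imp_normal_space by blast
  have "y \<in> topspace Y" using assms(3,4) openin_subset by blast
  then have "closedin Y {y}" using assms(2) by (simp add: closedin_Hausdorff_singleton)
  then obtain U where U: "openin Y U" "{y} \<subseteq> U" "Y closure_of U \<subseteq> W"
    using nY assms(3,4) unfolding normal_space_alt by (meson empty_subsetI insert_subset)
  show ?thesis
    by (rule that[OF U(1) _ _ _ U(3)]) (use U closure_of_subset[OF openin_subset[OF U(1)]] in auto)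
qed

lemma continuous_map_paste:
  assumes "closedin Y A" "closedin Y B" "continuous_map (subtopology Y A) euclidean f"
    "continuous_map (subtopology Y B) euclidean g" "\<And>y. y \<in> A \<Longrightarrow> y \<in> B \<Longrightarrow> f y = g y"
  shows "continuous_map (subtopology Y (A \<union> B)) euclidean (\<lambda>y. if y \<in> A then f y else g y)"
proof -
  let ?X = "subtopology Y (A \<union> B)"
  let ?T = "\<lambda>b. if b then A else B" and ?f = "\<lambda>b. if b then f else g"
  have s: "subtopology ?X A = subtopology Y A" "subtopology ?X B = subtopology Y B"
    by (simp_all add: subtopology_subtopology Int_absorb1 Int_Un_distrib2)
  have c: "closedin ?X A" "closedin ?X B"
    using assms(1,2) by (auto simp: closedin_subset_topspace)
  show ?thesis
  proof (rule pasting_lemma_closed[of "UNIV :: bool set" ?X ?T euclidean ?f])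
    show "\<exists>j. j \<in> UNIV \<and> x \<in> ?T j \<and> (if x \<in> A then f x else g x) = ?f j x" if "x \<in> topspace ?X" for x
      using that by (cases "x \<in> A") (auto intro: exI[of _ True] exI[of _ False])
    show "closedin ?X (?T i)" for i using c by simp
    show "continuous_map (subtopology ?X (?T i)) euclidean (?f i)" for i using assms s by simp
    show "?f i x = ?f j x" if "x \<in> topspace ?X \<inter> ?T i \<inter> ?T j" for i j x
      using that assms(5) by (auto split: if_splits)
  qed simp
qed

text \<open>The extension problem is posed relative to arbitrary closed subsets of \<open>F\<close>. In this form solvability
  passes from the members of a finite closed cover to their union, one member at a time.\<close>

definition extends_over :: "'y topology \<Rightarrow> ('y \<Rightarrow> fmat set) \<Rightarrow> 'y set \<Rightarrow> bool" where
  "extends_over Y S F \<longleftrightarrow> closedin Y F \<and>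
     (\<forall>Z f. closedin Y Z \<and> Z \<subseteq> F \<and> continuous_map (subtopology Y Z) euclidean f \<and> (\<forall>z\<in>Z. f z \<in> S z) \<longrightarrow>
        (\<exists>g. continuous_map (subtopology Y F) euclidean g \<and> (\<forall>z\<in>Z. g z = f z) \<and> (\<forall>y\<in>F. g y \<in> S y)))"

lemma extends_overD:
  assumes "extends_over Y S F" "closedin Y Z" "Z \<subseteq> F" "continuous_map (subtopology Y Z) euclidean f" "\<forall>z\<in>Z. f z \<in> S z"
  shows "\<exists>g. continuous_map (subtopology Y F) euclidean g \<and> (\<forall>z\<in>Z. g z = f z) \<and> (\<forall>y\<in>F. g y \<in> S y)"
  using assms unfolding extends_over_def by simp

lemma glue_local_extensions:
  assumes Y: "compact_space Y" and Z: "closedin Y Z"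
    and f: "continuous_map (subtopology Y Z) euclidean f" "\<And>z. z \<in> Z \<Longrightarrow> f z \<in> S z"
    and local: "\<And>y. y \<in> topspace Y \<Longrightarrow> \<exists>U F. openin Y U \<and> y \<in> U \<and> U \<subseteq> F \<and> extends_over Y S F"
  obtains g where "continuous_map Y euclidean g" "\<And>z. z \<in> Z \<Longrightarrow> g z = f z" "\<And>y. y \<in> topspace Y \<Longrightarrow> g y \<in> S y"
proof -
  have "\<forall>y\<in>topspace Y. \<exists>U F. openin Y U \<and> y \<in> U \<and> U \<subseteq> F \<and> extends_over Y S F"
    using local by blast
  from bchoice[OF this] obtain U where "\<forall>y\<in>topspace Y. \<exists>F. openin Y (U y) \<and> y \<in> U y \<and> U y \<subseteq> F \<and> extends_over Y S F" ..
  from bchoice[OF this] obtain F where F: "\<forall>y\<in>topspace Y. openin Y (U y) \<and> y \<in> U y \<and> U y \<subseteq> F y \<and> extends_over Y S (F y)" ..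
  obtain K where K: "finite K" "K \<subseteq> topspace Y" "topspace Y \<subseteq> \<Union>(U ` K)"
    using F by (elim finite_point_subcover[OF Y, of U, rotated]) auto
  have "\<exists>g. closedin Y (Z \<union> \<Union>(F ` L)) \<and> continuous_map (subtopology Y (Z \<union> \<Union>(F ` L))) euclidean g
      \<and> (\<forall>z\<in>Z. g z = f z) \<and> (\<forall>y\<in>Z \<union> \<Union>(F ` L). g y \<in> S y)" if "finite L" "L \<subseteq> topspace Y" for L
    using that
  proof (induction L)
    case empty
    then show ?case using Z f by auto
  next
    case (insert k L)
    let ?W = "Z \<union> \<Union>(F ` L)"
    have "L \<subseteq> topspace Y" using insert.prems by simp
    from insert.IH[OF this]
    obtain g where g: "closedin Y ?W" "continuous_map (subtopology Y ?W) euclidean g" "\<forall>z\<in>Z. g z = f z" "\<forall>y\<in>?W. g y \<in> S y"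
      by (elim exE conjE)
    have k: "extends_over Y S (F k)" using F insert.prems by simp
    then have kc: "closedin Y (F k)" by (simp add: extends_over_def)
    have cl: "closedin Y (F k \<inter> ?W)" using kc g(1) by (rule closedin_Int)
    have gk: "continuous_map (subtopology Y (F k \<inter> ?W)) euclidean g"
      by (rule continuous_map_from_subtopology_mono[OF g(2)]) (rule Int_lower2)
    have gS: "\<forall>z\<in>F k \<inter> ?W. g z \<in> S z" using g(4) by simp
    from extends_overD[OF k cl Int_lower1 gk gS]
    obtain g' where g': "continuous_map (subtopology Y (F k)) euclidean g'" "\<forall>z\<in>F k \<inter> ?W. g' z = g z" "\<forall>y\<in>F k. g' y \<in> S y"
      by (elim exE conjE)
    let ?h = "\<lambda>y. if y \<in> ?W then g y else g' y"
    have 1: "continuous_map (subtopology Y (?W \<union> F k)) euclidean ?h"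
      by (rule continuous_map_paste[OF g(1) kc g(2) g'(1)]) (use g'(2) in simp)
    have eq: "Z \<union> \<Union>(F ` insert k L) = ?W \<union> F k" by auto
    have 2: "closedin Y (?W \<union> F k)" using g(1) kc by (rule closedin_Un)
    have 3: "\<forall>z\<in>Z. ?h z = f z" using g(3) by simp
    have 4: "\<forall>y\<in>?W \<union> F k. ?h y \<in> S y"
    proof
      fix y assume y: "y \<in> ?W \<union> F k"
      show "?h y \<in> S y"
      proof (cases "y \<in> ?W")
        case True
        then show ?thesis using g(4) by presburger
      next
        case False
        have "y \<in> F k"
          by (rule disjE[OF iffD1[OF Un_iff y]]) (rule notE[OF False], assumption, assumption)
        then show ?thesis using False g'(3) by presburger
      qed
    qed
    show ?case unfolding eq by (intro exI[of _ ?h] conjI 1 2 3 4)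
  qed
  from this[OF K(1,2)] obtain g where g: "closedin Y (Z \<union> \<Union>(F ` K))" "continuous_map (subtopology Y (Z \<union> \<Union>(F ` K))) euclidean g"
      "\<forall>z\<in>Z. g z = f z" "\<forall>y\<in>Z \<union> \<Union>(F ` K). g y \<in> S y" by (elim exE conjE)
  have "topspace Y \<subseteq> \<Union>(F ` K)" using K(2,3) F by blast
  then have "Z \<union> \<Union>(F ` K) = topspace Y" using closedin_subset[OF g(1)] by blast
  then show ?thesis using g by (intro that[of g]) auto
qed

definition proj_mat :: "fmat \<Rightarrow> bool" where "proj_mat e \<longleftrightarrow> e * e = e \<and> adj e = e"

text \<open>Vectors are matrices supported in the first column; \<open>E0\<close> is the projection onto the first
  coordinate, so that \<open>adj v * v = E0\<close> says that \<open>v\<close> is a unit vector.\<close>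

abbreviation E0 :: fmat where "E0 \<equiv> unit_mat 0 0 1"

lemma unit_vector_E0: "adj v * v = E0 \<Longrightarrow> v * E0 = v"
  by (rule partial_isometry_mult) auto

lemma E0_adj: "v * E0 = v \<Longrightarrow> E0 * adj v = adj v"
  by (metis adj_mult adj_unit_mat complex_cnj_one)

lemma mult_vectors: assumes "v * E0 = v" "w * E0 = w"
  shows "adj v * w = unit_mat 0 0 (ent (adj v * w) 0 0)"
proof (rule fmat_eqI)
  fix i j
  have "adj v * w = E0 * (adj v * w) * E0"
    using E0_adj[OF assms(1)] assms(2) by (simp add: mult.assoc[symmetric]) (simp add: mult.assoc)
  also have "\<dots> = unit_mat 0 0 (ent (adj v * w) 0 0)"
  proof (rule fmat_eqI)
    fix i j
    have "E0 * a = adj (adj a * E0)" for a by simp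
    then show "ent (E0 * (adj v * w) * E0) i j = ent (unit_mat 0 0 (ent (adj v * w) 0 0)) i j"
      by (simp only: mult_unit_mat_ent ent_adj ent_unit_mat) simp
  qed
  finally show "ent (adj v * w) i j = ent (unit_mat 0 0 (ent (adj v * w) 0 0)) i j" by (rule arg_cong)
qed

lemma inner_E0: "inner E0 (unit_mat 0 0 z) = Re z"
  using inner_fmat[OF bnd_unit_mat[of 0 1 0], of 1 "unit_mat 0 0 z"] by (simp add: inner_complex_def)

lemma adj_mult_vector: assumes "v * E0 = v" shows "adj v * v = (norm v)\<^sup>2 *\<^sub>R E0"
proof -
  define z where "z = ent (adj v * v) 0 0"
  have v: "adj v * v = unit_mat 0 0 z" using mult_vectors[OF assms assms] by (simp add: z_def)
  have "adj (unit_mat 0 0 z) = unit_mat 0 0 z" unfolding v[symmetric] by simp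
  then have "z = cnj z" by (metis adj_unit_mat ent_unit_mat)
  then have "Im z = 0" by (simp add: complex_eq_iff)
  moreover have "Re z = (norm v)\<^sup>2"
  proof -
    have "inner v v = inner (v * E0) v" using assms by simp
    also have "\<dots> = Re z" by (simp add: inner_mult_left v inner_E0)
    finally show ?thesis by (simp add: power2_norm_eq_inner)
  qed
  ultimately have "z = complex_of_real ((norm v)\<^sup>2)" by (simp add: complex_eq_iff)
  then show ?thesis unfolding v by (intro fmat_eqI) (simp add: scaleR_conv_of_real)
qed

lemma norm_unit_vector: assumes "adj v * v = E0" shows "norm v = 1"
proof -
  have "(norm v)\<^sup>2 *\<^sub>R E0 = E0" using adj_mult_vector[OF unit_vector_E0[OF assms]] assms by simp
  from arg_cong[OF this, of "\<lambda>a. Re (ent a 0 0)"] have "(norm v)\<^sup>2 = 1" by simp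
  then show ?thesis by (simp add: power2_eq_1_iff) (use norm_ge_zero[of v] in linarith)
qed

lemma normalize_vector:
  assumes "v * E0 = v" "v \<noteq> 0"
  shows "adj ((1 / norm v) *\<^sub>R v) * ((1 / norm v) *\<^sub>R v) = E0"
  using assms by (simp add: adj_mult_vector power2_eq_square)

text \<open>The square of the Frobenius norm of a projection is its rank. Splitting off a unit vector
  lowers it by one.\<close>

lemma proj_split_vector:
  assumes e: "proj_mat e" and h: "adj h * h = E0" "e * h = h"
  shows "proj_mat (e - h * adj h)" "(norm (e - h * adj h))\<^sup>2 = (norm e)\<^sup>2 - 1" "1 \<le> (norm e)\<^sup>2"
proof -
  have hE: "h * E0 = h" by (rule unit_vector_E0[OF h(1)])
  have he: "adj h * e = adj h" using arg_cong[OF h(2), of adj] e by (simp add: proj_mat_def)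
  have hh: "h * adj h * (h * adj h) = h * adj h"
  proof -
    have "h * adj h * (h * adj h) = h * (adj h * h) * adj h" by (simp only: mult.assoc)
    then show ?thesis by (simp add: h(1) hE)
  qed
  have eh: "e * (h * adj h) = h * adj h" "h * adj h * e = h * adj h"
    using h(2) he by (simp_all add: mult.assoc[symmetric]) (simp add: mult.assoc)
  show p: "proj_mat (e - h * adj h)"
    using e hh eh unfolding proj_mat_def by (simp add: left_diff_distrib right_diff_distrib)
  have 1: "inner h h = 1" using norm_unit_vector[OF h(1)] by (simp add: norm_eq_sqrt_inner)
  have "inner (h * adj h) e = inner h (e * h)" by (simp add: inner_mult_right)
  then have ie: "inner (h * adj h) e = 1" using h(2) 1 by simp
  have "inner (h * adj h) (h * adj h) = inner h (h * (adj h * h))"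
    by (simp add: inner_mult_right mult.assoc)
  then have "inner (h * adj h) (h * adj h) = 1" using h(1) hE 1 by simp
  then show n: "(norm (e - h * adj h))\<^sup>2 = (norm e)\<^sup>2 - 1"
    using ie by (simp add: power2_norm_eq_inner inner_diff_left inner_diff_right inner_commute)
  show "1 \<le> (norm e)\<^sup>2" using n zero_le_power2[of "norm (e - h * adj h)"] by linarith
qed

lemma bnd_left: "bnd N q \<Longrightarrow> N \<le> i \<Longrightarrow> ent (q * a) i j = 0"
  by (subst ent_mult[of N]) (auto simp: bnd_ent)

lemma bnd_compress: assumes "bnd N q" shows "bnd N (q * a * q)"
proof -
  have "ent (q * a * q) i j = 0" if "N \<le> j" for i j
    using assms that by (subst ent_mult'[of N]) (auto simp: bnd_ent)
  then show ?thesis using bnd_left[OF assms, of _ "a * q"] by (auto simp: bnd_def mult.assoc)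
qed

lemma bnd_vector: assumes "bnd N q" "q * v = v" "v * E0 = v" shows "bnd (Suc N) v"
  unfolding bnd_def
proof (intro allI impI)
  fix i j assume "Suc N \<le> i \<or> Suc N \<le> j"
  then show "ent v i j = 0"
  proof
    assume "Suc N \<le> i"
    then show ?thesis using bnd_left[OF assms(1), of i v j] assms(2) by simp
  next
    assume "Suc N \<le> j"
    then show ?thesis using mult_unit_mat_ent[of v 0 0 1 i j] assms(3) by simp
  qed
qed

lemma proj_vector_exists:
  assumes "bnd N e" "e \<noteq> 0" obtains i where "i < N" "e * unit_mat i 0 1 \<noteq> 0"
proof -
  have "\<exists>k i. ent e k i \<noteq> 0" using assms(2) by (metis ent_0 fmat_eqI)
  then obtain k i where ki: "ent e k i \<noteq> 0" by blast
  then have "i < N" using bnd_ent[OF assms(1)] by (meson not_le)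
  moreover have "ent (e * unit_mat i 0 1) k 0 \<noteq> 0" using ki by (simp add: mult_unit_mat_ent)
  ultimately show ?thesis using that by force
qed

text \<open>Near \<open>y0\<close>, a projection of rank at least \<open>m\<close> has \<open>m\<close> orthonormal sections. They are found one by
  one: a section \<open>q v\<close> that is nonzero at \<open>y0\<close> is normalized and split off from \<open>q\<close>.\<close>

lemma local_frame:
  assumes Y: "compact_space Y" "Hausdorff_space Y"
    and q: "continuous_map Y euclidean q" "\<And>y. y \<in> topspace Y \<Longrightarrow> bnd N (q y) \<and> proj_mat (q y)"
    and y0: "y0 \<in> topspace Y" and rk: "real m - 1 < (norm (q y0))\<^sup>2"
  shows "\<exists>U F g. openin Y U \<and> y0 \<in> U \<and> U \<subseteq> F \<and> closedin Y F \<and>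
    (\<forall>j<m. continuous_map (subtopology Y F) euclidean (g j)) \<and>
    (\<forall>y\<in>F. \<forall>j<m. q y * g j y = g j y \<and> (\<forall>k<m. adj (g j y) * g k y = (if j = k then E0 else 0)))"
  using Y q y0 rk
proof (induction m arbitrary: Y q)
  case 0
  show ?case
    by (rule exI[of _ "topspace Y"], rule exI[of _ "topspace Y"]) (use 0 in auto)
next
  case (Suc m)
  note Y = Suc.prems(1,2) and q = Suc.prems(3,4) and y0 = Suc.prems(5)
  have "q y0 \<noteq> 0" using Suc.prems(6) by auto
  then obtain i where i: "q y0 * unit_mat i 0 1 \<noteq> 0"
    using proj_vector_exists q(2)[OF y0] by metis
  define f where "f y = q y * unit_mat i 0 1" for y
  have fc: "continuous_map Y euclidean f" unfolding f_def by (intro continuous_map_fmat_mult q(1)) simp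
  have "openin Y {y \<in> topspace Y. norm (f y) \<in> {0<..}}"
    by (rule openin_continuous_map_preimage[of Y euclidean]) (intro continuous_map_norm fc, simp)
  moreover have "y0 \<in> {y \<in> topspace Y. norm (f y) \<in> {0<..}}" using y0 i by (simp add: f_def)
  ultimately obtain U1 F1 where U1: "openin Y U1" "y0 \<in> U1" "U1 \<subseteq> F1" "closedin Y F1" "F1 \<subseteq> {y \<in> topspace Y. norm (f y) \<in> {0<..}}"
    by (rule closed_neighbourhood[OF Y])
  have F1Y: "F1 \<subseteq> topspace Y" using U1 by blast
  define h where "h y = (1 / norm (f y)) *\<^sub>R f y" for y
  let ?X = "subtopology Y F1"
  have tX: "topspace ?X = F1" using F1Y by auto
  have hc: "continuous_map ?X euclidean h"
    unfolding h_def
    by (intro continuous_map_fmat_scaleR continuous_map_real_divide continuous_map_norm continuous_map_from_subtopology fc)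
      (use U1(5) in auto)
  have hh: "adj (h y) * h y = E0" "q y * h y = h y" if "y \<in> F1" for y
  proof -
    have "f y \<noteq> 0" "f y * E0 = f y" using that U1(5) by (auto simp: f_def mult.assoc)
    then show "adj (h y) * h y = E0" unfolding h_def by (intro normalize_vector)
    show "q y * h y = h y" using q(2)[of y] that F1Y
      by (auto simp: h_def f_def proj_mat_def mult.assoc[symmetric])
  qed
  have pq: "proj_mat (q y)" "bnd N (q y)" if "y \<in> F1" for y using q(2) that F1Y by auto
  have X: "compact_space ?X" "Hausdorff_space ?X"
    using Y U1(4) closedin_compact_space compact_space_subtopology by (auto simp: Hausdorff_space_subtopology)
  define q' where "q' y = q y - h y * adj (h y)" for y
  have q'c: "continuous_map ?X euclidean q'"
    unfolding q'_def
    by (intro continuous_map_diff continuous_map_fmat_mult continuous_map_adj hc continuous_map_from_subtopology q(1))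
  have bh: "bnd N (h y * adj (h y))" if y: "y \<in> F1" for y
  proof -
    have "h y * adj (h y) = q y * (h y * adj (h y)) * q y"
    proof -
      have "adj (h y) * q y = adj (h y)" using arg_cong[OF hh(2)[OF y], of adj] pq[OF y] by (simp add: proj_mat_def)
      then show ?thesis using hh(2)[OF y] by (simp add: mult.assoc) (simp add: mult.assoc[symmetric])
    qed
    also have "bnd N \<dots>" using bnd_compress[OF pq(2)[OF y]] .
    finally show ?thesis .
  qed
  have q'p: "bnd N (q' y) \<and> proj_mat (q' y)" if "y \<in> topspace ?X" for y
    using that bh pq proj_split_vector(1)[OF pq(1) hh] F1Y by (auto simp: q'_def)
  have y0F: "y0 \<in> F1" using U1 by blast
  have "real m - 1 < (norm (q' y0))\<^sup>2"
    using Suc.prems(6) proj_split_vector(2)[OF pq(1)[OF y0F] hh[OF y0F]] by (simp add: q'_def)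
  moreover have "y0 \<in> topspace ?X" using y0F tX by simp
  ultimately have "\<exists>U F g. openin ?X U \<and> y0 \<in> U \<and> U \<subseteq> F \<and> closedin ?X F \<and>
    (\<forall>j<m. continuous_map (subtopology ?X F) euclidean (g j)) \<and>
    (\<forall>y\<in>F. \<forall>j<m. q' y * g j y = g j y \<and> (\<forall>k<m. adj (g j y) * g k y = (if j = k then E0 else 0)))"
    using Suc.IH[OF X q'c q'p] by blast
  then obtain U F g where IH: "openin ?X U" "y0 \<in> U" "U \<subseteq> F" "closedin ?X F"
    "\<forall>j<m. continuous_map (subtopology ?X F) euclidean (g j)"
    "\<forall>y\<in>F. \<forall>j<m. q' y * g j y = g j y \<and> (\<forall>k<m. adj (g j y) * g k y = (if j = k then E0 else 0))"
    by (elim exE conjE)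
  have FF1: "F \<subseteq> F1" using closedin_subset[OF IH(4)] tX by simp
  have cF: "closedin Y F" using IH(4) U1(4) closedin_trans_full by blast
  have sX: "subtopology ?X F = subtopology Y F" using FF1 by (simp add: subtopology_subtopology Int_absorb1)
  define g' where "g' j = (if j = m then h else g j)" for j
  have orth: "q y * g j y = g j y" "adj (h y) * g j y = 0" "adj (g j y) * h y = 0" if "y \<in> F" "j < m" for y j
  proof -
    have y: "y \<in> F1" using that FF1 by blast
    have gq: "q' y * g j y = g j y" using IH(6) that by blast
    have hq: "adj (h y) * q' y = 0"
    proof -
      have "adj (h y) * q y = adj (h y)" using arg_cong[OF hh(2)[OF y], of adj] pq[OF y] by (simp add: proj_mat_def)
      moreover have "adj (h y) * (h y * adj (h y)) = adj (h y)"
        using hh(1)[OF y] E0_adj[OF unit_vector_E0[OF hh(1)[OF y]]] by (simp add: mult.assoc[symmetric])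
      ultimately show ?thesis by (simp add: q'_def right_diff_distrib)
    qed
    have "adj (h y) * (q' y * g j y) = 0" using hq by (simp add: mult.assoc[symmetric])
    then show o: "adj (h y) * g j y = 0" by (simp add: gq)
    show "adj (g j y) * h y = 0" using arg_cong[OF o, of adj] by simp
    have "q y * q' y = q' y"
      using pq(1)[OF y] hh(2)[OF y] by (simp add: q'_def right_diff_distrib proj_mat_def mult.assoc[symmetric])
    then show "q y * g j y = g j y" using gq by (metis mult.assoc)
  qed
  show ?case
  proof (intro exI conjI)
    obtain T where T: "openin Y T" "U = T \<inter> F1" using IH(1) unfolding openin_subtopology by blast
    have "U \<inter> U1 = T \<inter> U1" using T(2) U1(3) by blast
    then show "openin Y (U \<inter> U1)" using T(1) U1(1) by (simp add: openin_Int)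
    show "y0 \<in> U \<inter> U1" using IH(2) U1(2) by blast
    show "U \<inter> U1 \<subseteq> F" using IH(3) by blast
    show "closedin Y F" by (rule cF)
    show "\<forall>j<Suc m. continuous_map (subtopology Y F) euclidean (g' j)"
      using IH(5) sX continuous_map_from_subtopology_mono[OF hc FF1] by (simp add: g'_def less_Suc_eq)
    show "\<forall>y\<in>F. \<forall>j<Suc m. q y * g' j y = g' j y \<and> (\<forall>k<Suc m. adj (g' j y) * g' k y = (if j = k then E0 else 0))"
    proof (intro ballI allI impI conjI)
      fix y j assume y: "y \<in> F" and j: "j < Suc m"
      show "q y * g' j y = g' j y" using orth(1)[OF y] hh(2) y FF1 j by (auto simp: g'_def less_Suc_eq)
      fix k assume k: "k < Suc m"
      show "adj (g' j y) * g' k y = (if j = k then E0 else 0)"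
        using orth(2,3)[OF y] IH(6) hh(1)[of y] y FF1 j k by (auto simp: g'_def less_Suc_eq)
    qed
  qed
qed

lemma Tietze_interval:
  fixes f :: "'y \<Rightarrow> real"
  assumes "normal_space Y" "closedin Y Z" "continuous_map (subtopology Y Z) euclideanreal f"
    "\<And>z. z \<in> Z \<Longrightarrow> \<bar>f z\<bar> \<le> \<epsilon>" "0 \<le> \<epsilon>"
  obtains g where "continuous_map Y euclideanreal g" "\<And>y. y \<in> topspace Y \<Longrightarrow> \<bar>g y\<bar> \<le> \<epsilon>" "\<And>z. z \<in> Z \<Longrightarrow> g z = f z"
proof -
  have i: "is_interval {- \<epsilon>..\<epsilon>}" "{- \<epsilon>..\<epsilon>} \<noteq> {}" using assms(5) by (auto simp: is_interval_cc)
  have "f ` Z \<subseteq> {- \<epsilon>..\<epsilon>}" using assms(4) by (auto simp: abs_le_iff) (metis minus_le_iff)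
  from Tietze_extension_realinterval[OF assms(1,2) i assms(3) this]
  obtain g where g: "continuous_map Y euclideanreal g" "g ` topspace Y \<subseteq> {- \<epsilon>..\<epsilon>}" "\<And>z. z \<in> Z \<Longrightarrow> g z = f z" by metis
  have "\<bar>g y\<bar> \<le> \<epsilon>" if "y \<in> topspace Y" for y
  proof -
    have "g y \<in> {- \<epsilon>..\<epsilon>}" using g(2) that by blast
    then show ?thesis by (simp add: abs_le_iff)
  qed
  then show ?thesis using g that by blast
qed

text \<open>On a set where \<open>q\<close> has \<open>m\<close> orthonormal sections, a section extending \<open>\<xi>\<close> may vanish somewhere
  away from \<open>Z\<close>; there its \<open>m\<close> complex coordinates with respect to the frame are \<open>2m\<close> real functions,
  and in dimension less than \<open>2m\<close> they can be perturbed so as to have no common zero.\<close>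

lemma extend_unit_vector_in_frame:
  assumes F: "compact_space F" "Hausdorff_space F" and dim: "covering_dim_le F (2 * m - 1)" and m: "0 < m"
    and q: "continuous_map F euclidean q" "\<And>y. y \<in> topspace F \<Longrightarrow> bnd N (q y) \<and> proj_mat (q y)"
    and g: "\<And>j. j < m \<Longrightarrow> continuous_map F euclidean (g j)"
      "\<And>y j. y \<in> topspace F \<Longrightarrow> j < m \<Longrightarrow> q y * g j y = g j y"
      "\<And>y j k. y \<in> topspace F \<Longrightarrow> j < m \<Longrightarrow> k < m \<Longrightarrow> adj (g j y) * g k y = (if j = k then E0 else 0)"
    and Z: "closedin F Z" and \<xi>: "continuous_map (subtopology F Z) euclidean \<xi>"
      "\<And>z. z \<in> Z \<Longrightarrow> adj (\<xi> z) * \<xi> z = E0 \<and> q z * \<xi> z = \<xi> z"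
  obtains \<eta> where "continuous_map F euclidean \<eta>" "\<And>z. z \<in> Z \<Longrightarrow> \<eta> z = \<xi> z"
    "\<And>y. y \<in> topspace F \<Longrightarrow> adj (\<eta> y) * \<eta> y = E0 \<and> q y * \<eta> y = \<eta> y"
proof -
  have nF: "normal_space F" using F compact_Hausdorff_or_regular_imp_normal_space by blast
  have ZF: "Z \<subseteq> topspace F" using Z closedin_subset by blast
  have b\<xi>: "bnd (Suc N) (\<xi> z)" if z: "z \<in> Z" for z
  proof (rule bnd_vector)
    show "bnd N (q z)" using q(2) z ZF by blast
    show "q z * \<xi> z = \<xi> z" using \<xi>(2)[OF z] by blast
    show "\<xi> z * E0 = \<xi> z" using \<xi>(2)[OF z] unit_vector_E0 by blast
  qed
  obtain a0 where a0: "continuous_map F euclidean a0" "\<And>z. z \<in> Z \<Longrightarrow> a0 z = \<xi> z"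
    by (rule Tietze_fmat[OF nF Z \<xi>(1) b\<xi>], assumption) (rule that)
  define a where "a y = q y * a0 y * E0" for y
  have ac: "continuous_map F euclidean a"
    unfolding a_def by (intro continuous_map_fmat_mult q(1) a0(1)) simp
  have aZ: "a z = \<xi> z" if "z \<in> Z" for z
    using \<xi>(2)[OF that] unit_vector_E0[of "\<xi> z"] by (simp add: a_def a0(2)[OF that])
  have aq: "q y * a y = a y" if "y \<in> topspace F" for y
    using q(2)[OF that] by (simp add: a_def proj_mat_def mult.assoc[symmetric])
  have aE: "a y * E0 = a y" for y by (simp add: a_def mult.assoc)
  have gE: "g j y * E0 = g j y" if "y \<in> topspace F" "j < m" for y j
    using g(3)[OF that(1,2,2)] by (intro unit_vector_E0) simp
  \<comment> \<open>zeros have to be avoided only on \<open>K\<close>; elsewhere \<open>|a| >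
      1/2\<close> exceeds the size of the perturbation\<close>
  define K where "K = {y \<in> topspace F. norm (a y) \<in> {..1/2}}"
  have cK: "closedin F K" unfolding K_def
    by (rule closedin_continuous_map_preimage[of F euclidean]) (intro continuous_map_norm ac, simp)
  have KF: "K \<subseteq> topspace F" by (auto simp: K_def)
  have dKZ: "disjnt Z K"
    using norm_unit_vector \<xi>(2) aZ by (auto simp: disjnt_iff K_def)
  let ?K = "subtopology F K"
  have tK: "topspace ?K = K" using KF by auto
  have K: "compact_space ?K" "Hausdorff_space ?K"
    using F cK closedin_compact_space compact_space_subtopology by (auto simp: Hausdorff_space_subtopology)
  define z where "z j y = ent (adj (g j y) * a y) 0 0" for j y
  define \<alpha> where "\<alpha> i y = (if even i then Re (z (i div 2) y) else Im (z (i div 2) y))" for i y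
  have \<alpha>c: "continuous_map F euclideanreal (\<alpha> i)" if "i \<le> 2 * m - 1" for i
  proof -
    have "i div 2 < m" using that m by linarith
    then have c: "continuous_map F euclidean (z (i div 2))"
      unfolding z_def by (intro continuous_map_ent continuous_map_fmat_mult continuous_map_adj g(1) ac)
    have "continuous_map F euclideanreal (\<lambda>y. Re (z (i div 2) y))" "continuous_map F euclideanreal (\<lambda>y. Im (z (i div 2) y))"
      by (rule continuous_map_fmat_compose[OF c]; simp add: continuous_on_Re continuous_on_Im)+
    then show ?thesis unfolding \<alpha>_def by (cases "even i") simp_all
  qed
  \<comment> \<open>\<open>2m\<close> real coordinates, each moved by at most \<open>\<epsilon>\<close>,
      change the section by at most \<open>2 m \<epsilon> = 1/4\<close>\<close>
  define \<epsilon> where "\<epsilon> = 1 / (8 * real m)"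
  have \<epsilon>: "0 < \<epsilon>" using m by (simp add: \<epsilon>_def)
  obtain \<beta> where \<beta>: "\<And>i. i \<le> 2 * m - 1 \<Longrightarrow> continuous_map ?K euclideanreal (\<beta> i)"
    "\<And>i y. i \<le> 2 * m - 1 \<Longrightarrow> y \<in> K \<Longrightarrow> \<bar>\<beta> i y - \<alpha> i y\<bar> < \<epsilon>"
    "\<And>y. y \<in> K \<Longrightarrow> \<exists>i\<le>2 * m - 1. \<beta> i y \<noteq> 0"
    by (rule perturb_to_nonvanishing[OF K covering_dim_le_closed[OF dim cK] continuous_map_from_subtopology[OF \<alpha>c] \<epsilon>, unfolded tK], assumption)
      (rule that)
  obtain \<theta> where \<theta>: "continuous_map F (top_of_set {0..1}) \<theta>" "\<theta> ` Z \<subseteq> {0}" "\<theta> ` K \<subseteq> {1::real}"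
    using Urysohn_lemma[OF nF Z cK dKZ, of 0 1] by auto
  have \<theta>c: "continuous_map F euclideanreal \<theta>" using \<theta>(1) continuous_map_into_fulltopology by blast
  have \<theta>01: "\<bar>\<theta> y\<bar> \<le> 1" if "y \<in> topspace F" for y
    using \<theta>(1) that by (force simp: continuous_map_in_subtopology)
  have "\<exists>d. continuous_map F euclideanreal d \<and> (\<forall>y\<in>topspace F. \<bar>d y\<bar> \<le> \<epsilon>) \<and> (\<forall>z\<in>Z. d z = 0) \<and> (\<forall>y\<in>K. d y = \<beta> i y - \<alpha> i y)"
    if i: "i \<le> 2 * m - 1" for i
  proof -
    have b: "\<bar>\<beta> i y - \<alpha> i y\<bar> \<le> \<epsilon>" if "y \<in> K" for y
      by (rule less_imp_le[OF \<beta>(2)[OF i that]])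
    have c: "continuous_map ?K euclideanreal (\<lambda>y. \<beta> i y - \<alpha> i y)"
      by (intro continuous_map_diff \<beta>(1) i continuous_map_from_subtopology \<alpha>c)
    obtain d where d: "continuous_map F euclideanreal d" "\<And>y. y \<in> topspace F \<Longrightarrow> \<bar>d y\<bar> \<le> \<epsilon>" "\<And>y. y \<in> K \<Longrightarrow> d y = \<beta> i y - \<alpha> i y"
      by (rule Tietze_interval[OF nF cK c b less_imp_le[OF \<epsilon>]], assumption) (rule that)
    show ?thesis
    proof (intro exI conjI ballI)
      show "continuous_map F euclideanreal (\<lambda>y. \<theta> y * d y)" by (intro continuous_map_real_mult \<theta>c d(1))
      show "\<bar>\<theta> y * d y\<bar> \<le> \<epsilon>" if "y \<in> topspace F" for y
        using mult_mono[OF \<theta>01[OF that] d(2)[OF that]] by (simp add: abs_mult)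
      show "\<theta> z * d z = 0" if "z \<in> Z" for z using \<theta>(2) that by auto
      show "\<theta> y * d y = \<beta> i y - \<alpha> i y" if "y \<in> K" for y
      proof -
        have "\<theta> y = 1" using \<theta>(3) that by blast
        then show ?thesis using d(3)[OF that] by simp
      qed
    qed
  qed
  then have "\<forall>i\<in>{..2 * m - 1}. \<exists>d. continuous_map F euclideanreal d \<and> (\<forall>y\<in>topspace F. \<bar>d y\<bar> \<le> \<epsilon>) \<and> (\<forall>z\<in>Z. d z = 0) \<and> (\<forall>y\<in>K. d y = \<beta> i y - \<alpha> i y)"
    by simp
  from bchoice[OF this] obtain d where d0: "\<forall>i\<in>{..2 * m - 1}. continuous_map F euclideanreal (d i) \<and> (\<forall>y\<in>topspace F. \<bar>d i y\<bar> \<le> \<epsilon>) \<and> (\<forall>z\<in>Z. d i z = 0) \<and> (\<forall>y\<in>K. d i y = \<beta> i y - \<alpha> i y)" ..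
  have d: "continuous_map F euclideanreal (d i)" "\<forall>y\<in>topspace F. \<bar>d i y\<bar> \<le> \<epsilon>" "\<forall>z\<in>Z. d i z = 0" "\<forall>y\<in>K. d i y = \<beta> i y - \<alpha> i y"
    if "i \<le> 2 * m - 1" for i using d0 that by simp_all
  have le: "2 * j \<le> 2 * m - 1" "2 * j + 1 \<le> 2 * m - 1" if "j < m" for j using that by simp_all
  define c where "c j y = Complex (d (2 * j) y) (d (2 * j + 1) y)" for j y
  define p where "p y = (\<Sum>j<m. g j y * unit_mat 0 0 (c j y))" for y
  define b where "b y = a y + p y" for y
  have cc: "continuous_map F euclidean (c j)" if "j < m" for j
  proof -
    have "c j = (\<lambda>y. d (2 * j) y *\<^sub>R 1 + d (2 * j + 1) y *\<^sub>R \<i>)"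
      by (rule ext) (simp add: c_def complex_eq_iff)
    then show ?thesis
      by (simp only:) (intro continuous_map_add continuous_map_bilinear[OF bounded_bilinear_scaleR] d(1) le that; simp)
  qed
  have pc: "continuous_map F euclidean p"
    unfolding p_def by (intro continuous_map_sum continuous_map_fmat_mult continuous_map_unit_mat g(1) cc) auto
  have bc: "continuous_map F euclidean b" unfolding b_def by (intro continuous_map_add ac pc)
  have bq: "q y * b y = b y" "b y * E0 = b y" if y: "y \<in> topspace F" for y
  proof -
    have "q y * p y = p y" unfolding p_def sum_distrib_left
      by (rule sum.cong) (use g(2)[OF y] in \<open>auto simp: mult.assoc[symmetric]\<close>)
    then show "q y * b y = b y" using aq[OF y] by (simp add: b_def distrib_left)
    have "p y * E0 = p y" unfolding p_def sum_distrib_right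
      by (rule sum.cong) (auto simp: mult.assoc)
    then show "b y * E0 = b y" using aE by (simp add: b_def distrib_right)
  qed
  have bZ: "b z = \<xi> z" if z: "z \<in> Z" for z
  proof -
    have "c j z = 0" if "j < m" for j using d(3)[OF le(1)[OF that]] d(3)[OF le(2)[OF that]] z
      by (simp add: c_def complex_eq_iff)
    then have "p z = 0" unfolding p_def by (intro sum.neutral) auto
    then show ?thesis using aZ[OF z] by (simp add: b_def)
  qed
  have b0: "b y \<noteq> 0" if y: "y \<in> topspace F" for y
  proof (cases "y \<in> K")
    case True
    obtain i where i: "i \<le> 2 * m - 1" "\<beta> i y \<noteq> 0" using \<beta>(3)[OF True] by blast
    define j where "j = i div 2"
    have j: "j < m" using i m by (simp add: j_def)
    have "adj (g j y) * b y = adj (g j y) * a y + (\<Sum>k<m. adj (g j y) * g k y * unit_mat 0 0 (c k y))"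
      by (simp add: b_def p_def distrib_left sum_distrib_left mult.assoc)
    also have "(\<Sum>k<m. adj (g j y) * g k y * unit_mat 0 0 (c k y)) = (\<Sum>k<m. if k = j then unit_mat 0 0 (c k y) else 0)"
      by (rule sum.cong) (use g(3)[OF y j] in auto)
    also have "\<dots> = unit_mat 0 0 (c j y)" using j by simp
    finally have e: "ent (adj (g j y) * b y) 0 0 = z j y + c j y" by (simp add: z_def)
    have "\<beta> i y = \<alpha> i y + d i y" using d(4)[OF i(1)] True by simp
    also have "\<dots> = (if even i then Re (z j y + c j y) else Im (z j y + c j y))"
    proof (cases "even i")
      case True
      then have "2 * j = i" by (simp add: j_def)
      then show ?thesis using True by (simp add: \<alpha>_def c_def j_def[symmetric])
    next
      case False
      then have "2 * j + 1 = i" by (simp add: j_def)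
      then show ?thesis using False by (simp add: \<alpha>_def c_def j_def[symmetric])
    qed
    finally have "z j y + c j y \<noteq> 0" using i(2) by (metis zero_complex.simps)
    then show ?thesis using e by auto
  next
    case False
    then have "1/2 < norm (a y)" using y by (simp add: K_def not_le)
    moreover have "norm (p y) \<le> 1/4"
    proof -
      have "norm (p y) \<le> (\<Sum>j<m. norm (g j y * unit_mat 0 0 (c j y)))" unfolding p_def by (rule norm_sum)
      also have "\<dots> \<le> (\<Sum>j<m. 2 * \<epsilon>)"
      proof (rule sum_mono)
        fix j assume "j \<in> {..<m}"
        then have j: "j < m" by simp
        have "norm (g j y * unit_mat 0 0 (c j y)) \<le> norm (g j y) * norm (unit_mat 0 0 (c j y))" by (rule norm_mult_ineq)
        also have "\<dots> = cmod (c j y)" using norm_unit_vector[of "g j y"] g(3)[OF y j j] by simp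
        also have "\<dots> \<le> \<bar>Re (c j y)\<bar> + \<bar>Im (c j y)\<bar>" by (rule cmod_le)
        also have "\<dots> \<le> \<epsilon> + \<epsilon>" using d(2)[OF le(1)[OF j]] d(2)[OF le(2)[OF j]] y
          by (intro add_mono) (simp_all add: c_def)
        finally show "norm (g j y * unit_mat 0 0 (c j y)) \<le> 2 * \<epsilon>" by simp
      qed
      also have "\<dots> = 1/4" using m by (simp add: \<epsilon>_def)
      finally show ?thesis .
    qed
    ultimately show ?thesis using norm_minus_cancel[of "p y"] by (auto simp: b_def add_eq_0_iff2)
  qed
  show ?thesis
  proof (rule that[of "\<lambda>y. (1 / norm (b y)) *\<^sub>R b y"])
    show "continuous_map F euclidean (\<lambda>y. (1 / norm (b y)) *\<^sub>R b y)"
      by (intro continuous_map_fmat_scaleR continuous_map_real_divide continuous_map_norm bc) (use b0 in auto)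
    show "(1 / norm (b z)) *\<^sub>R b z = \<xi> z" if "z \<in> Z" for z
      using norm_unit_vector[of "\<xi> z"] \<xi>(2)[OF that] by (simp add: bZ[OF that])
  next
    fix y
    show "adj ((1 / norm (b y)) *\<^sub>R b y) * ((1 / norm (b y)) *\<^sub>R b y) = E0 \<and> q y * ((1 / norm (b y)) *\<^sub>R b y) = (1 / norm (b y)) *\<^sub>R b y"
      if "y \<in> topspace F"
      using normalize_vector[OF bq(2) b0] bq(1) that by simp
  qed
qed

text \<open>Local frames exist near every point, so the problem can be solved locally.\<close>

lemma extend_unit_vector:
  assumes Y: "compact_space Y" "Hausdorff_space Y" and dim: "covering_dim_le Y (2 * m - 1)" and m: "0 < m"
    and q: "continuous_map Y euclidean q" "\<And>y. y \<in> topspace Y \<Longrightarrow> bnd N (q y) \<and> proj_mat (q y)"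
    and rk: "\<And>y. y \<in> topspace Y \<Longrightarrow> real m - 1 < (norm (q y))\<^sup>2"
    and Z: "closedin Y Z" and \<xi>: "continuous_map (subtopology Y Z) euclidean \<xi>"
      "\<And>z. z \<in> Z \<Longrightarrow> adj (\<xi> z) * \<xi> z = E0 \<and> q z * \<xi> z = \<xi> z"
  obtains \<eta> where "continuous_map Y euclidean \<eta>" "\<And>z. z \<in> Z \<Longrightarrow> \<eta> z = \<xi> z"
    "\<And>y. y \<in> topspace Y \<Longrightarrow> adj (\<eta> y) * \<eta> y = E0 \<and> q y * \<eta> y = \<eta> y"
proof -
  define S where "S y = {v. adj v * v = E0 \<and> q y * v = v}" for y
  have \<xi>S: "\<xi> z \<in> S z" if "z \<in> Z" for z using \<xi>(2)[OF that] by (simp add: S_def)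
  have loc: "\<exists>U F. openin Y U \<and> y \<in> U \<and> U \<subseteq> F \<and> extends_over Y S F" if y: "y \<in> topspace Y" for y
  proof -
    obtain U F g where UF: "openin Y U" "y \<in> U" "U \<subseteq> F" "closedin Y F"
      "\<forall>j<m. continuous_map (subtopology Y F) euclidean (g j)"
      "\<forall>y\<in>F. \<forall>j<m. q y * g j y = g j y \<and> (\<forall>k<m. adj (g j y) * g k y = (if j = k then E0 else 0))"
      by (rule exE[OF local_frame[OF Y q y rk[OF y]]], assumption, elim exE conjE) (rule that)
    have FY: "F \<subseteq> topspace Y" using UF(4) closedin_subset by blast
    let ?X = "subtopology Y F"
    have tX: "topspace ?X = F" using FY by auto
    have X: "compact_space ?X" "Hausdorff_space ?X"
      using Y UF(4) closedin_compact_space compact_space_subtopology by (auto simp: Hausdorff_space_subtopology)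
    have qX: "bnd N (q x) \<and> proj_mat (q x)" if "x \<in> topspace ?X" for x using q(2) that by simp
    have gc: "continuous_map ?X euclidean (g j)" if "j < m" for j using UF(5) that by blast
    have gq: "q x * g j x = g j x" if "x \<in> topspace ?X" "j < m" for x j using UF(6) that tX by blast
    have go: "adj (g j x) * g k x = (if j = k then E0 else 0)" if "x \<in> topspace ?X" "j < m" "k < m" for x j k
      using UF(6) that tX by blast
    have "extends_over Y S F"
      unfolding extends_over_def
    proof (intro conjI allI impI)
      fix Z' f assume A: "closedin Y Z' \<and> Z' \<subseteq> F \<and> continuous_map (subtopology Y Z') euclidean f \<and> (\<forall>z\<in>Z'. f z \<in> S z)"
      have cZ: "closedin ?X Z'" using A by (simp add: closedin_subset_topspace)
      have "subtopology ?X Z' = subtopology Y Z'" using A by (simp add: subtopology_subtopology Int_absorb1)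
      then have fc: "continuous_map (subtopology ?X Z') euclidean f" using A by simp
      have fS: "adj (f z) * f z = E0 \<and> q z * f z = f z" if "z \<in> Z'" for z
        using A that by (simp add: S_def)
      obtain \<eta> where "continuous_map ?X euclidean \<eta>" "\<And>z. z \<in> Z' \<Longrightarrow> \<eta> z = f z"
        "\<And>y. y \<in> topspace ?X \<Longrightarrow> adj (\<eta> y) * \<eta> y = E0 \<and> q y * \<eta> y = \<eta> y"
        by (rule extend_unit_vector_in_frame[OF X covering_dim_le_closed[OF dim UF(4)] m
              continuous_map_from_subtopology[OF q(1)] qX gc gq go cZ fc fS], assumption+) (rule that)
      then show "\<exists>g. continuous_map ?X euclidean g \<and> (\<forall>z\<in>Z'. g z = f z) \<and> (\<forall>y\<in>F. g y \<in> S y)"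
        using tX by (intro exI[of _ \<eta>]) (auto simp: S_def)
    qed (rule UF(4))
    then show ?thesis using UF by blast
  qed
  obtain \<eta> where "continuous_map Y euclidean \<eta>" "\<And>z. z \<in> Z \<Longrightarrow> \<eta> z = \<xi> z" "\<And>y. y \<in> topspace Y \<Longrightarrow> \<eta> y \<in> S y"
    by (rule glue_local_extensions[OF Y(1) Z \<xi>(1) \<xi>S loc], assumption+) (rule that)
  then show ?thesis by (intro that[of \<eta>]) (auto simp: S_def)
qed

text \<open>The space of isometries from the fibres of \<open>e\<close> to those of \<open>q\<close> is \<open>2r\<close>-connected when the
  ranks differ by at least \<open>r\<close>, so such isometries extend in dimension at most \<open>2r + 1\<close>. Where \<open>e\<close> has a unit
  section \<open>h\<close>, one extends \<open>s h\<close> first and then the rest of \<open>s\<close>, on the complement of \<open>h\<close> and with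
  values in the complement of \<open>s h\<close>; the difference of the ranks does not change.\<close>

lemma extend_partial_isometry:
  fixes Y :: "'y topology"
  assumes Y: "compact_space Y" "Hausdorff_space Y" and dim: "covering_dim_le Y (2 * r + 1)"
    and q: "continuous_map Y euclidean q" "\<And>y. y \<in> topspace Y \<Longrightarrow> bnd N (q y) \<and> proj_mat (q y)"
    and e: "continuous_map Y euclidean e" "\<And>y. y \<in> topspace Y \<Longrightarrow> bnd N (e y) \<and> proj_mat (e y)"
    and rk: "\<And>y. y \<in> topspace Y \<Longrightarrow> real r - 1 < (norm (q y))\<^sup>2 - (norm (e y))\<^sup>2"
    and k: "\<And>y. y \<in> topspace Y \<Longrightarrow> (norm (e y))\<^sup>2 \<le> real k"
    and Z: "closedin Y Z" and s: "continuous_map (subtopology Y Z) euclidean s"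
      "\<And>z. z \<in> Z \<Longrightarrow> adj (s z) * s z = e z \<and> q z * s z = s z"
  shows "\<exists>t. continuous_map Y euclidean t \<and> (\<forall>z\<in>Z. t z = s z) \<and>
    (\<forall>y\<in>topspace Y. adj (t y) * t y = e y \<and> q y * t y = t y)"
  using assms
proof (induction k arbitrary: Y q e Z s)
  case (0 Y q e Z s)
  have "e y = 0" if "y \<in> topspace Y" for y using 0(9)[OF that] by simp
  moreover have "Z \<subseteq> topspace Y" using 0(10) closedin_subset by blast
  moreover have "s z = 0" if "z \<in> Z" for z
    using 0(12)[OF that] calculation that by (auto simp: subset_iff)
  ultimately show ?case by (intro exI[of _ "\<lambda>_. 0"]) auto
next
  case (Suc k Y q e Z s)
  note Y = Suc.prems(1,2) and dim = Suc.prems(3) and q = Suc.prems(4,5) and e = Suc.prems(6,7)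
    and rk = Suc.prems(8) and k = Suc.prems(9) and Z = Suc.prems(10) and s = Suc.prems(11,12)
  define S where "S y = {t. adj t * t = e y \<and> q y * t = t}" for y
  have sS: "s z \<in> S z" if "z \<in> Z" for z using s(2)[OF that] by (simp add: S_def)
  have loc: "\<exists>U F. openin Y U \<and> y0 \<in> U \<and> U \<subseteq> F \<and> extends_over Y S F" if y0: "y0 \<in> topspace Y" for y0
  proof (cases "e y0 = 0")
    case True
    have "openin Y {y \<in> topspace Y. norm (e y) \<in> {..<1}}"
      by (rule openin_continuous_map_preimage[of Y euclidean]) (intro continuous_map_norm e(1), simp)
    moreover have "y0 \<in> {y \<in> topspace Y. norm (e y) \<in> {..<1}}" using y0 True by simp
    ultimately obtain U F where UF: "openin Y U" "y0 \<in> U" "U \<subseteq> F" "closedin Y F" "F \<subseteq> {y \<in> topspace Y. norm (e y) \<in> {..<1}}"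
      by (rule closed_neighbourhood[OF Y])
    have e0: "e y = 0" if y: "y \<in> F" for y
    proof (rule ccontr)
      assume n: "e y \<noteq> 0"
      have yY: "y \<in> topspace Y" and ly: "norm (e y) < 1" using UF(5) y by auto
      have p: "proj_mat (e y)" and b: "bnd N (e y)" using e(2)[OF yY] by auto
      obtain i where i: "e y * unit_mat i 0 1 \<noteq> 0" using proj_vector_exists[OF b n] by metis
      define f where "f = e y * unit_mat i 0 1"
      have f: "f * E0 = f" "e y * f = f" "f \<noteq> 0"
        using p i by (simp_all add: f_def mult.assoc proj_mat_def) (simp add: mult.assoc[symmetric])
      have "1 \<le> (norm (e y))\<^sup>2"
        by (rule proj_split_vector(3)[OF p normalize_vector[OF f(1,3)]]) (simp add: f)
      moreover have "(norm (e y))\<^sup>2 < 1" using ly by (simp add: power_less_one_iff abs_square_less_1)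
      ultimately show False by simp
    qed
    have "extends_over Y S F"
      unfolding extends_over_def
    proof (intro conjI allI impI)
      fix Z' f assume A: "closedin Y Z' \<and> Z' \<subseteq> F \<and> continuous_map (subtopology Y Z') euclidean f \<and> (\<forall>z\<in>Z'. f z \<in> S z)"
      have "f z = 0" if "z \<in> Z'" for z using A e0 that by (auto simp: S_def subset_iff)
      then show "\<exists>g. continuous_map (subtopology Y F) euclidean g \<and> (\<forall>z\<in>Z'. g z = f z) \<and> (\<forall>y\<in>F. g y \<in> S y)"
        using e0 by (intro exI[of _ "\<lambda>_. 0"]) (simp add: S_def)
    qed (rule UF(4))
    then show ?thesis using UF by blast
  next
    case False
    have pe0: "proj_mat (e y0)" "bnd N (e y0)" using e(2)[OF y0] by auto
    have r1: "real 1 - 1 < (norm (e y0))\<^sup>2" using False by simp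
    obtain U F g where UF: "openin Y U" "y0 \<in> U" "U \<subseteq> F" "closedin Y F"
      "\<forall>j<(1::nat). continuous_map (subtopology Y F) euclidean (g j)"
      "\<forall>y\<in>F. \<forall>j<(1::nat). e y * g j y = g j y \<and> (\<forall>k<(1::nat). adj (g j y) * g k y = (if j = k then E0 else 0))"
      by (rule exE[OF local_frame[OF Y e y0 r1]], assumption, elim exE conjE) (rule that)
    define h where "h = g (0::nat)"
    have FY: "F \<subseteq> topspace Y" using UF(4) closedin_subset by blast
    let ?X = "subtopology Y F"
    have tX: "topspace ?X = F" using FY by auto
    have X: "compact_space ?X" "Hausdorff_space ?X"
      using Y UF(4) closedin_compact_space compact_space_subtopology by (auto simp: Hausdorff_space_subtopology)
    have dX: "covering_dim_le ?X (2 * r + 1)" by (rule covering_dim_le_closed[OF dim UF(4)])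
    have hc: "continuous_map ?X euclidean h" using UF(5) by (simp add: h_def)
    have h: "adj (h y) * h y = E0" "e y * h y = h y" if "y \<in> F" for y
      using UF(6) that by (simp_all add: h_def)
    have he: "adj (h y) * e y = adj (h y)" if "y \<in> F" for y
      using arg_cong[OF h(2)[OF that], of adj] e(2)[of y] that FY by (auto simp: proj_mat_def)
    have qe: "bnd N (q y)" "proj_mat (q y)" "bnd N (e y)" "proj_mat (e y)" if "y \<in> F" for y
      using q(2) e(2) that FY by auto
    have rkq: "real (r + 1) - 1 < (norm (q y))\<^sup>2" if y: "y \<in> topspace ?X" for y
      using proj_split_vector(3)[OF qe(4) h] rk[of y] that tX FY by fastforce
    have qX: "bnd N (q y) \<and> proj_mat (q y)" if "y \<in> topspace ?X" for y using that tX qe by blast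
    have qc: "continuous_map ?X euclidean q" and ec: "continuous_map ?X euclidean e"
      using continuous_map_from_subtopology q(1) e(1) by blast+
    have compress: "bnd N (a * adj b)" if "bnd N p" "proj_mat p" "p * a = a" "p * b = b" for a b p
    proof -
      have "adj b * p = adj b" using arg_cong[OF that(4), of adj] that(2) by (simp add: proj_mat_def)
      then have "a * adj b = p * (a * adj b) * p" using that(3) by (simp add: mult.assoc[symmetric]) (simp add: mult.assoc)
      then show ?thesis using bnd_compress[OF that(1)] by metis
    qed
    have "extends_over Y S F"
      unfolding extends_over_def
    proof (intro conjI allI impI)
      fix Z' f assume A: "closedin Y Z' \<and> Z' \<subseteq> F \<and> continuous_map (subtopology Y Z') euclidean f \<and> (\<forall>z\<in>Z'. f z \<in> S z)"
      then have ZF: "Z' \<subseteq> F" by blast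
      have cZ: "closedin ?X Z'" using A by (simp add: closedin_subset_topspace)
      have sX: "subtopology ?X Z' = subtopology Y Z'" using A by (simp add: subtopology_subtopology Int_absorb1)
      then have fc: "continuous_map (subtopology ?X Z') euclidean f" using A by simp
      have f: "adj (f z) * f z = e z" "q z * f z = f z" if "z \<in> Z'" for z
        using A that by (simp_all add: S_def)
      have hcZ: "continuous_map (subtopology ?X Z') euclidean h" by (rule continuous_map_from_subtopology[OF hc])
      have fh: "adj (f z * h z) * (f z * h z) = E0 \<and> q z * (f z * h z) = f z * h z" if z: "z \<in> Z'" for z
      proof
        have "adj (f z * h z) * (f z * h z) = adj (h z) * (adj (f z) * f z) * h z" by (simp add: mult.assoc)
        then show "adj (f z * h z) * (f z * h z) = E0" using f[OF z] he h z ZF by auto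
        show "q z * (f z * h z) = f z * h z" using f[OF z] by (simp add: mult.assoc[symmetric])
      qed
      have dX': "covering_dim_le ?X (2 * (r + 1) - 1)" using dX by simp
      obtain \<xi> where \<xi>: "continuous_map ?X euclidean \<xi>" "\<And>z. z \<in> Z' \<Longrightarrow> \<xi> z = f z * h z"
        "\<And>y. y \<in> topspace ?X \<Longrightarrow> adj (\<xi> y) * \<xi> y = E0 \<and> q y * \<xi> y = \<xi> y"
        by (rule extend_unit_vector[OF X dX' _ qc qX rkq cZ continuous_map_fmat_mult[OF fc hcZ] fh], simp, assumption+) (rule that)
      \<comment> \<open>\<open>\<xi>\<close> extends \<open>f h\<close>; what remains is an isometry
          from \<open>e' = e - h h*\<close> into \<open>q' = q - \<xi> \<xi>*\<close>\<close>
      define e' where "e' y = e y - h y * adj (h y)" for y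
      define q' where "q' y = q y - \<xi> y * adj (\<xi> y)" for y
      define f' where "f' y = f y - \<xi> y * adj (h y)" for y
      have \<xi>X: "adj (\<xi> y) * \<xi> y = E0" "q y * \<xi> y = \<xi> y" if "y \<in> F" for y using \<xi>(3) that tX by auto
      have e'c: "continuous_map ?X euclidean e'" unfolding e'_def
        by (intro continuous_map_diff continuous_map_fmat_mult continuous_map_adj ec hc)
      have q'c: "continuous_map ?X euclidean q'" unfolding q'_def
        by (intro continuous_map_diff continuous_map_fmat_mult continuous_map_adj qc \<xi>(1))
      have f'c: "continuous_map (subtopology ?X Z') euclidean f'" unfolding f'_def
        by (intro continuous_map_diff continuous_map_fmat_mult continuous_map_adj fc hcZ continuous_map_from_subtopology[OF \<xi>(1)])
      have e'p: "bnd N (e' y) \<and> proj_mat (e' y)" if "y \<in> topspace ?X" for y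
        using that tX compress[OF qe(3,4) h(2) h(2)] proj_split_vector(1)[OF qe(4) h] qe(3) by (auto simp: e'_def)
      have q'p: "bnd N (q' y) \<and> proj_mat (q' y)" if "y \<in> topspace ?X" for y
        using that tX compress[OF qe(1,2) \<xi>X(2) \<xi>X(2)] proj_split_vector(1)[OF qe(2) \<xi>X] qe(1) by (auto simp: q'_def)
      have ne: "(norm (e' y))\<^sup>2 = (norm (e y))\<^sup>2 - 1" "(norm (q' y))\<^sup>2 = (norm (q y))\<^sup>2 - 1" if "y \<in> F" for y
        unfolding e'_def q'_def using proj_split_vector(2)[OF qe(4) h] proj_split_vector(2)[OF qe(2) \<xi>X] that by auto
      have rk': "real r - 1 < (norm (q' y))\<^sup>2 - (norm (e' y))\<^sup>2" if "y \<in> topspace ?X" for y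
        using ne[of y] rk[of y] that tX by simp
      have k': "(norm (e' y))\<^sup>2 \<le> real k" if "y \<in> topspace ?X" for y
        using ne[of y] k[of y] that tX by simp
      have f': "adj (f' z) * f' z = e' z \<and> q' z * f' z = f' z" if z: "z \<in> Z'" for z
      proof
        have zF: "z \<in> F" using z ZF by blast
        have fe: "f z * e z = f z"
          using partial_isometry_mult[OF f(1)[OF z]] qe(4)[OF zF] by (simp add: proj_mat_def)
        have eh: "e z * (h z * adj (h z)) = h z * adj (h z)" "h z * adj (h z) * e z = h z * adj (h z)"
          using h(2)[OF zF] he[OF zF] by (simp_all add: mult.assoc[symmetric]) (simp add: mult.assoc)
        have f'e: "f' z = f z * e' z"
          by (simp add: f'_def e'_def \<xi>(2)[OF z] right_diff_distrib fe mult.assoc)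
        have ee': "e z * e' z = e' z" "adj (e' z) = e' z" "e' z * e' z = e' z"
          using qe(4)[OF zF] eh e'p[of z] zF tX by (auto simp: e'_def right_diff_distrib proj_mat_def)
        have "adj (f' z) * f' z = adj (e' z) * (adj (f z) * f z) * e' z" by (simp add: f'e mult.assoc)
        also have "\<dots> = e' z" using f(1)[OF z] ee' by (simp add: mult.assoc)
        finally show "adj (f' z) * f' z = e' z" .
        have xs: "adj (\<xi> z) * f z = adj (h z)"
        proof -
          have "adj (\<xi> z) * f z = adj (h z) * (adj (f z) * f z)" by (simp add: \<xi>(2)[OF z] mult.assoc)
          then show ?thesis using f(1)[OF z] he[OF zF] by simp
        qed
        have xx: "\<xi> z * adj (\<xi> z) * (\<xi> z * adj (h z)) = \<xi> z * adj (h z)"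
        proof -
          have "\<xi> z * adj (\<xi> z) * (\<xi> z * adj (h z)) = \<xi> z * (adj (\<xi> z) * \<xi> z) * adj (h z)" by (simp only: mult.assoc)
          then show ?thesis using \<xi>X(1)[OF zF] unit_vector_E0[OF \<xi>X(1)[OF zF]] by simp
        qed
        have "\<xi> z * adj (\<xi> z) * f z = \<xi> z * adj (h z)" using xs by (simp add: mult.assoc)
        moreover have "q z * (\<xi> z * adj (h z)) = \<xi> z * adj (h z)" using \<xi>X(2)[OF zF] by (simp add: mult.assoc[symmetric])
        ultimately show "q' z * f' z = f' z"
          using f(2)[OF z] xx by (simp add: q'_def f'_def left_diff_distrib right_diff_distrib)
      qed
      from Suc.IH[OF X dX q'c q'p e'c e'p rk' k' cZ f'c f']
      obtain t where t: "continuous_map ?X euclidean t" "\<forall>z\<in>Z'. t z = f' z"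
        "\<forall>y\<in>topspace ?X. adj (t y) * t y = e' y \<and> q' y * t y = t y" by auto
      have tS: "t y + \<xi> y * adj (h y) \<in> S y" if y: "y \<in> F" for y
      proof -
        have ty: "adj (t y) * t y = e' y" "q' y * t y = t y" using t(3) y tX by auto
        have xq: "adj (\<xi> y) * q' y = 0"
        proof -
          have "adj (\<xi> y) * q y = adj (\<xi> y)"
            using arg_cong[OF \<xi>X(2)[OF y], of adj] qe(2)[OF y] by (simp add: proj_mat_def)
          moreover have "adj (\<xi> y) * (\<xi> y * adj (\<xi> y)) = adj (\<xi> y)"
            using \<xi>X(1)[OF y] E0_adj[OF unit_vector_E0[OF \<xi>X(1)[OF y]]] by (simp add: mult.assoc[symmetric])
          ultimately show ?thesis by (simp add: q'_def right_diff_distrib)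
        qed
        have xt: "adj (\<xi> y) * t y = 0"
        proof -
          have "adj (\<xi> y) * t y = (adj (\<xi> y) * q' y) * t y" using ty(2) by (simp add: mult.assoc)
          then show ?thesis by (simp add: xq)
        qed
        have tx: "adj (t y) * \<xi> y = 0" using arg_cong[OF xt, of adj] by simp
        have "adj (t y + \<xi> y * adj (h y)) * (t y + \<xi> y * adj (h y)) =
          adj (t y) * t y + (adj (t y) * \<xi> y) * adj (h y) + h y * (adj (\<xi> y) * t y) + h y * (adj (\<xi> y) * \<xi> y) * adj (h y)"
          by (simp add: distrib_left distrib_right mult.assoc)
        also have "\<dots> = e y" using ty(1) unit_vector_E0[OF h(1)[OF y]] by (simp add: tx xt \<xi>X(1)[OF y] e'_def)
        finally have 1: "adj (t y + \<xi> y * adj (h y)) * (t y + \<xi> y * adj (h y)) = e y" .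
        have "q y * q' y = q' y"
          using qe(2)[OF y] \<xi>X(2)[OF y] by (simp add: q'_def right_diff_distrib proj_mat_def mult.assoc[symmetric])
        then have "q y * t y = t y" using ty(2) by (metis mult.assoc)
        then have "q y * (t y + \<xi> y * adj (h y)) = t y + \<xi> y * adj (h y)"
          using \<xi>X(2)[OF y] by (simp add: distrib_left mult.assoc[symmetric])
        with 1 show ?thesis by (simp add: S_def)
      qed
      show "\<exists>g. continuous_map ?X euclidean g \<and> (\<forall>z\<in>Z'. g z = f z) \<and> (\<forall>y\<in>F. g y \<in> S y)"
      proof (intro exI[of _ "\<lambda>y. t y + \<xi> y * adj (h y)"] conjI ballI)
        show "continuous_map ?X euclidean (\<lambda>y. t y + \<xi> y * adj (h y))"
          by (intro continuous_map_add continuous_map_fmat_mult continuous_map_adj t(1) \<xi>(1) hc)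
        show "t z + \<xi> z * adj (h z) = f z" if "z \<in> Z'" for z using t(2) that by (simp add: f'_def)
      qed (rule tS)
    qed (rule UF(4))
    then show ?thesis using UF by blast
  qed
  obtain t where "continuous_map Y euclidean t" "\<And>z. z \<in> Z \<Longrightarrow> t z = s z" "\<And>y. y \<in> topspace Y \<Longrightarrow> t y \<in> S y"
    by (rule glue_local_extensions[OF Y(1) Z s(1) sS loc], assumption+) (rule that)
  then show ?case by (intro exI[of _ t]) (auto simp: S_def)
qed

section \<open>Deforming unitaries over one space\<close>

definition unitary_in :: "fmat \<Rightarrow> fmat \<Rightarrow> bool" where
  "unitary_in q u \<longleftrightarrow> adj u * u = q \<and> u * adj u = q"

lemma unitary_in_mult:
  assumes "proj_mat q" "unitary_in q u" shows "q * u = u" "u * q = u"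
proof -
  have qq: "q * q = q" "adj q = q" using assms(1) by (auto simp: proj_mat_def)
  show "u * q = u" by (rule partial_isometry_mult) (use assms(2) qq in \<open>auto simp: unitary_in_def\<close>)
  have "adj u * q = adj u" by (rule partial_isometry_mult) (use assms(2) qq in \<open>auto simp: unitary_in_def\<close>)
  from arg_cong[OF this, of adj] show "q * u = u" using qq by simp
qed

lemma bnd_unitary_in: "proj_mat q \<Longrightarrow> bnd N q \<Longrightarrow> unitary_in q u \<Longrightarrow> bnd N u"
  using bnd_compress[of N q u] by (metis unitary_in_mult)

lemma norm_proj_le:
  assumes "proj_mat e" "bnd N e" shows "(norm e)\<^sup>2 \<le> (norm (Id N))\<^sup>2"
proof -
  have "inner e (Id N - e) = inner (e * e) (Id N - e)" using assms by (simp add: proj_mat_def)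
  also have "\<dots> = inner e (adj e * (Id N - e))" by (rule inner_mult_left)
  also have "\<dots> = 0" using assms by (simp add: right_diff_distrib mult_Id proj_mat_def)
  finally have 0: "inner e (Id N - e) = 0" .
  have "(norm (Id N))\<^sup>2 = (norm (e + (Id N - e)))\<^sup>2" by simp
  also have "\<dots> = (norm e)\<^sup>2 + (norm (Id N - e))\<^sup>2"
    unfolding power2_norm_eq_inner using 0
    by (simp only: inner_add_left inner_add_right inner_commute[of "Id N - e" e])
  finally show ?thesis by simp
qed

text \<open>The partial isometries \<open>u e\<close> are deformed to \<open>e\<close> by extending them from the part of
  \<open>(X \<times> T) \<times> [0, 1]\<close> where the deformation is prescribed; the homotopy lifting property then
  turns this into a deformation of the unitaries. Adding \<open>1 - q\<close> makes all unitaries unitary in the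
  same matrix algebra.\<close>

lemma deform_unitaries_over_space:
  fixes X :: "'x topology" and T T0 :: "real set"
  defines "Pt \<equiv> prod_topology X (top_of_set T)"
  defines "Y \<equiv> prod_topology Pt (top_of_set {0..1::real})"
  assumes X: "compact_space X" "Hausdorff_space X" and B: "closedin X B"
    and T: "compact T" "closedin (top_of_set T) T0"
    and q: "continuous_map X euclidean q" "\<And>x. x \<in> topspace X \<Longrightarrow> bnd N (q x) \<and> proj_mat (q x)"
    and e: "continuous_map X euclidean e" "\<And>x. x \<in> topspace X \<Longrightarrow> bnd N (e x) \<and> proj_mat (e x) \<and> q x * e x = e x"
    and dim: "covering_dim_le Y (2 * r + 1)"
    and rk: "\<And>x. x \<in> topspace X \<Longrightarrow> real r - 1 < (norm (q x))\<^sup>2 - (norm (e x))\<^sup>2"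
    and U: "continuous_map Pt euclidean U"
      "\<And>x t. x \<in> topspace X \<Longrightarrow> t \<in> T \<Longrightarrow> unitary_in (q x) (U (x, t))"
      "\<And>x t. x \<in> topspace X \<Longrightarrow> t \<in> T0 \<Longrightarrow> U (x, t) * e x = e x"
    and \<Gamma>0: "continuous_map (subtopology Y ((B \<times> T) \<times> {0..1})) euclidean \<Gamma>0"
      "\<And>x t \<tau>. x \<in> B \<Longrightarrow> t \<in> T \<Longrightarrow> \<tau> \<in> {0..1} \<Longrightarrow> unitary_in (q x) (\<Gamma>0 ((x, t), \<tau>))"
      "\<And>x t. x \<in> B \<Longrightarrow> t \<in> T \<Longrightarrow> \<Gamma>0 ((x, t), 0) = U (x, t)"
      "\<And>x t. x \<in> B \<Longrightarrow> t \<in> T \<Longrightarrow> \<Gamma>0 ((x, t), 1) * e x = e x"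
      "\<And>x t \<tau>. x \<in> B \<Longrightarrow> t \<in> T0 \<Longrightarrow> \<tau> \<in> {0..1} \<Longrightarrow> \<Gamma>0 ((x, t), \<tau>) = U (x, t)"
  shows "\<exists>\<Gamma>. continuous_map Y euclidean \<Gamma> \<and>
    (\<forall>x\<in>topspace X. \<forall>t\<in>T. (\<forall>\<tau>\<in>{0..1}. unitary_in (q x) (\<Gamma> ((x, t), \<tau>))) \<and>
      \<Gamma> ((x, t), 0) = U (x, t) \<and> \<Gamma> ((x, t), 1) * e x = e x \<and>
      (t \<in> T0 \<longrightarrow> (\<forall>\<tau>\<in>{0..1}. \<Gamma> ((x, t), \<tau>) = U (x, t))) \<and>
      (x \<in> B \<longrightarrow> (\<forall>\<tau>\<in>{0..1}. \<Gamma> ((x, t), \<tau>) = \<Gamma>0 ((x, t), \<tau>))))"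
proof -
  have BX: "B \<subseteq> topspace X" using B closedin_subset by blast
  have T0T: "T0 \<subseteq> T" using T(2) closedin_subset by fastforce
  have tP: "topspace Pt = topspace X \<times> T" by (simp add: Pt_def)
  have tY: "topspace Y = (topspace X \<times> T) \<times> {0..1}" by (simp add: Y_def tP)
  have PP: "compact_space Pt" "Hausdorff_space Pt"
    unfolding Pt_def using X T(1) by (auto simp: compact_space_prod_topology Hausdorff_space_prod_topology
        compact_space_subtopology Hausdorff_space_subtopology)
  have YY: "compact_space Y" "Hausdorff_space Y"
    unfolding Y_def using PP by (auto simp: compact_space_prod_topology Hausdorff_space_prod_topology
        compact_space_subtopology Hausdorff_space_subtopology)
  \<comment> \<open>\<open>Zg\<close> is the set where the unitaries are prescribed, \<open>Z3\<close>
      the one where only their products with \<open>e\<close> are; the part \<open>Z1\<close> of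
      \<open>Zg\<close> lies over \<open>B\<close>\<close>
  define P0 where "P0 = B \<times> T \<union> topspace X \<times> T0"
  define Z1 where "Z1 = (B \<times> T) \<times> {0..1::real}"
  define Z2 where "Z2 = (topspace X \<times> T0) \<times> {0..1::real} \<union> topspace Pt \<times> {0::real}"
  define Zg where "Zg = P0 \<times> {0..1::real} \<union> topspace Pt \<times> {0::real}"
  define Z3 where "Z3 = topspace Pt \<times> {1::real}"
  have c1: "closedin Pt (B \<times> T)" "closedin Pt (topspace X \<times> T0)"
    unfolding Pt_def using B T(2) by (simp_all add: closedin_prod_Times_iff)
  have cP0: "closedin Pt P0" unfolding P0_def using c1 by (rule closedin_Un)
  have "closedin (top_of_set {0..1::real}) {0}" "closedin (top_of_set {0..1::real}) {1}"
    "closedin (top_of_set {0..1::real}) {0..1}"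
    by (simp_all add: closed_subset)
  then have cY: "closedin Y (A \<times> {0..1})" "closedin Y (A \<times> {0})" "closedin Y (A \<times> {1})" if "closedin Pt A" for A
    unfolding Y_def using that by (simp_all add: closedin_prod_Times_iff)
  have cZ: "closedin Y Z1" "closedin Y Z2" "closedin Y Z3"
    unfolding Z1_def Z2_def Z3_def using cY c1 by (auto intro!: closedin_Un)
  have Zg: "Zg = Z1 \<union> Z2" unfolding Zg_def Z1_def Z2_def P0_def tP by blast
  have cZg: "closedin Y Zg" unfolding Zg using cZ by (intro closedin_Un)
  have ZgY: "Zg \<subseteq> topspace Y" using cZg closedin_subset by blast
  have fstY: "continuous_map Y Pt fst" unfolding Y_def by (rule continuous_map_fst)
  have fstfst: "continuous_map Y X (\<lambda>z. fst (fst z))"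
  proof -
    have "continuous_map Pt X fst" unfolding Pt_def by (rule continuous_map_fst)
    from continuous_map_compose[OF fstY this] show ?thesis by (simp add: o_def)
  qed
  have qY: "continuous_map Y euclidean (\<lambda>z. q (fst (fst z)))" and eY: "continuous_map Y euclidean (\<lambda>z. e (fst (fst z)))"
    using continuous_map_compose[OF fstfst q(1)] continuous_map_compose[OF fstfst e(1)] by (simp_all add: o_def)
  have UY: "continuous_map Y euclidean (\<lambda>z. U (fst z))"
    using continuous_map_compose[OF fstY U(1)] by (simp add: o_def)
  define g where "g z = (if z \<in> Z1 then \<Gamma>0 z else U (fst z))" for z
  have gc: "continuous_map (subtopology Y Zg) euclidean g"
    unfolding g_def Zg
  proof (rule continuous_map_paste[OF cZ(1,2)])
    show "continuous_map (subtopology Y Z1) euclidean \<Gamma>0" unfolding Z1_def by (rule \<Gamma>0(1))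
    show "continuous_map (subtopology Y Z2) euclidean (\<lambda>z. U (fst z))" by (rule continuous_map_from_subtopology[OF UY])
    show "\<Gamma>0 z = U (fst z)" if "z \<in> Z1" "z \<in> Z2" for z
      using that \<Gamma>0(3,5) by (auto simp: Z1_def Z2_def)
  qed
  have gu: "unitary_in (q x) (g ((x, t), \<tau>))" if "((x, t), \<tau>) \<in> Zg" for x t \<tau>
  proof (cases "((x, t), \<tau>) \<in> Z1")
    case True
    then show ?thesis using \<Gamma>0(2) by (auto simp: g_def Z1_def)
  next
    case False
    have "x \<in> topspace X" "t \<in> T" using that ZgY tY by auto
    then show ?thesis using False U(2) by (simp add: g_def)
  qed
  define s where "s z = (if z \<in> Zg then g z * e (fst (fst z)) else e (fst (fst z)))" for z
  have sc: "continuous_map (subtopology Y (Zg \<union> Z3)) euclidean s"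
    unfolding s_def
  proof (rule continuous_map_paste[OF cZg cZ(3)])
    show "continuous_map (subtopology Y Zg) euclidean (\<lambda>z. g z * e (fst (fst z)))"
      by (intro continuous_map_fmat_mult gc continuous_map_from_subtopology[OF eY])
    show "continuous_map (subtopology Y Z3) euclidean (\<lambda>z. e (fst (fst z)))" by (rule continuous_map_from_subtopology[OF eY])
    fix z assume z: "z \<in> Zg" "z \<in> Z3"
    then obtain x t where xt: "z = ((x, t), 1)" "x \<in> topspace X" "t \<in> T" unfolding Z3_def tP by auto
    show "g z * e (fst (fst z)) = e (fst (fst z))"
    proof (cases "z \<in> Z1")
      case True
      then show ?thesis using \<Gamma>0(4) xt by (auto simp: g_def Z1_def)
    next
      case False
      then have "z \<in> Z2" using z Zg by blast
      then have "t \<in> T0" using xt by (auto simp: Z2_def)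
      then show ?thesis using False U(3) xt by (simp add: g_def)
    qed
  qed
  have s: "adj (s z) * s z = e (fst (fst z)) \<and> q (fst (fst z)) * s z = s z" if z: "z \<in> Zg \<union> Z3" for z
  proof -
    obtain x t \<tau> where xt: "z = ((x, t), \<tau>)" by (metis prod.collapse)
    have x: "x \<in> topspace X" using z ZgY closedin_subset[OF cZ(3)] tY xt by auto
    have pe: "e x * e x = e x" "adj (e x) = e x" "q x * e x = e x" using e(2)[OF x] by (auto simp: proj_mat_def)
    show ?thesis
    proof (cases "z \<in> Zg")
      case True
      have u: "unitary_in (q x) (g z)" using gu True xt by blast
      have "adj (g z * e x) * (g z * e x) = e x * (adj (g z) * g z) * e x" by (simp add: pe mult.assoc)
      also have "\<dots> = e x" using u pe by (simp add: unitary_in_def mult.assoc)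
      finally have "adj (g z * e x) * (g z * e x) = e x" .
      moreover have "q x * (g z * e x) = g z * e x"
        using unitary_in_mult(1)[OF _ u] q(2)[OF x] by (simp add: mult.assoc[symmetric])
      ultimately show ?thesis using True xt by (simp add: s_def)
    next
      case False
      then show ?thesis using pe xt by (simp add: s_def)
    qed
  qed
  obtain k :: nat where k: "(norm (Id N))\<^sup>2 \<le> real k" using real_arch_simple by blast
  have qp: "bnd N (q (fst (fst z))) \<and> proj_mat (q (fst (fst z)))" if "z \<in> topspace Y" for z
    using that q(2) tY by auto
  have ep: "bnd N (e (fst (fst z))) \<and> proj_mat (e (fst (fst z)))" if "z \<in> topspace Y" for z
    using that e(2) tY by auto
  have rkY: "real r - 1 < (norm (q (fst (fst z))))\<^sup>2 - (norm (e (fst (fst z))))\<^sup>2" if "z \<in> topspace Y" for z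
    using that rk tY by auto
  have kY: "(norm (e (fst (fst z))))\<^sup>2 \<le> real k" if "z \<in> topspace Y" for z
    using norm_proj_le[of "e (fst (fst z))" N] ep[OF that] k by linarith
  have "\<exists>t. continuous_map Y euclidean t \<and> (\<forall>z\<in>Zg \<union> Z3. t z = s z) \<and>
    (\<forall>z\<in>topspace Y. adj (t z) * t z = e (fst (fst z)) \<and> q (fst (fst z)) * t z = t z)"
    by (rule extend_partial_isometry[OF YY dim qY qp eY ep rkY kY closedin_Un[OF cZg cZ(3)] sc s])
  then obtain s' where s'c: "continuous_map Y euclidean s'" and s'Z: "\<And>z. z \<in> Zg \<union> Z3 \<Longrightarrow> s' z = s z"
    and s': "\<And>z. z \<in> topspace Y \<Longrightarrow> adj (s' z) * s' z = e (fst (fst z)) \<and> q (fst (fst z)) * s' z = s' z" by blast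
  let ?I = "Id N"
  \<comment> \<open>adding \<open>1 - q\<close> turns the unitaries of \<open>q\<close> into unitaries
      of \<open>M\<^sub>N\<close>; the lift is forced to be the identity on \<open>1 - q\<close>\<close>
  define e1 where "e1 p = e (fst p) + (?I - q (fst p))" for p :: "'x \<times> real"
  define s1 where "s1 z = s' z + (?I - q (fst (fst z)))" for z :: "('x \<times> real) \<times> real"
  define g1 where "g1 z = g z + (?I - q (fst (fst z)))" for z :: "('x \<times> real) \<times> real"
  have s1c: "continuous_map Y euclidean s1" unfolding s1_def
    by (intro continuous_map_add continuous_map_diff s'c qY) simp
  have g1c: "continuous_map (subtopology Y Zg) euclidean g1" unfolding g1_def
    by (intro continuous_map_add continuous_map_diff gc continuous_map_from_subtopology[OF qY]) simp
  have s'e: "s' z * e (fst (fst z)) = s' z" if "z \<in> topspace Y" for z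
    by (rule partial_isometry_mult) (use s'[OF that] ep[OF that] in \<open>auto simp: proj_mat_def\<close>)
  have alg: "(?I - q x) * (?I - q x) = ?I - q x" "adj (?I - q x) = ?I - q x" "q x * (?I - q x) = 0" "(?I - q x) * q x = 0"
    "e x * (?I - q x) = 0" "(?I - q x) * e x = 0" "e x * e x = e x" "adj (e x) = e x" if x: "x \<in> topspace X" for x
  proof -
    have qx: "bnd N (q x)" "q x * q x = q x" "adj (q x) = q x" and ex: "bnd N (e x)" "e x * e x = e x" "adj (e x) = e x" "q x * e x = e x"
      using q(2)[OF x] e(2)[OF x] by (auto simp: proj_mat_def)
    have eq: "e x * q x = e x" using arg_cong[OF ex(4), of adj] by (simp only: adj_mult qx(3) ex(3))
    show "(?I - q x) * (?I - q x) = ?I - q x" "adj (?I - q x) = ?I - q x" "q x * (?I - q x) = 0" "(?I - q x) * q x = 0"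
      "e x * (?I - q x) = 0" "(?I - q x) * e x = 0" "e x * e x = e x" "adj (e x) = e x"
      using qx ex eq by (simp_all add: left_diff_distrib right_diff_distrib Id_mult mult_Id)
  qed
  have s1: "bnd N (s1 (p, t)) \<and> adj (s1 (p, t)) * s1 (p, t) = e1 p \<and> e1 p * e1 p = e1 p"
    if p: "p \<in> topspace Pt" and t: "t \<in> {0..1}" for p t
  proof -
    let ?x = "fst p" and ?z = "(p, t)"
    have z: "?z \<in> topspace Y" using p t by (simp add: Y_def)
    have x: "?x \<in> topspace X" using p tP by auto
    have qs: "q ?x * s' ?z = s' ?z" "adj (s' ?z) * s' ?z = e ?x" using s'[OF z] by auto
    have b: "bnd N (q ?x)" "bnd N (e ?x)" using qp[OF z] ep[OF z] by auto
    have es: "s' ?z * e ?x = s' ?z" using s'e[OF z] by simp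
    have bs: "bnd N (s' ?z)"
    proof -
      have "e ?x * q ?x = e ?x" using alg(5)[OF x] b by (simp add: right_diff_distrib mult_Id)
      then have "s' ?z * q ?x = s' ?z" using es by (metis mult.assoc)
      then have "q ?x * s' ?z * q ?x = s' ?z" using qs(1) by simp
      then show ?thesis using bnd_compress[OF b(1)] by metis
    qed
    have 0: "(?I - q ?x) * s' ?z = 0" using qs(1) bs by (simp add: left_diff_distrib Id_mult)
    have zz: "adj (s' ?z) * (?I - q ?x) = 0" using arg_cong[OF 0, of adj] alg(2)[OF x] by simp
    have "adj (s1 ?z) * s1 ?z = adj (s' ?z) * s' ?z + adj (s' ?z) * (?I - q ?x) + (?I - q ?x) * s' ?z + (?I - q ?x) * (?I - q ?x)"
      by (simp only: s1_def fst_conv adj_add alg(2)[OF x] distrib_left distrib_right add_ac)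
    then have "adj (s1 ?z) * s1 ?z = e1 p" by (simp only: 0 zz alg(1)[OF x] qs(2) e1_def) simp
    moreover have "e1 p * e1 p = e ?x * e ?x + e ?x * (?I - q ?x) + (?I - q ?x) * e ?x + (?I - q ?x) * (?I - q ?x)"
      by (simp only: e1_def distrib_left distrib_right add_ac)
    then have "e1 p * e1 p = e1 p" by (simp only: alg[OF x] e1_def) simp
    moreover have "bnd N (s1 ?z)" using bs b by (simp add: s1_def)
    ultimately show ?thesis by blast
  qed
  have g1: "unitary_mat N (g1 z) \<and> g1 z * e1 (fst z) = s1 z" if z: "z \<in> Zg" for z
  proof -
    obtain x t \<tau> where xt: "z = ((x, t), \<tau>)" by (metis prod.collapse)
    have zY: "z \<in> topspace Y" using z ZgY by blast
    have x: "x \<in> topspace X" using zY tY xt by auto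
    have pq: "proj_mat (q x)" "bnd N (q x)" using q(2)[OF x] by auto
    have u: "unitary_in (q x) (g z)" using gu z xt by blast
    note uq = unitary_in_mult[OF pq(1) u]
    have b: "bnd N (g z)" by (rule bnd_unitary_in[OF pq u])
    have 0: "(?I - q x) * g z = 0" "g z * (?I - q x) = 0"
      using uq b by (simp_all add: left_diff_distrib right_diff_distrib Id_mult mult_Id)
    have zz: "adj (g z) * (?I - q x) = 0" "(?I - q x) * adj (g z) = 0"
      using arg_cong[OF 0(1), of adj] arg_cong[OF 0(2), of adj] alg(2)[OF x] by simp_all
    have gx: "g1 z = g z + (?I - q x)" by (simp add: g1_def xt)
    have "adj (g1 z) * g1 z = adj (g z) * g z + adj (g z) * (?I - q x) + (?I - q x) * g z + (?I - q x) * (?I - q x)"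
      by (simp only: gx adj_add alg(2)[OF x] distrib_left distrib_right add_ac)
    then have 1: "adj (g1 z) * g1 z = ?I" using u by (simp only: 0 zz alg(1)[OF x] unitary_in_def) simp
    have "g1 z * adj (g1 z) = g z * adj (g z) + g z * (?I - q x) + (?I - q x) * adj (g z) + (?I - q x) * (?I - q x)"
      by (simp only: gx adj_add alg(2)[OF x] distrib_left distrib_right add_ac)
    then have 2: "g1 z * adj (g1 z) = ?I" using u by (simp only: 0 zz alg(1)[OF x] unitary_in_def) simp
    have ez: "e1 (fst z) = e x + (?I - q x)" by (simp add: e1_def xt)
    have "g1 z * e1 (fst z) = g z * e x + g z * (?I - q x) + (?I - q x) * e x + (?I - q x) * (?I - q x)"
      by (simp only: gx ez distrib_left distrib_right add_ac)
    then have "g1 z * e1 (fst z) = g z * e x + (?I - q x)" by (simp only: 0 alg[OF x]) simp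
    also have "\<dots> = s1 z" using s'Z[of z] z by (simp add: s1_def s_def xt)
    finally show ?thesis using 1 2 b pq by (simp add: unitary_mat_def gx)
  qed
  obtain G where Gc: "continuous_map Y euclidean G" and Gu: "\<And>z. z \<in> topspace Y \<Longrightarrow> unitary_mat N (G z)"
    and GZ: "\<And>z. z \<in> Zg \<Longrightarrow> G z = g1 z" and Ge: "\<And>z. z \<in> topspace Y \<Longrightarrow> G z * e1 (fst z) = s1 z"
    using unitary_lift[OF PP cP0 s1c[unfolded Y_def] s1 g1c[unfolded Y_def Zg_def] g1[unfolded Zg_def], folded Y_def Zg_def]
    by blast
  define \<Gamma> where "\<Gamma> z = G z - (?I - q (fst (fst z)))" for z
  have \<Gamma>c: "continuous_map Y euclidean \<Gamma>" unfolding \<Gamma>_def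
    by (intro continuous_map_diff Gc qY) simp
  have \<Gamma>Zg: "\<Gamma> z = g z" if "z \<in> Zg" for z using GZ[OF that] by (simp add: \<Gamma>_def g1_def)
  have \<Gamma>: "unitary_in (q x) (\<Gamma> ((x, t), \<tau>)) \<and> \<Gamma> ((x, t), \<tau>) * e x = s' ((x, t), \<tau>)"
    if x: "x \<in> topspace X" and t: "t \<in> T" "\<tau> \<in> {0..1}" for x t \<tau>
  proof -
    let ?z = "((x, t), \<tau>)"
    have z: "?z \<in> topspace Y" using x t tY by simp
    have G: "bnd N (G ?z)" "adj (G ?z) * G ?z = ?I" "G ?z * adj (G ?z) = ?I" using Gu[OF z] by (auto simp: unitary_mat_def)
    have pq: "q x * q x = q x" "adj (q x) = q x" "bnd N (q x)" using q(2)[OF x] by (auto simp: proj_mat_def)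
    have s0: "s' ?z * (?I - q x) = 0" using s'e[OF z] alg(5)[OF x] by (metis fst_conv mult.assoc mult_zero_right)
    have "G ?z * (?I - q x) = G ?z * (e1 (fst ?z) * (?I - q x))"
      by (simp only: e1_def fst_conv distrib_right alg[OF x]) simp
    also have "\<dots> = s1 ?z * (?I - q x)" using Ge[OF z] by (simp only: mult.assoc[symmetric])
    also have "\<dots> = ?I - q x" by (simp only: s1_def fst_conv distrib_right alg[OF x] s0) simp
    finally have G1: "G ?z * (?I - q x) = ?I - q x" .
    have "adj (G ?z) * (?I - q x) = adj (G ?z) * (G ?z * (?I - q x))" by (simp only: G1)
    also have "\<dots> = (adj (G ?z) * G ?z) * (?I - q x)" by (simp only: mult.assoc)
    also have "\<dots> = ?I - q x" using G pq by (simp add: Id_mult)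
    finally have G2: "adj (G ?z) * (?I - q x) = ?I - q x" .
    have Gq: "\<Gamma> ?z = G ?z * q x" using G1 G by (simp add: \<Gamma>_def right_diff_distrib mult_Id) (simp add: algebra_simps)
    have "adj (\<Gamma> ?z) * \<Gamma> ?z = q x * (adj (G ?z) * G ?z) * q x" by (simp add: Gq pq mult.assoc)
    then have 1: "adj (\<Gamma> ?z) * \<Gamma> ?z = q x" using G pq by (simp add: mult_Id)
    have qI: "q x = ?I - (?I - q x)" by simp
    have "\<Gamma> ?z * adj (\<Gamma> ?z) = G ?z * (q x * q x) * adj (G ?z)" by (simp only: Gq pq(2) adj_mult mult.assoc)
    also have "\<dots> = G ?z * adj (G ?z) - (G ?z * (?I - q x)) * adj (G ?z)"
      unfolding pq(1) using G by (subst qI) (simp add: left_diff_distrib right_diff_distrib mult_Id mult.assoc)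
    also have "\<dots> = ?I - (?I - q x) * adj (G ?z)" by (simp only: G1 G)
    also have "(?I - q x) * adj (G ?z) = ?I - q x" using arg_cong[OF G1, of adj] alg(2)[OF x] by simp
    finally have 2: "\<Gamma> ?z * adj (\<Gamma> ?z) = q x" by simp
    have e1e: "e1 (fst ?z) * e x = e x" by (simp only: e1_def fst_conv distrib_right alg[OF x]) simp
    have "\<Gamma> ?z * e x = G ?z * e x" using e(2)[OF x] by (simp add: Gq mult.assoc)
    also have "\<dots> = (G ?z * e1 (fst ?z)) * e x" by (simp only: mult.assoc e1e)
    also have "\<dots> = s' ?z * e x" unfolding Ge[OF z] by (simp only: s1_def fst_conv distrib_right alg[OF x]) simp
    also have "\<dots> = s' ?z" using s'e[OF z] by simp
    finally show ?thesis using 1 2 by (simp add: unitary_in_def)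
  qed
  show ?thesis
  proof (intro exI[of _ \<Gamma>] conjI ballI impI \<Gamma>c)
    fix x t \<tau> assume x: "x \<in> topspace X" and t: "t \<in> T" and \<tau>: "\<tau> \<in> {0..1::real}"
    show "unitary_in (q x) (\<Gamma> ((x, t), \<tau>))" using \<Gamma>[OF x t \<tau>] by blast
    show "\<Gamma> ((x, t), \<tau>) = U (x, t)" if t: "t \<in> T0"
    proof -
      have "((x, t), \<tau>) \<in> Zg" using x t \<tau> by (simp add: Zg_def P0_def)
      then have "\<Gamma> ((x, t), \<tau>) = g ((x, t), \<tau>)" by (rule \<Gamma>Zg)
      also have "\<dots> = U (x, t)" using \<Gamma>0(5) t \<tau> by (auto simp: g_def Z1_def)
      finally show ?thesis .
    qed
    show "\<Gamma> ((x, t), \<tau>) = \<Gamma>0 ((x, t), \<tau>)" if x: "x \<in> B"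
    proof -
      have "((x, t), \<tau>) \<in> Z1" using x t \<tau> by (simp add: Z1_def)
      then show ?thesis using \<Gamma>Zg[of "((x, t), \<tau>)"] by (simp add: Zg g_def)
    qed
  next
    fix x t assume x: "x \<in> topspace X" and t: "t \<in> T"
    show "\<Gamma> ((x, t), 0) = U (x, t)"
    proof -
      have "((x, t), 0) \<in> Zg" using x t by (simp add: Zg_def tP)
      then have "\<Gamma> ((x, t), 0) = g ((x, t), 0)" by (rule \<Gamma>Zg)
      also have "\<dots> = U (x, t)" using \<Gamma>0(3) by (auto simp: g_def Z1_def)
      finally show ?thesis .
    qed
    show "\<Gamma> ((x, t), 1) * e x = e x"
    proof -
      have z: "((x, t), 1) \<in> Z3" using x t by (simp add: Z3_def tP)
      have "\<Gamma> ((x, t), 1) * e x = s ((x, t), 1)" using \<Gamma>[OF x t, of 1] s'Z z by simp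
      also have "\<dots> = e x"
      proof (cases "((x, t), 1) \<in> Zg")
        case True
        then have "\<Gamma> ((x, t), 1) = g ((x, t), 1)" by (rule \<Gamma>Zg)
        have "((x, t), 1) \<in> Z1 \<or> t \<in> T0" using True unfolding Zg by (auto simp: Z2_def)
        then have "g ((x, t), 1) * e x = e x" using \<Gamma>0(4) U(3)[OF x] by (auto simp: g_def Z1_def)
        then show ?thesis using True by (simp add: s_def)
      qed (simp add: s_def)
      finally show ?thesis .
    qed
  qed
qed

section \<open>Square matrices as finitely supported matrices\<close>

definition ofm :: "nat \<Rightarrow> complex mat \<Rightarrow> fmat" where "ofm n A = fm n (\<lambda>r s. A $$ (r, s))"
definition tom :: "nat \<Rightarrow> fmat \<Rightarrow> complex mat" where "tom n a = mat n n (\<lambda>(r, s). ent a r s)"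

lemma bnd_ofm [simp]: "bnd n (ofm n A)" by (simp add: ofm_def)
lemma ent_ofm: "r < n \<Longrightarrow> s < n \<Longrightarrow> ent (ofm n A) r s = A $$ (r, s)" by (simp add: ofm_def)
lemma tom_carrier [simp]: "tom n a \<in> carrier_mat n n" by (simp add: tom_def)
lemma tom_dim [simp]: "dim_row (tom n a) = n" "dim_col (tom n a) = n" by (simp_all add: tom_def)
lemma tom_index [simp]: "r < n \<Longrightarrow> s < n \<Longrightarrow> tom n a $$ (r, s) = ent a r s" by (simp add: tom_def)

lemma ofm_tom: "bnd n a \<Longrightarrow> ofm n (tom n a) = a"
  by (rule fmat_eqI) (auto simp: ofm_def bnd_ent not_less)

lemma tom_ofm: "A \<in> carrier_mat n n \<Longrightarrow> tom n (ofm n A) = A"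
  by (rule eq_matI) (auto simp: tom_def ent_ofm)

lemma ofm_mult:
  assumes "A \<in> carrier_mat n n" "B \<in> carrier_mat n n" shows "ofm n (A * B) = ofm n A * ofm n B"
proof (rule fmat_eqI)
  fix i j
  show "ent (ofm n (A * B)) i j = ent (ofm n A * ofm n B) i j"
  proof (cases "i < n \<and> j < n")
    case True
    have "ent (ofm n A * ofm n B) i j = (\<Sum>l<n. A $$ (i, l) * B $$ (l, j))"
      unfolding ent_mult[OF bnd_ofm] using True by (intro sum.cong) (auto simp: ent_ofm)
    also have "\<dots> = (A * B) $$ (i, j)"
      using True assms by (auto simp: scalar_prod_def lessThan_atLeast0 intro!: sum.cong)
    finally show ?thesis using True by (simp add: ent_ofm)
  next
    case False
    then show ?thesis using bnd_ent[OF bnd_ofm, of n i j] bnd_ent[OF bnd_mult[OF bnd_ofm bnd_ofm], of n i j] by (auto simp: not_less)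
  qed
qed

lemma ofm_one: "ofm n (1\<^sub>m n) = Id n"
  by (rule fmat_eqI) (auto simp: ofm_def ent_Id)

lemma tom_mult: "bnd n a \<Longrightarrow> bnd n b \<Longrightarrow> tom n (a * b) = tom n a * tom n b"
  using ofm_mult[of "tom n a" n "tom n b"] tom_ofm[OF mult_carrier_mat[OF tom_carrier tom_carrier], of n a b] by (simp add: ofm_tom)

lemma tom_Id: "tom n (Id n) = 1\<^sub>m n"
  by (rule eq_matI) (auto simp: tom_def ent_Id)

lemma mat_adjoint_carrier: "A \<in> carrier_mat n n \<Longrightarrow> mat_adjoint A \<in> carrier_mat n n"
  by (auto simp: mat_adjoint_def mat_of_rows_def)

lemma mat_adjoint_index:
  "A \<in> carrier_mat n n \<Longrightarrow> i < n \<Longrightarrow> j < n \<Longrightarrow> mat_adjoint A $$ (i, j) = cnj (A $$ (j, i))"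
  by (auto simp: mat_adjoint_def mat_of_rows_index)

lemma ofm_adjoint: "A \<in> carrier_mat n n \<Longrightarrow> ofm n (mat_adjoint A) = adj (ofm n A)"
  by (rule fmat_eqI) (auto simp: ofm_def mat_adjoint_index)

lemma trace_commute:
  assumes "bnd n a" "bnd n b"
  shows "(\<Sum>i<n. ent (a * b) i i) = (\<Sum>i<n. ent (b * a) i i)"
proof -
  have "(\<Sum>i<n. ent (a * b) i i) = (\<Sum>i<n. \<Sum>l<n. ent a i l * ent b l i)" by (simp add: ent_mult[OF assms(1)])
  also have "\<dots> = (\<Sum>l<n. \<Sum>i<n. ent a i l * ent b l i)" by (rule sum.swap)
  also have "\<dots> = (\<Sum>i<n. ent (b * a) i i)" by (simp add: ent_mult[OF assms(2)] mult.commute)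
  finally show ?thesis .
qed

text \<open>The eigenvalues of \<open>A* A\<close> bound its trace, which is the sum of the squared moduli of the
  entries of \<open>A\<close>.\<close>

lemma entries_le_eigenvalues:
  assumes A: "A \<in> carrier_mat n n"
    and ev: "\<And>k. eigenvalue (mat_adjoint A * A) k \<Longrightarrow> Re k \<le> c"
    and rs: "r < n" "s < n"
  shows "(cmod (A $$ (r, s)))\<^sup>2 \<le> real n * c"
proof -
  define H where "H = mat_adjoint A * A"
  have H: "H \<in> carrier_mat n n" using A mat_adjoint_carrier[OF A] by (simp add: H_def)
  obtain es where es: "char_poly H = (\<Prod>a\<leftarrow>es. [:- a, 1:])" "length es = n" using char_poly_factorized[OF H] by blast
  obtain B P Q where "schur_decomposition H es = (B, P, Q)" by (metis prod_cases3)
  from schur_decomposition[OF H es(1) this]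
  have w: "similar_mat_wit H B P Q" and diag: "diag_mat B = es" by auto
  note wd = similar_mat_witD2[OF H w]
  have B: "B \<in> carrier_mat n n" and P: "P \<in> carrier_mat n n" and Q: "Q \<in> carrier_mat n n"
    and QP: "Q * P = 1\<^sub>m n" and HPBQ: "H = P * B * Q" using wd by auto
  have "ofm n H = ofm n P * (ofm n B * ofm n Q)"
    unfolding HPBQ using B P Q by (simp add: ofm_mult mult.assoc)
  then have "(\<Sum>i<n. ent (ofm n H) i i) = (\<Sum>i<n. ent ((ofm n B * ofm n Q) * ofm n P) i i)"
    by (simp add: trace_commute)
  also have "(ofm n B * ofm n Q) * ofm n P = ofm n B * ofm n (Q * P)" using Q P by (simp add: ofm_mult mult.assoc)
  also have "\<dots> = ofm n B" by (simp add: QP ofm_one mult_Id)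
  finally have "(\<Sum>i<n. H $$ (i, i)) = (\<Sum>i<n. B $$ (i, i))" by (simp add: ent_ofm)
  moreover have "Re (B $$ (i, i)) \<le> c" if i: "i < n" for i
  proof -
    have "B $$ (i, i) = es ! i" using diag B i by (auto simp: diag_mat_def)
    then have "B $$ (i, i) \<in> set es" using es(2) i by simp
    then have "poly (char_poly H) (B $$ (i, i)) = 0"
      unfolding es(1) by (induction es) auto
    then have "eigenvalue H (B $$ (i, i))" using eigenvalue_root_char_poly[OF H] by blast
    then show ?thesis using ev by (simp add: H_def)
  qed
  ultimately have "Re (\<Sum>i<n. H $$ (i, i)) \<le> (\<Sum>i<n. c)" by (simp only: Re_sum) (intro sum_mono, simp)
  moreover have "H $$ (i, i) = of_real (\<Sum>k<n. (cmod (A $$ (k, i)))\<^sup>2)" if i: "i < n" for i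
  proof -
    have "H $$ (i, i) = (\<Sum>k<n. mat_adjoint A $$ (i, k) * A $$ (k, i))"
      unfolding H_def using i A mat_adjoint_carrier[OF A] by (auto simp: scalar_prod_def lessThan_atLeast0 intro!: sum.cong)
    also have "\<dots> = (\<Sum>k<n. of_real ((cmod (A $$ (k, i)))\<^sup>2))"
      by (rule sum.cong) (use i A in \<open>simp_all add: mat_adjoint_index complex_norm_square mult.commute del: of_real_power\<close>)
    finally show ?thesis by simp
  qed
  ultimately have "(\<Sum>i<n. \<Sum>k<n. (cmod (A $$ (k, i)))\<^sup>2) \<le> real n * c" by (simp add: Re_sum)
  moreover have "(cmod (A $$ (r, s)))\<^sup>2 \<le> (\<Sum>k<n. (cmod (A $$ (k, s)))\<^sup>2)"
    using rs by (intro member_le_sum[of r "{..<n}" "\<lambda>k. (cmod (A $$ (k, s)))\<^sup>2"]) auto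
  moreover have "\<dots> \<le> (\<Sum>i<n. \<Sum>k<n. (cmod (A $$ (k, i)))\<^sup>2)"
    using rs by (intro member_le_sum[of s "{..<n}" "\<lambda>i. \<Sum>k<n. (cmod (A $$ (k, i)))\<^sup>2"]) (auto intro: sum_nonneg)
  ultimately show ?thesis by linarith
qed

text \<open>The eigenvalues of \<open>A* A\<close> are real, because \<open>A* A v = k v\<close> gives \<open>|A v|\<^sup>2 = k |v|\<^sup>2\<close>.\<close>

lemma eigenvalue_adjoint_square:
  assumes A: "A \<in> carrier_mat n n" and ev: "eigenvalue (mat_adjoint A * A) k"
  obtains V \<mu> where "bnd n V" "V \<noteq> 0" "k = complex_of_real \<mu>" "adj (ofm n A) * ofm n A * V = \<mu> *\<^sub>R V"
proof -
  define H where "H = mat_adjoint A * A"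
  have H: "H \<in> carrier_mat n n" using A mat_adjoint_carrier[OF A] by (simp add: H_def)
  obtain v where v: "v \<in> carrier_vec n" "v \<noteq> 0\<^sub>v n" "H *\<^sub>v v = k \<cdot>\<^sub>v v"
    using ev H unfolding H_def[symmetric] eigenvalue_def eigenvector_def by auto
  have n: "0 < n" using v(1,2) by (cases n) auto
  define V where "V = fm n (\<lambda>i j. if j = 0 then vec_index v i else 0)"
  have V: "bnd n V" by (simp add: V_def)
  have VE: "V * E0 = V" by (rule fmat_eqI) (auto simp: mult_unit_mat_ent V_def)
  have V0: "V \<noteq> 0"
  proof
    assume "V = 0"
    have "vec_index v i = 0" if "i < n" for i
    proof -
      have "ent V i 0 = 0" by (simp only: \<open>V = 0\<close> ent_0)
      then show ?thesis using that n by (simp add: V_def)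
    qed
    then have "v = 0\<^sub>v n" by (intro eq_vecI) (use v(1) in auto)
    then show False using v(2) by blast
  qed
  have HV: "ofm n H * V = V * unit_mat 0 0 k"
  proof (rule fmat_eqI)
    fix i j
    show "ent (ofm n H * V) i j = ent (V * unit_mat 0 0 k) i j"
    proof (cases "i < n \<and> j = 0")
      case True
      have "ent (ofm n H * V) i 0 = (\<Sum>l<n. H $$ (i, l) * vec_index v l)"
        unfolding ent_mult[OF bnd_ofm] using True n by (intro sum.cong) (auto simp: V_def ent_ofm)
      also have "\<dots> = vec_index (H *\<^sub>v v) i"
        using True v(1) H by (auto simp: scalar_prod_def lessThan_atLeast0 intro!: sum.cong)
      also have "\<dots> = k * vec_index v i" using v True by simp
      finally show ?thesis using True n by (simp add: mult_unit_mat_ent V_def mult.commute)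
    next
      case False
      then show ?thesis
        unfolding ent_mult[OF bnd_ofm] mult_unit_mat_ent by (auto simp: V_def ofm_def intro!: sum.neutral)
    qed
  qed
  define Af where "Af = ofm n A"
  have Hf: "ofm n H = adj Af * Af" unfolding H_def Af_def using A mat_adjoint_carrier[OF A] by (simp add: ofm_mult ofm_adjoint)
  have AVE: "(Af * V) * E0 = Af * V" using VE by (simp add: mult.assoc)
  have "(norm (Af * V))\<^sup>2 *\<^sub>R E0 = adj V * (adj Af * Af * V)"
    using adj_mult_vector[OF AVE] by (simp add: mult.assoc)
  also have "\<dots> = (norm V)\<^sup>2 *\<^sub>R E0 * unit_mat 0 0 k"
    using HV adj_mult_vector[OF VE] by (simp add: Hf mult.assoc[symmetric])
  finally have "(norm (Af * V))\<^sup>2 *\<^sub>R E0 = (norm V)\<^sup>2 *\<^sub>R unit_mat 0 0 k" by simp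
  from arg_cong[OF this, of "\<lambda>a. ent a 0 0"]
  have "complex_of_real ((norm (Af * V))\<^sup>2) = complex_of_real ((norm V)\<^sup>2) * k" by (simp add: scaleR_conv_of_real)
  moreover have "complex_of_real ((norm V)\<^sup>2) \<noteq> 0" using V0 by simp
  ultimately have k: "k = complex_of_real ((norm (Af * V))\<^sup>2 / (norm V)\<^sup>2)" by (simp add: field_simps)
  define \<mu> where "\<mu> = (norm (Af * V))\<^sup>2 / (norm V)\<^sup>2"
  have "unit_mat 0 0 (complex_of_real \<mu>) = \<mu> *\<^sub>R E0" by (rule fmat_eqI) (simp add: scaleR_conv_of_real)
  then have "V * unit_mat 0 0 k = \<mu> *\<^sub>R V" using VE by (simp add: k \<mu>_def[symmetric])
  then show ?thesis using that[OF V V0 k[folded \<mu>_def]] HV Hf by (simp add: Af_def)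
qed

section \<open>The stages of a recursive subhomogeneous algebra\<close>

lemma C_alg_carrier: "f \<in> carrier (C_alg X n) \<longleftrightarrow> f \<in> extensional (topspace X) \<and>
    (\<forall>x\<in>topspace X. f x \<in> carrier_mat n n) \<and> (\<forall>i<n. \<forall>j<n. continuous_map X euclidean (\<lambda>x. f x $$ (i, j)))"
  by (auto simp: C_alg_def PiE_def Pi_def)

locale rsh =
  fixes D :: "'a rsh_data"
  assumes D: "rsh_decomposition D"
begin

abbreviation "X j \<equiv> space D j"
abbreviation "n j \<equiv> msize D j"
abbreviation "St k \<equiv> rsh_stage D k"
abbreviation "R k \<equiv> rsh_carrier D k"

lemma X: "j \<le> len D \<Longrightarrow> compact_space (X j) \<and> Hausdorff_space (X j) \<and> 1 \<le> n j"
  using D by (simp add: rsh_decomposition_def)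

lemma bdry: "Suc k \<le> len D \<Longrightarrow> closedin (X (Suc k)) (bdry D (Suc k))"
  using D unfolding rsh_decomposition_def by (metis Suc_le_eq atLeastAtMost_iff le_zero_eq not_less_eq_eq One_nat_def Suc_le_mono zero_le)

lemma topspace_bdry: "Suc k \<le> len D \<Longrightarrow> topspace (subtopology (X (Suc k)) (bdry D (Suc k))) = bdry D (Suc k)"
  using closedin_subset[OF bdry] by auto

lemma attach: "Suc k \<le> len D \<Longrightarrow> attach D (Suc k) \<in> unital_star_hom (St k) (C_bdry D (Suc k))"
  using D unfolding rsh_decomposition_def by (metis atLeastAtMost_iff diff_Suc_1 le_add1 plus_1_eq_Suc)

lemma stage_sel:
  "carrier (St k) = R k"
  "a \<otimes>\<^bsub>St k\<^esub> b = (\<lambda>i\<in>{..k}. \<lambda>x\<in>topspace (X i). a i x * b i x)"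
  "\<one>\<^bsub>St k\<^esub> = (\<lambda>i\<in>{..k}. \<lambda>x\<in>topspace (X i). 1\<^sub>m (n i))"
  "\<zero>\<^bsub>St k\<^esub> = (\<lambda>i\<in>{..k}. \<lambda>x\<in>topspace (X i). 0\<^sub>m (n i) (n i))"
  "a \<oplus>\<^bsub>St k\<^esub> b = (\<lambda>i\<in>{..k}. \<lambda>x\<in>topspace (X i). a i x + b i x)"
  "c \<odot>\<^bsub>St k\<^esub> a = (\<lambda>i\<in>{..k}. \<lambda>x\<in>topspace (X i). c \<cdot>\<^sub>m a i x)"
  "star (St k) a = (\<lambda>i\<in>{..k}. \<lambda>x\<in>topspace (X i). mat_adjoint (a i x))"
  by (simp_all add: rsh_stage_def sum_alg_def C_alg_def)

text \<open>The tuples in \<open>C\<^sub>0 \<oplus> \<dots> \<oplus> C\<^sub>k\<close>, of which those in \<open>R k\<close> satisfy the pullback conditions.\<close>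

definition tup :: "nat \<Rightarrow> (nat \<Rightarrow> 'a \<Rightarrow> complex mat) set" where
  "tup k = {a \<in> extensional {..k}. \<forall>j\<le>k. a j \<in> carrier (C_alg (X j) (n j))}"

lemma carrier_sum_alg: "carrier (sum_alg {..k} (C_stage D)) = tup k"
  by (auto simp: sum_alg_def tup_def PiE_def Pi_def)

lemma R_tup: "a \<in> R k \<Longrightarrow> a \<in> tup k"
  by (cases k) (simp_all only: rsh_carrier.simps carrier_sum_alg mem_Collect_eq)

lemma R_0: "R 0 = tup 0"
  by (simp only: rsh_carrier.simps carrier_sum_alg)

lemma tup_mat: "a \<in> tup k \<Longrightarrow> j \<le> k \<Longrightarrow> x \<in> topspace (X j) \<Longrightarrow> a j x \<in> carrier_mat (n j) (n j)"
  by (auto simp: tup_def C_alg_carrier)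

lemmas R_mat = tup_mat[OF R_tup]

lemma tup_dim:
  assumes "a \<in> tup k" "j \<le> k" "x \<in> topspace (X j)"
  shows "dim_row (a j x) = n j" "dim_col (a j x) = n j"
  using tup_mat[OF assms] by auto

lemma tup_cont: "a \<in> tup k \<Longrightarrow> j \<le> k \<Longrightarrow> r < n j \<Longrightarrow> s < n j \<Longrightarrow> continuous_map (X j) euclidean (\<lambda>x. a j x $$ (r, s))"
  by (auto simp: tup_def C_alg_carrier)

lemma tup_eqI:
  assumes "a \<in> tup k" "b \<in> tup k" "\<And>j x. j \<le> k \<Longrightarrow> x \<in> topspace (X j) \<Longrightarrow> a j x = b j x"
  shows "a = b"
proof (rule extensionalityI[of _ "{..k}"])
  show "a \<in> extensional {..k}" "b \<in> extensional {..k}" using assms(1,2) by (auto simp: tup_def)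
  fix j assume "j \<in> {..k}"
  then show "a j = b j"
    using assms by (intro extensionalityI[of _ "topspace (X j)"]) (auto simp: tup_def C_alg_carrier)
qed

lemma tupI:
  assumes "\<And>j x. j \<le> k \<Longrightarrow> x \<in> topspace (X j) \<Longrightarrow> f j x \<in> carrier_mat (n j) (n j)"
    "\<And>j r s. j \<le> k \<Longrightarrow> r < n j \<Longrightarrow> s < n j \<Longrightarrow> continuous_map (X j) euclidean (\<lambda>x. f j x $$ (r, s))"
  shows "(\<lambda>j\<in>{..k}. \<lambda>x\<in>topspace (X j). f j x) \<in> tup k"
proof -
  have "continuous_map (X j) euclidean (\<lambda>x. (\<lambda>x\<in>topspace (X j). f j x) x $$ (r, s))"
    if "j \<le> k" "r < n j" "s < n j" for j r s
    by (rule continuous_map_eq[OF assms(2)[OF that]]) simp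
  then show ?thesis using assms(1) by (auto simp: tup_def C_alg_carrier)
qed

lemma mat_mult_index: "A \<in> carrier_mat m m \<Longrightarrow> B \<in> carrier_mat m m \<Longrightarrow> r < m \<Longrightarrow> s < m \<Longrightarrow>
    (A * B) $$ (r, s) = (\<Sum>l<m. A $$ (r, l) * B $$ (l, s))"
  by (auto simp: scalar_prod_def lessThan_atLeast0 intro!: sum.cong)

lemma tup_closed:
  assumes a: "a \<in> tup k" and b: "b \<in> tup k"
  shows "a \<otimes>\<^bsub>St k\<^esub> b \<in> tup k" "a \<oplus>\<^bsub>St k\<^esub> b \<in> tup k" "c \<odot>\<^bsub>St k\<^esub> a \<in> tup k" "star (St k) a \<in> tup k" "\<one>\<^bsub>St k\<^esub> \<in> tup k"
proof -
  note m = tup_mat[OF a] tup_mat[OF b] and ct = tup_cont[OF a] tup_cont[OF b]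
    and d = tup_dim[OF a] tup_dim[OF b]
  show "a \<otimes>\<^bsub>St k\<^esub> b \<in> tup k" unfolding stage_sel
  proof (rule tupI)
    fix j r s assume j: "j \<le> k" "r < n j" "s < n j"
    have "continuous_map (X j) euclidean (\<lambda>x. \<Sum>l<n j. a j x $$ (r, l) * b j x $$ (l, s))"
      using j by (intro continuous_map_sum continuous_map_bilinear[OF bounded_bilinear_mult] ct) auto
    then show "continuous_map (X j) euclidean (\<lambda>x. (a j x * b j x) $$ (r, s))"
      by (rule continuous_map_eq) (use j in \<open>simp add: mat_mult_index[OF m(1) m(2)] del: index_mult_mat\<close>)
  qed (rule mult_carrier_mat[OF m])
  show "a \<oplus>\<^bsub>St k\<^esub> b \<in> tup k" unfolding stage_sel
  proof (rule tupI)
    fix j r s assume j: "j \<le> k" "r < n j" "s < n j"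
    have "continuous_map (X j) euclidean (\<lambda>x. a j x $$ (r, s) + b j x $$ (r, s))"
      using j by (intro continuous_map_add ct)
    then show "continuous_map (X j) euclidean (\<lambda>x. (a j x + b j x) $$ (r, s))"
      by (rule continuous_map_eq) (use j in \<open>simp add: d\<close>)
  qed (use m in auto)
  show "c \<odot>\<^bsub>St k\<^esub> a \<in> tup k" unfolding stage_sel
  proof (rule tupI)
    fix j r s assume j: "j \<le> k" "r < n j" "s < n j"
    have "continuous_map (X j) euclidean (\<lambda>x. c * a j x $$ (r, s))"
      using j by (intro continuous_map_bilinear[OF bounded_bilinear_mult] ct) simp
    then show "continuous_map (X j) euclidean (\<lambda>x. (c \<cdot>\<^sub>m a j x) $$ (r, s))"
      by (rule continuous_map_eq) (use j in \<open>simp add: d\<close>)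
  qed (use m in auto)
  show "star (St k) a \<in> tup k" unfolding stage_sel
  proof (rule tupI)
    fix j r s assume j: "j \<le> k" "r < n j" "s < n j"
    have "continuous_map (X j) euclidean (\<lambda>x. cnj (a j x $$ (s, r)))"
      by (rule continuous_map_fmat_compose[OF ct(1)]) (use j in \<open>auto intro: continuous_intros\<close>)
    then show "continuous_map (X j) euclidean (\<lambda>x. mat_adjoint (a j x) $$ (r, s))"
      by (rule continuous_map_eq) (use j in \<open>simp add: mat_adjoint_index[OF m(1)]\<close>)
  qed (rule mat_adjoint_carrier[OF m(1)])
  show "\<one>\<^bsub>St k\<^esub> \<in> tup k" unfolding stage_sel
    by (rule tupI) auto
qed

text \<open>The homomorphism from the stage \<open>k\<close> to the functions on the closed subset of \<open>X\<^sub>k\<^sub>+\<^sub>1\<close>.\<close>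

definition \<alpha> :: "nat \<Rightarrow> (nat \<Rightarrow> 'a \<Rightarrow> complex mat) \<Rightarrow> 'a \<Rightarrow> complex mat" where
  "\<alpha> k = attach D (Suc k)"

lemma R_Suc_iff: assumes "Suc k \<le> len D"
  shows "a \<in> R (Suc k) \<longleftrightarrow> a \<in> tup (Suc k) \<and> restrict a {..k} \<in> R k \<and>
    (\<forall>y\<in>bdry D (Suc k). \<alpha> k (restrict a {..k}) y = a (Suc k) y)"
proof -
  have e: "\<alpha> k c \<in> extensional (bdry D (Suc k))" if "c \<in> R k" for c
  proof -
    have "\<alpha> k c \<in> carrier (C_bdry D (Suc k))"
      using attach[OF assms] that unfolding unital_star_hom_def Ring.ring_hom_def stage_sel(1) \<alpha>_def by blast
    then show ?thesis unfolding C_alg_carrier topspace_bdry[OF assms] by blast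
  qed
  have "\<alpha> k c = restrict f (bdry D (Suc k)) \<longleftrightarrow> (\<forall>y\<in>bdry D (Suc k). \<alpha> k c y = f y)" if "c \<in> R k" for c f
  proof
    assume "\<forall>y\<in>bdry D (Suc k). \<alpha> k c y = f y"
    then show "\<alpha> k c = restrict f (bdry D (Suc k))"
      by (intro extensionalityI[OF e[OF that] restrict_extensional]) simp
  qed simp
  then show ?thesis
    unfolding rsh_carrier.simps carrier_sum_alg \<alpha>_def[symmetric] mem_Collect_eq by blast
qed

context
  fixes k assumes k: "Suc k \<le> len D"
begin

lemma \<alpha>_hom:
  assumes a: "a \<in> R k" and b: "b \<in> R k" and y: "y \<in> bdry D (Suc k)"
  shows "\<alpha> k (a \<otimes>\<^bsub>St k\<^esub> b) y = \<alpha> k a y * \<alpha> k b y" "\<alpha> k (a \<oplus>\<^bsub>St k\<^esub> b) y = \<alpha> k a y + \<alpha> k b y"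
    "\<alpha> k (c \<odot>\<^bsub>St k\<^esub> a) y = c \<cdot>\<^sub>m \<alpha> k a y" "\<alpha> k (star (St k) a) y = mat_adjoint (\<alpha> k a y)"
    "\<alpha> k (\<one>\<^bsub>St k\<^esub>) y = 1\<^sub>m (n (Suc k))" "\<alpha> k a y \<in> carrier_mat (n (Suc k)) (n (Suc k))"
proof -
  have yt: "y \<in> topspace (X (Suc k))" using closedin_subset[OF bdry[OF k]] y by blast
  note h = attach[OF k, unfolded unital_star_hom_def Ring.ring_hom_def stage_sel(1), folded \<alpha>_def]
  have h1: "\<alpha> k (a \<otimes>\<^bsub>St k\<^esub> b) = \<alpha> k a \<otimes>\<^bsub>C_bdry D (Suc k)\<^esub> \<alpha> k b" "\<alpha> k (a \<oplus>\<^bsub>St k\<^esub> b) = \<alpha> k a \<oplus>\<^bsub>C_bdry D (Suc k)\<^esub> \<alpha> k b"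
    "\<alpha> k (c \<odot>\<^bsub>St k\<^esub> a) = c \<odot>\<^bsub>C_bdry D (Suc k)\<^esub> \<alpha> k a" "\<alpha> k (star (St k) a) = star (C_bdry D (Suc k)) (\<alpha> k a)"
    "\<alpha> k (\<one>\<^bsub>St k\<^esub>) = \<one>\<^bsub>C_bdry D (Suc k)\<^esub>" "\<alpha> k a \<in> carrier (C_bdry D (Suc k))"
    using h a b by blast+
  show "\<alpha> k (a \<otimes>\<^bsub>St k\<^esub> b) y = \<alpha> k a y * \<alpha> k b y" "\<alpha> k (a \<oplus>\<^bsub>St k\<^esub> b) y = \<alpha> k a y + \<alpha> k b y"
    "\<alpha> k (c \<odot>\<^bsub>St k\<^esub> a) y = c \<cdot>\<^sub>m \<alpha> k a y" "\<alpha> k (star (St k) a) y = mat_adjoint (\<alpha> k a y)"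
    "\<alpha> k (\<one>\<^bsub>St k\<^esub>) y = 1\<^sub>m (n (Suc k))"
    unfolding h1 using y yt by (simp_all add: C_alg_def)
  show "\<alpha> k a y \<in> carrier_mat (n (Suc k)) (n (Suc k))" using h1(6) y yt by (simp add: C_alg_carrier)
qed

lemma \<alpha>_cont:
  assumes a: "a \<in> R k" and rs: "r < n (Suc k)" "s < n (Suc k)"
  shows "continuous_map (subtopology (X (Suc k)) (bdry D (Suc k))) euclidean (\<lambda>y. \<alpha> k a y $$ (r, s))"
proof -
  have "\<alpha> k a \<in> carrier (C_bdry D (Suc k))"
    using attach[OF k] a unfolding unital_star_hom_def Ring.ring_hom_def stage_sel(1) \<alpha>_def by blast
  then show ?thesis using rs by (simp add: C_alg_carrier)
qed

end

lemma restrict_ops: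
  "restrict (a \<otimes>\<^bsub>St (Suc k)\<^esub> b) {..k} = restrict a {..k} \<otimes>\<^bsub>St k\<^esub> restrict b {..k}"
  "restrict (a \<oplus>\<^bsub>St (Suc k)\<^esub> b) {..k} = restrict a {..k} \<oplus>\<^bsub>St k\<^esub> restrict b {..k}"
  "restrict (c \<odot>\<^bsub>St (Suc k)\<^esub> a) {..k} = c \<odot>\<^bsub>St k\<^esub> restrict a {..k}"
  "restrict (star (St (Suc k)) a) {..k} = star (St k) (restrict a {..k})"
  "restrict (\<one>\<^bsub>St (Suc k)\<^esub>) {..k} = \<one>\<^bsub>St k\<^esub>"
  by (auto simp: stage_sel restrict_def fun_eq_iff)

lemma R_closed_aux:
  "k \<le> len D \<Longrightarrow> (\<forall>a\<in>R k. \<forall>b\<in>R k. \<forall>c. a \<otimes>\<^bsub>St k\<^esub> b \<in> R k \<and> a \<oplus>\<^bsub>St k\<^esub> b \<in> R k \<and> c \<odot>\<^bsub>St k\<^esub> a \<in> R k \<and> star (St k) a \<in> R k)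
    \<and> \<one>\<^bsub>St k\<^esub> \<in> R k"
proof (induction k)
  case 0
  have o: "\<one>\<^bsub>St 0\<^esub> \<in> tup 0" unfolding stage_sel by (rule tupI) auto
  have c: "a \<otimes>\<^bsub>St 0\<^esub> b \<in> tup 0 \<and> a \<oplus>\<^bsub>St 0\<^esub> b \<in> tup 0 \<and> c \<odot>\<^bsub>St 0\<^esub> a \<in> tup 0 \<and> star (St 0) a \<in> tup 0"
    if "a \<in> tup 0" "b \<in> tup 0" for a b c by (intro conjI tup_closed[OF that])
  show ?case unfolding R_0 by (rule conjI[OF _ o]) (intro ballI allI c)
next
  case (Suc k)
  then have k: "Suc k \<le> len D" "k \<le> len D" by simp_all
  note IH = Suc.IH[OF k(2)]
  have yt: "y \<in> topspace (X (Suc k))" if "y \<in> bdry D (Suc k)" for y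
    using closedin_subset[OF bdry[OF k(1)]] that by blast
  have "a \<otimes>\<^bsub>St (Suc k)\<^esub> b \<in> R (Suc k) \<and> a \<oplus>\<^bsub>St (Suc k)\<^esub> b \<in> R (Suc k) \<and> c \<odot>\<^bsub>St (Suc k)\<^esub> a \<in> R (Suc k) \<and> star (St (Suc k)) a \<in> R (Suc k)"
    if "a \<in> R (Suc k)" "b \<in> R (Suc k)" for a b c
  proof -
    have a: "a \<in> tup (Suc k)" "restrict a {..k} \<in> R k" "\<And>y. y \<in> bdry D (Suc k) \<Longrightarrow> \<alpha> k (restrict a {..k}) y = a (Suc k) y"
      and b: "b \<in> tup (Suc k)" "restrict b {..k} \<in> R k" "\<And>y. y \<in> bdry D (Suc k) \<Longrightarrow> \<alpha> k (restrict b {..k}) y = b (Suc k) y"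
      using that unfolding R_Suc_iff[OF k(1)] by blast+
    note h = \<alpha>_hom[OF k(1) a(2) b(2)]
    have r: "restrict a {..k} \<otimes>\<^bsub>St k\<^esub> restrict b {..k} \<in> R k" "restrict a {..k} \<oplus>\<^bsub>St k\<^esub> restrict b {..k} \<in> R k"
      "c \<odot>\<^bsub>St k\<^esub> restrict a {..k} \<in> R k" "star (St k) (restrict a {..k}) \<in> R k" using IH a(2) b(2) by blast+
    have v: "(a \<otimes>\<^bsub>St (Suc k)\<^esub> b) (Suc k) y = a (Suc k) y * b (Suc k) y" "(a \<oplus>\<^bsub>St (Suc k)\<^esub> b) (Suc k) y = a (Suc k) y + b (Suc k) y"
      "(c \<odot>\<^bsub>St (Suc k)\<^esub> a) (Suc k) y = c \<cdot>\<^sub>m a (Suc k) y" "(star (St (Suc k)) a) (Suc k) y = mat_adjoint (a (Suc k) y)"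
      if "y \<in> bdry D (Suc k)" for y using yt[OF that] by (simp_all add: stage_sel)
    show ?thesis
      unfolding R_Suc_iff[OF k(1)] restrict_ops
      using tup_closed[OF a(1) b(1)] r h(1-4) a(3) b(3) v by simp
  qed
  moreover have "\<one>\<^bsub>St (Suc k)\<^esub> \<in> R (Suc k)"
    unfolding R_Suc_iff[OF k(1)] restrict_ops
  proof (intro conjI ballI)
    show "\<one>\<^bsub>St (Suc k)\<^esub> \<in> tup (Suc k)" unfolding stage_sel by (rule tupI) auto
    show o: "\<one>\<^bsub>St k\<^esub> \<in> R k" using IH by blast
    show "\<alpha> k \<one>\<^bsub>St k\<^esub> y = \<one>\<^bsub>St (Suc k)\<^esub> (Suc k) y" if "y \<in> bdry D (Suc k)" for y
      using \<alpha>_hom(5)[OF k(1) o o that] yt[OF that] by (simp add: stage_sel)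
  qed
  ultimately show ?case by blast
qed

lemma R_closed:
  assumes "k \<le> len D" "a \<in> R k" "b \<in> R k"
  shows "a \<otimes>\<^bsub>St k\<^esub> b \<in> R k" "a \<oplus>\<^bsub>St k\<^esub> b \<in> R k" "c \<odot>\<^bsub>St k\<^esub> a \<in> R k" "star (St k) a \<in> R k"
  using R_closed_aux[OF assms(1)] assms(2,3) by blast+

lemma R_one: "k \<le> len D \<Longrightarrow> \<one>\<^bsub>St k\<^esub> \<in> R k" using R_closed_aux by blast

lemma R_zero: assumes "k \<le> len D" shows "\<zero>\<^bsub>St k\<^esub> \<in> R k"
proof -
  have "0 \<odot>\<^bsub>St k\<^esub> \<one>\<^bsub>St k\<^esub> = \<zero>\<^bsub>St k\<^esub>"
    by (auto simp: stage_sel restrict_def fun_eq_iff intro!: eq_matI)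
  then show ?thesis using R_closed(3)[OF assms R_one[OF assms] R_one[OF assms], of 0] by simp
qed

lemma stage_val:
  assumes "j \<le> k" "x \<in> topspace (X j)"
  shows "(a \<otimes>\<^bsub>St k\<^esub> b) j x = a j x * b j x" "(a \<oplus>\<^bsub>St k\<^esub> b) j x = a j x + b j x"
    "(c \<odot>\<^bsub>St k\<^esub> a) j x = c \<cdot>\<^sub>m a j x" "star (St k) a j x = mat_adjoint (a j x)"
    "\<one>\<^bsub>St k\<^esub> j x = 1\<^sub>m (n j)" "\<zero>\<^bsub>St k\<^esub> j x = 0\<^sub>m (n j) (n j)"
  using assms by (simp_all add: stage_sel)

text \<open>The stages are closed under pointwise inverses, because a unital homomorphism preserves inverses:
  an elementary case of the spectral permanence of C*-subalgebras.\<close>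

lemma R_inverse:
  "k \<le> len D \<Longrightarrow> a \<in> R k \<Longrightarrow> b \<in> tup k \<Longrightarrow>
   (\<And>j x. j \<le> k \<Longrightarrow> x \<in> topspace (X j) \<Longrightarrow> a j x * b j x = 1\<^sub>m (n j) \<and> b j x * a j x = 1\<^sub>m (n j)) \<Longrightarrow> b \<in> R k"
proof (induction k arbitrary: a b)
  case 0
  then show ?case by (simp only: R_0)
next
  case (Suc k)
  have k: "Suc k \<le> len D" "k \<le> len D" using Suc.prems(1) by simp_all
  have a: "a \<in> tup (Suc k)" "restrict a {..k} \<in> R k" "\<And>y. y \<in> bdry D (Suc k) \<Longrightarrow> \<alpha> k (restrict a {..k}) y = a (Suc k) y"
    using Suc.prems(2) unfolding R_Suc_iff[OF k(1)] by blast+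
  have bt: "restrict b {..k} \<in> tup k" using Suc.prems(3) by (auto simp: tup_def)
  have rb: "restrict b {..k} \<in> R k"
    by (rule Suc.IH[OF k(2) a(2) bt]) (use Suc.prems(4) in auto)
  have one: "restrict a {..k} \<otimes>\<^bsub>St k\<^esub> restrict b {..k} = \<one>\<^bsub>St k\<^esub>"
    by (rule tup_eqI[of _ k]) (use R_tup R_closed[OF k(2) a(2) rb] R_one[OF k(2)] Suc.prems(4) in \<open>auto simp: stage_val\<close>)
  have "\<alpha> k (restrict b {..k}) y = b (Suc k) y" if y: "y \<in> bdry D (Suc k)" for y
  proof -
    have yt: "y \<in> topspace (X (Suc k))" using closedin_subset[OF bdry[OF k(1)]] y by blast
    let ?m = "n (Suc k)"
    have c: "a (Suc k) y \<in> carrier_mat ?m ?m" "b (Suc k) y \<in> carrier_mat ?m ?m" "\<alpha> k (restrict b {..k}) y \<in> carrier_mat ?m ?m"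
      using tup_mat[OF a(1) _ yt] tup_mat[OF Suc.prems(3) _ yt] \<alpha>_hom(6)[OF k(1) rb rb y] by auto
    have 1: "a (Suc k) y * \<alpha> k (restrict b {..k}) y = 1\<^sub>m ?m"
      using \<alpha>_hom(1)[OF k(1) a(2) rb y] \<alpha>_hom(5)[OF k(1) rb rb y] a(3)[OF y] by (simp add: one)
    have 2: "b (Suc k) y * a (Suc k) y = 1\<^sub>m ?m" using Suc.prems(4)[of "Suc k" y] yt by simp
    have "\<alpha> k (restrict b {..k}) y = b (Suc k) y * a (Suc k) y * \<alpha> k (restrict b {..k}) y" using 2 c by simp
    also have "\<dots> = b (Suc k) y * (a (Suc k) y * \<alpha> k (restrict b {..k}) y)" using c by (simp add: assoc_mult_mat[of _ ?m ?m _ ?m _ ?m])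
    also have "\<dots> = b (Suc k) y" using 1 c by simp
    finally show ?thesis .
  qed
  then show ?case unfolding R_Suc_iff[OF k(1)] using Suc.prems(3) rb by blast
qed

text \<open>Hence an attaching homomorphism cannot enlarge the spectrum of \<open>a* a\<close>.\<close>

lemma \<alpha>_eigenvalue_le:
  assumes k: "Suc k \<le> len D" and a: "a \<in> R k" and y: "y \<in> bdry D (Suc k)"
    and bound: "\<And>j x. j \<le> k \<Longrightarrow> x \<in> topspace (X j) \<Longrightarrow> (norm (ofm (n j) (a j x)))\<^sup>2 \<le> c"
    and ev: "eigenvalue (mat_adjoint (\<alpha> k a y) * \<alpha> k a y) l"
  shows "Re l \<le> c"
proof (rule ccontr)
  assume "\<not> Re l \<le> c"
  let ?m = "n (Suc k)"
  have k': "k \<le> len D" using k by simp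
  have A: "\<alpha> k a y \<in> carrier_mat ?m ?m" by (rule \<alpha>_hom(6)[OF k a a y])
  obtain V \<mu> where V: "bnd ?m V" "V \<noteq> 0" "l = complex_of_real \<mu>" "adj (ofm ?m (\<alpha> k a y)) * ofm ?m (\<alpha> k a y) * V = \<mu> *\<^sub>R V"
    by (rule eigenvalue_adjoint_square[OF A ev])
  have \<mu>: "c < \<mu>" using \<open>\<not> Re l \<le> c\<close> V(3) by simp
  define h where "h = star (St k) a \<otimes>\<^bsub>St k\<^esub> a"
  \<comment> \<open>if \<open>\<mu> > c\<close>, then \<open>L = \<mu> - a* a\<close> has an inverse in
      the stage, so \<open>\<alpha> k L y\<close> is injective, but it kills the eigenvector
      \<open>V\<close>\<close>
  define L where "L = (complex_of_real \<mu> \<odot>\<^bsub>St k\<^esub> \<one>\<^bsub>St k\<^esub>) \<oplus>\<^bsub>St k\<^esub> ((- 1) \<odot>\<^bsub>St k\<^esub> h)"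
  have sR: "star (St k) a \<in> R k" by (rule R_closed(4)[OF k' a a])
  have hR: "h \<in> R k" unfolding h_def by (rule R_closed(1)[OF k' sR a])
  have m1: "complex_of_real \<mu> \<odot>\<^bsub>St k\<^esub> \<one>\<^bsub>St k\<^esub> \<in> R k" "(- 1) \<odot>\<^bsub>St k\<^esub> h \<in> R k"
    using R_closed(3)[OF k'] R_one[OF k'] hR by blast+
  have LR: "L \<in> R k" unfolding L_def by (rule R_closed(2)[OF k' m1])
  define Lf where "Lf j x = \<mu> *\<^sub>R Id (n j) - adj (ofm (n j) (a j x)) * ofm (n j) (a j x)" for j x
  have lin: "ofm m (complex_of_real \<mu> \<cdot>\<^sub>m 1\<^sub>m m + (- 1) \<cdot>\<^sub>m (mat_adjoint M * M)) = \<mu> *\<^sub>R Id m - adj (ofm m M) * ofm m M"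
    if M: "M \<in> carrier_mat m m" for m M
  proof -
    have c: "mat_adjoint M * M \<in> carrier_mat m m" using mat_adjoint_carrier[OF M] M by simp
    have "adj (ofm m M) * ofm m M = ofm m (mat_adjoint M * M)"
      using M mat_adjoint_carrier[OF M] by (simp add: ofm_mult ofm_adjoint)
    moreover have "ofm m (complex_of_real \<mu> \<cdot>\<^sub>m 1\<^sub>m m + (- 1) \<cdot>\<^sub>m (mat_adjoint M * M)) = \<mu> *\<^sub>R Id m - ofm m (mat_adjoint M * M)"
      by (rule fmat_eqI) (use c in \<open>auto simp: ofm_def ent_Id scaleR_conv_of_real simp del: index_mult_mat\<close>)
    ultimately show ?thesis by simp
  qed
  have Lv: "ofm (n j) (L j x) = Lf j x" if "j \<le> k" "x \<in> topspace (X j)" for j x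
    using lin[OF R_mat[OF a that]] that by (simp add: L_def h_def Lf_def stage_val)
  have acc: "accretive (n j) (\<mu> - c) (Lf j x)" if jx: "j \<le> k" "x \<in> topspace (X j)" for j x
    unfolding accretive_def
  proof (intro conjI allI impI)
    let ?a = "ofm (n j) (a j x)"
    show "bnd (n j) (Lf j x)" by (simp add: Lf_def)
    fix v assume v: "bnd (n j) v"
    have "(norm (?a * v))\<^sup>2 \<le> (norm ?a * norm v)\<^sup>2" by (rule power_mono[OF norm_mult_ineq]) simp
    also have "\<dots> \<le> c * (norm v)\<^sup>2" using bound[OF jx] by (simp add: power_mult_distrib mult_right_mono)
    finally have 1: "inner (?a * v) (?a * v) \<le> c * (norm v)\<^sup>2" by (simp add: power2_norm_eq_inner)
    have "inner v (Lf j x * v) = \<mu> * (norm v)\<^sup>2 - inner (?a * v) (?a * v)"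
      using v by (simp add: Lf_def left_diff_distrib Id_mult inner_diff_right power2_norm_eq_inner mult.assoc inner_mult_left)
    then show "(\<mu> - c) * (norm v)\<^sup>2 \<le> inner v (Lf j x * v)" using 1 by (simp add: left_diff_distrib)
  qed
  have pos: "0 < \<mu> - c" using \<mu> by simp
  define b where "b = (\<lambda>j\<in>{..k}. \<lambda>x\<in>topspace (X j). tom (n j) (inv_mat (n j) (Lf j x)))"
  have bt: "b \<in> tup k" unfolding b_def
  proof (rule tupI)
    fix j r s assume j: "j \<le> k" "r < n j" "s < n j"
    have ac: "continuous_map (X j) euclidean (\<lambda>x. ofm (n j) (a j x))"
      by (subst continuous_map_fmat_iff[of _ "n j"]) (use tup_cont[OF R_tup[OF a]] j in \<open>simp_all add: ent_ofm\<close>)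
    have "continuous_map (X j) euclidean (\<lambda>x. Lf j x)"
      unfolding Lf_def by (intro continuous_map_diff continuous_map_fmat_mult continuous_map_adj ac) simp
    then have "continuous_map (X j) euclidean (\<lambda>x. ent (inv_mat (n j) (Lf j x)) r s)"
      by (intro continuous_map_ent continuous_map_inv_mat[OF _ acc pos]) (use j in auto)
    then show "continuous_map (X j) euclidean (\<lambda>x. tom (n j) (inv_mat (n j) (Lf j x)) $$ (r, s))"
      using j by simp
  qed simp
  have inv: "L j x * b j x = 1\<^sub>m (n j) \<and> b j x * L j x = 1\<^sub>m (n j)" if jx: "j \<le> k" "x \<in> topspace (X j)" for j x
  proof -
    note i = inv_mat[OF acc[OF jx] pos]
    have "L j x = tom (n j) (Lf j x)" using tom_ofm[OF R_mat[OF LR jx]] Lv[OF jx] by simp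
    then show ?thesis using i acc[OF jx] jx
      by (simp add: b_def tom_mult[symmetric] accretive_def tom_Id)
  qed
  have bR: "b \<in> R k" by (rule R_inverse[OF k' LR bt inv])
  have one: "b \<otimes>\<^bsub>St k\<^esub> L = \<one>\<^bsub>St k\<^esub>"
    by (rule tup_eqI[of _ k]) (use R_tup R_closed(1)[OF k' bR LR] R_one[OF k'] inv in \<open>auto simp: stage_val\<close>)
  have aL: "\<alpha> k L y = complex_of_real \<mu> \<cdot>\<^sub>m 1\<^sub>m ?m + (- 1) \<cdot>\<^sub>m (mat_adjoint (\<alpha> k a y) * \<alpha> k a y)"
  proof -
    have "\<alpha> k L y = \<alpha> k (complex_of_real \<mu> \<odot>\<^bsub>St k\<^esub> \<one>\<^bsub>St k\<^esub>) y + \<alpha> k ((- 1) \<odot>\<^bsub>St k\<^esub> h) y"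
      unfolding L_def by (rule \<alpha>_hom(2)[OF k m1 y])
    also have "\<alpha> k (complex_of_real \<mu> \<odot>\<^bsub>St k\<^esub> \<one>\<^bsub>St k\<^esub>) y = complex_of_real \<mu> \<cdot>\<^sub>m 1\<^sub>m ?m"
      using \<alpha>_hom(3)[OF k R_one[OF k'] R_one[OF k'] y] \<alpha>_hom(5)[OF k hR hR y] by simp
    also have "\<alpha> k ((- 1) \<odot>\<^bsub>St k\<^esub> h) y = (- 1) \<cdot>\<^sub>m \<alpha> k h y" by (rule \<alpha>_hom(3)[OF k hR hR y])
    also have "\<alpha> k h y = mat_adjoint (\<alpha> k a y) * \<alpha> k a y"
      unfolding h_def \<alpha>_hom(1)[OF k sR a y] \<alpha>_hom(4)[OF k a a y] ..
    finally show ?thesis .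
  qed
  have "\<alpha> k b y * \<alpha> k L y = 1\<^sub>m ?m"
    using \<alpha>_hom(1)[OF k bR LR y] \<alpha>_hom(5)[OF k bR LR y] by (simp add: one)
  then have bL: "ofm ?m (\<alpha> k b y) * ofm ?m (\<alpha> k L y) = Id ?m"
    using ofm_mult[OF \<alpha>_hom(6)[OF k bR bR y] \<alpha>_hom(6)[OF k LR LR y]] by (metis ofm_one)
  have "V = Id ?m * V" using V(1) by (simp add: Id_mult)
  also have "\<dots> = ofm ?m (\<alpha> k b y) * (ofm ?m (\<alpha> k L y) * V)" unfolding bL[symmetric] by (simp only: mult.assoc)
  also have "ofm ?m (\<alpha> k L y) * V = 0"
    unfolding aL lin[OF A] using V(1,4) by (simp add: left_diff_distrib Id_mult)
  finally show False using V(2) by simp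
qed

text \<open>The square of each entry of \<open>\<alpha> k a y\<close> is at most the size of the matrix times the largest eigenvalue
  of \<open>(\<alpha> k a y)* (\<alpha> k a y)\<close>, which gives \<open>C\<close>.\<close>

lemma \<alpha>_bounded:
  assumes k: "Suc k \<le> len D"
  shows "\<exists>C\<ge>0. \<forall>a\<in>R k. \<forall>\<epsilon>\<ge>0. (\<forall>j\<le>k. \<forall>x\<in>topspace (X j). norm (ofm (n j) (a j x)) \<le> \<epsilon>) \<longrightarrow>
    (\<forall>y\<in>bdry D (Suc k). \<forall>r<n (Suc k). \<forall>s<n (Suc k). cmod (\<alpha> k a y $$ (r, s)) \<le> C * \<epsilon>)"
proof (intro exI conjI ballI allI impI)
  let ?m = "n (Suc k)"
  show "0 \<le> real ?m" by simp
  fix a \<epsilon> y r s assume a: "a \<in> R k" and \<epsilon>: "0 \<le> (\<epsilon>::real)"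
    and b: "\<forall>j\<le>k. \<forall>x\<in>topspace (X j). norm (ofm (n j) (a j x)) \<le> \<epsilon>"
    and y: "y \<in> bdry D (Suc k)" and rs: "r < ?m" "s < ?m"
  have b2: "(norm (ofm (n j) (a j x)))\<^sup>2 \<le> \<epsilon>\<^sup>2" if "j \<le> k" "x \<in> topspace (X j)" for j x
    using b that by (simp add: power_mono)
  have "(cmod (\<alpha> k a y $$ (r, s)))\<^sup>2 \<le> real ?m * \<epsilon>\<^sup>2"
    by (rule entries_le_eigenvalues[OF \<alpha>_hom(6)[OF k a a y] \<alpha>_eigenvalue_le[OF k a y b2] rs])
  also have "\<dots> \<le> (real ?m)\<^sup>2 * \<epsilon>\<^sup>2"
    using rs by (intro mult_right_mono) (simp_all add: power2_eq_square)
  finally have "(cmod (\<alpha> k a y $$ (r, s)))\<^sup>2 \<le> (real ?m * \<epsilon>)\<^sup>2" by (simp add: power_mult_distrib)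
  then show "cmod (\<alpha> k a y $$ (r, s)) \<le> real ?m * \<epsilon>" by (rule power2_le_imp_le) (simp add: \<epsilon>)
qed

end

section \<open>Matrices over the stages\<close>

lemma sum_lessThan_add: "(\<Sum>u<a + (b::nat). f u) = (\<Sum>u<a. f u) + (\<Sum>u<b. f (a + u) :: 'b::comm_monoid_add)"
  by (induction b) (simp_all add: add.assoc)

lemma sum_lessThan_mult: "(\<Sum>u<m * (n::nat). f u) = (\<Sum>l<m. \<Sum>t<n. f (l * n + t) :: 'b::comm_monoid_add)"
proof (induction m)
  case (Suc m)
  have "Suc m * n = m * n + n" by simp
  then show ?case by (simp only: sum_lessThan_add Suc.IH sum.lessThan_Suc)
qed simp

lemma block_index_less: "i < m \<Longrightarrow> r < (n::nat) \<Longrightarrow> i * n + r < m * n"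
proof -
  assume "i < m" "r < n"
  then have "i * n + r < Suc i * n" by simp
  also have "\<dots> \<le> m * n" using \<open>i < m\<close> by (intro mult_le_mono1) simp
  finally show ?thesis .
qed

lemma continuous_map_metricI:
  fixes f :: "'y \<Rightarrow> 'b::metric_space"
  assumes "\<And>z \<epsilon>. z \<in> topspace X \<Longrightarrow> 0 < \<epsilon> \<Longrightarrow> \<exists>U. openin X U \<and> z \<in> U \<and> (\<forall>w\<in>U. dist (f w) (f z) < \<epsilon>)"
  shows "continuous_map X euclidean f"
  unfolding continuous_map_def
proof (intro conjI allI impI)
  fix V :: "'b set" assume "openin euclidean V"
  then have V: "open V" by simp
  show "openin X {x \<in> topspace X. f x \<in> V}"
  proof (subst openin_subopen, intro ballI)
    fix x assume x: "x \<in> {x \<in> topspace X. f x \<in> V}"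
    then obtain \<epsilon> where \<epsilon>: "0 < \<epsilon>" "ball (f x) \<epsilon> \<subseteq> V" using V open_contains_ball by blast
    obtain U where U: "openin X U" "x \<in> U" "\<forall>w\<in>U. dist (f w) (f x) < \<epsilon>" using assms x \<epsilon>(1) by blast
    have "U \<subseteq> {x \<in> topspace X. f x \<in> V}"
      using U openin_subset[OF U(1)] \<epsilon>(2) by (auto simp: dist_commute subset_iff)
    then show "\<exists>T. openin X T \<and> x \<in> T \<and> T \<subseteq> {x \<in> topspace X. f x \<in> V}" using U by blast
  qed
qed simp

context rsh
begin

text \<open>A matrix over the stage \<open>k\<close> is given by a family \<open>F\<close> of matrices, \<open>F j x\<close> being its value at
  \<open>x \<in> X\<^sub>j\<close>; its entries are the blocks.\<close>

definition blk :: "nat \<Rightarrow> (nat \<Rightarrow> 'a \<Rightarrow> fmat) \<Rightarrow> nat \<Rightarrow> nat \<Rightarrow> nat \<Rightarrow> 'a \<Rightarrow> complex mat" where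
  "blk k F i i' = (\<lambda>j\<in>{..k}. \<lambda>x\<in>topspace (X j).
     mat (n j) (n j) (\<lambda>(r, s). ent (F j x) (i * n j + r) (i' * n j + s)))"

definition mem :: "nat \<Rightarrow> (nat \<Rightarrow> 'a \<Rightarrow> fmat) \<Rightarrow> bool" where
  "mem k F \<longleftrightarrow> (\<forall>i i'. blk k F i i' \<in> R k)"

definition bd :: "nat \<Rightarrow> nat \<Rightarrow> (nat \<Rightarrow> 'a \<Rightarrow> fmat) \<Rightarrow> bool" where
  "bd m k F \<longleftrightarrow> (\<forall>j\<le>k. \<forall>x\<in>topspace (X j). bnd (m * n j) (F j x))"

lemma blk_index: "j \<le> k \<Longrightarrow> x \<in> topspace (X j) \<Longrightarrow> r < n j \<Longrightarrow> s < n j \<Longrightarrow>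
    blk k F i i' j x $$ (r, s) = ent (F j x) (i * n j + r) (i' * n j + s)"
  by (simp add: blk_def)

lemma blk_carrier: "j \<le> k \<Longrightarrow> x \<in> topspace (X j) \<Longrightarrow> blk k F i i' j x \<in> carrier_mat (n j) (n j)"
  by (simp add: blk_def)

lemma blk_cong: "(\<And>j x. j \<le> k \<Longrightarrow> x \<in> topspace (X j) \<Longrightarrow> F j x = G j x) \<Longrightarrow> blk k F = blk k G"
  unfolding blk_def by (intro ext restrict_ext) simp

lemma blk_tup:
  assumes "\<And>j. j \<le> k \<Longrightarrow> continuous_map (X j) euclidean (F j)" shows "blk k F i i' \<in> tup k"
  unfolding blk_def
proof (rule tupI)
  fix j r s assume "j \<le> k" "r < n j" "s < n j"
  then show "continuous_map (X j) euclidean (\<lambda>x. mat (n j) (n j) (\<lambda>(r, s). ent (F j x) (i * n j + r) (i' * n j + s)) $$ (r, s))"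
    using continuous_map_ent[OF assms] by simp
qed simp

lemma n_pos: "j \<le> len D \<Longrightarrow> 0 < n j" using X[of j] by simp

lemma mem_continuous:
  assumes "k \<le> len D" "mem k F" "bd m k F" "j \<le> k" shows "continuous_map (X j) euclidean (F j)"
proof -
  have n: "0 < n j" using n_pos assms by simp
  have "continuous_map (X j) euclidean (\<lambda>x. ent (F j x) r s)" for r s
  proof -
    have "continuous_map (X j) euclidean (\<lambda>x. blk k F (r div n j) (s div n j) j x $$ (r mod n j, s mod n j))"
      using assms(2,4) n by (intro tup_cont[OF R_tup]) (auto simp: mem_def)
    then show ?thesis
      by (rule continuous_map_eq) (use assms(4) n in \<open>simp add: blk_index div_mult_mod_eq\<close>)
  qed
  then show ?thesis
    by (subst continuous_map_fmat_iff[of _ "m * n j"]) (use assms(3,4) in \<open>auto simp: bd_def\<close>)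
qed

lemma restrict_blk: "restrict (blk (Suc k) F i i') {..k} = blk k F i i'"
  by (auto simp: blk_def restrict_def fun_eq_iff)

lemma mem_Suc_iff:
  assumes "Suc k \<le> len D"
  shows "mem (Suc k) F \<longleftrightarrow> mem k F \<and> (\<forall>i i'. blk (Suc k) F i i' \<in> tup (Suc k) \<and>
    (\<forall>y\<in>bdry D (Suc k). \<alpha> k (blk k F i i') y = blk (Suc k) F i i' (Suc k) y))"
  unfolding mem_def R_Suc_iff[OF assms] restrict_blk by blast

lemma mem_le: "mem l F \<Longrightarrow> k \<le> l \<Longrightarrow> l \<le> len D \<Longrightarrow> mem k F"
proof (induction l)
  case (Suc l)
  then show ?case using mem_Suc_iff[of l F] by (cases "k = Suc l") auto
qed simp

lemma blk_adj: "blk k (\<lambda>j x. adj (F j x)) i i' = star (St k) (blk k F i' i)"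
proof -
  have "mat (n j) (n j) (\<lambda>(r, s). ent (adj (F j x)) (i * n j + r) (i' * n j + s)) =
    mat_adjoint (mat (n j) (n j) (\<lambda>(r, s). ent (F j x) (i' * n j + r) (i * n j + s)))" for j x
    using mat_adjoint_carrier[OF mat_carrier, of "n j" "\<lambda>(r, s). ent (F j x) (i' * n j + r) (i * n j + s)"]
    by (intro eq_matI) (auto simp: mat_adjoint_index[OF mat_carrier])
  then show ?thesis by (auto simp: blk_def stage_sel restrict_def fun_eq_iff)
qed

lemma mem_adj: "k \<le> len D \<Longrightarrow> mem k F \<Longrightarrow> mem k (\<lambda>j x. adj (F j x))"
  unfolding mem_def blk_adj using R_closed(4) by blast

lemma blk_mult:
  assumes jx: "j \<le> k" "x \<in> topspace (X j)" "r < n j" "s < n j" and F: "bnd (m * n j) (F j x)"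
    and H: "H j x = F j x * G j x"
  shows "blk k H i i' j x $$ (r, s) = (\<Sum>l<m. (blk k F i l j x * blk k G l i' j x) $$ (r, s))"
proof -
  have "blk k H i i' j x $$ (r, s) = (\<Sum>l<m. \<Sum>t<n j. ent (F j x) (i * n j + r) (l * n j + t) * ent (G j x) (l * n j + t) (i' * n j + s))"
    using jx by (simp add: blk_index H ent_mult[OF F] sum_lessThan_mult)
  also have "\<dots> = (\<Sum>l<m. (blk k F i l j x * blk k G l i' j x) $$ (r, s))"
    by (rule sum.cong[OF refl], subst mat_mult_index[OF blk_carrier blk_carrier]) (use jx in \<open>auto simp: blk_index\<close>)
  finally show ?thesis .
qed

context
  fixes k assumes k: "Suc k \<le> len D"
begin

lemma kl: "k \<le> len D" using k by simp

lemma \<alpha>_zero: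
  assumes c: "c \<in> R k" and y: "y \<in> bdry D (Suc k)"
    and 0: "\<And>j x r s. j \<le> k \<Longrightarrow> x \<in> topspace (X j) \<Longrightarrow> r < n j \<Longrightarrow> s < n j \<Longrightarrow> c j x $$ (r, s) = 0"
    and rs: "r < n (Suc k)" "s < n (Suc k)"
  shows "\<alpha> k c y $$ (r, s) = 0"
proof -
  have "c = 0 \<odot>\<^bsub>St k\<^esub> c"
  proof (rule tup_eqI[OF R_tup[OF c] R_tup[OF R_closed(3)[OF kl c c]]])
    fix j x assume jx: "j \<le> k" "x \<in> topspace (X j)"
    then show "c j x = (0 \<odot>\<^bsub>St k\<^esub> c) j x"
      using 0[OF jx] tup_dim[OF R_tup[OF c] jx] by (intro eq_matI) (simp_all add: stage_val)
  qed
  then have "\<alpha> k c y = 0 \<cdot>\<^sub>m \<alpha> k c y" using \<alpha>_hom(3)[OF k c c y] by metis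
  moreover have "(0 \<cdot>\<^sub>m \<alpha> k c y) $$ (r, s) = 0" using \<alpha>_hom(6)[OF k c c y] rs by simp
  ultimately show ?thesis by simp
qed

text \<open>The entries of a product of matrices over a stage are the sums of products \<open>c = \<Sum> a\<^sub>l b\<^sub>l\<close>. The sum is
  described by the values of \<open>c\<close>, and one summand at a time is subtracted from \<open>c\<close>.\<close>

lemma \<alpha>_sum_prod:
  assumes y: "y \<in> bdry D (Suc k)" and rs: "r < n (Suc k)" "s < n (Suc k)"
  shows "(\<And>l. l < m \<Longrightarrow> a l \<in> R k \<and> b l \<in> R k) \<Longrightarrow> c \<in> R k \<Longrightarrow>
    (\<And>j x r s. j \<le> k \<Longrightarrow> x \<in> topspace (X j) \<Longrightarrow> r < n j \<Longrightarrow> s < n j \<Longrightarrow>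
       c j x $$ (r, s) = (\<Sum>l<m. (a l j x * b l j x) $$ (r, s))) \<Longrightarrow>
    \<alpha> k c y $$ (r, s) = (\<Sum>l<(m::nat). (\<alpha> k (a l) y * \<alpha> k (b l) y) $$ (r, s))"
proof (induction m arbitrary: c)
  case 0
  then show ?case using \<alpha>_zero[OF 0(2) y _ rs] by simp
next
  case (Suc m)
  have ab: "a m \<in> R k" "b m \<in> R k" using Suc.prems(1) by auto
  define p where "p = a m \<otimes>\<^bsub>St k\<^esub> b m"
  have p: "p \<in> R k" unfolding p_def by (rule R_closed(1)[OF kl ab])
  have mp: "(- 1) \<odot>\<^bsub>St k\<^esub> p \<in> R k" by (rule R_closed(3)[OF kl p p])
  define c' where "c' = c \<oplus>\<^bsub>St k\<^esub> ((- 1) \<odot>\<^bsub>St k\<^esub> p)"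
  have c': "c' \<in> R k" unfolding c'_def by (rule R_closed(2)[OF kl Suc.prems(2) mp])
  have v: "c' j x $$ (r, s) = c j x $$ (r, s) - p j x $$ (r, s)" if "j \<le> k" "x \<in> topspace (X j)" "r < n j" "s < n j" for j x r s
    using that tup_dim[OF R_tup[OF p] that(1,2)] by (simp add: c'_def stage_val)
  have e1: "\<alpha> k c' y $$ (r, s) = (\<Sum>l<m. (\<alpha> k (a l) y * \<alpha> k (b l) y) $$ (r, s))"
  proof (rule Suc.IH[OF _ c'])
    show "a l \<in> R k \<and> b l \<in> R k" if "l < m" for l using Suc.prems(1) that by simp
    fix j x r s assume that: "j \<le> k" "x \<in> topspace (X j)" "r < n j" "s < n j"
    have pm: "p j x = a m j x * b m j x" unfolding p_def by (rule stage_val(1)[OF that(1,2)])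
    have "c' j x $$ (r, s) = (\<Sum>l<Suc m. (a l j x * b l j x) $$ (r, s)) - (a m j x * b m j x) $$ (r, s)"
      unfolding v[OF that] by (rule arg_cong2[of _ _ _ _ minus, OF Suc.prems(3)[OF that]]) (simp only: pm)
    then show "c' j x $$ (r, s) = (\<Sum>l<m. (a l j x * b l j x) $$ (r, s))"
      by (simp only: sum.lessThan_Suc add_diff_cancel_right')
  qed
  have e2: "\<alpha> k c' y $$ (r, s) = \<alpha> k c y $$ (r, s) - \<alpha> k p y $$ (r, s)"
  proof -
    have "\<alpha> k c' y = \<alpha> k c y + (- 1) \<cdot>\<^sub>m \<alpha> k p y"
      unfolding c'_def \<alpha>_hom(2)[OF k Suc.prems(2) mp y] \<alpha>_hom(3)[OF k p p y] ..
    then show ?thesis using rs \<alpha>_hom(6)[OF k p p y] by simp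
  qed
  have e3: "\<alpha> k p y = \<alpha> k (a m) y * \<alpha> k (b m) y" unfolding p_def by (rule \<alpha>_hom(1)[OF k ab y])
  show ?case unfolding sum.lessThan_Suc e1[symmetric] e3[symmetric] e2 by (rule diff_add_cancel[symmetric])
qed

text \<open>The extension of the attaching homomorphism to \<open>m \<times> m\<close> matrices over the stage \<open>k\<close>.\<close>

definition phi :: "nat \<Rightarrow> (nat \<Rightarrow> 'a \<Rightarrow> fmat) \<Rightarrow> 'a \<Rightarrow> fmat" where
  "phi m F y = fm (m * n (Suc k)) (\<lambda>r s. \<alpha> k (blk k F (r div n (Suc k)) (s div n (Suc k))) y $$ (r mod n (Suc k), s mod n (Suc k)))"

lemma phi_cong: "(\<And>j x. j \<le> k \<Longrightarrow> x \<in> topspace (X j) \<Longrightarrow> F j x = G j x) \<Longrightarrow> phi m F y = phi m G y"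
  using blk_cong[of k F G] by (simp add: phi_def)

lemma phi_block:
  assumes "i < m" "i' < m" "r < n (Suc k)" "s < n (Suc k)"
  shows "ent (phi m F y) (i * n (Suc k) + r) (i' * n (Suc k) + s) = \<alpha> k (blk k F i i') y $$ (r, s)"
  using assms by (simp add: phi_def block_index_less)

lemma ent_block_eqI:
  assumes "bnd (m * n (Suc k)) a" "bnd (m * n (Suc k)) b"
    "\<And>i i' r s. i < m \<Longrightarrow> i' < m \<Longrightarrow> r < n (Suc k) \<Longrightarrow> s < n (Suc k) \<Longrightarrow>
      ent a (i * n (Suc k) + r) (i' * n (Suc k) + s) = ent b (i * n (Suc k) + r) (i' * n (Suc k) + s)"
  shows "a = b"
proof (rule fmat_eqI)
  fix u v
  let ?n = "n (Suc k)"
  have n: "0 < ?n" using n_pos[OF k] .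
  show "ent a u v = ent b u v"
  proof (cases "u < m * ?n \<and> v < m * ?n")
    case True
    then have "u div ?n < m" "v div ?n < m" by (simp_all add: less_mult_imp_div_less)
    from assms(3)[OF this, of "u mod ?n" "v mod ?n"] n show ?thesis by (simp add: div_mult_mod_eq)
  next
    case False
    then show ?thesis using bnd_ent[OF assms(1)] bnd_ent[OF assms(2)] by (auto simp: not_less)
  qed
qed

lemma phi_eq:
  assumes F: "mem (Suc k) F" "bd m (Suc k) F" and y: "y \<in> bdry D (Suc k)"
  shows "phi m F y = F (Suc k) y"
proof (rule ent_block_eqI)
  have yt: "y \<in> topspace (X (Suc k))" using closedin_subset[OF bdry[OF k]] y by blast
  show "bnd (m * n (Suc k)) (F (Suc k) y)" using F(2) yt by (simp add: bd_def)
  fix i i' r s assume a: "i < m" "i' < m" "r < n (Suc k)" "s < n (Suc k)"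
  have "\<alpha> k (blk k F i i') y = blk (Suc k) F i i' (Suc k) y" using F(1) y by (simp add: mem_Suc_iff[OF k])
  then show "ent (phi m F y) (i * n (Suc k) + r) (i' * n (Suc k) + s) = ent (F (Suc k) y) (i * n (Suc k) + r) (i' * n (Suc k) + s)"
    using a yt by (simp add: phi_block blk_index)
qed (simp add: phi_def)

lemma bnd_phi: "bnd (m * n (Suc k)) (phi m F y)" by (simp add: phi_def)

lemma phi_mult:
  assumes F: "mem k F" "bd m k F" and G: "mem k G" and H: "mem k H" and y: "y \<in> bdry D (Suc k)"
    and eq: "\<And>j x. j \<le> k \<Longrightarrow> x \<in> topspace (X j) \<Longrightarrow> H j x = F j x * G j x"
  shows "phi m H y = phi m F y * phi m G y"
proof (rule ent_block_eqI)
  let ?n = "n (Suc k)"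
  show "bnd (m * ?n) (phi m H y)" "bnd (m * ?n) (phi m F y * phi m G y)" by (simp_all add: bnd_phi)
  fix i i' r s assume a: "i < m" "i' < m" "r < ?n" "s < ?n"
  have c: "blk k F i i' \<in> R k" "blk k G i i' \<in> R k" "blk k H i i' \<in> R k" for i i' using F G H by (auto simp: mem_def)
  have "ent (phi m H y) (i * ?n + r) (i' * ?n + s) = \<alpha> k (blk k H i i') y $$ (r, s)" by (rule phi_block[OF a])
  also have "\<dots> = (\<Sum>l<m. (\<alpha> k (blk k F i l) y * \<alpha> k (blk k G l i') y) $$ (r, s))"
  proof (rule \<alpha>_sum_prod[OF y a(3,4)])
    show "blk k F i l \<in> R k \<and> blk k G l i' \<in> R k" for l using c by blast
    show "blk k H i i' j x $$ (r, s) = (\<Sum>l<m. (blk k F i l j x * blk k G l i' j x) $$ (r, s))"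
      if "j \<le> k" "x \<in> topspace (X j)" "r < n j" "s < n j" for j x r s
    proof (rule blk_mult[where m = m, OF that])
      show "bnd (m * n j) (F j x)" using F(2) that by (simp add: bd_def)
      show "H j x = F j x * G j x" by (rule eq[OF that(1,2)])
    qed
  qed (rule c)
  also have "\<dots> = (\<Sum>l<m. \<Sum>t<?n. ent (phi m F y) (i * ?n + r) (l * ?n + t) * ent (phi m G y) (l * ?n + t) (i' * ?n + s))"
  proof (rule sum.cong[OF refl])
    fix l assume "l \<in> {..<m}"
    then have l: "l < m" by simp
    show "(\<alpha> k (blk k F i l) y * \<alpha> k (blk k G l i') y) $$ (r, s) =
      (\<Sum>t<?n. ent (phi m F y) (i * ?n + r) (l * ?n + t) * ent (phi m G y) (l * ?n + t) (i' * ?n + s))"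
      by (subst mat_mult_index[OF \<alpha>_hom(6)[OF k c(1) c(1) y] \<alpha>_hom(6)[OF k c(2) c(2) y] a(3,4)], rule sum.cong)
        (use a l in \<open>simp_all add: phi_block\<close>)
  qed
  also have "\<dots> = ent (phi m F y * phi m G y) (i * ?n + r) (i' * ?n + s)"
    by (simp add: ent_mult[OF bnd_phi] sum_lessThan_mult)
  finally show "ent (phi m H y) (i * ?n + r) (i' * ?n + s) = ent (phi m F y * phi m G y) (i * ?n + r) (i' * ?n + s)" .
qed

lemma phi_adj:
  assumes F: "mem k F" and y: "y \<in> bdry D (Suc k)"
  shows "phi m (\<lambda>j x. adj (F j x)) y = adj (phi m F y)"
proof (rule ent_block_eqI)
  fix i i' r s assume a: "i < m" "i' < m" "r < n (Suc k)" "s < n (Suc k)"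
  have c: "blk k F i' i \<in> R k" using F by (simp add: mem_def)
  show "ent (phi m (\<lambda>j x. adj (F j x)) y) (i * n (Suc k) + r) (i' * n (Suc k) + s) = ent (adj (phi m F y)) (i * n (Suc k) + r) (i' * n (Suc k) + s)"
    using a by (simp add: phi_block blk_adj \<alpha>_hom(4)[OF k c c y] mat_adjoint_index[OF \<alpha>_hom(6)[OF k c c y]])
qed (simp_all add: bnd_phi)

text \<open>The homomorphism is bounded, so a family that is jointly continuous over the stage \<open>k\<close>, hence norm
  continuous in \<open>s\<close> uniformly over the compact spaces, is carried to a family that is continuous in
  \<open>s\<close> uniformly over the closed subset of \<open>X\<^sub>k\<^sub>+\<^sub>1\<close>.\<close>

lemma phi_continuous:
  fixes S :: "'s topology" and F :: "'s \<Rightarrow> nat \<Rightarrow> 'a \<Rightarrow> fmat"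
  assumes F: "\<And>s. s \<in> topspace S \<Longrightarrow> mem k (F s)"
    and cont: "\<And>j. j \<le> k \<Longrightarrow> continuous_map (prod_topology (X j) S) euclidean (\<lambda>z. F (snd z) j (fst z))"
  shows "continuous_map (prod_topology (subtopology (X (Suc k)) (bdry D (Suc k))) S) euclidean (\<lambda>z. phi m (F (snd z)) (fst z))"
proof -
  let ?B = "subtopology (X (Suc k)) (bdry D (Suc k))"
  let ?n = "n (Suc k)"
  obtain C where C: "0 \<le> C" "\<forall>a\<in>R k. \<forall>\<epsilon>\<ge>0. (\<forall>j\<le>k. \<forall>x\<in>topspace (X j). norm (ofm (n j) (a j x)) \<le> \<epsilon>) \<longrightarrow>
    (\<forall>y\<in>bdry D (Suc k). \<forall>r<?n. \<forall>s<?n. cmod (\<alpha> k a y $$ (r, s)) \<le> C * \<epsilon>)"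
    using \<alpha>_bounded[OF k] by (elim exE conjE)
  have tB: "topspace ?B = bdry D (Suc k)" by (rule topspace_bdry[OF k])
  have n: "0 < ?n" using n_pos[OF k] .
  have "continuous_map (prod_topology ?B S) euclidean (\<lambda>z. \<alpha> k (blk k (F (snd z)) i i') (fst z) $$ (r, s))"
    if rs: "r < ?n" "s < ?n" for i i' r s
  proof (rule continuous_map_metricI)
    fix z0 \<epsilon> assume z0: "z0 \<in> topspace (prod_topology ?B S)" and \<epsilon>: "0 < (\<epsilon>::real)"
    obtain y0 s0 where ys: "z0 = (y0, s0)" "y0 \<in> bdry D (Suc k)" "s0 \<in> topspace S" using z0 tB by (cases z0) auto
    define N where "N = (\<Sum>j\<le>k. (real (n j))\<^sup>2) + 1"
    have N: "0 < N" "(real (n j))\<^sup>2 \<le> N" if "j \<le> k" for j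
    proof -
      have "(real (n j))\<^sup>2 \<le> (\<Sum>j\<le>k. (real (n j))\<^sup>2)" using that by (intro member_le_sum) auto
      then show "(real (n j))\<^sup>2 \<le> N" by (simp add: N_def)
      show "0 < N" unfolding N_def by (intro add_nonneg_pos sum_nonneg) auto
    qed
    have N0: "0 < N" using N(1)[of k] by simp
    define \<delta> where "\<delta> = \<epsilon> / (2 * (C + 1) * N)"
    have \<delta>: "0 < \<delta>" using \<epsilon> C(1) N0 by (simp add: \<delta>_def)
    have "\<exists>U. openin S U \<and> s0 \<in> U \<and> (\<forall>s\<in>U. \<forall>x\<in>topspace (X j). norm (F s j x - F s0 j x) < \<delta>)" if j: "j \<in> {..k}" for j
    proof -
      have "j \<le> k" "j \<le> len D" using j k by auto
      then have "compact_space (X j)" using X by blast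
      then obtain U where "openin S U" "s0 \<in> U" "\<And>s x. s \<in> U \<Longrightarrow> x \<in> topspace (X j) \<Longrightarrow> norm (F (snd (x, s)) j (fst (x, s)) - F (snd (x, s0)) j (fst (x, s0))) < \<delta>"
        by (rule uniform_near_parameter[OF _ cont[OF \<open>j \<le> k\<close>] ys(3) \<delta>]) (rule that)
      then show ?thesis by auto
    qed
    then have "\<forall>j\<in>{..k}. \<exists>U. openin S U \<and> s0 \<in> U \<and> (\<forall>s\<in>U. \<forall>x\<in>topspace (X j). norm (F s j x - F s0 j x) < \<delta>)" by blast
    from bchoice[OF this] obtain U where U: "\<forall>j\<in>{..k}. openin S (U j) \<and> s0 \<in> U j \<and> (\<forall>s\<in>U j. \<forall>x\<in>topspace (X j). norm (F s j x - F s0 j x) < \<delta>)" ..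
    define W where "W = (\<Inter>j\<in>{..k}. U j)"
    have W: "openin S W" "s0 \<in> W" unfolding W_def using U by (auto intro!: openin_INT2)
    have c: "blk k (F s) i i' \<in> R k" if "s \<in> topspace S" for s using F[OF that] by (simp add: mem_def)
    define a0 where "a0 = blk k (F s0) i i'"
    have a0: "a0 \<in> R k" unfolding a0_def by (rule c[OF ys(3)])
    have "openin ?B {y \<in> topspace ?B. \<alpha> k a0 y $$ (r, s) \<in> ball (\<alpha> k a0 y0 $$ (r, s)) (\<epsilon>/2)}"
      by (rule openin_continuous_map_preimage[OF \<alpha>_cont[OF k a0 rs]]) simp
    then obtain V where V: "openin ?B V" "y0 \<in> V" "V = {y \<in> topspace ?B. \<alpha> k a0 y $$ (r, s) \<in> ball (\<alpha> k a0 y0 $$ (r, s)) (\<epsilon>/2)}"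
      using ys(2) \<epsilon> tB by auto
    show "\<exists>U. openin (prod_topology ?B S) U \<and> z0 \<in> U \<and> (\<forall>w\<in>U. dist (\<alpha> k (blk k (F (snd w)) i i') (fst w) $$ (r, s)) (\<alpha> k (blk k (F (snd z0)) i i') (fst z0) $$ (r, s)) < \<epsilon>)"
    proof (intro exI[of _ "V \<times> W"] conjI ballI)
      show "openin (prod_topology ?B S) (V \<times> W)" using V(1) W(1) by (simp add: openin_prod_Times_iff)
      show "z0 \<in> V \<times> W" using V(2) W(2) ys by simp
      fix w assume "w \<in> V \<times> W"
      then obtain y t where w: "w = (y, t)" "y \<in> V" "t \<in> W" by auto
      have yb: "y \<in> bdry D (Suc k)" using w(2) V(1) openin_subset tB by blast
      have tS: "t \<in> topspace S" using w(3) W(1) openin_subset by blast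
      define a where "a = blk k (F t) i i'"
      have a: "a \<in> R k" unfolding a_def by (rule c[OF tS])
      have ma: "(- 1) \<odot>\<^bsub>St k\<^esub> a0 \<in> R k" by (rule R_closed(3)[OF kl a0 a0])
      define d where "d = a \<oplus>\<^bsub>St k\<^esub> ((- 1) \<odot>\<^bsub>St k\<^esub> a0)"
      have d: "d \<in> R k" unfolding d_def by (rule R_closed(2)[OF kl a ma])
      have "norm (ofm (n j) (d j x)) \<le> N * \<delta>" if jx: "j \<le> k" "x \<in> topspace (X j)" for j x
      proof -
        have "norm (ofm (n j) (d j x)) \<le> (\<Sum>r<n j. \<Sum>s<n j. cmod (ent (ofm (n j) (d j x)) r s))"
          by (rule norm_le_sum_ent) simp
        also have "\<dots> \<le> (\<Sum>r<n j. \<Sum>s<n j. \<delta>)"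
        proof (intro sum_mono)
          fix r s assume rs: "r \<in> {..<n j}" "s \<in> {..<n j}"
          have "ent (ofm (n j) (d j x)) r s = ent (F t j x - F s0 j x) (i * n j + r) (i' * n j + s)"
            using rs jx tup_dim[OF R_tup[OF a0] jx] tup_dim[OF R_tup[OF a] jx]
            by (simp add: ent_ofm d_def stage_val) (simp add: a_def a0_def blk_index)
          also have "cmod \<dots> \<le> norm (F t j x - F s0 j x)" by (rule norm_ent_le)
          also have "\<dots> \<le> \<delta>" using U jx w(3) by (auto simp: W_def less_imp_le)
          finally show "cmod (ent (ofm (n j) (d j x)) r s) \<le> \<delta>" .
        qed
        also have "\<dots> = (real (n j))\<^sup>2 * \<delta>" by (simp add: power2_eq_square)
        also have "\<dots> \<le> N * \<delta>" using N(2)[OF jx(1)] \<delta> by (intro mult_right_mono) auto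
        finally show ?thesis .
      qed
      then have "cmod (\<alpha> k d y $$ (r, s)) \<le> C * (N * \<delta>)"
        using C(2)[rule_format, OF d, of "N * \<delta>" y r s] N0 \<delta> yb rs by simp
      also have "\<dots> \<le> \<epsilon>/2"
      proof -
        have "(C + 1) * (N * \<delta>) = \<epsilon>/2" using C(1) N0 by (simp add: \<delta>_def field_simps add_nonneg_eq_0_iff)
        moreover have "0 \<le> N * \<delta>" using N0 \<delta> by simp
        ultimately show ?thesis by (simp add: distrib_right)
      qed
      finally have 1: "cmod (\<alpha> k d y $$ (r, s)) \<le> \<epsilon>/2" .
      have "\<alpha> k d y = \<alpha> k a y + (- 1) \<cdot>\<^sub>m \<alpha> k a0 y"
        unfolding d_def \<alpha>_hom(2)[OF k a ma yb] \<alpha>_hom(3)[OF k a0 a0 yb] ..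
      then have "\<alpha> k d y $$ (r, s) = \<alpha> k a y $$ (r, s) - \<alpha> k a0 y $$ (r, s)"
        using rs \<alpha>_hom(6)[OF k a0 a0 yb] by simp
      moreover have "dist (\<alpha> k a0 y0 $$ (r, s)) (\<alpha> k a0 y $$ (r, s)) < \<epsilon>/2" using w(2) V(3) by simp
      ultimately have "dist (\<alpha> k a y $$ (r, s)) (\<alpha> k a0 y0 $$ (r, s)) < \<epsilon>"
        using 1 dist_triangle[of "\<alpha> k a y $$ (r, s)" "\<alpha> k a0 y0 $$ (r, s)" "\<alpha> k a0 y $$ (r, s)"]
        by (simp add: dist_norm norm_minus_commute)
      then show "dist (\<alpha> k (blk k (F (snd w)) i i') (fst w) $$ (r, s)) (\<alpha> k (blk k (F (snd z0)) i i') (fst z0) $$ (r, s)) < \<epsilon>"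
        by (simp add: w(1) ys(1) a_def a0_def)
    qed
  qed
  then show ?thesis
    by (subst continuous_map_fmat_iff[of _ "m * ?n"]) (use n in \<open>simp_all add: bnd_phi, simp add: phi_def\<close>)
qed

end

section \<open>Deforming unitaries over all stages\<close>

text \<open>Unitarity, the condition \<open>\<Gamma> e = e\<close> at time 1 and the prescribed values are equations between products,
  so \<open>phi\<close> carries them from the stage \<open>k\<close> to the closed subset of \<open>X\<^sub>k\<^sub>+\<^sub>1\<close>. There they are the
  boundary conditions under which the deformation is extended over \<open>X\<^sub>k\<^sub>+\<^sub>1\<close>.\<close>

lemma deform_unitaries:
  fixes T T0 :: "real set" and q e :: "nat \<Rightarrow> 'a \<Rightarrow> fmat" and U :: "real \<Rightarrow> nat \<Rightarrow> 'a \<Rightarrow> fmat"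
  assumes T: "compact T" "closedin (top_of_set T) T0"
    and q: "mem (len D) q" "bd m (len D) q" "\<And>j x. j \<le> len D \<Longrightarrow> x \<in> topspace (X j) \<Longrightarrow> proj_mat (q j x)"
    and e: "mem (len D) e" "bd m (len D) e" "\<And>j x. j \<le> len D \<Longrightarrow> x \<in> topspace (X j) \<Longrightarrow> proj_mat (e j x) \<and> q j x * e j x = e j x"
    and dim: "\<And>j. j \<le> len D \<Longrightarrow> covering_dim_le (prod_topology (prod_topology (X j) (top_of_set T)) (top_of_set {0..1::real})) (2 * rr j + 1)"
    and rk: "\<And>j x. j \<le> len D \<Longrightarrow> x \<in> topspace (X j) \<Longrightarrow> real (rr j) - 1 < (norm (q j x))\<^sup>2 - (norm (e j x))\<^sup>2"
    and U: "\<And>t. t \<in> T \<Longrightarrow> mem (len D) (U t)"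
      "\<And>j. j \<le> len D \<Longrightarrow> continuous_map (prod_topology (X j) (top_of_set T)) euclidean (\<lambda>z. U (snd z) j (fst z))"
      "\<And>j x t. j \<le> len D \<Longrightarrow> x \<in> topspace (X j) \<Longrightarrow> t \<in> T \<Longrightarrow> unitary_in (q j x) (U t j x)"
      "\<And>j x t. j \<le> len D \<Longrightarrow> x \<in> topspace (X j) \<Longrightarrow> t \<in> T0 \<Longrightarrow> U t j x * e j x = e j x"
  shows "k \<le> len D \<Longrightarrow> \<exists>\<Gamma> :: real \<Rightarrow> real \<Rightarrow> nat \<Rightarrow> 'a \<Rightarrow> fmat. (\<forall>t\<in>T. \<forall>\<tau>\<in>{0..1}. mem k (\<Gamma> t \<tau>)) \<and>
    (\<forall>j\<le>k. continuous_map (prod_topology (prod_topology (X j) (top_of_set T)) (top_of_set {0..1::real})) euclidean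
        (\<lambda>z. \<Gamma> (snd (fst z)) (snd z) j (fst (fst z)))) \<and>
    (\<forall>j\<le>k. \<forall>x\<in>topspace (X j). \<forall>t\<in>T. (\<forall>\<tau>\<in>{0..1}. unitary_in (q j x) (\<Gamma> t \<tau> j x)) \<and>
        \<Gamma> t 0 j x = U t j x \<and> \<Gamma> t 1 j x * e j x = e j x \<and> (t \<in> T0 \<longrightarrow> (\<forall>\<tau>\<in>{0..1}. \<Gamma> t \<tau> j x = U t j x)))"
    (is "_ \<Longrightarrow> \<exists>\<Gamma>. ?P k \<Gamma>")
proof (induction k)
  have T0T: "T0 \<subseteq> T" using T(2) closedin_subset by fastforce
  let ?I = "top_of_set {0..1::real}"
  let ?Y = "\<lambda>j. prod_topology (prod_topology (X j) (top_of_set T)) ?I"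
  have qj: "continuous_map (X j) euclidean (q j)" "\<And>x. x \<in> topspace (X j) \<Longrightarrow> bnd (m * n j) (q j x) \<and> proj_mat (q j x)"
    and ej: "continuous_map (X j) euclidean (e j)" "\<And>x. x \<in> topspace (X j) \<Longrightarrow> bnd (m * n j) (e j x) \<and> proj_mat (e j x) \<and> q j x * e j x = e j x"
    if "j \<le> len D" for j
    using mem_continuous[OF order_refl q(1,2) that] mem_continuous[OF order_refl e(1,2) that] q(2,3) e(2,3) that by (auto simp: bd_def)
  have Xj: "compact_space (X j)" "Hausdorff_space (X j)" if "j \<le> len D" for j using X[OF that] by auto
  have slice: "continuous_map (X j) euclidean (\<lambda>x. f ((x, t), \<tau>))"
    if f: "continuous_map (?Y j) euclidean f" and t: "t \<in> T" "\<tau> \<in> {0..1}" for j and f :: "('a \<times> real) \<times> real \<Rightarrow> fmat" and t \<tau>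
  proof -
    have "continuous_map (X j) (?Y j) (\<lambda>x. ((x, t), \<tau>))"
      using t by (intro continuous_map_pairedI continuous_map_id[unfolded id_def]) auto
    from continuous_map_compose[OF this f] show ?thesis by (simp add: o_def)
  qed
  {
    case 0
    have l0: "0 \<le> len D" by simp
    have "\<exists>\<Gamma>. continuous_map (?Y 0) euclidean \<Gamma> \<and>
      (\<forall>x\<in>topspace (X 0). \<forall>t\<in>T. (\<forall>\<tau>\<in>{0..1}. unitary_in (q 0 x) (\<Gamma> ((x, t), \<tau>))) \<and>
        \<Gamma> ((x, t), 0) = U (snd (x, t)) 0 (fst (x, t)) \<and> \<Gamma> ((x, t), 1) * e 0 x = e 0 x \<and>
        (t \<in> T0 \<longrightarrow> (\<forall>\<tau>\<in>{0..1}. \<Gamma> ((x, t), \<tau>) = U (snd (x, t)) 0 (fst (x, t)))) \<and>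
        (x \<in> {} \<longrightarrow> (\<forall>\<tau>\<in>{0..1}. \<Gamma> ((x, t), \<tau>) = 0)))"
    proof (rule deform_unitaries_over_space[OF Xj[OF l0] closedin_empty T qj(1,2)[OF l0] ej(1,2)[OF l0] dim[OF l0] rk[OF l0] U(2)[OF l0],
          of "\<lambda>_. 0"])
      show "unitary_in (q 0 x) (U (snd (x, t)) 0 (fst (x, t)))" if "x \<in> topspace (X 0)" "t \<in> T" for x t
        using U(3)[OF l0 that] by simp
      show "U (snd (x, t)) 0 (fst (x, t)) * e 0 x = e 0 x" if "x \<in> topspace (X 0)" "t \<in> T0" for x t
        using U(4)[OF l0 that] by simp
    qed simp_all
    then obtain \<Gamma> where gc: "continuous_map (?Y 0) euclidean \<Gamma>"
      and g: "\<forall>x\<in>topspace (X 0). \<forall>t\<in>T. (\<forall>\<tau>\<in>{0..1}. unitary_in (q 0 x) (\<Gamma> ((x, t), \<tau>))) \<and>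
        \<Gamma> ((x, t), 0) = U t 0 x \<and> \<Gamma> ((x, t), 1) * e 0 x = e 0 x \<and>
        (t \<in> T0 \<longrightarrow> (\<forall>\<tau>\<in>{0..1}. \<Gamma> ((x, t), \<tau>) = U t 0 x))"
      unfolding fst_conv snd_conv by blast
    define G where "G t \<tau> j x = \<Gamma> ((x, t), \<tau>)" for t \<tau> and j :: nat and x
    have G: "G t \<tau> j = (\<lambda>x. \<Gamma> ((x, t), \<tau>))" for t \<tau> j by (rule ext) (simp add: G_def)
    have 1: "mem 0 (G t \<tau>)" if "t \<in> T" "\<tau> \<in> {0..1}" for t \<tau>
      unfolding mem_def R_0 by (intro allI blk_tup) (use slice[OF gc that] in \<open>simp add: G\<close>)
    have 2: "continuous_map (?Y j) euclidean (\<lambda>z. G (snd (fst z)) (snd z) j (fst (fst z)))" if "j \<le> 0" for j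
      unfolding G prod.collapse using that gc by simp
    have 3: "(\<forall>\<tau>\<in>{0..1}. unitary_in (q j x) (G t \<tau> j x)) \<and>
        G t 0 j x = U t j x \<and> G t 1 j x * e j x = e j x \<and> (t \<in> T0 \<longrightarrow> (\<forall>\<tau>\<in>{0..1}. G t \<tau> j x = U t j x))"
      if "j \<le> 0" "x \<in> topspace (X j)" "t \<in> T" for j x t
    proof -
      have j: "j = 0" using that by simp
      show ?thesis unfolding j G_def by (rule bspec[OF bspec[OF g that(2)[unfolded j]] that(3)])
    qed
    show ?case
    proof (rule exI[of _ G], intro conjI)
      show "\<forall>t\<in>T. \<forall>\<tau>\<in>{0..1}. mem 0 (G t \<tau>)" by (intro ballI 1)
      show "\<forall>j\<le>0. continuous_map (?Y j) euclidean (\<lambda>z. G (snd (fst z)) (snd z) j (fst (fst z)))" by (intro allI impI 2)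
    qed (intro allI ballI impI 3)
  next
    case (Suc k)
    then have k: "Suc k \<le> len D" "k \<le> len D" by simp_all
    let ?j = "Suc k" and ?B = "bdry D (Suc k)"
    obtain \<Gamma> where \<Gamma>: "?P k \<Gamma>" using Suc.IH[OF k(2)] by blast
    have Gm: "mem k (\<Gamma> t \<tau>)" if "t \<in> T" "\<tau> \<in> {0..1}" for t \<tau> using \<Gamma> that by blast
    have Gc: "continuous_map (?Y j) euclidean (\<lambda>z. \<Gamma> (snd (fst z)) (snd z) j (fst (fst z)))" if "j \<le> k" for j using \<Gamma> that by blast
    have Gu: "unitary_in (q j x) (\<Gamma> t \<tau> j x)" if "j \<le> k" "x \<in> topspace (X j)" "t \<in> T" "\<tau> \<in> {0..1}" for j x t \<tau> using \<Gamma> that by blast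
    have G0: "\<Gamma> t 0 j x = U t j x" "\<Gamma> t 1 j x * e j x = e j x" if "j \<le> k" "x \<in> topspace (X j)" "t \<in> T" for j x t using \<Gamma> that by blast+
    have GT0: "\<Gamma> t \<tau> j x = U t j x" if "j \<le> k" "x \<in> topspace (X j)" "t \<in> T0" "\<tau> \<in> {0..1}" for j x t \<tau> using \<Gamma> that T0T by blast
    have Gb: "bd m k (\<Gamma> t \<tau>)" if "t \<in> T" "\<tau> \<in> {0..1}" for t \<tau>
      unfolding bd_def using bnd_unitary_in[OF _ _ Gu[OF _ _ that]] qj(2) k by (meson le_trans)
    have mk: "mem k q" "mem k e" "mem ?j q" "mem ?j e" using mem_le q(1) e(1) k by blast+
    have bq: "bd m ?j q" "bd m ?j e" "bd m k q" "bd m k e" using q(2) e(2) k by (auto simp: bd_def)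
    have mU: "mem ?j (U t)" "mem k (U t)" if "t \<in> T" for t using mem_le[OF U(1)[OF that]] k by blast+
    have bU: "bd m ?j (U t)" if "t \<in> T" for t
      unfolding bd_def using bnd_unitary_in[OF _ _ U(3)[OF _ _ that]] qj(2) k by (meson le_trans)
    have BX: "?B \<subseteq> topspace (X ?j)" using closedin_subset[OF bdry[OF k(1)]] .
    define \<Gamma>0 where "\<Gamma>0 z = phi k m (\<Gamma> (snd (fst z)) (snd z)) (fst (fst z))" for z :: "('a \<times> real) \<times> real"
    have c0: "continuous_map (subtopology (?Y ?j) ((?B \<times> T) \<times> {0..1})) euclidean \<Gamma>0"
    proof -
      let ?S = "prod_topology (top_of_set T) ?I"
      have cj: "continuous_map (prod_topology (X j) ?S) euclidean (\<lambda>z. \<Gamma> (fst (snd z)) (snd (snd z)) j (fst z))" if "j \<le> k" for j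
      proof -
        have "continuous_map (prod_topology (X j) ?S) (top_of_set T) (\<lambda>z. fst (snd z))"
          using continuous_map_compose[OF continuous_map_snd[of "X j" ?S] continuous_map_fst[of "top_of_set T" ?I]] by (simp only: o_def)
        moreover have "continuous_map (prod_topology (X j) ?S) ?I (\<lambda>z. snd (snd z))"
          using continuous_map_compose[OF continuous_map_snd[of "X j" ?S] continuous_map_snd[of "top_of_set T" ?I]] by (simp only: o_def)
        ultimately have "continuous_map (prod_topology (X j) ?S) (?Y j) (\<lambda>z. ((fst z, fst (snd z)), snd (snd z)))"
          by (intro continuous_map_pairedI continuous_map_fst)
        from continuous_map_compose[OF this Gc[OF that]] show ?thesis by (simp add: o_def)
      qed
      have "continuous_map (prod_topology (subtopology (X ?j) ?B) ?S) euclidean (\<lambda>z. phi k m (case snd z of (t, \<tau>) \<Rightarrow> \<Gamma> t \<tau>) (fst z))"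
      proof (rule phi_continuous[OF k(1), of ?S "\<lambda>(t, \<tau>). \<Gamma> t \<tau>"])
        show "mem k (case s of (t, \<tau>) \<Rightarrow> \<Gamma> t \<tau>)" if "s \<in> topspace ?S" for s using that Gm by (cases s) auto
        show "continuous_map (prod_topology (X j) ?S) euclidean (\<lambda>z. (case snd z of (t, \<tau>) \<Rightarrow> \<Gamma> t \<tau>) j (fst z))" if "j \<le> k" for j
          using cj[OF that] by (simp add: case_prod_beta)
      qed
      moreover have "continuous_map (subtopology (?Y ?j) ((?B \<times> T) \<times> {0..1})) (prod_topology (subtopology (X ?j) ?B) ?S) (\<lambda>z. (fst (fst z), (snd (fst z), snd z)))"
      proof -
        have c1: "continuous_map (?Y ?j) (X ?j) (\<lambda>z. fst (fst z))"
          using continuous_map_compose[OF continuous_map_fst[of "prod_topology (X ?j) (top_of_set T)" ?I] continuous_map_fst] by (simp only: o_def)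
        have c2: "continuous_map (?Y ?j) (top_of_set T) (\<lambda>z. snd (fst z))"
          using continuous_map_compose[OF continuous_map_fst[of "prod_topology (X ?j) (top_of_set T)" ?I] continuous_map_snd] by (simp only: o_def)
        show ?thesis
          by (intro continuous_map_pairedI continuous_map_from_subtopology[OF c2] continuous_map_from_subtopology[OF continuous_map_snd]
              continuous_map_into_subtopology[OF continuous_map_from_subtopology[OF c1]]) auto
      qed
      ultimately have "continuous_map (subtopology (?Y ?j) ((?B \<times> T) \<times> {0..1})) euclidean
        ((\<lambda>z. phi k m (case snd z of (t, \<tau>) \<Rightarrow> \<Gamma> t \<tau>) (fst z)) \<circ> (\<lambda>z. (fst (fst z), (snd (fst z), snd z))))"
        by (rule continuous_map_compose[rotated])
      then show ?thesis by (simp add: o_def \<Gamma>0_def[abs_def])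
    qed
    have u0: "unitary_in (q ?j y) (\<Gamma>0 ((y, t), \<tau>))" if y: "y \<in> ?B" and t: "t \<in> T" "\<tau> \<in> {0..1}" for y t \<tau>
    proof -
      note F = Gm[OF t] Gb[OF t]
      have aF: "mem k (\<lambda>j x. adj (\<Gamma> t \<tau> j x))" "bd m k (\<lambda>j x. adj (\<Gamma> t \<tau> j x))"
        using mem_adj[OF k(2) F(1)] F(2) by (simp_all add: bd_def)
      have "phi k m q y = phi k m (\<lambda>j x. adj (\<Gamma> t \<tau> j x)) y * phi k m (\<Gamma> t \<tau>) y"
        by (rule phi_mult[OF k(1) aF F(1) mk(1) y]) (use Gu[OF _ _ t] in \<open>simp add: unitary_in_def\<close>)
      moreover have "phi k m q y = phi k m (\<Gamma> t \<tau>) y * phi k m (\<lambda>j x. adj (\<Gamma> t \<tau> j x)) y"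
        by (rule phi_mult[OF k(1) F aF(1) mk(1) y]) (use Gu[OF _ _ t] in \<open>simp add: unitary_in_def\<close>)
      ultimately show ?thesis
        using phi_eq[OF k(1) mk(3) bq(1) y] by (simp add: unitary_in_def \<Gamma>0_def phi_adj[OF k(1) F(1) y])
    qed
    have z0: "\<Gamma>0 ((y, t), 0) = U t ?j y" if y: "y \<in> ?B" and t: "t \<in> T" for y t
    proof -
      have "phi k m (\<Gamma> t 0) y = phi k m (U t) y" by (rule phi_cong[OF k(1)]) (use G0(1)[OF _ _ t] in simp)
      then show ?thesis using phi_eq[OF k(1) mU(1)[OF t] bU[OF t] y] by (simp add: \<Gamma>0_def)
    qed
    have e0: "\<Gamma>0 ((y, t), 1) * e ?j y = e ?j y" if y: "y \<in> ?B" and t: "t \<in> T" for y t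
    proof -
      have 1: "1 \<in> {0..1::real}" by simp
      have "phi k m e y = phi k m (\<Gamma> t 1) y * phi k m e y"
        by (rule phi_mult[OF k(1) Gm[OF t 1] Gb[OF t 1] mk(2) mk(2) y]) (use G0(2)[OF _ _ t] in simp)
      then show ?thesis using phi_eq[OF k(1) mk(4) bq(2) y] by (simp add: \<Gamma>0_def)
    qed
    have t0: "\<Gamma>0 ((y, t), \<tau>) = U t ?j y" if y: "y \<in> ?B" and t: "t \<in> T0" "\<tau> \<in> {0..1}" for y t \<tau>
    proof -
      have tT: "t \<in> T" using t T0T by blast
      have "phi k m (\<Gamma> t \<tau>) y = phi k m (U t) y" by (rule phi_cong[OF k(1)]) (use GT0[OF _ _ t] in simp)
      then show ?thesis using phi_eq[OF k(1) mU(1)[OF tT] bU[OF tT] y] by (simp add: \<Gamma>0_def)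
    qed
    have "\<exists>\<Gamma>. continuous_map (?Y ?j) euclidean \<Gamma> \<and>
      (\<forall>x\<in>topspace (X ?j). \<forall>t\<in>T. (\<forall>\<tau>\<in>{0..1}. unitary_in (q ?j x) (\<Gamma> ((x, t), \<tau>))) \<and>
        \<Gamma> ((x, t), 0) = U (snd (x, t)) ?j (fst (x, t)) \<and> \<Gamma> ((x, t), 1) * e ?j x = e ?j x \<and>
        (t \<in> T0 \<longrightarrow> (\<forall>\<tau>\<in>{0..1}. \<Gamma> ((x, t), \<tau>) = U (snd (x, t)) ?j (fst (x, t)))) \<and>
        (x \<in> ?B \<longrightarrow> (\<forall>\<tau>\<in>{0..1}. \<Gamma> ((x, t), \<tau>) = \<Gamma>0 ((x, t), \<tau>))))"
    proof (rule deform_unitaries_over_space[OF Xj[OF k(1)] bdry[OF k(1)] T qj(1,2)[OF k(1)] ej(1,2)[OF k(1)] dim[OF k(1)] rk[OF k(1)] U(2)[OF k(1)],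
          of \<Gamma>0])
      show "unitary_in (q ?j x) (U (snd (x, t)) ?j (fst (x, t)))" if "x \<in> topspace (X ?j)" "t \<in> T" for x t
        using U(3)[OF k(1) that] by simp
      show "U (snd (x, t)) ?j (fst (x, t)) * e ?j x = e ?j x" if "x \<in> topspace (X ?j)" "t \<in> T0" for x t
        using U(4)[OF k(1) that] by simp
    qed (use c0 u0 z0 e0 t0 in simp_all)
    then obtain \<Gamma>s where gc: "continuous_map (?Y ?j) euclidean \<Gamma>s"
      and g: "\<forall>x\<in>topspace (X ?j). \<forall>t\<in>T. (\<forall>\<tau>\<in>{0..1}. unitary_in (q ?j x) (\<Gamma>s ((x, t), \<tau>))) \<and>
        \<Gamma>s ((x, t), 0) = U t ?j x \<and> \<Gamma>s ((x, t), 1) * e ?j x = e ?j x \<and>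
        (t \<in> T0 \<longrightarrow> (\<forall>\<tau>\<in>{0..1}. \<Gamma>s ((x, t), \<tau>) = U t ?j x)) \<and>
        (x \<in> ?B \<longrightarrow> (\<forall>\<tau>\<in>{0..1}. \<Gamma>s ((x, t), \<tau>) = \<Gamma>0 ((x, t), \<tau>)))"
      unfolding fst_conv snd_conv by blast
    define G where "G t \<tau> j x = (if j = ?j then \<Gamma>s ((x, t), \<tau>) else \<Gamma> t \<tau> j x)" for t \<tau> and j :: nat and x
    have Gj: "G t \<tau> ?j = (\<lambda>x. \<Gamma>s ((x, t), \<tau>))" for t \<tau> by (rule ext) (simp add: G_def)
    have Gk: "G t \<tau> j = \<Gamma> t \<tau> j" if "j \<noteq> ?j" for t \<tau> j by (rule ext) (simp add: G_def that)
    have 1: "mem ?j (G t \<tau>)" if t: "t \<in> T" "\<tau> \<in> {0..1}" for t \<tau>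
      unfolding mem_Suc_iff[OF k(1)]
    proof (intro conjI allI ballI)
      have eq: "blk k (G t \<tau>) = blk k (\<Gamma> t \<tau>)" by (rule blk_cong) (simp add: G_def)
      show mG: "mem k (G t \<tau>)" using Gm[OF t] eq by (simp add: mem_def)
      fix i i'
      show "blk ?j (G t \<tau>) i i' \<in> tup ?j"
      proof (rule blk_tup)
        fix j assume j: "j \<le> ?j"
        show "continuous_map (X j) euclidean (G t \<tau> j)"
        proof (cases "j = ?j")
          case True
          then show ?thesis using slice[OF gc t] by (simp add: Gj)
        next
          case False
          then have "j \<le> k" using j by simp
          then show ?thesis using mem_continuous[OF k(2) Gm[OF t] Gb[OF t]] False by (simp add: Gk)
        qed
      qed
      fix y assume y: "y \<in> ?B"
      have yt: "y \<in> topspace (X ?j)" using y BX by blast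
      have c: "blk k (\<Gamma> t \<tau>) i i' \<in> R k" using Gm[OF t] by (simp add: mem_def)
      have Gy: "G t \<tau> ?j y = phi k m (\<Gamma> t \<tau>) y" using g y yt t by (simp add: Gj \<Gamma>0_def)
      show "\<alpha> k (blk k (G t \<tau>) i i') y = blk ?j (G t \<tau>) i i' ?j y"
        unfolding eq
      proof (rule eq_matI)
        have dB: "dim_row (blk ?j (G t \<tau>) i i' ?j y) = n ?j" "dim_col (blk ?j (G t \<tau>) i i' ?j y) = n ?j"
          using blk_carrier[of ?j ?j y "G t \<tau>" i i'] yt by auto
        have dA: "dim_row (\<alpha> k (blk k (\<Gamma> t \<tau>) i i') y) = n ?j" "dim_col (\<alpha> k (blk k (\<Gamma> t \<tau>) i i') y) = n ?j"
          using \<alpha>_hom(6)[OF k(1) c c y] by auto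
        show "dim_row (\<alpha> k (blk k (\<Gamma> t \<tau>) i i') y) = dim_row (blk ?j (G t \<tau>) i i' ?j y)"
          "dim_col (\<alpha> k (blk k (\<Gamma> t \<tau>) i i') y) = dim_col (blk ?j (G t \<tau>) i i' ?j y)" using dA dB by simp_all
        fix r s assume "r < dim_row (blk ?j (G t \<tau>) i i' ?j y)" "s < dim_col (blk ?j (G t \<tau>) i i' ?j y)"
        then have rs: "r < n ?j" "s < n ?j" using dB by simp_all
        have b: "blk ?j (G t \<tau>) i i' ?j y $$ (r, s) = ent (phi k m (\<Gamma> t \<tau>) y) (i * n ?j + r) (i' * n ?j + s)"
          using yt rs by (simp add: blk_index Gy)
        show "\<alpha> k (blk k (\<Gamma> t \<tau>) i i') y $$ (r, s) = blk ?j (G t \<tau>) i i' ?j y $$ (r, s)"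
        proof (cases "i < m \<and> i' < m")
          case True
          then show ?thesis using b phi_block[OF k(1), of i m i' r s] rs by simp
        next
          case False
          have big: "m * n' \<le> i * n' + u" if "m \<le> i" for n' u i :: nat
            using that by (simp add: trans_le_add1)
          have "\<alpha> k (blk k (\<Gamma> t \<tau>) i i') y $$ (r, s) = 0"
          proof (rule \<alpha>_zero[OF k(1) c y _ rs])
            fix j x r s assume "j \<le> k" "x \<in> topspace (X j)" "r < n j" "s < n j"
            then show "blk k (\<Gamma> t \<tau>) i i' j x $$ (r, s) = 0"
              using False Gb[OF t] big[of i "n j" r] big[of i' "n j" s] bnd_ent[of "m * n j" "\<Gamma> t \<tau> j x" "i * n j + r" "i' * n j + s"]
              by (auto simp: blk_index bd_def not_less)
          qed
          moreover have "ent (phi k m (\<Gamma> t \<tau>) y) (i * n ?j + r) (i' * n ?j + s) = 0"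
            by (rule bnd_ent[OF bnd_phi[OF k(1)]]) (use False big in \<open>auto simp: not_less\<close>)
          ultimately show ?thesis using b by simp
        qed
      qed
    qed
    have 2: "continuous_map (?Y j) euclidean (\<lambda>z. G (snd (fst z)) (snd z) j (fst (fst z)))" if "j \<le> ?j" for j
    proof (cases "j = ?j")
      case True
      then show ?thesis using gc by (simp add: Gj)
    next
      case False
      then show ?thesis using Gc[of j] that by (simp add: Gk)
    qed
    have 3: "(\<forall>\<tau>\<in>{0..1}. unitary_in (q j x) (G t \<tau> j x)) \<and>
        G t 0 j x = U t j x \<and> G t 1 j x * e j x = e j x \<and> (t \<in> T0 \<longrightarrow> (\<forall>\<tau>\<in>{0..1}. G t \<tau> j x = U t j x))"
      if "j \<le> ?j" "x \<in> topspace (X j)" "t \<in> T" for j x t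
    proof (cases "j = ?j")
      case True
      then show ?thesis using g that by (simp add: Gj)
    next
      case False
      then have "j \<le> k" using that by simp
      then show ?thesis using Gu G0 GT0 that False by (simp add: Gk)
    qed
    show ?case
    proof (rule exI[of _ G], intro conjI)
      show "\<forall>t\<in>T. \<forall>\<tau>\<in>{0..1}. mem ?j (G t \<tau>)" by (intro ballI 1)
      show "\<forall>j\<le>?j. continuous_map (?Y j) euclidean (\<lambda>z. G (snd (fst z)) (snd z) j (fst (fst z)))" by (intro allI impI 2)
    qed (intro allI ballI impI 3)
  }
qed

end

section \<open>Rank and operator norm\<close>

lemma tom_add: "tom N (a + b) = tom N a + tom N b" by (rule eq_matI) (simp_all add: tom_def)

text \<open>The squared Frobenius norm of a projection is its trace. Splitting off unit vectors one by one
  writes the projection as a sum of that many matrices of rank one.\<close>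

lemma rank_proj_le:
  assumes "proj_mat e" "bnd N e" shows "real (vec_space.rank N (tom N e)) \<le> (norm e)\<^sup>2"
  using assms
proof (induction "nat \<lfloor>(norm e)\<^sup>2\<rfloor>" arbitrary: e rule: less_induct)
  case less
  interpret vec_space "TYPE(complex)" N .
  show ?case
  proof (cases "e = 0")
    case True
    then have "tom N e = 0\<^sub>m N N" by (intro eq_matI) (simp_all add: tom_def)
    then show ?thesis by (simp add: rank_0I)
  next
    case False
    obtain i where i: "i < N" "e * unit_mat i 0 1 \<noteq> 0" by (rule proj_vector_exists[OF less.prems(2) False])
    define w where "w = e * unit_mat i 0 1"
    have w: "w * E0 = w" "w \<noteq> 0" using i(2) by (simp_all add: w_def mult.assoc)
    have ew: "e * w = w" using less.prems(1) by (simp add: w_def proj_mat_def mult.assoc[symmetric])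
    define h where "h = (1 / norm w) *\<^sub>R w"
    have h: "adj h * h = E0" "e * h = h" using normalize_vector[OF w] ew by (simp_all add: h_def)
    have wb: "bnd N w" unfolding w_def using less.prems(2) i(1) by (simp add: bnd_mult bnd_unit_mat)
    have hb: "bnd N (h * adj h)" by (simp add: h_def wb)
    have hE: "h * E0 = h" by (rule unit_vector_E0[OF h(1)])
    note s = proj_split_vector[OF less.prems(1) h]
    have b': "bnd N (e - h * adj h)" using less.prems(2) hb by simp
    have "nat \<lfloor>(norm (e - h * adj h))\<^sup>2\<rfloor> < nat \<lfloor>(norm e)\<^sup>2\<rfloor>" using s(2,3) by (simp add: floor_diff_one)
    from less.hyps[OF this s(1) b'] have 1: "real (rank (tom N (e - h * adj h))) \<le> (norm e)\<^sup>2 - 1" unfolding s(2) .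
    have "rank (tom N (h * adj h)) \<le> 1"
    proof (rule rank_le_1_product_entries)
      show "tom N (h * adj h) $$ (r, c) = ent h r 0 * cnj (ent h c 0)"
        if "r < dim_row (tom N (h * adj h))" "c < dim_col (tom N (h * adj h))" for r c
      proof -
        have hS: "bnd (Suc N) h" using wb bnd_mono[of N h "Suc N"] by (simp add: h_def)
        have h0: "ent h r (Suc l) = 0" for l
          using arg_cong[OF hE, of "\<lambda>a. ent a r (Suc l)"] by (simp add: mult_unit_mat_ent)
        have "ent (h * adj h) r c = (\<Sum>l<Suc N. ent h r l * cnj (ent h c l))" by (simp only: ent_mult[OF hS] ent_adj)
        also have "\<dots> = ent h r 0 * cnj (ent h c 0)" unfolding sum.lessThan_Suc_shift by (simp add: h0)
        finally show ?thesis using that by (simp add: tom_def)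
      qed
    qed (rule tom_carrier)
    moreover have "tom N e = tom N (e - h * adj h) + tom N (h * adj h)" unfolding tom_add[symmetric] by simp
    moreover have "rank (tom N (e - h * adj h) + tom N (h * adj h)) \<le> rank (tom N (e - h * adj h)) + rank (tom N (h * adj h))"
      by (rule rank_subadditive[OF tom_carrier tom_carrier])
    ultimately show ?thesis using 1 by simp
  qed
qed

lemma l2norm_mult_le:
  assumes a: "bnd N a" and v: "v \<in> carrier_vec N" "l2norm v \<le> 1"
  shows "l2norm (tom N a *\<^sub>v v) \<le> norm a"
proof -
  define col where "col v = fm N (\<lambda>i j. if j = 0 then v $ i else 0)" for v :: "complex vec"
  have n: "norm (col v) = l2norm v" if "v \<in> carrier_vec N" for v
  proof -
    have "(norm (col v))\<^sup>2 = (\<Sum>i<N. \<Sum>j<N. if j = 0 then (cmod (v $ i))\<^sup>2 else 0)"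
      by (subst norm_fmat_sq[of N], simp add: col_def, intro sum.cong refl) (simp add: col_def)
    also have "\<dots> = (\<Sum>i<N. (cmod (v $ i))\<^sup>2)" by (rule sum.cong) (auto simp: sum.delta)
    finally show ?thesis using that unfolding l2norm_def by (metis carrier_vecD norm_ge_zero real_sqrt_unique)
  qed
  have tv: "tom N a *\<^sub>v v \<in> carrier_vec N" by (rule mult_mat_vec_carrier[OF tom_carrier v(1)])
  have "col (tom N a *\<^sub>v v) = a * col v"
  proof (rule fmat_eqI)
    fix i j
    show "ent (col (tom N a *\<^sub>v v)) i j = ent (a * col v) i j"
    proof (cases "i < N \<and> j < N")
      case True
      then show ?thesis using v(1) by (simp add: ent_mult[OF a] col_def scalar_prod_def lessThan_atLeast0)
    next
      case False
      have "bnd N (a * col v)" using a by (simp add: col_def)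
      then show ?thesis using False bnd_ent[of N "a * col v" i j] by (auto simp: col_def not_less)
    qed
  qed
  then have "l2norm (tom N a *\<^sub>v v) = norm (a * col v)" using n[OF tv] by simp
  also have "\<dots> \<le> norm a * norm (col v)" by (rule norm_mult_ineq)
  also have "\<dots> \<le> norm a * 1" using n[OF v(1)] v(2) by (intro mult_left_mono) auto
  finally show ?thesis by simp
qed

lemma op_norm_bdd:
  assumes "bnd N a"
  shows "bdd_above {l2norm (tom N a *\<^sub>v v) |v. v \<in> carrier_vec (dim_col (tom N a)) \<and> l2norm v \<le> 1}"
  by (rule bdd_aboveI[of _ "norm a"]) (use l2norm_mult_le[OF assms] in \<open>auto simp: tom_def\<close>)

lemma op_norm_le:
  assumes "bnd N a" shows "op_norm (tom N a) \<le> norm a"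
  unfolding op_norm_def
proof (rule cSup_least)
  have "l2norm (0\<^sub>v N) \<le> 1" "0\<^sub>v N \<in> carrier_vec (dim_col (tom N a))" by (simp_all add: l2norm_def tom_def)
  then show "{l2norm (tom N a *\<^sub>v v) |v. v \<in> carrier_vec (dim_col (tom N a)) \<and> l2norm v \<le> 1} \<noteq> {}" by blast
qed (use l2norm_mult_le[OF assms] in \<open>auto simp: tom_def\<close>)

lemma ent_le_op_norm:
  assumes a: "bnd N a" and rs: "r < N" "s < N" shows "cmod (ent a r s) \<le> op_norm (tom N a)"
proof -
  let ?v = "unit_vec N s :: complex vec"
  have "(\<Sum>i<N. (cmod (?v $ i))\<^sup>2) = (\<Sum>i<N. if i = s then 1 else 0)" by (rule sum.cong) (auto simp: rs)
  then have v: "?v \<in> carrier_vec (dim_col (tom N a))" "l2norm ?v \<le> 1" using rs by (simp_all add: l2norm_def tom_def)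
  have t: "(tom N a *\<^sub>v ?v) $ i = ent a i s" if "i < N" for i
    using that rs by (simp add: scalar_prod_right_unit[of _ N])
  have "(cmod (ent a r s))\<^sup>2 \<le> (\<Sum>i<N. (cmod (ent a i s))\<^sup>2)"
    by (rule member_le_sum) (use rs in auto)
  also have "\<dots> = (\<Sum>i<N. (cmod ((tom N a *\<^sub>v ?v) $ i))\<^sup>2)" using rs by (intro sum.cong) (auto simp: t)
  finally have "cmod (ent a r s) \<le> l2norm (tom N a *\<^sub>v ?v)"
    unfolding l2norm_def by (intro real_le_rsqrt) (simp add: tom_def)
  also have "\<dots> \<le> op_norm (tom N a)" unfolding op_norm_def by (rule cSup_upper[OF _ op_norm_bdd[OF a]]) (use v in blast)
  finally show ?thesis .
qed

lemma norm_le_op_norm: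
  assumes a: "bnd N a" shows "norm a \<le> (real N)\<^sup>2 * op_norm (tom N a)"
proof -
  have "norm a \<le> (\<Sum>i<N. \<Sum>j<N. cmod (ent a i j))" by (rule norm_le_sum_ent[OF a])
  also have "\<dots> \<le> (\<Sum>i<N. \<Sum>j<N. op_norm (tom N a))" by (intro sum_mono ent_le_op_norm[OF a]) auto
  finally show ?thesis by (simp add: power2_eq_square mult.assoc)
qed

section \<open>Projections below a projection\<close>

text \<open>With \<open>w = p(1 - q)\<close>, compressing \<open>q - p = c* c\<close> by \<open>1 - q\<close> gives \<open>- w* w = d* d\<close> for \<open>d = c(1 - q)\<close>; the traces
  of \<open>w* w\<close> and \<open>d* d\<close> are nonnegative, hence zero.\<close>

lemma proj_le_mult:
  assumes p: "proj_mat p" and q: "proj_mat q" and c: "q - p = adj c * c"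
  shows "q * p = p" "p * q = p"
proof -
  have pp: "p * p = p" "adj p = p" "q * q = q" "adj q = q" using p q by (auto simp: proj_mat_def)
  obtain N where N: "bnd N p" "bnd N q" "bnd N c" by (rule ex_bnd3)
  define I where "I = Id N"
  have I: "I * p = p" "p * I = p" "I * q = q" "q * I = q" "c * I = c" "adj I = I" "bnd N I"
    using N by (simp_all add: I_def Id_mult mult_Id)
  define w where "w = p - p * q"
  define d where "d = c - c * q"
  have tr: "inner (adj x * x) I = (norm x)\<^sup>2" if "bnd N x" for x
    using mult_Id[OF that] by (simp add: inner_mult_left I_def power2_norm_eq_inner)
  have "adj d * d = adj c * c - adj c * c * q - q * (adj c * c) + q * (adj c * c) * q"
    by (simp add: d_def pp left_diff_distrib right_diff_distrib mult.assoc)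
  also have "\<dots> = - (adj w * w)"
    unfolding c[symmetric] by (simp add: w_def pp left_diff_distrib right_diff_distrib mult.assoc) (simp add: mult.assoc[symmetric] pp)
  finally have "inner (adj d * d) I = - inner (adj w * w) I" by simp
  moreover have "bnd N d" "bnd N w" using N by (simp_all add: d_def w_def)
  ultimately have "(norm d)\<^sup>2 + (norm w)\<^sup>2 = 0" using tr by simp
  then have "w = 0" by (simp add: sum_power2_eq_zero_iff)
  then show "p * q = p" by (simp add: w_def)
  from arg_cong[OF this, of adj] show "q * p = p" by (simp add: pp)
qed

lemma proj_complement:
  assumes p: "proj_mat p" and q: "proj_mat q" and m: "q * p = p" "p * q = p"
  shows "proj_mat (q - p)" "q * (q - p) = q - p" "p * (q - p) = 0" "(q - p) * p = 0"
    "(norm q)\<^sup>2 - (norm (q - p))\<^sup>2 = (norm p)\<^sup>2"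
proof -
  have pp: "p * p = p" "adj p = p" "q * q = q" "adj q = q" using p q by (auto simp: proj_mat_def)
  show "proj_mat (q - p)" "q * (q - p) = q - p" and 0: "p * (q - p) = 0" and "(q - p) * p = 0"
    using pp m by (simp_all add: proj_mat_def left_diff_distrib right_diff_distrib)
  define d where "d = q - p"
  have "inner p (q - p) = inner (p * p) (q - p)" by (simp only: pp)
  also have "\<dots> = 0" by (subst inner_mult_left) (simp only: pp 0 inner_zero_right)
  finally have "inner p d = 0" unfolding d_def .
  then have "(norm (p + d))\<^sup>2 = (norm p)\<^sup>2 + (norm d)\<^sup>2"
    unfolding power2_norm_eq_inner by (simp add: inner_add_left inner_add_right inner_commute)
  then show "(norm q)\<^sup>2 - (norm (q - p))\<^sup>2 = (norm p)\<^sup>2" by (simp add: d_def)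
qed

text \<open>This and the next lemma identify the unitaries of \<open>p\<close> with the unitaries of \<open>q\<close> that fix \<open>q - p\<close>.\<close>

lemma unitary_in_cut:
  assumes p: "proj_mat p" and q: "proj_mat q" and m: "q * p = p" "p * q = p"
    and v: "unitary_in q v" "v * (q - p) = q - p"
  shows "unitary_in p (v - (q - p))"
proof -
  define e where "e = q - p"
  note c = proj_complement[OF p q m]
  have e: "e * e = e" "adj e = e" "q * e = e" using c(1,2) by (auto simp: e_def proj_mat_def)
  have ve: "v * e = e" using v(2) by (simp add: e_def)
  have uv: "adj v * v = q" "v * adj v = q" using v(1) by (auto simp: unitary_in_def)
  have eav: "e * adj v = e" using arg_cong[OF ve, of adj] e by simp
  have ave: "adj v * e = e" by (metis ve uv(1) mult.assoc e(3))
  have ev: "e * v = e" using arg_cong[OF ave, of adj] e by simp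
  show ?thesis unfolding e_def[symmetric] unitary_in_def
    using uv ve eav ave ev e by (simp add: left_diff_distrib right_diff_distrib) (simp add: e_def)
qed

lemma unitary_in_sum:
  assumes p: "proj_mat p" and q: "proj_mat q" and m: "q * p = p" "p * q = p" and v: "unitary_in p v"
  shows "unitary_in q (v + (q - p))" "(v + (q - p)) * (q - p) = q - p"
proof -
  define e where "e = q - p"
  note c = proj_complement[OF p q m]
  have e: "e * e = e" "adj e = e" "p * e = 0" "e * p = 0" using c by (auto simp: e_def proj_mat_def)
  have vp: "v * p = v" "p * v = v" using unitary_in_mult[OF p v] by auto
  have ve: "v * e = 0" by (metis vp(1) e(3) mult.assoc mult_zero_right)
  have ev: "e * v = 0" by (metis vp(2) e(4) mult.assoc mult_zero_left)
  have "adj v * e = 0" "e * adj v = 0" using arg_cong[OF ev, of adj] arg_cong[OF ve, of adj] e by simp_all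
  then show "unitary_in q (v + (q - p))"
    using v ve ev e unfolding e_def[symmetric] unitary_in_def by (simp add: distrib_left distrib_right) (simp add: e_def)
  show "(v + (q - p)) * (q - p) = q - p" using ve e(1) unfolding e_def[symmetric] by (simp add: distrib_right)
qed

section \<open>Matrices over the algebra as families of matrices\<close>

lemma ent_blockI:
  assumes n: "0 < (n::nat)"
    and eq: "\<And>i i' r s. r < n \<Longrightarrow> s < n \<Longrightarrow> ent a (i * n + r) (i' * n + s) = ent b (i * n + r) (i' * n + s)"
  shows "a = b"
proof (rule fmat_eqI)
  fix u v
  show "ent a u v = ent b u v" using eq[of "u mod n" "v mod n" "u div n" "v div n"] n by (simp add: div_mult_mod_eq)
qed

context rsh
begin

abbreviation "L \<equiv> len D"
abbreviation "A \<equiv> rsh_algebra D"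
abbreviation "B \<equiv> rsh_Minf D"
abbreviation "MM \<equiv> mat_in (rsh_algebra D)"

lemma A_eq: "A = St L" by (simp add: rsh_algebra_def)

lemma carrier_A: "carrier A = R L" by (simp add: A_eq stage_sel)

lemmas A_val = stage_val[of _ L, folded A_eq]

lemma A_closed: "a \<in> R L \<Longrightarrow> b \<in> R L \<Longrightarrow> a \<otimes>\<^bsub>A\<^esub> b \<in> R L" "a \<in> R L \<Longrightarrow> b \<in> R L \<Longrightarrow> a \<oplus>\<^bsub>A\<^esub> b \<in> R L"
  "a \<in> R L \<Longrightarrow> c \<odot>\<^bsub>A\<^esub> a \<in> R L" "a \<in> R L \<Longrightarrow> star A a \<in> R L" "\<zero>\<^bsub>A\<^esub> \<in> R L"
  by (simp_all add: A_eq R_closed(1,2) R_closed(3,4)[of L a a] R_zero)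

lemma R_eqI:
  assumes "a \<in> R L" "b \<in> R L"
    "\<And>j x r s. j \<le> L \<Longrightarrow> x \<in> topspace (X j) \<Longrightarrow> r < n j \<Longrightarrow> s < n j \<Longrightarrow> a j x $$ (r, s) = b j x $$ (r, s)"
  shows "a = b"
proof (rule tup_eqI[OF R_tup[OF assms(1)] R_tup[OF assms(2)]])
  fix j x assume jx: "j \<le> L" "x \<in> topspace (X j)"
  show "a j x = b j x"
    using assms(3)[OF jx] tup_dim[OF R_tup[OF assms(1)] jx] tup_dim[OF R_tup[OF assms(2)] jx] by (intro eq_matI) auto
qed

lemma A_index:
  assumes "a \<in> R L" "b \<in> R L" "j \<le> L" "x \<in> topspace (X j)" "r < n j" "s < n j"
  shows "(a \<oplus>\<^bsub>A\<^esub> b) j x $$ (r, s) = a j x $$ (r, s) + b j x $$ (r, s)"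
    "(a \<otimes>\<^bsub>A\<^esub> b) j x $$ (r, s) = (\<Sum>t<n j. a j x $$ (r, t) * b j x $$ (t, s))"
    "(c \<odot>\<^bsub>A\<^esub> a) j x $$ (r, s) = c * a j x $$ (r, s)"
    "star A a j x $$ (r, s) = cnj (a j x $$ (s, r))"
    "\<zero>\<^bsub>A\<^esub> j x $$ (r, s) = 0"
  using assms(3-) tup_dim[OF R_tup[OF assms(1)] assms(3,4)] tup_dim[OF R_tup[OF assms(2)] assms(3,4)]
    mat_mult_index[OF R_mat[OF assms(1) assms(3,4)] R_mat[OF assms(2) assms(3,4)] assms(5,6)]
    mat_adjoint_index[OF R_mat[OF assms(1) assms(3,4)] assms(5,6)]
  by (simp_all add: A_val del: index_mult_mat)

lemma abelian_monoid_A: "abelian_monoid A"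
proof (rule abelian_monoidI)
  note [simp] = carrier_A A_index A_closed
  show "x \<oplus>\<^bsub>A\<^esub> y \<in> carrier A" if "x \<in> carrier A" "y \<in> carrier A" for x y using that by simp
  show "\<zero>\<^bsub>A\<^esub> \<in> carrier A" by simp
  show "(x \<oplus>\<^bsub>A\<^esub> y) \<oplus>\<^bsub>A\<^esub> z = x \<oplus>\<^bsub>A\<^esub> (y \<oplus>\<^bsub>A\<^esub> z)" if "x \<in> carrier A" "y \<in> carrier A" "z \<in> carrier A" for x y z
    using that by (intro R_eqI) simp_all
  show "\<zero>\<^bsub>A\<^esub> \<oplus>\<^bsub>A\<^esub> x = x" if "x \<in> carrier A" for x
    using that by (intro R_eqI) simp_all
  show "x \<oplus>\<^bsub>A\<^esub> y = y \<oplus>\<^bsub>A\<^esub> x" if "x \<in> carrier A" "y \<in> carrier A" for x y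
    using that by (intro R_eqI) simp_all
qed

text \<open>Sums in the algebra are computed pointwise; the product in \<open>M\<^sub>\<infinity>(A)\<close> is defined by such sums.\<close>

lemma finsum_index:
  assumes "finite S" "\<And>k. k \<in> S \<Longrightarrow> f k \<in> R L"
  shows "finsum A f S \<in> R L \<and> (\<forall>j\<le>L. \<forall>x\<in>topspace (X j). \<forall>r<n j. \<forall>s<n j.
    finsum A f S j x $$ (r, s) = (\<Sum>k\<in>S. f k j x $$ (r, s)))"
  using assms
proof (induction S)
  case empty
  interpret abelian_monoid A by (rule abelian_monoid_A)
  show ?case using A_closed(5) A_index(5)[OF A_closed(5) A_closed(5)] by simp
next
  case (insert k S)
  interpret abelian_monoid A by (rule abelian_monoid_A)
  have f: "f k \<in> R L" "f \<in> S \<rightarrow> carrier A" using insert.prems by (auto simp: carrier_A)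
  have IH: "finsum A f S \<in> R L" "\<forall>j\<le>L. \<forall>x\<in>topspace (X j). \<forall>r<n j. \<forall>s<n j.
    finsum A f S j x $$ (r, s) = (\<Sum>k\<in>S. f k j x $$ (r, s))" using insert by blast+
  have "finsum A f (insert k S) = f k \<oplus>\<^bsub>A\<^esub> finsum A f S"
    using f by (intro finsum_insert insert) (auto simp: carrier_A)
  then show ?case using IH f(1) A_closed(2)[OF f(1) IH(1)] A_index(1)[OF f(1) IH(1)] insert.hyps by simp
qed

text \<open>The family of matrices of an element of \<open>M\<^sub>m(A)\<close>; its inverse is \<^term>\<open>blk L\<close>.\<close>

definition toF :: "nat \<Rightarrow> (nat \<Rightarrow> nat \<Rightarrow> nat \<Rightarrow> 'a \<Rightarrow> complex mat) \<Rightarrow> nat \<Rightarrow> 'a \<Rightarrow> fmat" where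
  "toF m a j x = fm (m * n j) (\<lambda>r s. a (r div n j) (s div n j) j x $$ (r mod n j, s mod n j))"

lemma MM_iff: "a \<in> MM m \<longleftrightarrow> (\<forall>i i'. a i i' \<in> R L) \<and> (\<forall>i i'. m \<le> i \<or> m \<le> i' \<longrightarrow> a i i' = \<zero>\<^bsub>A\<^esub>)"
  by (simp add: mat_in_def carrier_A)

lemma MM_R: "a \<in> MM m \<Longrightarrow> a i i' \<in> R L" by (simp add: MM_iff)

lemma MM_mono: "a \<in> MM m \<Longrightarrow> m \<le> m' \<Longrightarrow> a \<in> MM m'" by (auto simp: MM_iff)

lemma block_ge: "(m::nat) \<le> i \<Longrightarrow> m * n' \<le> i * n' + u"
  by (simp add: trans_le_add1)

lemma bnd_toF [simp]: "bnd (m * n j) (toF m a j x)" by (simp add: toF_def)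

lemma ent_toF:
  assumes "a \<in> MM m" "j \<le> L" "x \<in> topspace (X j)" "r < n j" "s < n j"
  shows "ent (toF m a j x) (i * n j + r) (i' * n j + s) = a i i' j x $$ (r, s)"
proof (cases "i < m \<and> i' < m")
  case True
  then show ?thesis using assms by (simp add: toF_def block_index_less)
next
  case False
  then have "a i i' = \<zero>\<^bsub>A\<^esub>" using assms(1) by (auto simp: MM_iff)
  then have "a i i' j x $$ (r, s) = 0" using A_index(5)[OF A_closed(5) A_closed(5) assms(2-)] by simp
  moreover have "ent (toF m a j x) (i * n j + r) (i' * n j + s) = 0"
    by (rule bnd_ent[OF bnd_toF]) (use False block_ge in \<open>auto simp: not_less\<close>)
  ultimately show ?thesis by simp
qed

lemma restrict_tup: assumes "a \<in> tup k" shows "(\<lambda>j\<in>{..k}. \<lambda>x\<in>topspace (X j). a j x) = a"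
proof
  fix j
  show "(\<lambda>j\<in>{..k}. \<lambda>x\<in>topspace (X j). a j x) j = a j"
  proof (cases "j \<le> k")
    case True
    then have "a j \<in> extensional (topspace (X j))" using assms by (auto simp: tup_def C_alg_carrier)
    then show ?thesis using True by (simp add: extensional_restrict)
  next
    case False
    then show ?thesis using assms by (auto simp: tup_def extensional_def)
  qed
qed

lemma blk_toF: assumes "a \<in> MM m" shows "blk L (toF m a) = a"
proof (intro ext)
  fix i i'
  have t: "a i i' \<in> tup L" by (rule R_tup[OF MM_R[OF assms]])
  have "blk L (toF m a) i i' = (\<lambda>j\<in>{..L}. \<lambda>x\<in>topspace (X j). a i i' j x)"
    unfolding blk_def
  proof (intro restrict_ext)
    fix j x assume "j \<in> {..L}" and x: "x \<in> topspace (X j)"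
    then have j: "j \<le> L" by simp
    show "mat (n j) (n j) (\<lambda>(r, s). ent (toF m a j x) (i * n j + r) (i' * n j + s)) = a i i' j x"
      using ent_toF[OF assms j x] tup_dim[OF t j x] by (intro eq_matI) simp_all
  qed
  then show "blk L (toF m a) i i' j x = a i i' j x" for j x using restrict_tup[OF t] by simp
qed

lemma mem_toF: "a \<in> MM m \<Longrightarrow> mem L (toF m a)" unfolding mem_def by (simp add: blk_toF MM_R)

lemma bd_toF: "bd m L (toF m a)" by (simp add: bd_def)

lemma MM_blk:
  assumes "mem L F" "bd m L F" shows "blk L F \<in> MM m"
  unfolding MM_iff
proof (intro conjI allI impI)
  show c: "blk L F i i' \<in> R L" for i i' using assms by (simp add: mem_def)
  fix i i' assume i: "m \<le> i \<or> m \<le> i'"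
  show "blk L F i i' = \<zero>\<^bsub>A\<^esub>"
  proof (rule R_eqI[OF c A_closed(5)])
    fix j x r s assume jx: "j \<le> L" "x \<in> topspace (X j)" "r < n j" "s < n j"
    have "ent (F j x) (i * n j + r) (i' * n j + s) = 0"
      by (rule bnd_ent[of "m * n j"]) (use assms(2) jx i block_ge in \<open>auto simp: bd_def\<close>)
    then show "blk L F i i' j x $$ (r, s) = \<zero>\<^bsub>A\<^esub> j x $$ (r, s)"
      using jx A_index(5)[OF A_closed(5) A_closed(5) jx] by (simp add: blk_index)
  qed
qed

lemma toF_blk:
  assumes "mem L F" "bd m L F" "j \<le> L" "x \<in> topspace (X j)" shows "toF m (blk L F) j x = F j x"
  by (rule ent_blockI[OF n_pos[OF assms(3)]]) (simp add: ent_toF[OF MM_blk[OF assms(1,2)] assms(3,4)] blk_index[OF assms(3,4)])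

lemma MM_eqI:
  assumes "a \<in> MM m" "b \<in> MM m" "\<And>j x. j \<le> L \<Longrightarrow> x \<in> topspace (X j) \<Longrightarrow> toF m a j x = toF m b j x"
  shows "a = b"
  using blk_toF[OF assms(1)] blk_toF[OF assms(2)] blk_cong[of L "toF m a" "toF m b"] assms(3) by metis

lemma toF_mono:
  assumes "a \<in> MM m" "m \<le> m'" "j \<le> L" "x \<in> topspace (X j)" shows "toF m' a j x = toF m a j x"
  by (rule ent_blockI[OF n_pos[OF assms(3)]]) (simp add: ent_toF[OF assms(1,3,4)] ent_toF[OF MM_mono[OF assms(1,2)] assms(3,4)])

lemma carrier_B: "carrier B = (\<Union>m. MM m)" by (simp add: Minf_def)

lemma B_MM2:
  assumes "a \<in> carrier B" "b \<in> carrier B" obtains m where "a \<in> MM m" "b \<in> MM m"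
proof -
  obtain k l where "a \<in> MM k" "b \<in> MM l" using assms by (auto simp: carrier_B)
  then have "a \<in> MM (max k l)" "b \<in> MM (max k l)" by (auto intro: MM_mono)
  then show ?thesis by (rule that)
qed

lemma add_toF:
  assumes "a \<in> MM m" "b \<in> MM m"
  shows "a \<oplus>\<^bsub>B\<^esub> b \<in> MM m" "j \<le> L \<Longrightarrow> x \<in> topspace (X j) \<Longrightarrow> toF m (a \<oplus>\<^bsub>B\<^esub> b) j x = toF m a j x + toF m b j x"
proof -
  interpret abelian_monoid A by (rule abelian_monoid_A)
  have e: "(a \<oplus>\<^bsub>B\<^esub> b) i i' = a i i' \<oplus>\<^bsub>A\<^esub> b i i'" for i i' by (simp add: Minf_def)
  show M: "a \<oplus>\<^bsub>B\<^esub> b \<in> MM m" using assms A_closed(2) unfolding MM_iff e by simp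
  assume jx: "j \<le> L" "x \<in> topspace (X j)"
  show "toF m (a \<oplus>\<^bsub>B\<^esub> b) j x = toF m a j x + toF m b j x"
    by (rule ent_blockI[OF n_pos[OF jx(1)]])
      (simp add: ent_toF[OF assms(1) jx] ent_toF[OF assms(2) jx] ent_toF[OF M jx] e A_index(1)[OF MM_R[OF assms(1)] MM_R[OF assms(2)] jx])
qed

lemma smult_toF:
  assumes "a \<in> MM m"
  shows "c \<odot>\<^bsub>B\<^esub> a \<in> MM m" "j \<le> L \<Longrightarrow> x \<in> topspace (X j) \<Longrightarrow> r < n j \<Longrightarrow> s < n j \<Longrightarrow>
    ent (toF m (c \<odot>\<^bsub>B\<^esub> a) j x) (i * n j + r) (i' * n j + s) = c * ent (toF m a j x) (i * n j + r) (i' * n j + s)"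
proof -
  have e: "(c \<odot>\<^bsub>B\<^esub> a) i i' = c \<odot>\<^bsub>A\<^esub> a i i'" for i i' by (simp add: Minf_def)
  have z: "c \<odot>\<^bsub>A\<^esub> \<zero>\<^bsub>A\<^esub> = \<zero>\<^bsub>A\<^esub>"
    by (rule R_eqI[OF A_closed(3)[OF A_closed(5)] A_closed(5)]) (simp add: A_index[OF A_closed(5) A_closed(5)])
  show M: "c \<odot>\<^bsub>B\<^esub> a \<in> MM m" using assms A_closed(3) z unfolding MM_iff e by simp
  assume jx: "j \<le> L" "x \<in> topspace (X j)" "r < n j" "s < n j"
  then show "ent (toF m (c \<odot>\<^bsub>B\<^esub> a) j x) (i * n j + r) (i' * n j + s) = c * ent (toF m a j x) (i * n j + r) (i' * n j + s)"
    by (simp add: ent_toF[OF assms jx] ent_toF[OF M jx] e A_index(3)[OF MM_R[OF assms] MM_R[OF assms] jx])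
qed

lemma star_toF:
  assumes "a \<in> MM m"
  shows "star B a \<in> MM m" "j \<le> L \<Longrightarrow> x \<in> topspace (X j) \<Longrightarrow> toF m (star B a) j x = adj (toF m a j x)"
proof -
  have e: "star B a i i' = star A (a i' i)" for i i' by (simp add: Minf_def)
  have z: "star A \<zero>\<^bsub>A\<^esub> = \<zero>\<^bsub>A\<^esub>"
    by (rule R_eqI[OF A_closed(4)[OF A_closed(5)] A_closed(5)]) (simp add: A_index[OF A_closed(5) A_closed(5)])
  show M: "star B a \<in> MM m" using assms A_closed(4) z unfolding MM_iff e by auto
  assume jx: "j \<le> L" "x \<in> topspace (X j)"
  then show "toF m (star B a) j x = adj (toF m a j x)"
    by (intro ent_blockI[OF n_pos[OF jx(1)]])
      (simp add: ent_toF[OF assms jx] ent_toF[OF M jx] e A_index(4)[OF MM_R[OF assms] MM_R[OF assms] jx])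
qed

lemma mult_toF:
  assumes a: "a \<in> MM m" and b: "b \<in> MM m"
  shows "a \<otimes>\<^bsub>B\<^esub> b \<in> MM m" "j \<le> L \<Longrightarrow> x \<in> topspace (X j) \<Longrightarrow> toF m (a \<otimes>\<^bsub>B\<^esub> b) j x = toF m a j x * toF m b j x"
proof -
  interpret abelian_monoid A by (rule abelian_monoid_A)
  define S where "S i i' = {k. a i k \<otimes>\<^bsub>A\<^esub> b k i' \<noteq> \<zero>\<^bsub>A\<^esub>}" for i i'
  have e: "(a \<otimes>\<^bsub>B\<^esub> b) i i' = finsum A (\<lambda>k. a i k \<otimes>\<^bsub>A\<^esub> b k i') (S i i')" for i i' by (simp add: Minf_def S_def)
  have c: "a i k \<otimes>\<^bsub>A\<^esub> b k i' \<in> R L" for i k i' by (rule A_closed(1)[OF MM_R[OF a] MM_R[OF b]])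
  have z: "\<zero>\<^bsub>A\<^esub> \<otimes>\<^bsub>A\<^esub> d = \<zero>\<^bsub>A\<^esub>" "d \<otimes>\<^bsub>A\<^esub> \<zero>\<^bsub>A\<^esub> = \<zero>\<^bsub>A\<^esub>" if d: "d \<in> R L" for d
    by (rule R_eqI, intro A_closed d, rule A_closed, simp add: A_index[OF A_closed(5) d] A_index[OF d A_closed(5)] A_index(5)[OF d d])+
  have S: "S i i' \<subseteq> {..<m}" for i i'
    using a z[OF MM_R[OF b]] by (auto simp: S_def MM_iff not_less[symmetric])
  have S0: "S i i' = {}" if "m \<le> i \<or> m \<le> i'" for i i'
    using that a b z[OF MM_R[OF b]] z[OF MM_R[OF a]] by (auto simp: S_def MM_iff)
  have f: "finsum A (\<lambda>k. a i k \<otimes>\<^bsub>A\<^esub> b k i') (S i i') \<in> R L \<and> (\<forall>j\<le>L. \<forall>x\<in>topspace (X j). \<forall>r<n j. \<forall>s<n j.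
    finsum A (\<lambda>k. a i k \<otimes>\<^bsub>A\<^esub> b k i') (S i i') j x $$ (r, s) = (\<Sum>k\<in>S i i'. (a i k \<otimes>\<^bsub>A\<^esub> b k i') j x $$ (r, s)))" for i i'
    by (rule finsum_index) (use finite_subset[OF S] c in auto)
  show M: "a \<otimes>\<^bsub>B\<^esub> b \<in> MM m" unfolding MM_iff e
  proof (intro conjI allI impI)
    show "finsum A (\<lambda>k. a i k \<otimes>\<^bsub>A\<^esub> b k i') (S i i') \<in> R L" for i i' using f by blast
    show "finsum A (\<lambda>k. a i k \<otimes>\<^bsub>A\<^esub> b k i') (S i i') = \<zero>\<^bsub>A\<^esub>" if "m \<le> i \<or> m \<le> i'" for i i'
      unfolding S0[OF that] by simp
  qed
  assume jx: "j \<le> L" "x \<in> topspace (X j)"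
  show "toF m (a \<otimes>\<^bsub>B\<^esub> b) j x = toF m a j x * toF m b j x"
  proof (rule ent_blockI[OF n_pos[OF jx(1)]])
    fix i i' r s assume rs: "r < n j" "s < n j"
    have "ent (toF m (a \<otimes>\<^bsub>B\<^esub> b) j x) (i * n j + r) (i' * n j + s) = (\<Sum>k\<in>S i i'. (a i k \<otimes>\<^bsub>A\<^esub> b k i') j x $$ (r, s))"
      unfolding ent_toF[OF M jx rs] e using f jx rs by blast
    also have "\<dots> = (\<Sum>k<m. (a i k \<otimes>\<^bsub>A\<^esub> b k i') j x $$ (r, s))"
    proof (rule sum.mono_neutral_left[OF _ S])
      show "\<forall>k\<in>{..<m} - S i i'. (a i k \<otimes>\<^bsub>A\<^esub> b k i') j x $$ (r, s) = 0"
        using A_index(5)[OF A_closed(5) A_closed(5) jx rs] by (simp add: S_def)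
    qed simp
    also have "\<dots> = (\<Sum>k<m. \<Sum>t<n j. ent (toF m a j x) (i * n j + r) (k * n j + t) * ent (toF m b j x) (k * n j + t) (i' * n j + s))"
      by (simp add: A_index(2)[OF MM_R[OF a] MM_R[OF b] jx rs] ent_toF[OF a jx] ent_toF[OF b jx] rs)
    also have "\<dots> = ent (toF m a j x * toF m b j x) (i * n j + r) (i' * n j + s)"
      by (simp only: ent_mult[OF bnd_toF] sum_lessThan_mult)
    finally show "ent (toF m (a \<otimes>\<^bsub>B\<^esub> b) j x) (i * n j + r) (i' * n j + s) = ent (toF m a j x * toF m b j x) (i * n j + r) (i' * n j + s)" .
  qed
qed

lemma zero_toF: "\<zero>\<^bsub>B\<^esub> \<in> MM m" "j \<le> L \<Longrightarrow> x \<in> topspace (X j) \<Longrightarrow> toF m \<zero>\<^bsub>B\<^esub> j x = 0"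
proof -
  have e: "\<zero>\<^bsub>B\<^esub> i i' = \<zero>\<^bsub>A\<^esub>" for i i' by (simp add: Minf_def)
  show M: "\<zero>\<^bsub>B\<^esub> \<in> MM m" using A_closed(5) by (simp add: MM_iff e)
  assume jx: "j \<le> L" "x \<in> topspace (X j)"
  then show "toF m \<zero>\<^bsub>B\<^esub> j x = 0"
    by (intro ent_blockI[OF n_pos[OF jx(1)]]) (simp add: ent_toF[OF M jx] e A_index(5)[OF A_closed(5) A_closed(5) jx])
qed

lemma uminus_toF:
  assumes "a \<in> MM m" "j \<le> L" "x \<in> topspace (X j)" shows "toF m ((- 1) \<odot>\<^bsub>B\<^esub> a) j x = - toF m a j x"
  by (rule ent_blockI[OF n_pos[OF assms(2)]]) (simp add: smult_toF(2)[OF assms])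

lemma minus_toF:
  assumes a: "a \<in> MM m" and b: "b \<in> MM m"
  shows "a \<ominus>\<^bsub>B\<^esub> b \<in> MM m" "j \<le> L \<Longrightarrow> x \<in> topspace (X j) \<Longrightarrow> toF m (a \<ominus>\<^bsub>B\<^esub> b) j x = toF m a j x - toF m b j x"
proof -
  let ?b = "(- 1) \<odot>\<^bsub>B\<^esub> b"
  have b': "?b \<in> MM m" by (rule smult_toF(1)[OF b])
  have inv: "\<ominus>\<^bsub>B\<^esub> b = ?b"
    unfolding a_inv_def m_inv_def
  proof (rule the_equality)
    have "b \<oplus>\<^bsub>B\<^esub> ?b = \<zero>\<^bsub>B\<^esub>" "?b \<oplus>\<^bsub>B\<^esub> b = \<zero>\<^bsub>B\<^esub>"
      by (rule MM_eqI[of _ m], intro add_toF b b', rule zero_toF, simp add: add_toF(2)[OF b b'] add_toF(2)[OF b' b] uminus_toF[OF b] zero_toF)+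
    then show "?b \<in> carrier (add_monoid B) \<and> b \<otimes>\<^bsub>add_monoid B\<^esub> ?b = \<one>\<^bsub>add_monoid B\<^esub> \<and> ?b \<otimes>\<^bsub>add_monoid B\<^esub> b = \<one>\<^bsub>add_monoid B\<^esub>"
      using b' carrier_B by auto
  next
    fix y assume y: "y \<in> carrier (add_monoid B) \<and> b \<otimes>\<^bsub>add_monoid B\<^esub> y = \<one>\<^bsub>add_monoid B\<^esub> \<and> y \<otimes>\<^bsub>add_monoid B\<^esub> b = \<one>\<^bsub>add_monoid B\<^esub>"
    then have y0: "b \<oplus>\<^bsub>B\<^esub> y = \<zero>\<^bsub>B\<^esub>" and yc: "y \<in> carrier B" by simp_all
    obtain M where M: "y \<in> MM M" "b \<in> MM M" by (rule B_MM2[OF yc, of b]) (use b carrier_B in auto)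
    show "y = ?b"
    proof (rule MM_eqI[OF M(1) smult_toF(1)[OF M(2)]])
      fix j x assume jx: "j \<le> L" "x \<in> topspace (X j)"
      have "toF M b j x + toF M y j x = 0" using add_toF(2)[OF M(2,1) jx] zero_toF(2)[OF jx] y0 by simp
      then show "toF M y j x = toF M ?b j x" using uminus_toF[OF M(2) jx] by (simp add: add_eq_0_iff)
    qed
  qed
  show "a \<ominus>\<^bsub>B\<^esub> b \<in> MM m" unfolding a_minus_def inv by (rule add_toF(1)[OF a b'])
  assume jx: "j \<le> L" "x \<in> topspace (X j)"
  show "toF m (a \<ominus>\<^bsub>B\<^esub> b) j x = toF m a j x - toF m b j x"
    unfolding a_minus_def inv using add_toF(2)[OF a b' jx] uminus_toF[OF b jx] by simp
qed

lemma projections_iff: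
  assumes "p \<in> MM m"
  shows "p \<in> projections B \<longleftrightarrow> (\<forall>j\<le>L. \<forall>x\<in>topspace (X j). proj_mat (toF m p j x))"
proof
  assume "p \<in> projections B"
  then have "p \<otimes>\<^bsub>B\<^esub> p = p" "star B p = p" by (auto simp: projections_def)
  then show "\<forall>j\<le>L. \<forall>x\<in>topspace (X j). proj_mat (toF m p j x)"
    using mult_toF(2)[OF assms assms] star_toF(2)[OF assms] by (simp add: proj_mat_def)
next
  assume R: "\<forall>j\<le>L. \<forall>x\<in>topspace (X j). proj_mat (toF m p j x)"
  have "p \<otimes>\<^bsub>B\<^esub> p = p"
    by (rule MM_eqI[OF mult_toF(1)[OF assms assms] assms]) (use mult_toF(2)[OF assms assms] R in \<open>simp add: proj_mat_def\<close>)
  moreover have "star B p = p"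
    by (rule MM_eqI[OF star_toF(1)[OF assms] assms]) (use star_toF(2)[OF assms] R in \<open>simp add: proj_mat_def\<close>)
  ultimately show "p \<in> projections B" using assms carrier_B by (auto simp: projections_def)
qed

text \<open>A unitary \<open>u = p a p\<close> of the corner has its entries outside the \<open>m \<times> m\<close> block equal to zero, however
  large \<open>a\<close> is.\<close>

lemma unitaries_iff:
  assumes p: "p \<in> MM m" "p \<in> projections B"
  shows "u \<in> unitaries (corner B p) \<longleftrightarrow> u \<in> MM m \<and> (\<forall>j\<le>L. \<forall>x\<in>topspace (X j). unitary_in (toF m p j x) (toF m u j x))"
proof -
  have P: "proj_mat (toF m p j x)" if "j \<le> L" "x \<in> topspace (X j)" for j x using projections_iff[OF p(1)] p(2) that by blast
  have U: "u \<in> unitaries (corner B p) \<longleftrightarrow> (\<exists>a\<in>carrier B. u = p \<otimes>\<^bsub>B\<^esub> a \<otimes>\<^bsub>B\<^esub> p) \<and> star B u \<otimes>\<^bsub>B\<^esub> u = p \<and> u \<otimes>\<^bsub>B\<^esub> star B u = p"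
    by (auto simp: unitaries_def corner_def)
  show ?thesis
  proof
    assume "u \<in> unitaries (corner B p)"
    then obtain a where a: "a \<in> carrier B" "u = p \<otimes>\<^bsub>B\<^esub> a \<otimes>\<^bsub>B\<^esub> p" and u: "star B u \<otimes>\<^bsub>B\<^esub> u = p" "u \<otimes>\<^bsub>B\<^esub> star B u = p"
      unfolding U by blast
    obtain k where k: "a \<in> MM k" using a(1) carrier_B by auto
    define M where "M = max m k"
    have aM: "a \<in> MM M" and pM: "p \<in> MM M" using k p(1) by (auto simp: M_def intro: MM_mono)
    have pa: "p \<otimes>\<^bsub>B\<^esub> a \<in> MM M" by (rule mult_toF(1)[OF pM aM])
    have uM: "u \<in> MM M" unfolding a(2) by (rule mult_toF(1)[OF pa pM])
    have tu: "toF M u j x = toF m p j x * toF M a j x * toF m p j x" if "j \<le> L" "x \<in> topspace (X j)" for j x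
      unfolding a(2) using mult_toF(2)[OF pa pM that] mult_toF(2)[OF pM aM that] toF_mono[OF p(1) _ that, of M] by (simp add: M_def)
    have "bd m L (toF M u)" unfolding bd_def using tu by (simp add: bnd_compress)
    then have "blk L (toF M u) \<in> MM m" by (rule MM_blk[OF mem_toF[OF uM]])
    then have um: "u \<in> MM m" using blk_toF[OF uM] by simp
    show "u \<in> MM m \<and> (\<forall>j\<le>L. \<forall>x\<in>topspace (X j). unitary_in (toF m p j x) (toF m u j x))"
      using um u mult_toF(2)[OF star_toF(1)[OF um] um] mult_toF(2)[OF um star_toF(1)[OF um]] star_toF(2)[OF um]
      by (simp add: unitary_in_def)
  next
    assume R: "u \<in> MM m \<and> (\<forall>j\<le>L. \<forall>x\<in>topspace (X j). unitary_in (toF m p j x) (toF m u j x))"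
    then have um: "u \<in> MM m" by blast
    have uu: "unitary_in (toF m p j x) (toF m u j x)" if "j \<le> L" "x \<in> topspace (X j)" for j x using R that by blast
    note su = star_toF[OF um] and pu = mult_toF[OF p(1) um]
    have "u = p \<otimes>\<^bsub>B\<^esub> u \<otimes>\<^bsub>B\<^esub> p"
      by (rule MM_eqI[OF um mult_toF(1)[OF pu(1) p(1)]]) (simp add: mult_toF(2)[OF pu(1) p(1)] pu(2) unitary_in_mult[OF P uu])
    moreover have "star B u \<otimes>\<^bsub>B\<^esub> u = p"
      by (rule MM_eqI[OF mult_toF(1)[OF su(1) um] p(1)]) (use uu in \<open>simp add: mult_toF(2)[OF su(1) um] su(2) unitary_in_def\<close>)
    moreover have "u \<otimes>\<^bsub>B\<^esub> star B u = p"
      by (rule MM_eqI[OF mult_toF(1)[OF um su(1)] p(1)]) (use uu in \<open>simp add: mult_toF(2)[OF um su(1)] su(2) unitary_in_def\<close>)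
    ultimately show "u \<in> unitaries (corner B p)" unfolding U using um carrier_B by blast
  qed
qed

end

section \<open>Norm-continuous paths\<close>

context rsh
begin

lemma ev_Minf_eq:
  assumes "a \<in> MM m"
  shows "\<exists>m0\<le>m. a \<in> MM m0 \<and> (\<forall>j x. ev_Minf D (j, x) a = tom (m0 * n j) (toF m0 a j x))"
proof (intro exI conjI allI)
  let ?m = "LEAST m. a \<in> MM m"
  show "a \<in> MM ?m" by (rule LeastI[of "\<lambda>m. a \<in> MM m", OF assms])
  show "?m \<le> m" by (rule Least_le[of "\<lambda>m. a \<in> MM m", OF assms])
  show "ev_Minf D (j, x) a = tom (?m * n j) (toF ?m a j x)" for j x
    unfolding ev_Minf_def Let_def by (intro eq_matI) (simp_all add: tom_def toF_def ev_def)
qed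

text \<open>The operator norm and the Frobenius norm are equivalent, with constants that do not depend on the
  point, so that they define the same continuous paths.\<close>

lemma op_norm_ev_Minf:
  assumes "a \<in> MM m" "j \<le> L" "x \<in> topspace (X j)"
  shows "op_norm (ev_Minf D (j, x) a) \<le> norm (toF m a j x)"
    "norm (toF m a j x) \<le> (real (m * n j))\<^sup>2 * op_norm (ev_Minf D (j, x) a)" "0 \<le> op_norm (ev_Minf D (j, x) a)"
proof -
  obtain m0 where m0: "a \<in> MM m0" "m0 \<le> m" "\<And>j x. ev_Minf D (j, x) a = tom (m0 * n j) (toF m0 a j x)"
    using ev_Minf_eq[OF assms(1)] by blast
  have eq: "toF m a j x = toF m0 a j x" by (rule toF_mono[OF m0(1,2) assms(2,3)])
  show "op_norm (ev_Minf D (j, x) a) \<le> norm (toF m a j x)" unfolding eq m0(3) by (rule op_norm_le[OF bnd_toF])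
  have 1: "norm (toF m a j x) \<le> (real (m0 * n j))\<^sup>2 * op_norm (ev_Minf D (j, x) a)"
    unfolding eq m0(3) by (rule norm_le_op_norm[OF bnd_toF])
  show 0: "0 \<le> op_norm (ev_Minf D (j, x) a)"
    unfolding m0(3) op_norm_def
    by (rule cSup_upper2[OF _ _ op_norm_bdd[OF bnd_toF], of "l2norm (tom (m0 * n j) (toF m0 a j x) *\<^sub>v 0\<^sub>v (m0 * n j))"])
      (auto intro!: exI[of _ "0\<^sub>v (m0 * n j)"] simp: l2norm_def sum_nonneg)
  have "(real (m0 * n j))\<^sup>2 \<le> (real (m * n j))\<^sup>2" using mult_le_mono1[OF m0(2), of "n j"] by (intro power_mono) (simp_all only: of_nat_le_iff of_nat_0_le_iff)
  from mult_right_mono[OF this 0] 1 show "norm (toF m a j x) \<le> (real (m * n j))\<^sup>2 * op_norm (ev_Minf D (j, x) a)" by linarith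
qed

lemma rank_ev_Minf_le:
  assumes "p \<in> MM m" "p \<in> projections B" "j \<le> L" "x \<in> topspace (X j)"
  shows "real (mat_rank (ev_Minf D (j, x) p)) \<le> (norm (toF m p j x))\<^sup>2"
proof -
  obtain m0 where m0: "p \<in> MM m0" "m0 \<le> m" "\<And>j x. ev_Minf D (j, x) p = tom (m0 * n j) (toF m0 p j x)"
    using ev_Minf_eq[OF assms(1)] by blast
  have "proj_mat (toF m0 p j x)" using projections_iff[OF m0(1)] assms by blast
  from rank_proj_le[OF this bnd_toF] show ?thesis
    unfolding toF_mono[OF m0(1,2) assms(3,4)] mat_rank_def m0(3) by simp
qed

lemma toF_continuous: "a \<in> MM m \<Longrightarrow> j \<le> L \<Longrightarrow> continuous_map (X j) euclidean (toF m a j)"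
  by (rule mem_continuous[OF order_refl mem_toF bd_toF])

lemma Minf_norm_bdd:
  assumes a: "a \<in> MM m"
  shows "bdd_above (insert 0 ((\<lambda>z. op_norm (ev_Minf D z a)) ` total_space D))"
proof -
  have "\<exists>K. \<forall>x\<in>topspace (X j). norm (toF m a j x) \<le> K" if j: "j \<le> L" for j
  proof -
    have "compactin euclidean (toF m a j ` topspace (X j))"
      by (rule image_compactin[OF _ toF_continuous[OF a j]]) (use X[OF j] in \<open>simp add: compact_space_def\<close>)
    then have "bounded (toF m a j ` topspace (X j))" by (simp add: compact_imp_bounded)
    then show ?thesis by (auto simp: bounded_iff)
  qed
  then obtain K where K: "\<And>j x. j \<le> L \<Longrightarrow> x \<in> topspace (X j) \<Longrightarrow> norm (toF m a j x) \<le> K j" by metis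
  define K' where "K' = (\<Sum>j\<le>L. \<bar>K j\<bar>)"
  have K': "\<bar>K j\<bar> \<le> K'" if "j \<le> L" for j unfolding K'_def by (rule member_le_sum) (use that in auto)
  have "op_norm (ev_Minf D z a) \<le> K'" if zt: "z \<in> total_space D" for z
  proof -
    obtain j x where z: "z = (j, x)" "j \<le> L" "x \<in> topspace (X j)" using zt by (auto simp: total_space_def)
    have "op_norm (ev_Minf D (j, x) a) \<le> norm (toF m a j x)" by (rule op_norm_ev_Minf(1)[OF a z(2,3)])
    then show ?thesis using K[OF z(2,3)] K'[OF z(2)] unfolding z(1) by linarith
  qed
  then have "bdd_above ((\<lambda>z. op_norm (ev_Minf D z a)) ` total_space D)" by (intro bdd_aboveI2)
  then show ?thesis by simp
qed

lemma Minf_norm_nonneg: "a \<in> MM m \<Longrightarrow> 0 \<le> Minf_norm D a"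
  unfolding Minf_norm_def by (rule cSup_upper[OF _ Minf_norm_bdd]) auto

lemma Minf_norm_le:
  assumes a: "a \<in> MM m" and "0 \<le> \<epsilon>" "\<And>j x. j \<le> L \<Longrightarrow> x \<in> topspace (X j) \<Longrightarrow> norm (toF m a j x) \<le> \<epsilon>"
  shows "Minf_norm D a \<le> \<epsilon>"
  unfolding Minf_norm_def
proof (rule cSup_least)
  fix y assume y: "y \<in> insert 0 ((\<lambda>z. op_norm (ev_Minf D z a)) ` total_space D)"
  show "y \<le> \<epsilon>"
  proof (cases "y = 0")
    case False
    then obtain j x where "j \<le> L" "x \<in> topspace (X j)" "y = op_norm (ev_Minf D (j, x) a)"
      using y by (auto simp: total_space_def)
    then show ?thesis using op_norm_ev_Minf(1)[OF a] assms(3) by fastforce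
  qed (use assms in simp)
qed simp

lemma norm_toF_le:
  assumes a: "a \<in> MM m" and jx: "j \<le> L" "x \<in> topspace (X j)"
  shows "norm (toF m a j x) \<le> (real (m * n j))\<^sup>2 * Minf_norm D a"
proof -
  have "op_norm (ev_Minf D (j, x) a) \<le> Minf_norm D a"
    unfolding Minf_norm_def by (rule cSup_upper[OF _ Minf_norm_bdd[OF a]]) (use jx in \<open>force simp: total_space_def\<close>)
  then have "(real (m * n j))\<^sup>2 * op_norm (ev_Minf D (j, x) a) \<le> (real (m * n j))\<^sup>2 * Minf_norm D a" by (rule mult_left_mono) simp
  then show ?thesis using op_norm_ev_Minf(2)[OF a jx] by linarith
qed

lemma homotopicD:
  assumes p: "p \<in> MM m" "p \<in> projections B" and h: "homotopic_unitaries D p u v"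
  shows "\<exists>\<gamma>. (\<forall>t\<in>{0..1::real}. \<gamma> t \<in> unitaries (corner B p)) \<and> \<gamma> 0 = u \<and> \<gamma> 1 = v \<and>
    (\<forall>j\<le>L. continuous_map (prod_topology (X j) (top_of_set {0..1})) euclidean (\<lambda>z. toF m (\<gamma> (snd z)) j (fst z)))"
proof -
  obtain \<gamma> where g: "\<forall>t\<in>{0..1::real}. \<gamma> t \<in> unitaries (corner B p)" "\<gamma> 0 = u" "\<gamma> 1 = v"
    and c: "\<forall>t\<in>{0..1}. ((\<lambda>s. Minf_norm D (\<gamma> s \<ominus>\<^bsub>B\<^esub> \<gamma> t)) \<longlongrightarrow> 0) (at t within {0..1})"
    using h unfolding homotopic_unitaries_def by blast
  have gm: "\<gamma> t \<in> MM m" if "t \<in> {0..1}" for t using g(1) that unitaries_iff[OF p] by blast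
  have "continuous_map (prod_topology (X j) (top_of_set {0..1})) euclidean (\<lambda>z. toF m (\<gamma> (snd z)) j (fst z))" if j: "j \<le> L" for j
  proof (rule continuous_map_metricI)
    let ?S = "prod_topology (X j) (top_of_set {0..1::real})"
    fix z :: "'a \<times> real" and \<epsilon> :: real
    assume z: "z \<in> topspace ?S" and \<epsilon>: "0 < \<epsilon>"
    obtain x t where xt: "z = (x, t)" "x \<in> topspace (X j)" "t \<in> {0..1}" using z by (cases z) auto
    define K where "K = (real (m * n j))\<^sup>2 + 1"
    have K: "0 < K" by (simp add: K_def add_nonneg_pos)
    have "((\<lambda>s. Minf_norm D (\<gamma> s \<ominus>\<^bsub>B\<^esub> \<gamma> t)) \<longlongrightarrow> 0) (at t within {0..1})" using c xt(3) by blast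
    then have "\<exists>d>0. \<forall>s\<in>{0..1}. 0 < dist s t \<and> dist s t < d \<longrightarrow> dist (Minf_norm D (\<gamma> s \<ominus>\<^bsub>B\<^esub> \<gamma> t)) 0 < \<epsilon> / (2 * K)"
      unfolding Lim_within using \<epsilon> K by simp
    then obtain d where d: "0 < d" "\<And>s. s \<in> {0..1} \<Longrightarrow> 0 < dist s t \<Longrightarrow> dist s t < d \<Longrightarrow>
        dist (Minf_norm D (\<gamma> s \<ominus>\<^bsub>B\<^esub> \<gamma> t)) 0 < \<epsilon> / (2 * K)" by blast
    define V where "V = {y \<in> topspace (X j). toF m (\<gamma> t) j y \<in> ball (toF m (\<gamma> t) j x) (\<epsilon> / 2)}"
    have V: "openin (X j) V" unfolding V_def
      by (rule openin_continuous_map_preimage[OF toF_continuous[OF gm[OF xt(3)] j]]) simp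
    have "openin ?S (V \<times> ({0..1} \<inter> ball t d))"
      using V by (auto simp: openin_prod_Times_iff openin_open)
    moreover have "z \<in> V \<times> ({0..1} \<inter> ball t d)" using xt d(1) \<epsilon> by (auto simp: V_def)
    moreover have "dist (toF m (\<gamma> (snd w)) j (fst w)) (toF m (\<gamma> (snd z)) j (fst z)) < \<epsilon>"
      if "w \<in> V \<times> ({0..1} \<inter> ball t d)" for w
    proof -
      obtain y s where w: "w = (y, s)" "y \<in> V" "s \<in> {0..1}" "dist s t < d" using \<open>w \<in> _\<close> by (auto simp: dist_commute)
      have yx: "y \<in> topspace (X j)" using w(2) by (simp add: V_def)
      have "norm (toF m (\<gamma> s) j y - toF m (\<gamma> t) j y) < \<epsilon> / 2"
      proof (cases "s = t")
        case True
        then show ?thesis using \<epsilon> by simp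
      next
        case False
        define c where "c = \<gamma> s \<ominus>\<^bsub>B\<^esub> \<gamma> t"
        have cm: "c \<in> MM m" unfolding c_def by (rule minus_toF(1)[OF gm[OF w(3)] gm[OF xt(3)]])
        have "Minf_norm D c < \<epsilon> / (2 * K)" using d(2)[OF w(3) _ w(4)] False by (simp add: c_def)
        moreover have "norm (toF m c j y) \<le> K * Minf_norm D c"
          using norm_toF_le[OF cm j yx] Minf_norm_nonneg[OF cm] by (simp add: K_def distrib_right)
        ultimately have "norm (toF m c j y) < \<epsilon> / 2" using K by (simp add: field_simps)
        then show ?thesis unfolding c_def minus_toF(2)[OF gm[OF w(3)] gm[OF xt(3)] j yx] .
      qed
      moreover have "dist (toF m (\<gamma> t) j y) (toF m (\<gamma> t) j x) < \<epsilon> / 2" using w(2) by (simp add: V_def dist_commute)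
      ultimately show ?thesis
        using dist_triangle_half_l[of "toF m (\<gamma> s) j y" "toF m (\<gamma> t) j y" \<epsilon> "toF m (\<gamma> t) j x"]
        unfolding w(1) xt(1) by (metis dist_commute dist_norm dist_triangle_half_r fst_conv snd_conv)
    qed
    ultimately show "\<exists>U. openin ?S U \<and> z \<in> U \<and> (\<forall>w\<in>U. dist (toF m (\<gamma> (snd w)) j (fst w)) (toF m (\<gamma> (snd z)) j (fst z)) < \<epsilon>)"
      by blast
  qed
  then show ?thesis using g by blast
qed

lemma homotopicI:
  assumes p: "p \<in> MM m" "p \<in> projections B"
    and g: "\<And>t. t \<in> {0..1} \<Longrightarrow> \<gamma> t \<in> unitaries (corner B p)" "\<gamma> 0 = u" "\<gamma> 1 = v"
    and c: "\<And>j. j \<le> L \<Longrightarrow> continuous_map (prod_topology (X j) (top_of_set {0..1::real})) euclidean (\<lambda>z. toF m (\<gamma> (snd z)) j (fst z))"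
  shows "homotopic_unitaries D p u v"
  unfolding homotopic_unitaries_def
proof (intro exI[of _ \<gamma>] conjI ballI g)
  fix t :: real assume t: "t \<in> {0..1}"
  have gm: "\<gamma> t \<in> MM m" if "t \<in> {0..1}" for t using g(1) that unitaries_iff[OF p] by blast
  show "((\<lambda>s. Minf_norm D (\<gamma> s \<ominus>\<^bsub>B\<^esub> \<gamma> t)) \<longlongrightarrow> 0) (at t within {0..1})"
    unfolding tendsto_iff
  proof (intro allI impI)
    fix \<epsilon> :: real assume \<epsilon>: "0 < \<epsilon>"
    have "\<exists>U. openin (top_of_set {0..1}) U \<and> t \<in> U \<and>
      (\<forall>s\<in>U. \<forall>x\<in>topspace (X j). norm (toF m (\<gamma> s) j x - toF m (\<gamma> t) j x) < \<epsilon> / 2)" if j: "j \<le> L" for j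
    proof -
      have "compact_space (X j)" "t \<in> topspace (top_of_set {0..1})" "0 < \<epsilon> / 2" using X[OF j] t \<epsilon> by auto
      from uniform_near_parameter[OF this(1) c[OF j] this(2,3)] obtain U where
        "openin (top_of_set {0..1}) U" "t \<in> U"
        "\<And>s x. s \<in> U \<Longrightarrow> x \<in> topspace (X j) \<Longrightarrow> norm (toF m (\<gamma> s) j x - toF m (\<gamma> t) j x) < \<epsilon> / 2"
        by (simp only: fst_conv snd_conv) metis
      then show ?thesis by blast
    qed
    then obtain U where U: "\<And>j. j \<le> L \<Longrightarrow> openin (top_of_set {0..1}) (U j)" "\<And>j. j \<le> L \<Longrightarrow> t \<in> U j"
      "\<And>j s x. j \<le> L \<Longrightarrow> s \<in> U j \<Longrightarrow> x \<in> topspace (X j) \<Longrightarrow> norm (toF m (\<gamma> s) j x - toF m (\<gamma> t) j x) < \<epsilon> / 2"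
      by metis
    define W where "W = (\<Inter>j\<in>{..L}. U j)"
    have W: "openin (top_of_set {0..1}) W" unfolding W_def by (rule openin_INT2) (use U(1) in auto)
    then obtain T where T: "open T" "W = {0..1} \<inter> T" by (auto simp: openin_open)
    have "t \<in> T" using U(2) T(2) by (auto simp: W_def)
    show "\<forall>\<^sub>F s in at t within {0..1}. dist (Minf_norm D (\<gamma> s \<ominus>\<^bsub>B\<^esub> \<gamma> t)) 0 < \<epsilon>"
      unfolding eventually_at_topological
    proof (intro exI[of _ T] conjI ballI impI T(1) \<open>t \<in> T\<close>)
      fix s assume s: "s \<in> T" "s \<noteq> t" "s \<in> {0..1}"
      then have sW: "s \<in> U j" if "j \<le> L" for j using T(2) that by (auto simp: W_def)
      note cm = minus_toF[OF gm[OF s(3)] gm[OF t]]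
      have "Minf_norm D (\<gamma> s \<ominus>\<^bsub>B\<^esub> \<gamma> t) \<le> \<epsilon> / 2"
        by (rule Minf_norm_le[OF cm(1)]) (use \<epsilon> U(3)[OF _ sW] cm(2) in \<open>auto simp: less_imp_le\<close>)
      then show "dist (Minf_norm D (\<gamma> s \<ominus>\<^bsub>B\<^esub> \<gamma> t)) 0 < \<epsilon>" using Minf_norm_nonneg[OF cm(1)] \<epsilon> by simp
    qed
  qed
qed

end

section \<open>Corners\<close>

text \<open>A factor \<open>{0}\<close> keeps the parameter space \<open>T\<close> in the statements about families.\<close>

lemma covering_dim_le_singleton:
  assumes "covering_dim_le X k" "compact_space X"
  shows "covering_dim_le (prod_topology (prod_topology X (top_of_set {0::real})) (top_of_set {0..1::real})) (k + 1)"
proof -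
  have "covering_dim_le (prod_topology X (top_of_set {0::real})) k"
    by (rule covering_dim_le_retract[OF assms(1), of _ fst "\<lambda>x. (x, 0)"])
      (auto intro!: continuous_map_fst continuous_map_pairedI continuous_map_id[unfolded id_def])
  moreover have "compact_space (prod_topology X (top_of_set {0::real}))"
    using assms(2) by (simp add: compact_space_prod_topology compact_space_subtopology)
  ultimately show ?thesis by (intro covering_dim_le_prod_interval)
qed

lemma covering_dim_le_square:
  assumes "covering_dim_le X k" "compact_space X"
  shows "covering_dim_le (prod_topology (prod_topology X (top_of_set {0..1::real})) (top_of_set {0..1::real})) (k + 2)"
proof -
  have "compact_space (prod_topology X (top_of_set {0..1::real}))"
    using assms(2) by (simp add: compact_space_prod_topology compact_space_subtopology)
  from covering_dim_le_prod_interval[OF this covering_dim_le_prod_interval[OF assms(2,1)]] show ?thesis by simp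
qed

context rsh
begin

context
  fixes p q m
  assumes p: "p \<in> MM m" "p \<in> projections B" and q: "q \<in> MM m" "q \<in> projections B" and le: "star_le B p q"
    and fin: "finite_top_dim D"
begin

lemma proj_pq: "j \<le> L \<Longrightarrow> x \<in> topspace (X j) \<Longrightarrow> proj_mat (toF m p j x)" "j \<le> L \<Longrightarrow> x \<in> topspace (X j) \<Longrightarrow> proj_mat (toF m q j x)"
  using projections_iff[OF p(1)] projections_iff[OF q(1)] p(2) q(2) by blast+

lemma pq_mult:
  assumes "j \<le> L" "x \<in> topspace (X j)"
  shows "toF m q j x * toF m p j x = toF m p j x" "toF m p j x * toF m q j x = toF m p j x"
proof -
  obtain c where c: "c \<in> carrier B" "q \<ominus>\<^bsub>B\<^esub> p = star B c \<otimes>\<^bsub>B\<^esub> c" using le by (auto simp: star_le_def)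
  obtain k where k: "c \<in> MM k" using c(1) carrier_B by auto
  define M where "M = max m k"
  have M: "c \<in> MM M" "p \<in> MM M" "q \<in> MM M" using k p(1) q(1) by (auto simp: M_def intro: MM_mono)
  have "toF M q j x - toF M p j x = adj (toF M c j x) * toF M c j x"
    using minus_toF(2)[OF M(3,2) assms] mult_toF(2)[OF star_toF(1)[OF M(1)] M(1) assms] star_toF(2)[OF M(1) assms] c(2) by simp
  then have "toF m q j x - toF m p j x = adj (toF M c j x) * toF M c j x"
    using toF_mono[OF p(1) _ assms, of M] toF_mono[OF q(1) _ assms, of M] by (simp add: M_def)
  from proj_le_mult[OF proj_pq[OF assms] this]
  show "toF m q j x * toF m p j x = toF m p j x" "toF m p j x * toF m q j x = toF m p j x" .
qed

abbreviation "e \<equiv> q \<ominus>\<^bsub>B\<^esub> p"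

lemma e_MM: "e \<in> MM m" by (rule minus_toF(1)[OF q(1) p(1)])

lemma toF_e: "j \<le> L \<Longrightarrow> x \<in> topspace (X j) \<Longrightarrow> toF m e j x = toF m q j x - toF m p j x"
  by (rule minus_toF(2)[OF q(1) p(1)])

lemma unitaries_add_e:
  assumes v: "v \<in> unitaries (corner B p)"
  shows "v \<oplus>\<^bsub>B\<^esub> e \<in> MM m" "j \<le> L \<Longrightarrow> x \<in> topspace (X j) \<Longrightarrow> toF m (v \<oplus>\<^bsub>B\<^esub> e) j x * toF m e j x = toF m e j x"
proof -
  have vm: "v \<in> MM m" using v unitaries_iff[OF p] by blast
  show "v \<oplus>\<^bsub>B\<^esub> e \<in> MM m" by (rule add_toF(1)[OF vm e_MM])
  assume jx: "j \<le> L" "x \<in> topspace (X j)"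
  have "unitary_in (toF m p j x) (toF m v j x)" using v jx unitaries_iff[OF p] by blast
  from unitary_in_sum(2)[OF proj_pq[OF jx] pq_mult[OF jx] this]
  show "toF m (v \<oplus>\<^bsub>B\<^esub> e) j x * toF m e j x = toF m e j x" using add_toF(2)[OF vm e_MM jx] toF_e[OF jx] by simp
qed

lemma unitaries_minus_e:
  assumes w: "w \<in> MM m" "\<And>j x. j \<le> L \<Longrightarrow> x \<in> topspace (X j) \<Longrightarrow> unitary_in (toF m q j x) (toF m w j x) \<and> toF m w j x * toF m e j x = toF m e j x"
  shows "w \<ominus>\<^bsub>B\<^esub> e \<in> unitaries (corner B p)"
  unfolding unitaries_iff[OF p]
proof (intro conjI allI impI ballI)
  show "w \<ominus>\<^bsub>B\<^esub> e \<in> MM m" by (rule minus_toF(1)[OF w(1) e_MM])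
  fix j x assume jx: "j \<le> L" "x \<in> topspace (X j)"
  show "unitary_in (toF m p j x) (toF m (w \<ominus>\<^bsub>B\<^esub> e) j x)"
    unfolding minus_toF(2)[OF w(1) e_MM jx] toF_e[OF jx]
    by (rule unitary_in_cut[OF proj_pq[OF jx] pq_mult[OF jx]]) (use w(2)[OF jx] toF_e[OF jx] in simp_all)
qed

text \<open>Given by \<open>deform_unitaries\<close> for \<open>q\<close> and \<open>e\<close>. The difference of their ranks at a point is the rank of \<open>p\<close>.\<close>

lemma deform_paths:
  assumes T: "compact T" "closedin (top_of_set T) T0"
    and dim: "\<And>j. j \<le> L \<Longrightarrow> covering_dim_le (prod_topology (prod_topology (X j) (top_of_set T)) (top_of_set {0..1::real})) (2 * rr j + 1)"
    and rk: "\<And>j x. j \<le> L \<Longrightarrow> x \<in> topspace (X j) \<Longrightarrow> real (rr j) - 1 < real (mat_rank (ev_Minf D (j, x) p))"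
    and U: "\<And>t. t \<in> T \<Longrightarrow> U t \<in> unitaries (corner B q)"
      "\<And>j. j \<le> L \<Longrightarrow> continuous_map (prod_topology (X j) (top_of_set T)) euclidean (\<lambda>z. toF m (U (snd z)) j (fst z))"
      "\<And>j x t. j \<le> L \<Longrightarrow> x \<in> topspace (X j) \<Longrightarrow> t \<in> T0 \<Longrightarrow> toF m (U t) j x * toF m e j x = toF m e j x"
  shows "\<exists>W :: real \<Rightarrow> real \<Rightarrow> nat \<Rightarrow> nat \<Rightarrow> nat \<Rightarrow> 'a \<Rightarrow> complex mat. (\<forall>t\<in>T. \<forall>\<tau>\<in>{0..1}. W t \<tau> \<in> unitaries (corner B q)) \<and>
    (\<forall>t\<in>T. W t 0 = U t \<and> W t 1 \<ominus>\<^bsub>B\<^esub> e \<in> unitaries (corner B p)) \<and> (\<forall>t\<in>T0. \<forall>\<tau>\<in>{0..1}. W t \<tau> = U t) \<and>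
    (\<forall>j\<le>L. continuous_map (prod_topology (prod_topology (X j) (top_of_set T)) (top_of_set {0..1})) euclidean
       (\<lambda>z. toF m (W (snd (fst z)) (snd z)) j (fst (fst z))))"
proof -
  have T0T: "T0 \<subseteq> T" using closedin_subset[OF T(2)] by simp
  have Um: "U t \<in> MM m" if "t \<in> T" for t using U(1)[OF that] unitaries_iff[OF q] by blast
  note cm = proj_complement[OF proj_pq pq_mult]
  have "\<exists>\<Gamma> :: real \<Rightarrow> real \<Rightarrow> nat \<Rightarrow> 'a \<Rightarrow> fmat. (\<forall>t\<in>T. \<forall>\<tau>\<in>{0..1}. mem L (\<Gamma> t \<tau>)) \<and>
    (\<forall>j\<le>L. continuous_map (prod_topology (prod_topology (X j) (top_of_set T)) (top_of_set {0..1::real})) euclidean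
        (\<lambda>z. \<Gamma> (snd (fst z)) (snd z) j (fst (fst z)))) \<and>
    (\<forall>j\<le>L. \<forall>x\<in>topspace (X j). \<forall>t\<in>T. (\<forall>\<tau>\<in>{0..1}. unitary_in (toF m q j x) (\<Gamma> t \<tau> j x)) \<and>
        \<Gamma> t 0 j x = toF m (U t) j x \<and> \<Gamma> t 1 j x * toF m e j x = toF m e j x \<and> (t \<in> T0 \<longrightarrow> (\<forall>\<tau>\<in>{0..1}. \<Gamma> t \<tau> j x = toF m (U t) j x)))"
  proof (rule deform_unitaries[OF T mem_toF[OF q(1)] bd_toF proj_pq(2) mem_toF[OF e_MM] bd_toF _ dim _ mem_toF[OF Um] U(2) _ U(3) order_refl])
    fix j x assume jx: "j \<le> L" "x \<in> topspace (X j)"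
    show "proj_mat (toF m e j x) \<and> toF m q j x * toF m e j x = toF m e j x" unfolding toF_e[OF jx] using cm(1,2)[OF jx jx jx jx] by simp
    show "real (rr j) - 1 < (norm (toF m q j x))\<^sup>2 - (norm (toF m e j x))\<^sup>2"
      unfolding toF_e[OF jx] cm(5)[OF jx jx jx jx] using rk[OF jx] rank_ev_Minf_le[OF p jx] by linarith
    show "unitary_in (toF m q j x) (toF m (U t) j x)" if "t \<in> T" for t using U(1)[OF that] jx unitaries_iff[OF q] by blast
  qed
  then obtain \<Gamma> where G: "\<And>t \<tau>. t \<in> T \<Longrightarrow> \<tau> \<in> {0..1} \<Longrightarrow> mem L (\<Gamma> t \<tau>)"
    and Gc: "\<And>j. j \<le> L \<Longrightarrow> continuous_map (prod_topology (prod_topology (X j) (top_of_set T)) (top_of_set {0..1::real})) euclidean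
        (\<lambda>z. \<Gamma> (snd (fst z)) (snd z) j (fst (fst z)))"
    and Gu: "\<forall>j\<le>L. \<forall>x\<in>topspace (X j). \<forall>t\<in>T. (\<forall>\<tau>\<in>{0..1}. unitary_in (toF m q j x) (\<Gamma> t \<tau> j x)) \<and>
        \<Gamma> t 0 j x = toF m (U t) j x \<and> \<Gamma> t 1 j x * toF m e j x = toF m e j x \<and> (t \<in> T0 \<longrightarrow> (\<forall>\<tau>\<in>{0..1}. \<Gamma> t \<tau> j x = toF m (U t) j x))"
  proof (elim exE conjE)
    fix \<Gamma> :: "real \<Rightarrow> real \<Rightarrow> nat \<Rightarrow> 'a \<Rightarrow> fmat"
    assume 1: "\<forall>t\<in>T. \<forall>\<tau>\<in>{0..1}. mem L (\<Gamma> t \<tau>)"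
      and 2: "\<forall>j\<le>L. continuous_map (prod_topology (prod_topology (X j) (top_of_set T)) (top_of_set {0..1::real})) euclidean
        (\<lambda>z. \<Gamma> (snd (fst z)) (snd z) j (fst (fst z)))"
      and 3: "\<forall>j\<le>L. \<forall>x\<in>topspace (X j). \<forall>t\<in>T. (\<forall>\<tau>\<in>{0..1}. unitary_in (toF m q j x) (\<Gamma> t \<tau> j x)) \<and>
        \<Gamma> t 0 j x = toF m (U t) j x \<and> \<Gamma> t 1 j x * toF m e j x = toF m e j x \<and> (t \<in> T0 \<longrightarrow> (\<forall>\<tau>\<in>{0..1}. \<Gamma> t \<tau> j x = toF m (U t) j x))"
    show thesis by (rule that[of \<Gamma>, OF bspec[OF bspec[OF 1]] mp[OF spec[OF 2]] 3])
  qed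
  define W where "W t \<tau> = blk L (\<Gamma> t \<tau>)" for t \<tau>
  have bdG: "bd m L (\<Gamma> t \<tau>)" if "t \<in> T" "\<tau> \<in> {0..1}" for t \<tau>
    unfolding bd_def
  proof (intro allI impI ballI)
    fix j x assume jx: "j \<le> L" "x \<in> topspace (X j)"
    show "bnd (m * n j) (\<Gamma> t \<tau> j x)" by (rule bnd_unitary_in[OF proj_pq(2)[OF jx] bnd_toF]) (use Gu jx that in blast)
  qed
  have Wm: "W t \<tau> \<in> MM m" if "t \<in> T" "\<tau> \<in> {0..1}" for t \<tau> unfolding W_def by (rule MM_blk[OF G[OF that] bdG[OF that]])
  have tW: "toF m (W t \<tau>) j x = \<Gamma> t \<tau> j x" if "t \<in> T" "\<tau> \<in> {0..1}" "j \<le> L" "x \<in> topspace (X j)" for t \<tau> j x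
    unfolding W_def by (rule toF_blk[OF G[OF that(1,2)] bdG[OF that(1,2)] that(3,4)])
  have I: "0 \<in> {0..1::real}" "1 \<in> {0..1::real}" by simp_all
  show ?thesis
  proof (intro exI[of _ W] conjI ballI allI impI)
    fix t \<tau> :: real assume t: "t \<in> T" "\<tau> \<in> {0..1}"
    show "W t \<tau> \<in> unitaries (corner B q)" unfolding unitaries_iff[OF q] using Wm[OF t] tW[OF t] Gu t by auto
  next
    fix t assume t: "t \<in> T"
    show "W t 0 = U t" by (rule MM_eqI[OF Wm[OF t I(1)] Um[OF t]]) (use tW[OF t I(1)] Gu t in auto)
    show "W t 1 \<ominus>\<^bsub>B\<^esub> e \<in> unitaries (corner B p)"
    proof (rule unitaries_minus_e[OF Wm[OF t I(2)]])
      fix j x assume jx: "j \<le> L" "x \<in> topspace (X j)"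
      show "unitary_in (toF m q j x) (toF m (W t 1) j x) \<and> toF m (W t 1) j x * toF m e j x = toF m e j x"
        unfolding tW[OF t I(2) jx] using Gu jx t I(2) by blast
    qed
  next
    fix t \<tau> :: real assume t: "t \<in> T0" "\<tau> \<in> {0..1}"
    then have tT: "t \<in> T" using T0T by blast
    show "W t \<tau> = U t" by (rule MM_eqI[OF Wm[OF tT t(2)] Um[OF tT]]) (use tW[OF tT t(2)] Gu t tT in auto)
  next
    fix j assume j: "j \<le> L"
    show "continuous_map (prod_topology (prod_topology (X j) (top_of_set T)) (top_of_set {0..1})) euclidean
       (\<lambda>z. toF m (W (snd (fst z)) (snd z)) j (fst (fst z)))"
      by (rule continuous_map_eq[OF Gc[OF j]]) (use tW j in auto)
  qed
qed

lemma covering_dim_X: "j \<le> L \<Longrightarrow> covering_dim_le (X j) (covering_dim (X j))"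
  by (rule covering_dim_le_covering_dim) (use fin in \<open>simp add: finite_top_dim_def\<close>)

text \<open>Here \<open>T = {0}\<close>. The number \<open>rr j\<close> is the least \<open>r\<close> with \<open>d + 1 \<le> 2 r + 1\<close>, and \<open>rank p \<ge> d/2\<close> implies
  \<open>rank p > r - 1\<close>.\<close>

lemma homotopic_to_corner:
  assumes rank: "\<And>x. x \<in> total_space D \<Longrightarrow> real (mat_rank (ev_Minf D x p)) \<ge> 1 / 2 * real (top_dim D x)"
    and u: "u \<in> unitaries (corner B q)"
  shows "\<exists>v\<in>unitaries (corner B p). homotopic_unitaries D q (v \<oplus>\<^bsub>B\<^esub> e) u"
proof -
  have um: "u \<in> MM m" using u unitaries_iff[OF q] by blast
  define rr where "rr j = (covering_dim (X j) + 1) div 2" for j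
  have "\<exists>W :: real \<Rightarrow> real \<Rightarrow> nat \<Rightarrow> nat \<Rightarrow> nat \<Rightarrow> 'a \<Rightarrow> complex mat. (\<forall>t\<in>{0}. \<forall>\<tau>\<in>{0..1}. W t \<tau> \<in> unitaries (corner B q)) \<and>
    (\<forall>t\<in>{0}. W t 0 = u \<and> W t 1 \<ominus>\<^bsub>B\<^esub> e \<in> unitaries (corner B p)) \<and> (\<forall>t\<in>{}. \<forall>\<tau>\<in>{0..1}. W t \<tau> = u) \<and>
    (\<forall>j\<le>L. continuous_map (prod_topology (prod_topology (X j) (top_of_set {0})) (top_of_set {0..1})) euclidean
       (\<lambda>z. toF m (W (snd (fst z)) (snd z)) j (fst (fst z))))"
  proof (rule deform_paths[of _ _ rr "\<lambda>_. u"])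
    fix j assume j: "j \<le> L"
    have le: "covering_dim (X j) + 1 \<le> 2 * rr j + 1" unfolding rr_def by linarith
    have c: "compact_space (X j)" using X[OF j] by simp
    show "covering_dim_le (prod_topology (prod_topology (X j) (top_of_set {0::real})) (top_of_set {0..1::real})) (2 * rr j + 1)"
      by (rule covering_dim_le_mono[OF covering_dim_le_singleton[OF covering_dim_X[OF j] c] le])
    show "continuous_map (prod_topology (X j) (top_of_set {0})) euclidean (\<lambda>z. toF m u j (fst z))"
      using continuous_map_compose[OF continuous_map_fst toF_continuous[OF um j]] by (simp add: o_def)
    fix x assume x: "x \<in> topspace (X j)"
    have "real (mat_rank (ev_Minf D (j, x) p)) \<ge> 1 / 2 * real (covering_dim (X j))"
      using rank[of "(j, x)"] j x by (simp add: total_space_def top_dim_def)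
    moreover have "2 * rr j \<le> covering_dim (X j) + 1" unfolding rr_def by linarith
    then have "2 * real (rr j) \<le> real (covering_dim (X j)) + 1" by linarith
    ultimately show "real (rr j) - 1 < real (mat_rank (ev_Minf D (j, x) p))" by linarith
  qed (use u in auto)
  then obtain W :: "real \<Rightarrow> real \<Rightarrow> nat \<Rightarrow> nat \<Rightarrow> nat \<Rightarrow> 'a \<Rightarrow> complex mat" where
      W': "\<forall>t\<in>{0}. \<forall>\<tau>\<in>{0..1}. W t \<tau> \<in> unitaries (corner B q)"
      "\<forall>t\<in>{0}. W t 0 = u \<and> W t 1 \<ominus>\<^bsub>B\<^esub> e \<in> unitaries (corner B p)"
    and Wc: "\<forall>j\<le>L. continuous_map (prod_topology (prod_topology (X j) (top_of_set {0})) (top_of_set {0..1})) euclidean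
       (\<lambda>z. toF m (W (snd (fst z)) (snd z)) j (fst (fst z)))" by (elim exE conjE) (rule that)
  have W: "\<And>\<tau>. \<tau> \<in> {0..1::real} \<Longrightarrow> W (0::real) \<tau> \<in> unitaries (corner B q)" "W 0 0 = u"
      "W 0 1 \<ominus>\<^bsub>B\<^esub> e \<in> unitaries (corner B p)" using W' by blast+
  have W1: "W 0 1 \<in> MM m" using W(1)[of 1] unitaries_iff[OF q] by auto
  have v: "W 0 1 \<ominus>\<^bsub>B\<^esub> e \<in> MM m" by (rule minus_toF(1)[OF W1 e_MM])
  \<comment> \<open>the deformation runs from \<open>u\<close> to the unitary that fixes
      \<open>e\<close>, hence the reversed parameter\<close>
  have "homotopic_unitaries D q ((W 0 1 \<ominus>\<^bsub>B\<^esub> e) \<oplus>\<^bsub>B\<^esub> e) u"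
  proof (rule homotopicI[OF q, of "\<lambda>t. W 0 (1 - t)"])
    show "W 0 (1 - t) \<in> unitaries (corner B q)" if "t \<in> {0..1}" for t using that by (intro W(1)) auto
    show "W 0 (1 - 0) = (W 0 1 \<ominus>\<^bsub>B\<^esub> e) \<oplus>\<^bsub>B\<^esub> e"
      by (rule MM_eqI[OF _ add_toF(1)[OF v e_MM]])
        (use W1 in \<open>simp_all add: add_toF(2)[OF v e_MM] minus_toF(2)[OF W1 e_MM]\<close>)
    show "W 0 (1 - 1) = u" using W(2) by simp
    fix j assume j: "j \<le> L"
    let ?S = "prod_topology (X j) (top_of_set {0..1::real})"
    have "continuous_map ?S (top_of_set {0..1}) (\<lambda>z. 1 - snd z)"
    proof (rule continuous_map_into_subtopology)
      have "continuous_map ?S euclidean (\<lambda>z. snd z :: real)"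
        using continuous_map_snd[of "X j" "top_of_set {0..1::real}"] by (simp add: continuous_map_in_subtopology)
      then show "continuous_map ?S euclidean (\<lambda>z. 1 - snd z)" by (intro continuous_map_diff) auto
    qed auto
    then have "continuous_map ?S (prod_topology (prod_topology (X j) (top_of_set {0})) (top_of_set {0..1})) (\<lambda>z. ((fst z, 0), 1 - snd z))"
      by (intro continuous_map_pairedI continuous_map_fst) auto
    from continuous_map_compose[OF this Wc[rule_format, OF j]] show "continuous_map ?S euclidean (\<lambda>z. toF m (W 0 (1 - snd z)) j (fst z))"
      by (simp add: o_def)
  qed
  then show ?thesis using W(3) by blast
qed

text \<open>Here \<open>T = [0, 1]\<close> is the parameter interval of the given path in \<open>U(q M\<^sub>\<infinity>(A) q)\<close>. The number \<open>rr j\<close> is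
  the least \<open>r\<close> with \<open>d + 2 \<le> 2 r + 1\<close>, and \<open>rank p \<ge> (d + 1)/2\<close> implies \<open>rank p > r - 1\<close>.\<close>

lemma homotopic_in_corner:
  assumes rank: "\<And>x. x \<in> total_space D \<Longrightarrow> real (mat_rank (ev_Minf D x p)) \<ge> 1 / 2 * (real (top_dim D x) + 1)"
    and v: "v0 \<in> unitaries (corner B p)" "v1 \<in> unitaries (corner B p)"
    and h: "homotopic_unitaries D q (v0 \<oplus>\<^bsub>B\<^esub> e) (v1 \<oplus>\<^bsub>B\<^esub> e)"
  shows "homotopic_unitaries D p v0 v1"
proof -
  obtain \<gamma> where g: "\<And>t. t \<in> {0..1::real} \<Longrightarrow> \<gamma> t \<in> unitaries (corner B q)" "\<gamma> 0 = v0 \<oplus>\<^bsub>B\<^esub> e" "\<gamma> 1 = v1 \<oplus>\<^bsub>B\<^esub> e"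
    and gc: "\<And>j. j \<le> L \<Longrightarrow> continuous_map (prod_topology (X j) (top_of_set {0..1})) euclidean (\<lambda>z. toF m (\<gamma> (snd z)) j (fst z))"
    using homotopicD[OF q h] by blast
  define rr where "rr j = (covering_dim (X j) + 2) div 2" for j
  have "\<exists>W :: real \<Rightarrow> real \<Rightarrow> nat \<Rightarrow> nat \<Rightarrow> nat \<Rightarrow> 'a \<Rightarrow> complex mat. (\<forall>t\<in>{0..1}. \<forall>\<tau>\<in>{0..1}. W t \<tau> \<in> unitaries (corner B q)) \<and>
    (\<forall>t\<in>{0..1}. W t 0 = \<gamma> t \<and> W t 1 \<ominus>\<^bsub>B\<^esub> e \<in> unitaries (corner B p)) \<and> (\<forall>t\<in>{0, 1}. \<forall>\<tau>\<in>{0..1}. W t \<tau> = \<gamma> t) \<and>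
    (\<forall>j\<le>L. continuous_map (prod_topology (prod_topology (X j) (top_of_set {0..1})) (top_of_set {0..1})) euclidean
       (\<lambda>z. toF m (W (snd (fst z)) (snd z)) j (fst (fst z))))"
  proof (rule deform_paths[of _ _ rr, OF _ _ _ _ g(1) gc])
    show "closedin (top_of_set {0..1::real}) {0, 1}" by (rule closed_subset) auto
    fix j assume j: "j \<le> L"
    have le: "covering_dim (X j) + 2 \<le> 2 * rr j + 1" unfolding rr_def by linarith
    have c: "compact_space (X j)" using X[OF j] by simp
    show "covering_dim_le (prod_topology (prod_topology (X j) (top_of_set {0..1::real})) (top_of_set {0..1::real})) (2 * rr j + 1)"
      by (rule covering_dim_le_mono[OF covering_dim_le_square[OF covering_dim_X[OF j] c] le])
    fix x assume x: "x \<in> topspace (X j)"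
    have "2 * real (mat_rank (ev_Minf D (j, x) p)) \<ge> real (covering_dim (X j)) + 1"
      using rank[of "(j, x)"] j x by (simp add: total_space_def top_dim_def)
    moreover have "2 * rr j \<le> covering_dim (X j) + 2" unfolding rr_def by linarith
    then have "2 * real (rr j) \<le> real (covering_dim (X j)) + 2" by linarith
    ultimately show "real (rr j) - 1 < real (mat_rank (ev_Minf D (j, x) p))" by linarith
    fix t :: real assume "t \<in> {0, 1}"
    then show "toF m (\<gamma> t) j x * toF m e j x = toF m e j x"
      using g(2,3) unitaries_add_e(2)[OF v(1) j x] unitaries_add_e(2)[OF v(2) j x] by auto
  qed simp
  then obtain W :: "real \<Rightarrow> real \<Rightarrow> nat \<Rightarrow> nat \<Rightarrow> nat \<Rightarrow> 'a \<Rightarrow> complex mat" where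
      W': "\<forall>t\<in>{0..1}. \<forall>\<tau>\<in>{0..1}. W t \<tau> \<in> unitaries (corner B q)"
      "\<forall>t\<in>{0..1}. W t 0 = \<gamma> t \<and> W t 1 \<ominus>\<^bsub>B\<^esub> e \<in> unitaries (corner B p)" "\<forall>t\<in>{0, 1}. \<forall>\<tau>\<in>{0..1}. W t \<tau> = \<gamma> t"
    and Wc: "\<forall>j\<le>L. continuous_map (prod_topology (prod_topology (X j) (top_of_set {0..1})) (top_of_set {0..1})) euclidean
       (\<lambda>z. toF m (W (snd (fst z)) (snd z)) j (fst (fst z)))" by (elim exE conjE) (rule that)
  have I: "0 \<in> {0..1::real}" "1 \<in> {0..1::real}" by simp_all
  have W: "\<And>t. t \<in> {0..1} \<Longrightarrow> W t 1 \<ominus>\<^bsub>B\<^esub> e \<in> unitaries (corner B p)"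
      "\<And>t. t \<in> {0..1} \<Longrightarrow> W t 1 \<in> unitaries (corner B q)" "W 0 1 = \<gamma> 0" "W 1 1 = \<gamma> 1"
    using W' I by blast+
  have Wm: "W t 1 \<in> MM m" if "t \<in> {0..1}" for t using W(2)[OF that] unitaries_iff[OF q] by blast
  have sub_e: "(v \<oplus>\<^bsub>B\<^esub> e) \<ominus>\<^bsub>B\<^esub> e = v" if "v \<in> unitaries (corner B p)" for v
  proof -
    have vm: "v \<in> MM m" using that unitaries_iff[OF p] by blast
    note a = add_toF[OF vm e_MM]
    show ?thesis by (rule MM_eqI[OF minus_toF(1)[OF a(1) e_MM] vm]) (simp add: minus_toF(2)[OF a(1) e_MM] a(2))
  qed
  show ?thesis
  proof (rule homotopicI[OF p, of "\<lambda>t. W t 1 \<ominus>\<^bsub>B\<^esub> e"])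
    show "W 0 1 \<ominus>\<^bsub>B\<^esub> e = v0" "W 1 1 \<ominus>\<^bsub>B\<^esub> e = v1" unfolding W(3,4) g(2,3) by (rule sub_e[OF v(1)], rule sub_e[OF v(2)])
    fix j assume j: "j \<le> L"
    let ?S = "prod_topology (X j) (top_of_set {0..1::real})"
    have "continuous_map ?S (prod_topology ?S (top_of_set {0..1})) (\<lambda>z. (z, 1::real))"
      by (intro continuous_map_pairedI continuous_map_id[unfolded id_def]) auto
    from continuous_map_compose[OF this Wc[rule_format, OF j]]
    have "continuous_map ?S euclidean (\<lambda>z. toF m (W (snd z) 1) j (fst z))" by (simp add: o_def)
    moreover have "continuous_map ?S euclidean (\<lambda>z. toF m e j (fst z))"
      using continuous_map_compose[OF continuous_map_fst toF_continuous[OF e_MM j]] by (simp add: o_def)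
    ultimately have "continuous_map ?S euclidean (\<lambda>z. toF m (W (snd z) 1) j (fst z) - toF m e j (fst z))"
      by (rule continuous_map_diff)
    then show "continuous_map ?S euclidean (\<lambda>z. toF m (W (snd z) 1 \<ominus>\<^bsub>B\<^esub> e) j (fst z))"
      by (rule continuous_map_eq) (use minus_toF(2)[OF Wm e_MM j] in auto)
  qed (rule W(1))
qed

end

end

theorem proposition4p4:
  fixes D :: "'a rsh_data"
    and p q :: "nat \<Rightarrow> nat \<Rightarrow> nat \<Rightarrow> 'a \<Rightarrow> complex mat"
  assumes "rsh_decomposition D"
    and "finite_top_dim D"
    and "p \<in> projections (rsh_Minf D)"
    and "q \<in> projections (rsh_Minf D)"
    and "star_le (rsh_Minf D) p q"
  shows
    "((\<forall>x\<in>total_space D. real (mat_rank (ev_Minf D x p)) \<ge> 1 / 2 * real (top_dim D x)) \<longrightarrow>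
      (\<forall>u\<in>unitaries (corner (rsh_Minf D) q). \<exists>v\<in>unitaries (corner (rsh_Minf D) p).
         homotopic_unitaries D q (v \<oplus>\<^bsub>rsh_Minf D\<^esub> (q \<ominus>\<^bsub>rsh_Minf D\<^esub> p)) u))
     \<and>
     ((\<forall>x\<in>total_space D. real (mat_rank (ev_Minf D x p)) \<ge> 1 / 2 * (real (top_dim D x) + 1)) \<longrightarrow>
      (\<forall>v\<^sub>0\<in>unitaries (corner (rsh_Minf D) p). \<forall>v\<^sub>1\<in>unitaries (corner (rsh_Minf D) p).
         homotopic_unitaries D q (v\<^sub>0 \<oplus>\<^bsub>rsh_Minf D\<^esub> (q \<ominus>\<^bsub>rsh_Minf D\<^esub> p)) (v\<^sub>1 \<oplus>\<^bsub>rsh_Minf D\<^esub> (q \<ominus>\<^bsub>rsh_Minf D\<^esub> p)) \<longrightarrow>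
         homotopic_unitaries D p v\<^sub>0 v\<^sub>1))"
proof -
  interpret rsh D by (rule rsh.intro[OF assms(1)])
  have "p \<in> carrier B" "q \<in> carrier B" using assms(3,4) by (auto simp: projections_def)
  then obtain m where m: "p \<in> MM m" "q \<in> MM m" by (rule B_MM2)
  note c = m(1) assms(3) m(2) assms(4,5,2)
  show ?thesis using homotopic_to_corner[OF c] homotopic_in_corner[OF c] by blast
qed

end
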